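(* Let $\rho:\underline M^*\to\underline H$ be the morphism of $A$-schemes given by $\rho(m)=h\circ m$. Then $\rho$ is smooth of relative dimension $\dim G$.
   Context: $F$ is a non-Archimedean local field with ring of integers $A$ and residue characteristic $p$. $(K,\sigma)$ is one of: $K=F$ with $\mathrm{char}\,F\neq2$, $\sigma=\mathrm{id}$; $K=E$ a separable quadratic extension with nontrivial automorphism $\sigma$; $K=F\oplus F$, $\sigma(x,y)=(y,x)$; $K=D$ the quaternion division algebra with standard involution. $B$ is the maximal $A$-order of $K$; $\epsilon\in\{\pm1\}$. If $(K,\epsilon,p)\ne(F,1,2)$, $L$ is a free right $B$-module of rank $n$ with a $(\sigma,\epsilon)$-hermitian form $h:L\times L\to B$ and "hermitian form" means such a form; if $(K,\epsilon,p)=(F,1,2)$, $L$ is a free $A$-module of rank $n$ with quadratic form $h$, $h(v,w)=\frac12(h(v+w)-h(v)-h(w))$, and "hermitian form" means quadratic form (conditions/formulas via the associated bilinear form). $V=L\otimes_AF$ is nondegenerate; $L^{\#}=\{x\in V:h(x,L)\subset B\}$ and $(L^{\#})^{\#}=L$ is assumed. $G$ is the smooth algebraic group over $F$ with $G(E)=\mathrm{Aut}_{K\otimes_FE}(V\otimes_FE,h\otimes_FE)$. Adjoint $X^{ad}$: $h(X(v),w)=h(v,X^{ad}(w))$. For a flat $A$-algebra $R$: $T^0(R)=\{X\in\mathrm{End}_{B\otimes R}(L\otimes R):X(L^{\#}\otimes R)\subset L^{\#}\otimes R\}$; $H^0(R)$ = hermitian forms $f$ on $L\otimes R$ with $f(L\otimes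 R,L^{\#}\otimes R)\subset B\otimes R$; $\varphi_{0,R}(X)=h\circ X$ with $(h\circ X)(v,w)=h(X(v),X(w))$; $\psi_{0,R}(X)(v,w)=h(v,X(w))+h(X(v),w)$. Recursively, $\overline{\varphi_{m,A}}:T^m(A)\to H^0(A)/\psi_{0,A}(T^m(A))$ is $\varphi_{0,A}$ followed by the quotient, $T^{m+1}(A)=\{X\in T^m(A):\overline{\varphi_{m,A}}(X)=0=\overline{\varphi_{m,A}}(X^{ad})\}$, and $T^m(R)=R\otimes_AT^m(A)$ for flat $R$. Let $\alpha\ge0$ be the smallest integer with $T^m(A)=T^\alpha(A)$ for all $m\ge\alpha$ (it exists), $\tilde T:=T^\alpha$, $\tilde H(R)=\psi_{0,R}(\tilde T(R))$. For flat $R$: $\underline M(R)=\{1+X:X\in\tilde T(R)\}$, $\underline H(R)=\{h+f:f\in\tilde H(R)\}$ (both represented by affine spaces over $A$), and $\underline M^*$ is the open subgroup scheme of $\underline M$ whose points are the elements of $\underline M$ with a two-sided inverse in $\underline M$. $\underline M^*$ acts on $\underline H$ on the right by $(h',m)\mapsto h'\circ m$. *)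

theory Defs
  imports
    "HOL-Library.Poly_Mapping"
    "HOL-Library.Function_Algebras"
    "HOL-Library.Extended_Nat"
    "HOL-Computational_Algebra.Polynomial"
    "HOL-Computational_Algebra.Primes"
    "Jordan_Normal_Form.Determinant"
begin

section \<open>Subrings, ideals, polynomials in several variables\<close>

text \<open>Commutative rings are subrings \<open>S\<close> of a type of class \<open>comm_ring_1\<close>, and an affine scheme
  \<open>Spec (S/I)\<close> is given by \<open>S\<close> together with an ideal \<open>I\<close> of \<open>S\<close>; its points are the prime ideals
  of \<open>S\<close> containing \<open>I\<close>.\<close>

definition is_subring :: "'a::ring_1 set \<Rightarrow> bool" where
  "is_subring S \<longleftrightarrow> 1 \<in> S \<and> (\<forall>x\<in>S. \<forall>y\<in>S. x - y \<in> S \<and> x * y \<in> S)"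

definition is_prime_ideal :: "'a::comm_ring_1 set \<Rightarrow> 'a set \<Rightarrow> bool" where
  "is_prime_ideal S P \<longleftrightarrow> P \<subseteq> S \<and> 0 \<in> P \<and> 1 \<notin> P \<and>
     (\<forall>x\<in>P. \<forall>y\<in>P. x + y \<in> P) \<and> (\<forall>x\<in>S. \<forall>y\<in>P. x * y \<in> P) \<and>
     (\<forall>x\<in>S. \<forall>y\<in>S. x * y \<in> P \<longrightarrow> x \<in> P \<or> y \<in> P)"

definition ideal_gen :: "'a::comm_ring_1 set \<Rightarrow> 'a set \<Rightarrow> 'a set" where
  "ideal_gen S X = {\<Sum>i<k. a i * x i | (k::nat) a x. \<forall>i<k. a i \<in> S \<and> x i \<in> X}"

type_synonym 'a mpol = "(nat \<Rightarrow>\<^sub>0 nat) \<Rightarrow>\<^sub>0 'a"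

text \<open>\<open>mpol_ring R n\<close> is the polynomial ring \<open>R[x\<^sub>0, \<dots>, x\<^sub>n\<^sub>-\<^sub>1]\<close>.\<close>

definition mpol_ring :: "'a::zero set \<Rightarrow> nat \<Rightarrow> 'a mpol set" where
  "mpol_ring R n = {g. \<forall>a\<in>Poly_Mapping.keys g.
      Poly_Mapping.lookup g a \<in> R \<and> Poly_Mapping.keys a \<subseteq> {..<n}}"

abbreviation mconst :: "'a::zero \<Rightarrow> 'a mpol" where
  "mconst c \<equiv> Poly_Mapping.single 0 c"

definition mvar :: "nat \<Rightarrow> 'a::zero_neq_one mpol" where
  "mvar i = Poly_Mapping.single (Poly_Mapping.single i 1) 1"

definition mpol_eval :: "('a::comm_ring_1 \<Rightarrow> 'b::comm_ring_1) \<Rightarrow> (nat \<Rightarrow> 'b) \<Rightarrow> 'a mpol \<Rightarrow> 'b" where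
  "mpol_eval \<phi> q g = (\<Sum>a\<in>Poly_Mapping.keys g. \<phi> (Poly_Mapping.lookup g a) *
      (\<Prod>i\<in>Poly_Mapping.keys a. q i ^ Poly_Mapping.lookup a i))"

definition mpol_deriv :: "nat \<Rightarrow> 'a::comm_ring_1 mpol \<Rightarrow> 'a mpol" where
  "mpol_deriv i g = (\<Sum>a\<in>Poly_Mapping.keys g.
      Poly_Mapping.single (a - Poly_Mapping.single i 1)
        (of_nat (Poly_Mapping.lookup a i) * Poly_Mapping.lookup g a))"

section \<open>Smooth morphisms\<close>

text \<open>The \<open>R\<close>-algebra \<open>S/J\<close> (with structure map induced by \<open>\<phi>: R \<rightarrow> S\<close>) is standard smooth of relative
  dimension \<open>d\<close>: it has a presentation \<open>R[z\<^sub>0, \<dots>, z\<^sub>n\<^sub>-\<^sub>1]/(f\<^sub>0, \<dots>, f\<^sub>c\<^sub>-\<^sub>1)\<close>, \<open>z\<^sub>j \<mapsto> q\<^sub>j mod J\<close>, with \<open>n = c + d\<close>, in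
  which the Jacobian determinant with respect to the first \<open>c\<close> variables is a unit.\<close>

definition standard_smooth ::
  "'r::comm_ring_1 set \<Rightarrow> ('r \<Rightarrow> 's::comm_ring_1) \<Rightarrow> 's set \<Rightarrow> 's set \<Rightarrow> nat \<Rightarrow> bool" where
  "standard_smooth R \<phi> S J d \<longleftrightarrow> (\<exists>n c f q. n = c + d \<and>
     (\<forall>i<c. f i \<in> mpol_ring R n) \<and> (\<forall>j<n. q j \<in> S) \<and>
     (\<forall>a\<in>S. \<exists>g\<in>mpol_ring R n. mpol_eval \<phi> q g - a \<in> J) \<and>
     {g \<in> mpol_ring R n. mpol_eval \<phi> q g \<in> J} = ideal_gen (mpol_ring R n) (f ` {..<c}) \<and>
     (\<exists>u\<in>S. u * det (mat c c (\<lambda>(i, j). mpol_eval \<phi> q (mpol_deriv j (f i)))) - 1 \<in> J))"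

text \<open>The morphism \<open>Spec (S/I) \<rightarrow> Spec R\<close> is smooth of relative dimension \<open>d\<close> at \<open>P\<close> if some principal
  open neighbourhood of \<open>P\<close> is the spectrum of a standard smooth \<open>R\<close>-algebra. The localisation
  of \<open>S/I\<close> at \<open>s\<close> is written as \<open>S[w]/(I, s w - 1)\<close>.\<close>

definition smooth_at ::
  "'r::comm_ring_1 set \<Rightarrow> ('r \<Rightarrow> 's::comm_ring_1) \<Rightarrow> 's set \<Rightarrow> 's set \<Rightarrow> 's set \<Rightarrow> nat \<Rightarrow> bool" where
  "smooth_at R \<phi> S I P d \<longleftrightarrow> (\<exists>s\<in>S - P.
     let S' = {g :: 's poly. \<forall>i. Polynomial.coeff g i \<in> S} in
     standard_smooth R (\<lambda>r. [:\<phi> r:]) S'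
       (ideal_gen S' (insert ([:-1, s:]) ((\<lambda>a. [:a:]) ` I))) d)"

text \<open>Smoothness of the restriction of \<open>Spec (S/I) \<rightarrow> Spec R\<close> to an open subscheme with set of points \<open>U\<close>.\<close>

definition smooth_of_rel_dim ::
  "'r::comm_ring_1 set \<Rightarrow> ('r \<Rightarrow> 's::comm_ring_1) \<Rightarrow> 's set \<Rightarrow> 's set \<Rightarrow> 's set set \<Rightarrow> nat \<Rightarrow> bool" where
  "smooth_of_rel_dim R \<phi> S I U d \<longleftrightarrow> (\<forall>P\<in>U. smooth_at R \<phi> S I P d)"

definition is_smooth ::
  "'r::comm_ring_1 set \<Rightarrow> ('r \<Rightarrow> 's::comm_ring_1) \<Rightarrow> 's set \<Rightarrow> 's set \<Rightarrow> 's set set \<Rightarrow> bool" where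
  "is_smooth R \<phi> S I U \<longleftrightarrow> (\<forall>P\<in>U. \<exists>d. smooth_at R \<phi> S I P d)"

text \<open>Krull dimension of a locally closed subspace \<open>U\<close> of a spectrum: its irreducible closed
  subsets are the closures of its points.\<close>

definition krull_dim :: "'s set set \<Rightarrow> enat" where
  "krull_dim U = Sup {enat r | r.
     \<exists>P :: nat \<Rightarrow> 's set. (\<forall>i\<le>r. P i \<in> U) \<and> (\<forall>i<r. P i \<subset> P (Suc i))}"

section \<open>Modules and extension of scalars\<close>

text \<open>\<open>b 0, \<dots>, b (N - 1)\<close> is a basis of \<open>W\<close> over the coefficient ring \<open>C\<close> acting by \<open>scale\<close>.\<close>

definition is_basis ::
  "'c::zero set \<Rightarrow> ('c \<Rightarrow> 'w \<Rightarrow> 'w) \<Rightarrow> nat \<Rightarrow> (nat \<Rightarrow> 'w::comm_monoid_add) \<Rightarrow> 'w set \<Rightarrow> bool" where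
  "is_basis C scale N b W \<longleftrightarrow>
     (\<forall>c. (\<forall>i<N. c i \<in> C) \<longrightarrow> (\<Sum>i<N. scale (c i) (b i)) \<in> W) \<and>
     (\<forall>w\<in>W. \<exists>!c. (\<forall>i<N. c i \<in> C) \<and> (\<forall>i\<ge>N. c i = 0) \<and> w = (\<Sum>i<N. scale (c i) (b i)))"

text \<open>For an \<open>F\<close>-vector space \<open>W\<close>, the type \<open>'w mpol\<close> of polynomials with coefficients in \<open>W\<close> is
  \<open>W \<otimes>\<^sub>F F[x\<^sub>0, x\<^sub>1, \<dots>]\<close>. A biadditive map \<open>\<beta>: W\<^sub>1 \<times> W\<^sub>2 \<rightarrow> W\<^sub>3\<close> extends to these by convolution; the extension
  of a linear map is \<^const>\<open>Poly_Mapping.map\<close>.\<close>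

definition conv :: "('a::zero \<Rightarrow> 'b::zero \<Rightarrow> 'c::comm_monoid_add) \<Rightarrow> 'a mpol \<Rightarrow> 'b mpol \<Rightarrow> 'c mpol" where
  "conv \<beta> g g' = (\<Sum>a\<in>Poly_Mapping.keys g. \<Sum>b\<in>Poly_Mapping.keys g'.
      Poly_Mapping.single (a + b) (\<beta> (Poly_Mapping.lookup g a) (Poly_Mapping.lookup g' b)))"

section \<open>Local fields and the pairs \<open>(K, \<sigma>)\<close>\<close>

text \<open>\<open>val_ge val k x\<close> means \<open>v(x) \<ge> k\<close>, where \<open>v(0) = \<infinity>\<close>; the value \<open>val 0\<close> is irrelevant.\<close>

definition val_ge :: "('f::field \<Rightarrow> int) \<Rightarrow> int \<Rightarrow> 'f \<Rightarrow> bool" where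
  "val_ge val k x \<longleftrightarrow> x = 0 \<or> val x \<ge> k"

definition val_ring :: "('f::field \<Rightarrow> int) \<Rightarrow> 'f set" where
  "val_ring val = {x. val_ge val 0 x}"

definition nonarch_local_field :: "('f::field \<Rightarrow> int) \<Rightarrow> bool" where
  "nonarch_local_field val \<longleftrightarrow>
     (\<forall>x y. x \<noteq> 0 \<longrightarrow> y \<noteq> 0 \<longrightarrow> val (x * y) = val x + val y) \<and>
     (\<forall>k x y. val_ge val k x \<longrightarrow> val_ge val k y \<longrightarrow> val_ge val k (x + y)) \<and>
     (\<exists>x. x \<noteq> 0 \<and> val x = 1) \<and>
     (\<exists>R. finite R \<and> (\<forall>x\<in>val_ring val. \<exists>r\<in>R. val_ge val 1 (x - r))) \<and>
     (\<forall>s :: nat \<Rightarrow> 'f. (\<forall>k. \<exists>n0. \<forall>m\<ge>n0. \<forall>n\<ge>n0. val_ge val k (s m - s n)) \<longrightarrow>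
        (\<exists>l. \<forall>k. \<exists>n0. \<forall>n\<ge>n0. val_ge val k (s n - l)))"

definition residue_char :: "('f::field \<Rightarrow> int) \<Rightarrow> nat \<Rightarrow> bool" where
  "residue_char val p \<longleftrightarrow> prime p \<and> val_ge val 1 (of_nat p)"

definition is_central_algebra_map :: "('f::field \<Rightarrow> 'k::ring_1) \<Rightarrow> bool" where
  "is_central_algebra_map \<iota> \<longleftrightarrow> \<iota> 1 = 1 \<and> (\<forall>a b. \<iota> (a + b) = \<iota> a + \<iota> b) \<and>
     (\<forall>a b. \<iota> (a * b) = \<iota> a * \<iota> b) \<and> (\<forall>a x. \<iota> a * x = x * \<iota> a)"

definition has_dim :: "('f::field \<Rightarrow> 'k::ring_1) \<Rightarrow> nat \<Rightarrow> bool" where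
  "has_dim \<iota> d \<longleftrightarrow> (\<exists>b. is_basis UNIV (\<lambda>a x. \<iota> a * x) d b UNIV)"

definition is_division_ring :: "'k::ring_1 itself \<Rightarrow> bool" where
  "is_division_ring _ \<longleftrightarrow> (\<forall>x::'k. x \<noteq> 0 \<longrightarrow> (\<exists>y. x * y = 1 \<and> y * x = 1))"

definition case_base :: "('f::field \<Rightarrow> 'k::ring_1) \<Rightarrow> ('k \<Rightarrow> 'k) \<Rightarrow> bool" where
  "case_base \<iota> \<sigma> \<longleftrightarrow> bij \<iota> \<and> \<sigma> = id \<and> (2::'f) \<noteq> 0"

definition case_quadratic :: "('f::field \<Rightarrow> 'k::ring_1) \<Rightarrow> ('k \<Rightarrow> 'k) \<Rightarrow> bool" where
  "case_quadratic \<iota> \<sigma> \<longleftrightarrow> (\<forall>x y::'k. x * y = y * x) \<and> is_division_ring TYPE('k) \<and> has_dim \<iota> 2 \<and>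
     (\<forall>x. \<exists>g::'f poly. coprime g (pderiv g) \<and>
        (\<Sum>i\<le>Polynomial.degree g. \<iota> (Polynomial.coeff g i) * x ^ i) = 0) \<and>
     (\<forall>x y. \<sigma> (x + y) = \<sigma> x + \<sigma> y) \<and> (\<forall>x y. \<sigma> (x * y) = \<sigma> x * \<sigma> y) \<and>
     (\<forall>a. \<sigma> (\<iota> a) = \<iota> a) \<and> bij \<sigma> \<and> \<sigma> \<noteq> id"

definition case_split :: "('f::field \<Rightarrow> 'k::ring_1) \<Rightarrow> ('k \<Rightarrow> 'k) \<Rightarrow> bool" where
  "case_split \<iota> \<sigma> \<longleftrightarrow> (\<exists>pr1 pr2 :: 'k \<Rightarrow> 'f.
     bij (\<lambda>x. (pr1 x, pr2 x)) \<and>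
     (\<forall>x y. pr1 (x + y) = pr1 x + pr1 y \<and> pr2 (x + y) = pr2 x + pr2 y) \<and>
     (\<forall>x y. pr1 (x * y) = pr1 x * pr1 y \<and> pr2 (x * y) = pr2 x * pr2 y) \<and>
     (\<forall>a. pr1 (\<iota> a) = a \<and> pr2 (\<iota> a) = a) \<and>
     (\<forall>x. pr1 (\<sigma> x) = pr2 x \<and> pr2 (\<sigma> x) = pr1 x))"

text \<open>A quaternion algebra is a central simple algebra of dimension 4, and its standard involution
  is the anti-automorphism \<open>\<sigma>\<close> for which all \<open>x + \<sigma>(x)\<close> and \<open>x \<sigma>(x)\<close> are scalars.\<close>

definition case_quaternion :: "('f::field \<Rightarrow> 'k::ring_1) \<Rightarrow> ('k \<Rightarrow> 'k) \<Rightarrow> bool" where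
  "case_quaternion \<iota> \<sigma> \<longleftrightarrow> is_division_ring TYPE('k) \<and> has_dim \<iota> 4 \<and>
     {x. \<forall>y. x * y = y * x} = range \<iota> \<and>
     (\<forall>x y. \<sigma> (x + y) = \<sigma> x + \<sigma> y) \<and> (\<forall>x y. \<sigma> (x * y) = \<sigma> y * \<sigma> x) \<and>
     (\<forall>a. \<sigma> (\<iota> a) = \<iota> a) \<and> (\<forall>x. \<sigma> (\<sigma> x) = x) \<and>
     (\<forall>x. x + \<sigma> x \<in> range \<iota> \<and> x * \<sigma> x \<in> range \<iota>)"

definition is_order :: "'f::field set \<Rightarrow> ('f \<Rightarrow> 'k::ring_1) \<Rightarrow> 'k set \<Rightarrow> bool" where
  "is_order A \<iota> Q \<longleftrightarrow> is_subring Q \<and>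
     (\<exists>(m::nat) b. Q = {\<Sum>i<m. \<iota> (a i) * b i | a. \<forall>i<m. a i \<in> A}) \<and>
     (\<forall>x. \<exists>a\<in>A. a \<noteq> 0 \<and> \<iota> a * x \<in> Q)"

definition is_maximal_order :: "'f::field set \<Rightarrow> ('f \<Rightarrow> 'k::ring_1) \<Rightarrow> 'k set \<Rightarrow> bool" where
  "is_maximal_order A \<iota> B \<longleftrightarrow> is_order A \<iota> B \<and> (\<forall>Q. is_order A \<iota> Q \<and> B \<subseteq> Q \<longrightarrow> Q = B)"

section \<open>Hermitian and quadratic forms\<close>

definition is_right_module :: "('v::ab_group_add \<Rightarrow> 'k::ring_1 \<Rightarrow> 'v) \<Rightarrow> bool" where
  "is_right_module act \<longleftrightarrow> (\<forall>v. act v 1 = v) \<and> (\<forall>v x y. act v (x * y) = act (act v x) y) \<and>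
     (\<forall>v w x. act (v + w) x = act v x + act w x) \<and> (\<forall>v x y. act v (x + y) = act v x + act v y)"

definition is_sesqui_hermitian ::
  "('v::ab_group_add \<Rightarrow> 'k::ring_1 \<Rightarrow> 'v) \<Rightarrow> ('k \<Rightarrow> 'k) \<Rightarrow> int \<Rightarrow> ('v \<Rightarrow> 'v \<Rightarrow> 'k) \<Rightarrow> bool" where
  "is_sesqui_hermitian act \<sigma> \<epsilon> f \<longleftrightarrow>
     (\<forall>u v w. f (u + v) w = f u w + f v w \<and> f w (u + v) = f w u + f w v) \<and>
     (\<forall>v w x y. f (act v x) (act w y) = \<sigma> x * f v w * y) \<and>
     (\<forall>v w. f w v = of_int \<epsilon> * \<sigma> (f v w))"

definition is_quadratic_form ::
  "('v::ab_group_add \<Rightarrow> 'k::ring_1 \<Rightarrow> 'v) \<Rightarrow> ('f::field \<Rightarrow> 'k) \<Rightarrow> ('v \<Rightarrow> 'f) \<Rightarrow> bool" where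
  "is_quadratic_form act \<iota> q \<longleftrightarrow>
     (\<forall>v a. q (act v (\<iota> a)) = a\<^sup>2 * q v) \<and>
     (let b = (\<lambda>v w. q (v + w) - q v - q w) in
       (\<forall>u v w. b (u + v) w = b u w + b v w) \<and> (\<forall>v w a. b (act v (\<iota> a)) w = a * b v w))"

text \<open>A form on \<open>L\<close> is recorded by its extension to \<open>V\<close>, and in the case \<open>(K, \<epsilon>, p) = (F, 1, 2)\<close> a quadratic
  form \<open>q: L \<rightarrow> A\<close> is recorded by the bilinear form \<open>(q(v + w) - q(v) - q(w))/2\<close>, which determines \<open>q\<close>
  but need not be integral on \<open>L\<close>.\<close>

definition is_form ::
  "('f::field \<Rightarrow> int) \<Rightarrow> nat \<Rightarrow> ('f \<Rightarrow> 'k::ring_1) \<Rightarrow> ('k \<Rightarrow> 'k) \<Rightarrow> int \<Rightarrow> 'k set \<Rightarrow>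
   ('v::ab_group_add \<Rightarrow> 'k \<Rightarrow> 'v) \<Rightarrow> 'v set \<Rightarrow> ('v \<Rightarrow> 'v \<Rightarrow> 'k) \<Rightarrow> bool" where
  "is_form val p \<iota> \<sigma> \<epsilon> B act L f \<longleftrightarrow>
     (if case_base \<iota> \<sigma> \<and> \<epsilon> = 1 \<and> p = 2
      then \<exists>q. is_quadratic_form act \<iota> q \<and> (\<forall>v\<in>L. q v \<in> val_ring val) \<and>
             (\<forall>v w. f v w = \<iota> ((q (v + w) - q v - q w) / 2))
      else is_sesqui_hermitian act \<sigma> \<epsilon> f \<and> (\<forall>v\<in>L. \<forall>w\<in>L. f v w \<in> B))"

text \<open>\<open>V\<close> is the whole type \<open>'v\<close>, and \<open>L\<close> is the \<open>B\<close>-span of a \<open>K\<close>-basis of \<open>V\<close>.\<close>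

locale hermitian_lattice =
  fixes val :: "'f::field \<Rightarrow> int"
    and p :: nat
    and \<iota> :: "'f \<Rightarrow> 'k::ring_1"
    and \<sigma> :: "'k \<Rightarrow> 'k"
    and \<epsilon> :: int
    and B :: "'k set"
    and act :: "'v::ab_group_add \<Rightarrow> 'k \<Rightarrow> 'v"
    and n :: nat
    and L :: "'v set"
    and h :: "'v \<Rightarrow> 'v \<Rightarrow> 'k"
  assumes local_field: "nonarch_local_field val"
    and residue_char: "residue_char val p"
    and algebra_map: "is_central_algebra_map \<iota>"
    and K_cases: "case_base \<iota> \<sigma> \<or> case_quadratic \<iota> \<sigma> \<or> case_split \<iota> \<sigma> \<or> case_quaternion \<iota> \<sigma>"
    and eps: "\<epsilon> \<in> {1, -1}"
    and maximal_order: "is_maximal_order (val_ring val) \<iota> B"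
    and right_module: "is_right_module act"
    and free: "\<exists>e. is_basis UNIV (\<lambda>x v. act v x) n e UNIV \<and> is_basis B (\<lambda>x v. act v x) n e L"
    and form: "is_form val p \<iota> \<sigma> \<epsilon> B act L h"
    and nondegenerate: "\<forall>v. (\<forall>w. h v w = 0) \<longrightarrow> v = 0"
    and double_dual: "{x. \<forall>y\<in>{x. \<forall>v\<in>L. h x v \<in> B}. h x y \<in> B} = L"
begin

abbreviation A :: "'f set" where
  "A \<equiv> val_ring val"

definition dual :: "'v set" where
  "dual = {x. \<forall>v\<in>L. h x v \<in> B}"

section \<open>The modules \<open>T\<^sup>m\<close> and \<open>H\<close>\<close>

definition EndK :: "('v \<Rightarrow> 'v) set" where
  "EndK = {X. (\<forall>v w. X (v + w) = X v + X w) \<and> (\<forall>v x. X (act v x) = act (X v) x)}"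

definition adj :: "('v \<Rightarrow> 'v) \<Rightarrow> 'v \<Rightarrow> 'v" where
  "adj X = (THE Y. Y \<in> EndK \<and> (\<forall>v w. h (X v) w = h v (Y w)))"

definition \<phi> :: "('v \<Rightarrow> 'v) \<Rightarrow> 'v \<Rightarrow> 'v \<Rightarrow> 'k" where
  "\<phi> X = (\<lambda>v w. h (X v) (X w))"

definition \<psi> :: "('v \<Rightarrow> 'v) \<Rightarrow> 'v \<Rightarrow> 'v \<Rightarrow> 'k" where
  "\<psi> X = (\<lambda>v w. h v (X w) + h (X v) w)"

definition H0 :: "('v \<Rightarrow> 'v \<Rightarrow> 'k) set" where
  "H0 = {f. is_form val p \<iota> \<sigma> \<epsilon> B act L f \<and> (\<forall>v\<in>L. \<forall>w\<in>dual. f v w \<in> B)}"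

text \<open>\<open>B\<close>-endomorphisms of \<open>L\<close> are identified with the \<open>K\<close>-endomorphisms of \<open>V\<close> preserving \<open>L\<close>. The class of
  \<open>f \<in> H\<^sup>0\<close> in \<open>H\<^sup>0/\<psi>(T\<^sup>m)\<close> is zero iff \<open>f \<in> \<psi>(T\<^sup>m)\<close>.\<close>

primrec T :: "nat \<Rightarrow> ('v \<Rightarrow> 'v) set" where
  "T 0 = {X \<in> EndK. X ` L \<subseteq> L \<and> X ` dual \<subseteq> dual}"
| "T (Suc m) = {X \<in> T m. \<phi> X \<in> H0 \<inter> \<psi> ` T m \<and> \<phi> (adj X) \<in> H0 \<inter> \<psi> ` T m}"

definition \<alpha> :: nat where
  "\<alpha> = (LEAST a. \<forall>m\<ge>a. T m = T a)"

definition T_tilde :: "('v \<Rightarrow> 'v) set" where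
  "T_tilde = T \<alpha>"

definition H_tilde :: "('v \<Rightarrow> 'v \<Rightarrow> 'k) set" where
  "H_tilde = \<psi> ` T_tilde"

definition scale_End :: "'f \<Rightarrow> ('v \<Rightarrow> 'v) \<Rightarrow> 'v \<Rightarrow> 'v" where
  "scale_End a X = (\<lambda>v. act (X v) (\<iota> a))"

definition scale_form :: "'f \<Rightarrow> ('v \<Rightarrow> 'v \<Rightarrow> 'k) \<Rightarrow> 'v \<Rightarrow> 'v \<Rightarrow> 'k" where
  "scale_form a f = (\<lambda>v w. \<iota> a * f v w)"

section \<open>Base change to polynomial rings\<close>

text \<open>The actions of \<open>F[x]\<close> on \<open>V \<otimes> F[x]\<close> and on \<open>K \<otimes> F[x]\<close>.\<close>

definition pscale :: "'f mpol \<Rightarrow> 'v mpol \<Rightarrow> 'v mpol" where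
  "pscale = conv (\<lambda>a v. act v (\<iota> a))"

definition kscale :: "'f mpol \<Rightarrow> 'k mpol \<Rightarrow> 'k mpol" where
  "kscale = conv (\<lambda>a c. \<iota> a * c)"

text \<open>The endomorphism \<open>\<Sum> y\<^sub>i t\<^sub>i\<close> of \<open>V \<otimes> F[x]\<close>, for \<open>t\<^sub>i \<in> End(V)\<close> and \<open>y\<^sub>i \<in> F[x]\<close>.\<close>

definition lin_comb :: "nat \<Rightarrow> (nat \<Rightarrow> 'v \<Rightarrow> 'v) \<Rightarrow> (nat \<Rightarrow> 'f mpol) \<Rightarrow> 'v mpol \<Rightarrow> 'v mpol" where
  "lin_comb N t y = (\<lambda>P. \<Sum>i<N. pscale (y i) (Poly_Mapping.map (t i) P))"

text \<open>An \<open>A\<close>-basis \<open>t\<^sub>0, \<dots>, t\<^sub>N\<^sub>-\<^sub>1\<close> of \<open>T\<close>-tilde identifies the affine space of all \<open>1 + X\<close> with \<open>Spec A[x\<^sub>0, \<dots>, x\<^sub>N\<^sub>-\<^sub>1]\<close>;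
  its universal point is \<open>1 + \<Sum> x\<^sub>i t\<^sub>i\<close>.\<close>

definition univ_point :: "nat \<Rightarrow> (nat \<Rightarrow> 'v \<Rightarrow> 'v) \<Rightarrow> 'v mpol \<Rightarrow> 'v mpol" where
  "univ_point N t = (\<lambda>P. P + lin_comb N t mvar P)"

text \<open>The points of the open subscheme of units: a prime belongs to it iff it has a principal open
  neighbourhood \<open>D(s)\<close> over which the universal point acquires a two-sided inverse in the monoid
  of all \<open>1 + Y\<close>. Here \<open>1 + (\<Sum> y\<^sub>i t\<^sub>i)/s\<close> is the inverse over the localisation at \<open>s\<close>, with denominators
  cleared; replacing \<open>s\<close> by a power does not change \<open>D(s)\<close>.\<close>

definition M_star :: "nat \<Rightarrow> (nat \<Rightarrow> 'v \<Rightarrow> 'v) \<Rightarrow> 'f mpol set set" where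
  "M_star N t = {Q. is_prime_ideal (mpol_ring A N) Q \<and>
     (\<exists>s\<in>mpol_ring A N - Q. \<exists>y. (\<forall>i<N. y i \<in> mpol_ring A N) \<and>
       (let m = univ_point N t; m' = (\<lambda>P. pscale s P + lin_comb N t y P) in
         \<forall>P. m (m' P) = pscale s P \<and> m' (m P) = pscale s P))}"

text \<open>An \<open>A\<close>-basis \<open>s\<^sub>0, \<dots>, s\<^sub>M\<^sub>-\<^sub>1\<close> of \<open>H\<close>-tilde identifies the affine space of all \<open>h + f\<close> with
  \<open>Spec A[y\<^sub>0, \<dots>, y\<^sub>M\<^sub>-\<^sub>1]\<close>. The image \<open>h + \<Sum> g\<^sub>k s\<^sub>k\<close> of the universal point \<open>m\<close> under \<open>m \<mapsto> h \<circ> m\<close> defines the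
  comorphism \<open>y\<^sub>k \<mapsto> g\<^sub>k\<close>.\<close>

definition rho_coords ::
  "nat \<Rightarrow> (nat \<Rightarrow> 'v \<Rightarrow> 'v) \<Rightarrow> nat \<Rightarrow> (nat \<Rightarrow> 'v \<Rightarrow> 'v \<Rightarrow> 'k) \<Rightarrow> nat \<Rightarrow> 'f mpol" where
  "rho_coords N t M s = (THE g. (\<forall>k<M. g k \<in> mpol_ring A N) \<and> (\<forall>k\<ge>M. g k = 0) \<and>
     (\<forall>P Q. conv h (univ_point N t P) (univ_point N t Q) =
        conv h P Q + (\<Sum>k<M. kscale (g k) (conv (s k) P Q))))"

definition rho_comorphism ::
  "nat \<Rightarrow> (nat \<Rightarrow> 'v \<Rightarrow> 'v) \<Rightarrow> nat \<Rightarrow> (nat \<Rightarrow> 'v \<Rightarrow> 'v \<Rightarrow> 'k) \<Rightarrow> 'f mpol \<Rightarrow> 'f mpol" where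
  "rho_comorphism N t M s = mpol_eval mconst (rho_coords N t M s)"

section \<open>The algebraic group \<open>G\<close>\<close>

text \<open>An \<open>F\<close>-basis \<open>E\<^sub>0, \<dots>, E\<^sub>r\<^sub>-\<^sub>1\<close> of \<open>End\<^sub>K(V)\<close> identifies the affine space of endomorphisms with
  \<open>Spec F[x\<^sub>0, \<dots>, x\<^sub>r\<^sub>-\<^sub>1]\<close> and \<open>Z = \<Sum> x\<^sub>i E\<^sub>i\<close> is the universal endomorphism. \<open>G\<close> is the closed subscheme
  \<open>h \<circ> Z = h\<close> of the open subscheme where \<open>Z\<close> is invertible. The equations are the components
  (under linear functionals \<open>\<xi>: K \<rightarrow> F\<close>) of \<open>h(Z v, Z w) - h(v, w) \<in> K \<otimes> F[x]\<close>.\<close>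

definition G_ideal :: "nat \<Rightarrow> (nat \<Rightarrow> 'v \<Rightarrow> 'v) \<Rightarrow> 'f mpol set" where
  "G_ideal r E = ideal_gen (mpol_ring UNIV r)
     {Poly_Mapping.map \<xi>
        (conv h (lin_comb r E mvar (mconst v)) (lin_comb r E mvar (mconst w)) - mconst (h v w)) |
      \<xi> v w. (\<forall>x y. \<xi> (x + y) = \<xi> x + \<xi> y) \<and> (\<forall>a x. \<xi> (\<iota> a * x) = a * \<xi> x)}"

definition G_points :: "nat \<Rightarrow> (nat \<Rightarrow> 'v \<Rightarrow> 'v) \<Rightarrow> 'f mpol set set" where
  "G_points r E = {Q. is_prime_ideal (mpol_ring UNIV r) Q \<and> G_ideal r E \<subseteq> Q \<and>
     (\<exists>s\<in>mpol_ring UNIV r - Q. \<exists>y. (\<forall>i<r. y i \<in> mpol_ring UNIV r) \<and>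
       (let Z = lin_comb r E mvar; Z' = lin_comb r E y in
         \<forall>P. Z (Z' P) = pscale s P \<and> Z' (Z P) = pscale s P))}"

definition G_smooth :: "nat \<Rightarrow> (nat \<Rightarrow> 'v \<Rightarrow> 'v) \<Rightarrow> bool" where
  "G_smooth r E \<longleftrightarrow> is_smooth UNIV mconst (mpol_ring UNIV r) (G_ideal r E) (G_points r E)"

definition dim_G :: "nat \<Rightarrow> (nat \<Rightarrow> 'v \<Rightarrow> 'v) \<Rightarrow> enat" where
  "dim_G r E = krull_dim (G_points r E)"

definition rho_smooth_of_rel_dim ::
  "nat \<Rightarrow> (nat \<Rightarrow> 'v \<Rightarrow> 'v) \<Rightarrow> nat \<Rightarrow> (nat \<Rightarrow> 'v \<Rightarrow> 'v \<Rightarrow> 'k) \<Rightarrow> nat \<Rightarrow> bool" where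
  "rho_smooth_of_rel_dim N t M s d \<longleftrightarrow>
     smooth_of_rel_dim (mpol_ring A M) (rho_comorphism N t M s)
       (mpol_ring A N) {0} (M_star N t) d"

end

end

theory Submission
  imports Defs "Jordan_Normal_Form.Char_Poly"
begin

text \<open>The differential of \<open>m \<mapsto> h \<circ> m\<close> at \<open>m\<close> in direction \<open>X\<close> is \<open>\<psi>(m\<^sup>* X)\<close>. If \<open>m\<close> is invertible, the direction
  \<open>(m\<^sup>*)\<^sup>-\<^sup>1 S\<close> realises a given \<open>\<psi>(S)\<close>, and it stays in \<open>T\<close>-tilde because \<open>T\<close>-tilde is closed under composition and
  adjoints, although it need not contain \<open>1\<close>. So near every point of \<open>M\<^sup>*\<close> a maximal minor of the Jacobian of \<open>\<rho>\<close>
  is invertible, and \<open>\<rho>\<close> is standard smooth of relative dimension \<open>rank T - rank H = dim End - dim \<psi>(End)\<close>.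

  The same minors bound the length of chains of primes of \<open>G\<close> from above. From below, an affine variant of the
  Cayley transform turns the skew endomorphisms (the kernel of \<open>\<psi>\<close>) into a unitary point whose coordinates have
  transcendence degree \<open>dim End - dim \<psi>(End)\<close>, and specialising parameters one at a time yields a chain.

  Both parts need \<open>h = \<psi>(Z)\<close> for some \<open>Z\<close>, since then \<open>h \<circ> X = \<psi>(X\<^sup>* Z X)\<close>. For \<open>2 \<noteq> 0\<close> one takes \<open>Z = 1/2\<close>; in
  characteristic 2 this is where smoothness of \<open>G\<close> enters.\<close>


section \<open>Subrings, ideals and polynomials\<close>

text \<open>A solution of \<open>h = \<psi> Z\<close> replaces division by 2. It bounds denominators
  in the recursion uniformly in \<open>m\<close>, so the lattices \<open>T m\<close> become constant
  and span \<open>EndK\<close> over the field, and it puts \<open>\<phi> X\<close> into the range of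
  \<open>\<psi>\<close>, so that \<rho> and the equations of \<open>G\<close> have coordinates in
  one basis of forms. In characteristic 2 it comes from smoothness at the identity: the curve (1 +
  X) id changes h by X^2 h, and a lift modulo X^3 can cancel this only by a value of \<psi>.

  For the lower bound on dim G, Y + adj Y = 1 makes 1 - Y^{-1} unitary; Y runs through a translate
  of the kernel of \<psi> by an invertible Z with \<open>\<psi> Z = h\<close>. For the upper bound,
  a chain of length k becomes k extra variables through the graph of elements separating its
  members; the enlarged prime is locally generated by dim End elements, yet contains k + dim
  \<psi>(End) equations with independent differentials.

  The basis of T-tilde and the basis of End used for G are unrelated. Both are instances of one
  coordinate formalism over the field; integrality is added for \<rho> alone.\<close>

lemma subring_closed:
  assumes "is_subring S"
  shows subring_0: "0 \<in> S" and subring_1: "1 \<in> S"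
    and subring_diff: "x \<in> S \<Longrightarrow> y \<in> S \<Longrightarrow> x - y \<in> S"
    and subring_mult: "x \<in> S \<Longrightarrow> y \<in> S \<Longrightarrow> x * y \<in> S"
    and subring_uminus: "x \<in> S \<Longrightarrow> - x \<in> S"
    and subring_add: "x \<in> S \<Longrightarrow> y \<in> S \<Longrightarrow> x + y \<in> S"
proof -
  show 1: "1 \<in> S" and d: "x \<in> S \<Longrightarrow> y \<in> S \<Longrightarrow> x - y \<in> S" for x y
    using assms by (auto simp: is_subring_def)
  show "x \<in> S \<Longrightarrow> y \<in> S \<Longrightarrow> x * y \<in> S"
    using assms by (auto simp: is_subring_def)
  show 0: "0 \<in> S" using d[OF 1 1] by simp
  show u: "x \<in> S \<Longrightarrow> - x \<in> S" for x using d[OF 0, of x] by simp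
  show "x \<in> S \<Longrightarrow> y \<in> S \<Longrightarrow> x + y \<in> S" using d[of x "- y"] u[of y] by simp
qed

lemma subring_sum: "is_subring S \<Longrightarrow> (\<And>i. i \<in> I \<Longrightarrow> f i \<in> S) \<Longrightarrow> sum f I \<in> S"
  by (induction I rule: infinite_finite_induct) (auto intro: subring_0 subring_add)

lemma subring_prod:
  fixes f :: "'i \<Rightarrow> 'a::comm_ring_1"
  shows "is_subring S \<Longrightarrow> (\<And>i. i \<in> I \<Longrightarrow> f i \<in> S) \<Longrightarrow> prod f I \<in> S"
  by (induction I rule: infinite_finite_induct) (auto intro: subring_1 subring_mult)

lemma subring_power: "is_subring S \<Longrightarrow> x \<in> S \<Longrightarrow> x ^ k \<in> S"
  by (induction k) (auto intro: subring_1 subring_mult)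

lemma is_subring_UNIV: "is_subring UNIV"
  by (simp add: is_subring_def)

lemma prime_idealD:
  assumes "is_prime_ideal S P"
  shows prime_ideal_subset: "x \<in> P \<Longrightarrow> x \<in> S" and prime_ideal_0: "0 \<in> P" and prime_ideal_1: "1 \<notin> P"
    and prime_ideal_add: "x \<in> P \<Longrightarrow> y \<in> P \<Longrightarrow> x + y \<in> P"
    and prime_ideal_mult: "x \<in> S \<Longrightarrow> y \<in> P \<Longrightarrow> x * y \<in> P"
    and prime_ideal_multD: "x \<in> S \<Longrightarrow> y \<in> S \<Longrightarrow> x * y \<in> P \<Longrightarrow> x \<in> P \<or> y \<in> P"
  using assms by (auto simp: is_prime_ideal_def)

lemma prime_ideal_diff:
  assumes "is_prime_ideal S P" "is_subring S" "x \<in> P" "y \<in> P"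
  shows "x - y \<in> P"
proof -
  have "- 1 * y \<in> P"
    by (rule prime_ideal_mult[OF assms(1)]) (use assms in \<open>auto intro: subring_1 subring_uminus\<close>)
  then show ?thesis using prime_ideal_add[OF assms(1) assms(3), of "- y"] by simp
qed

lemma prime_ideal_sum: "is_prime_ideal S P \<Longrightarrow> (\<And>i. i \<in> I \<Longrightarrow> f i \<in> P) \<Longrightarrow> sum f I \<in> P"
  by (induction I rule: infinite_finite_induct) (auto intro: prime_ideal_0 prime_ideal_add)

lemma prime_ideal_power: "is_prime_ideal S P \<Longrightarrow> is_subring S \<Longrightarrow> x \<in> S \<Longrightarrow> x ^ k \<in> P \<Longrightarrow> x \<in> P"
  by (induction k) (auto dest: prime_ideal_multD prime_ideal_1 intro: subring_power)

lemma prime_ideal_prod: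
  "is_prime_ideal S P \<Longrightarrow> is_subring S \<Longrightarrow> (\<And>i. i \<in> I \<Longrightarrow> f i \<in> S - P) \<Longrightarrow> prod f I \<in> S - P"
proof (induction I rule: infinite_finite_induct)
  case (insert x F)
  then show ?case using prime_ideal_multD[OF insert.prems(1), of "f x" "prod f F"]
    by (auto intro: subring_mult)
qed (auto dest: prime_ideal_1 intro: subring_1)

text \<open>Only stability is asked, not containment in \<open>S\<close>. Preimages under ring
  homomorphisms, such as all \<open>a\<close> with \<open>x dvd \<theta> a\<close>, then count as
  ideals without being cut down to \<open>S\<close>.\<close>

definition is_ideal :: "'a::comm_ring_1 set \<Rightarrow> 'a set \<Rightarrow> bool" where
  "is_ideal S I \<longleftrightarrow> 0 \<in> I \<and> (\<forall>x\<in>I. \<forall>y\<in>I. x + y \<in> I) \<and> (\<forall>a\<in>S. \<forall>x\<in>I. a * x \<in> I)"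

lemma is_ideal_sum: "is_ideal S I \<Longrightarrow> (\<And>i. i \<in> K \<Longrightarrow> f i \<in> I) \<Longrightarrow> sum f K \<in> I"
  by (induction K rule: infinite_finite_induct) (auto simp: is_ideal_def)

lemma is_ideal_mult: "is_ideal S I \<Longrightarrow> a \<in> S \<Longrightarrow> x \<in> I \<Longrightarrow> a * x \<in> I"
  by (auto simp: is_ideal_def)

lemma is_ideal_add: "is_ideal S I \<Longrightarrow> x \<in> I \<Longrightarrow> y \<in> I \<Longrightarrow> x + y \<in> I"
  by (auto simp: is_ideal_def)

lemma prime_ideal_imp_ideal: "is_prime_ideal S P \<Longrightarrow> is_ideal S P"
  by (auto simp: is_prime_ideal_def is_ideal_def)

lemma ideal_gen_ideal:
  assumes "is_subring S" shows "is_ideal S (ideal_gen S X)"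
  unfolding is_ideal_def
proof (intro conjI ballI)
  show "0 \<in> ideal_gen S X"
    unfolding ideal_gen_def by (rule CollectI, rule exI[of _ "0::nat"]) auto
next
  fix x y :: 'a assume "x \<in> ideal_gen S X" "y \<in> ideal_gen S X"
  then obtain k :: nat and a u and l :: nat and b v where x: "x = (\<Sum>i<k. a i * u i)" "\<forall>i<k. a i \<in> S \<and> u i \<in> X"
    and y: "y = (\<Sum>i<l. b i * v i)" "\<forall>i<l. b i \<in> S \<and> v i \<in> X"
    unfolding ideal_gen_def mem_Collect_eq by (elim exE conjE) (rule that; assumption)
  define c where "c i = (if i < k then a i else b (i - k))" for i
  define w where "w i = (if i < k then u i else v (i - k))" for i
  have "(\<Sum>i<k + l. c i * w i) = (\<Sum>i<k. c i * w i) + (\<Sum>i<l. c (k + i) * w (k + i))"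
    by (induction l) (auto simp: add.assoc)
  also have "\<dots> = x + y" unfolding x y by (simp add: c_def w_def)
  finally have "x + y = (\<Sum>i<k + l. c i * w i)" by simp
  moreover have "\<forall>i<k + l. c i \<in> S \<and> w i \<in> X" using x y by (auto simp: c_def w_def)
  ultimately show "x + y \<in> ideal_gen S X" unfolding ideal_gen_def
    by (intro CollectI exI[of _ "k + l"] exI[of _ c] exI[of _ w] conjI)
next
  fix s x assume s: "s \<in> S" and "x \<in> ideal_gen S X"
  then obtain k :: nat and a u where x: "x = (\<Sum>i<k. a i * u i)" "\<forall>i<k. a i \<in> S \<and> u i \<in> X"
    unfolding ideal_gen_def by auto
  have "s * x = (\<Sum>i<(k::nat). (s * a i) * u i)" "\<forall>i<k. s * a i \<in> S \<and> u i \<in> X"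
    using s x by (auto simp: sum_distrib_left mult.assoc intro: subring_mult assms)
  then show "s * x \<in> ideal_gen S X" unfolding ideal_gen_def
    by (intro CollectI exI[of _ k] exI[of _ "\<lambda>i. s * a i"] exI[of _ u]) auto
qed

lemma ideal_gen_superset: assumes "is_subring S" "x \<in> X" shows "x \<in> ideal_gen S X"
  unfolding ideal_gen_def
  by (rule CollectI, rule exI[of _ 1], rule exI[of _ "\<lambda>_. 1"], rule exI[of _ "\<lambda>_. x"])
    (use assms in \<open>auto intro: subring_1\<close>)

lemma ideal_gen_least:
  assumes "is_ideal S I" "X \<subseteq> I" shows "ideal_gen S X \<subseteq> I"
  using assms unfolding ideal_gen_def by (auto intro!: is_ideal_sum[OF assms(1)] is_ideal_mult)

lemma ideal_gen_mono: "X \<subseteq> Y \<Longrightarrow> ideal_gen S X \<subseteq> ideal_gen S Y"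
  unfolding ideal_gen_def by blast

text \<open>An element of \<open>ideal_gen\<close> may use a generator several times and in any
  order. The combinations with one coefficient per index already form an ideal containing the
  generators, so this normal form always exists; it is what gets differentiated in
  \<open>chain_bound\<close>.\<close>

lemma ideal_gen_finite:
  assumes "is_subring S" "y \<in> ideal_gen S (f ` {..<c::nat})"
  obtains a where "\<And>i. i < c \<Longrightarrow> a i \<in> S" "y = (\<Sum>i<c. a i * f i)"
proof -
  let ?I = "{\<Sum>i<c. a i * f i | a. \<forall>i<c. a i \<in> S}"
  have "is_ideal S ?I" unfolding is_ideal_def
  proof (intro conjI ballI)
    show "0 \<in> ?I"
      by (rule CollectI, rule exI[of _ "\<lambda>_. 0"]) (auto intro: subring_0 assms)
  next
    fix x y assume "x \<in> ?I" "y \<in> ?I"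
    then obtain a b where "x = (\<Sum>i<c. a i * f i)" "\<forall>i<c. a i \<in> S" "y = (\<Sum>i<c. b i * f i)" "\<forall>i<c. b i \<in> S"
      by auto
    then show "x + y \<in> ?I"
      by (intro CollectI exI[of _ "\<lambda>i. a i + b i"])
        (auto simp: sum.distrib distrib_right intro: subring_add assms)
  next
    fix s x assume "s \<in> S" "x \<in> ?I"
    then obtain a where "x = (\<Sum>i<c. a i * f i)" "\<forall>i<c. a i \<in> S" by auto
    then show "s * x \<in> ?I" using \<open>s \<in> S\<close>
      by (intro CollectI exI[of _ "\<lambda>i. s * a i"])
        (auto simp: sum_distrib_left mult.assoc intro: subring_mult assms)
  qed
  moreover have "f ` {..<c} \<subseteq> ?I"
  proof
    fix x assume "x \<in> f ` {..<c}"
    then obtain j where "j < c" "x = f j" by auto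
    then have "x = (\<Sum>i<c. (if i = j then 1 else 0) * f i)"
      by (simp add: if_distrib[of "\<lambda>x. x * _"] cong: if_cong)
    then show "x \<in> ?I"
      by (intro CollectI exI[of _ "\<lambda>i. if i = j then 1 else 0"]) (auto intro: subring_1 subring_0 assms)
  qed
  ultimately have "ideal_gen S (f ` {..<c}) \<subseteq> ?I" by (rule ideal_gen_least)
  then show thesis using assms(2) that by auto
qed

section \<open>Evaluation of polynomials in several variables\<close>

abbreviation mp_monom :: "(nat \<Rightarrow> 'b::comm_ring_1) \<Rightarrow> (nat \<Rightarrow>\<^sub>0 nat) \<Rightarrow> 'b" where
  "mp_monom q a \<equiv> \<Prod>i\<in>Poly_Mapping.keys a. q i ^ Poly_Mapping.lookup a i"

lemma mp_monom_superset:
  "finite I \<Longrightarrow> Poly_Mapping.keys a \<subseteq> I \<Longrightarrow> mp_monom q a = (\<Prod>i\<in>I. q i ^ Poly_Mapping.lookup a i)"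
  by (rule prod.mono_neutral_left) (auto simp: in_keys_iff)

lemma mp_monom_add: "mp_monom q (a + b) = mp_monom q a * mp_monom q b"
proof -
  let ?I = "Poly_Mapping.keys a \<union> Poly_Mapping.keys b"
  have "mp_monom q (a + b) = (\<Prod>i\<in>?I. q i ^ Poly_Mapping.lookup (a + b) i)"
    by (rule mp_monom_superset) (auto simp: in_keys_iff lookup_add)
  then show ?thesis
    by (simp add: lookup_add power_add prod.distrib mp_monom_superset[of ?I a] mp_monom_superset[of ?I b])
qed

lemma mpol_sum_singles:
  "finite A \<Longrightarrow> Poly_Mapping.keys g \<subseteq> A \<Longrightarrow> g = (\<Sum>a\<in>A. Poly_Mapping.single a (Poly_Mapping.lookup g a))"
  by (rule poly_mapping_eqI)
    (auto simp: lookup_sum lookup_single when_def sum.delta in_keys_iff subset_iff)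

lemma mpol_eval_superset:
  assumes "finite A" "Poly_Mapping.keys g \<subseteq> A" "\<phi> 0 = 0"
  shows "mpol_eval \<phi> q g = (\<Sum>a\<in>A. \<phi> (Poly_Mapping.lookup g a) * mp_monom q a)"
  unfolding mpol_eval_def
  by (rule sum.mono_neutral_left) (use assms in \<open>auto simp: in_keys_iff\<close>)

context
  fixes \<phi> :: "'a::comm_ring_1 \<Rightarrow> 'b::comm_ring_1" and q :: "nat \<Rightarrow> 'b"
  assumes hom: "comm_ring_hom \<phi>"
begin

interpretation \<phi>: comm_ring_hom \<phi> by (rule hom)

lemma mpol_eval_single: "mpol_eval \<phi> q (Poly_Mapping.single a c) = \<phi> c * mp_monom q a"
  by (subst mpol_eval_superset[of "{a}"]) auto

lemma mpol_eval_add: "mpol_eval \<phi> q (g + g') = mpol_eval \<phi> q g + mpol_eval \<phi> q g'"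
proof -
  let ?A = "Poly_Mapping.keys g \<union> Poly_Mapping.keys g'"
  have "finite ?A" "Poly_Mapping.keys g \<subseteq> ?A" "Poly_Mapping.keys g' \<subseteq> ?A"
    "Poly_Mapping.keys (g + g') \<subseteq> ?A"
    using keys_add[of g g'] by auto
  note * = mpol_eval_superset[OF \<open>finite ?A\<close>, of _ \<phi> q, OF _ \<phi>.hom_zero]
  show ?thesis
    by (simp only: *[OF \<open>Poly_Mapping.keys g \<subseteq> ?A\<close>] *[OF \<open>Poly_Mapping.keys g' \<subseteq> ?A\<close>]
        *[OF \<open>Poly_Mapping.keys (g + g') \<subseteq> ?A\<close>] lookup_add \<phi>.hom_add distrib_right sum.distrib)
qed

lemma mpol_eval_zero: "mpol_eval \<phi> q 0 = 0"
  by (simp add: mpol_eval_def)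

lemma mpol_eval_sum: "mpol_eval \<phi> q (sum f I) = (\<Sum>i\<in>I. mpol_eval \<phi> q (f i))"
  by (induction I rule: infinite_finite_induct) (auto simp: mpol_eval_zero mpol_eval_add)

lemma mpol_eval_mult: "mpol_eval \<phi> q (g * g') = mpol_eval \<phi> q g * mpol_eval \<phi> q g'"
proof -
  have "g * g' = (\<Sum>a\<in>Poly_Mapping.keys g. Poly_Mapping.single a (Poly_Mapping.lookup g a)) *
      (\<Sum>a\<in>Poly_Mapping.keys g'. Poly_Mapping.single a (Poly_Mapping.lookup g' a))"
    using mpol_sum_singles[of _ g] mpol_sum_singles[of _ g'] by auto
  also have "\<dots> = (\<Sum>a\<in>Poly_Mapping.keys g. \<Sum>b\<in>Poly_Mapping.keys g'.
      Poly_Mapping.single (a + b) (Poly_Mapping.lookup g a * Poly_Mapping.lookup g' b))"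
    by (simp add: sum_product mult_single)
  finally have "mpol_eval \<phi> q (g * g') = (\<Sum>a\<in>Poly_Mapping.keys g. \<Sum>b\<in>Poly_Mapping.keys g'.
      (\<phi> (Poly_Mapping.lookup g a) * mp_monom q a) * (\<phi> (Poly_Mapping.lookup g' b) * mp_monom q b))"
    by (simp add: mpol_eval_sum mpol_eval_single mp_monom_add \<phi>.hom_mult mult_ac)
  then show ?thesis by (simp add: sum_product mpol_eval_def)
qed

lemma comm_ring_hom_mpol_eval: "comm_ring_hom (mpol_eval \<phi> q)"
  using mpol_eval_single[of 0 1]
  by unfold_locales (auto simp: mpol_eval_add mpol_eval_mult mpol_eval_zero)

lemma mpol_eval_const [simp]: "mpol_eval \<phi> q (mconst c) = \<phi> c"
  by (simp add: mpol_eval_single)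

lemma mpol_eval_var [simp]: "mpol_eval \<phi> q (mvar i) = q i"
  by (simp add: mvar_def mpol_eval_single)

end

lemma mpol_eval_hom:
  assumes "comm_ring_hom \<theta>"
  shows "\<theta> (mpol_eval \<phi> q g) = mpol_eval (\<lambda>c. \<theta> (\<phi> c)) (\<lambda>i. \<theta> (q i)) g"
proof -
  interpret comm_ring_hom \<theta> by fact
  show ?thesis by (simp add: mpol_eval_def hom_sum hom_mult hom_prod hom_power)
qed

lemma comm_ring_hom_mconst: "comm_ring_hom (mconst :: 'a::comm_ring_1 \<Rightarrow> 'a mpol)"
proof unfold_locales
  show "mconst (1::'a) = 1" by (rule single_one)
qed (simp_all add: single_add mult_single)

lemma comm_ring_hom_id: "comm_ring_hom (\<lambda>x. x)"
  by unfold_locales auto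

lemma comm_ring_hom_comp: "comm_ring_hom f \<Longrightarrow> comm_ring_hom g \<Longrightarrow> comm_ring_hom (\<lambda>x. f (g x))"
proof -
  assume "comm_ring_hom f" "comm_ring_hom g"
  then interpret f: comm_ring_hom f + g: comm_ring_hom g .
  show ?thesis by unfold_locales (auto simp: f.hom_add f.hom_mult g.hom_add g.hom_mult)
qed

lemma mpol_eval_cong:
  assumes "g \<in> mpol_ring R n" "\<And>i. i < n \<Longrightarrow> q i = q' i" "\<And>c. c \<in> R \<Longrightarrow> \<phi> c = \<phi>' c"
  shows "mpol_eval \<phi> q g = mpol_eval \<phi>' q' g"
  unfolding mpol_eval_def
proof (rule sum.cong[OF refl])
  fix a assume "a \<in> Poly_Mapping.keys g"
  then have "Poly_Mapping.lookup g a \<in> R" "Poly_Mapping.keys a \<subseteq> {..<n}"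
    using assms(1) by (auto simp: mpol_ring_def)
  then show "\<phi> (Poly_Mapping.lookup g a) * mp_monom q a = \<phi>' (Poly_Mapping.lookup g a) * mp_monom q' a"
    using assms(2,3) by (auto intro!: arg_cong2[of _ _ _ _ "(*)"] prod.cong)
qed

lemma mpol_eval_in_subring:
  assumes "g \<in> mpol_ring R n" "is_subring S" "\<And>i. i < n \<Longrightarrow> q i \<in> S" "\<And>c. c \<in> R \<Longrightarrow> \<phi> c \<in> S"
  shows "mpol_eval \<phi> q g \<in> S"
  unfolding mpol_eval_def
  by (intro subring_sum subring_mult subring_prod subring_power assms)
    (use assms(1) in \<open>auto simp: mpol_ring_def\<close>)

lemma mconst_prod_var:
  fixes c :: "'a::comm_ring_1"
  shows "Poly_Mapping.single a c = mconst c * mp_monom mvar a"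
proof -
  have *: "mp_monom mvar a = Poly_Mapping.single a (1::'a)"
  proof -
    have pow: "mvar i ^ k = Poly_Mapping.single (Poly_Mapping.single i k) (1::'a)" for i k
    proof (induction k)
      case (Suc k)
      have "Poly_Mapping.single i 1 + Poly_Mapping.single i k = Poly_Mapping.single i (Suc k)"
        by (simp only: single_add[symmetric]) simp
      then show ?case by (simp only: power_Suc Suc) (simp add: mvar_def mult_single del: single_one)
    qed simp
    have "(\<Prod>i\<in>I. Poly_Mapping.single (f i) (1::'a)) = Poly_Mapping.single (\<Sum>i\<in>I. f i) 1"
      if "finite I" for I and f :: "nat \<Rightarrow> nat \<Rightarrow>\<^sub>0 nat"
      using that by (induction I) (auto simp: mult_single)
    then show ?thesis unfolding pow
      using mpol_sum_singles[of "Poly_Mapping.keys a" a] by simp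
  qed
  show ?thesis unfolding * by (simp add: mult_single)
qed

text \<open>A polynomial is the sum of its terms, and each term is a constant times a product of
  powers of variables. Identities between homomorphisms and derivations are thereby reduced to
  constants and variables.\<close>

lemma mpol_ring_induct [consumes 1, case_names const var add mult]:
  fixes g :: "'a::comm_ring_1 mpol"
  assumes g: "g \<in> mpol_ring R n" and R: "is_subring R"
    and c: "\<And>c. c \<in> R \<Longrightarrow> P (mconst c)" and v: "\<And>i. i < n \<Longrightarrow> P (mvar i)"
    and a: "\<And>f g. P f \<Longrightarrow> P g \<Longrightarrow> P (f + g)" and m: "\<And>f g. P f \<Longrightarrow> P g \<Longrightarrow> P (f * g)"
  shows "P g"
proof -
  have P0: "P 0" and P1: "P 1" using c[of 0] c[of 1] R by (auto intro: subring_0 subring_1)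
  have pw: "P (x ^ k)" if "P x" for x k using that by (induction k) (auto intro: P1 m)
  have pr: "P (\<Prod>i\<in>I. f i)" if "finite I" "\<forall>i\<in>I. P (f i)" for I :: "nat set" and f
    using that by (induction I) (auto intro: P1 m)
  have sm: "P (\<Sum>i\<in>I. f i)" if "finite I" "\<forall>i\<in>I. P (f i)" for I :: "(nat \<Rightarrow>\<^sub>0 nat) set" and f
    using that by (induction I) (auto intro: P0 a)
  have "P (\<Sum>a\<in>Poly_Mapping.keys g. mconst (Poly_Mapping.lookup g a) * mp_monom mvar a)"
    using g by (intro sm ballI m c pr pw v) (auto simp: mpol_ring_def)
  then show ?thesis unfolding mconst_prod_var[symmetric]
    using mpol_sum_singles[of "Poly_Mapping.keys g" g] by simp
qed

lemma mpol_ring_const [intro]: "c \<in> R \<Longrightarrow> mconst c \<in> mpol_ring R n"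
  by (auto simp: mpol_ring_def)

lemma mpol_ring_var [intro]: "is_subring R \<Longrightarrow> i < n \<Longrightarrow> mvar i \<in> mpol_ring R n"
  by (auto simp: mpol_ring_def mvar_def intro: subring_1)

lemma is_subring_mpol_ring [intro]:
  assumes R: "is_subring R" shows "is_subring (mpol_ring R n)"
  unfolding is_subring_def
proof (intro conjI ballI)
  show "1 \<in> mpol_ring R n" using R by (auto simp: mpol_ring_def intro: subring_1)
next
  fix x y assume xy: "x \<in> mpol_ring R n" "y \<in> mpol_ring R n"
  have 0: "Poly_Mapping.lookup z a \<in> R" if "z \<in> mpol_ring R n" for z a
    using that subring_0[OF R] by (cases "a \<in> Poly_Mapping.keys z") (auto simp: mpol_ring_def in_keys_iff)
  show "x - y \<in> mpol_ring R n" unfolding mpol_ring_def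
  proof (intro CollectI ballI conjI)
    fix a assume "a \<in> Poly_Mapping.keys (x - y)"
    then have "a \<in> Poly_Mapping.keys x \<or> a \<in> Poly_Mapping.keys y"
      by (auto simp: in_keys_iff lookup_minus)
    then show "Poly_Mapping.keys a \<subseteq> {..<n}" using xy by (auto simp: mpol_ring_def)
  next
    fix a show "Poly_Mapping.lookup (x - y) a \<in> R"
      unfolding lookup_minus by (intro subring_diff R 0 xy)
  qed
  show "x * y \<in> mpol_ring R n" unfolding mpol_ring_def
  proof (intro CollectI ballI conjI)
    fix a assume "a \<in> Poly_Mapping.keys (x * y)"
    then obtain b c where "a = b + c" "b \<in> Poly_Mapping.keys x" "c \<in> Poly_Mapping.keys y"
      using subsetD[OF keys_mult] by blast
    then show "Poly_Mapping.keys a \<subseteq> {..<n}" using xy keys_add[of b c] by (fastforce simp: mpol_ring_def)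
  next
    fix a
    have "x * y = (\<Sum>a\<in>Poly_Mapping.keys x. Poly_Mapping.single a (Poly_Mapping.lookup x a)) *
      (\<Sum>a\<in>Poly_Mapping.keys y. Poly_Mapping.single a (Poly_Mapping.lookup y a))"
      using mpol_sum_singles[of _ x] mpol_sum_singles[of _ y] by auto
    also have "Poly_Mapping.lookup \<dots> a \<in> R"
      unfolding sum_product lookup_sum mult_single lookup_single when_def
      by (intro subring_sum R) (auto intro: subring_mult subring_0 R 0 xy)
    finally show "Poly_Mapping.lookup (x * y) a \<in> R" .
  qed
qed

lemma mpol_ring_mono: "R \<subseteq> R' \<Longrightarrow> n \<le> n' \<Longrightarrow> mpol_ring R n \<subseteq> mpol_ring R' n'"
  unfolding mpol_ring_def by fastforce

lemma mpol_eval_mvar: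
  assumes "g \<in> mpol_ring R n" "is_subring R"
  shows "mpol_eval mconst mvar g = g"
  using mpol_sum_singles[of "Poly_Mapping.keys g" g]
  by (simp add: mpol_eval_def mconst_prod_var[symmetric])

lemma mpol_eval_subst:
  assumes "comm_ring_hom \<phi>"
  shows "mpol_eval \<phi> q (mpol_eval mconst p g) = mpol_eval \<phi> (\<lambda>i. mpol_eval \<phi> q (p i)) g"
  using mpol_eval_hom[OF comm_ring_hom_mpol_eval[OF assms], of q mconst p g]
  by (simp add: mpol_eval_const[OF assms])

section \<open>Partial derivatives and the product rule\<close>

lemma mpol_deriv_superset:
  assumes "finite A" "Poly_Mapping.keys g \<subseteq> A"
  shows "mpol_deriv i g = (\<Sum>a\<in>A. Poly_Mapping.single (a - Poly_Mapping.single i 1)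
        (of_nat (Poly_Mapping.lookup a i) * Poly_Mapping.lookup g a))"
  unfolding mpol_deriv_def
  by (rule sum.mono_neutral_left) (use assms in \<open>auto simp: in_keys_iff\<close>)

lemma mpol_deriv_single:
  "mpol_deriv i (Poly_Mapping.single a c) =
    Poly_Mapping.single (a - Poly_Mapping.single i 1) (of_nat (Poly_Mapping.lookup a i) * c)"
  by (subst mpol_deriv_superset[of "{a}"]) auto

lemma mpol_deriv_add: "mpol_deriv i (g + g') = mpol_deriv i g + mpol_deriv i g'"
proof -
  let ?A = "Poly_Mapping.keys g \<union> Poly_Mapping.keys g'"
  show ?thesis
    using mpol_deriv_superset[of ?A g] mpol_deriv_superset[of ?A g'] mpol_deriv_superset[of ?A "g + g'"]
    by (auto simp: lookup_add distrib_left sum.distrib keys_add single_add)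
qed

lemma mpol_deriv_zero [simp]: "mpol_deriv i 0 = 0"
  by (simp add: mpol_deriv_def)

lemma mpol_deriv_sum: "mpol_deriv i (sum f I) = (\<Sum>j\<in>I. mpol_deriv i (f j))"
  by (induction I rule: infinite_finite_induct) (auto simp: mpol_deriv_add)

lemma mpol_deriv_const [simp]: "mpol_deriv i (mconst c) = 0"
  by (simp add: mpol_deriv_single)

lemma mpol_deriv_var: "mpol_deriv i (mvar j) = (if i = j then 1 else 0)"
  by (auto simp: mvar_def mpol_deriv_single lookup_single)

lemma mpol_deriv_mult: "mpol_deriv i (g * g') = mpol_deriv i g * g' + g * mpol_deriv i g'"
proof -
  define S where "S a c = (Poly_Mapping.single a c :: 'a mpol)" for a c
  have s: "mpol_deriv i (S a c * S b d) = mpol_deriv i (S a c) * S b d + S a c * mpol_deriv i (S b d)"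
    for a b c d
  proof -
    let ?e = "Poly_Mapping.single i (1::nat)"
    \<comment> \<open>Subtraction of exponents is truncated. If the variable does not occur in
      \<open>a\<close>, the coefficient is 0 and both sides vanish; otherwise lowering the exponent
      of \<open>a\<close> commutes with adding \<open>b\<close>.\<close>
    have 1: "Poly_Mapping.single (a + b - ?e) (of_nat (Poly_Mapping.lookup a i) * x) =
      Poly_Mapping.single (a - ?e + b) (of_nat (Poly_Mapping.lookup a i) * (x::'a))" for a b x
    proof (cases "Poly_Mapping.lookup a i = 0")
      case False
      then have "a + b - ?e = a - ?e + b"
        by (intro poly_mapping_eqI) (auto simp: lookup_add lookup_minus lookup_single when_def)
      then show ?thesis by simp
    qed simp
    have "mpol_deriv i (S a c * S b d) =
       Poly_Mapping.single (a + b - ?e) (of_nat (Poly_Mapping.lookup a i) * (c * d)) +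
       Poly_Mapping.single (b + a - ?e) (of_nat (Poly_Mapping.lookup b i) * (c * d))"
      by (simp add: S_def mult_single mpol_deriv_single lookup_add distrib_right single_add add.commute)
    then show ?thesis unfolding 1
      by (simp add: S_def mult_single mpol_deriv_single add.commute mult_ac)
  qed
  have *: "mpol_deriv i ((\<Sum>a\<in>A. S a (f a)) * (\<Sum>a\<in>B. S a (f' a))) =
    mpol_deriv i (\<Sum>a\<in>A. S a (f a)) * (\<Sum>a\<in>B. S a (f' a)) +
    (\<Sum>a\<in>A. S a (f a)) * mpol_deriv i (\<Sum>a\<in>B. S a (f' a))" for A B f f'
    by (simp only: sum_product mpol_deriv_sum s sum.distrib)
  define sm where "sm g = (\<Sum>a\<in>Poly_Mapping.keys g. S a (Poly_Mapping.lookup g a))" for g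
  have sm: "sm g = g" for g
    unfolding sm_def S_def by (rule mpol_sum_singles[symmetric]) auto
  have "mpol_deriv i (sm g * sm g') = mpol_deriv i (sm g) * sm g' + sm g * mpol_deriv i (sm g')"
    unfolding sm_def
    by (rule *[where f = "Poly_Mapping.lookup g" and f' = "Poly_Mapping.lookup g'"
          and A = "Poly_Mapping.keys g" and B = "Poly_Mapping.keys g'"])
  then show ?thesis unfolding sm .
qed

lemma mpol_deriv_uminus: "mpol_deriv i (- g) = - mpol_deriv i g"
  by (rule minus_unique[symmetric], unfold mpol_deriv_add[symmetric]) simp

lemma mpol_deriv_diff: "mpol_deriv i (g - g') = mpol_deriv i g - mpol_deriv i g'"
  by (simp only: diff_conv_add_uminus mpol_deriv_add mpol_deriv_uminus)

lemma mpol_deriv_closed: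
  assumes "g \<in> mpol_ring R n" "is_subring R"
  shows "mpol_deriv i g \<in> mpol_ring R n"
proof -
  have S: "is_subring (mpol_ring R n)" using assms by auto
  from assms(1) have "g \<in> mpol_ring R n \<and> mpol_deriv i g \<in> mpol_ring R n"
  proof (induction rule: mpol_ring_induct[OF _ assms(2), consumes 1, case_names const var add mult])
    case (var j)
    then show ?case using assms S by (auto simp: mpol_deriv_var intro: subring_0 subring_1)
  qed (use S in \<open>auto simp: mpol_deriv_add mpol_deriv_mult intro!: subring_0 subring_add subring_mult\<close>)
  then show ?thesis ..
qed

section \<open>Determinants\<close>

text \<open>The Leibniz formula builds a determinant from ring operations alone, so any relation
  compatible with these passes from the entries to the determinants. The two instances used are
  membership in a subring and congruence modulo an ideal.\<close>

lemma det_rel: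
  fixes R :: "'a::comm_ring_1 \<Rightarrow> 'b::comm_ring_1 \<Rightarrow> bool"
  assumes R0: "R 0 0" and R1: "R 1 1" and Ra: "\<And>x x' y y'. R x y \<Longrightarrow> R x' y' \<Longrightarrow> R (x + x') (y + y')"
    and Rm: "\<And>x x' y y'. R x y \<Longrightarrow> R x' y' \<Longrightarrow> R (x * x') (y * y')"
    and Ru: "\<And>x y. R x y \<Longrightarrow> R (- x) (- y)"
    and A: "A \<in> carrier_mat n n" and B: "B \<in> carrier_mat n n"
    and AB: "\<And>i j. i < n \<Longrightarrow> j < n \<Longrightarrow> R (A $$ (i, j)) (B $$ (i, j))"
  shows "R (det A) (det B)"
proof -
  have s: "R (sum f I) (sum g I)" if "\<And>i. i \<in> I \<Longrightarrow> R (f i) (g i)" for f g and I :: "(nat \<Rightarrow> nat) set"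
    using that by (induction I rule: infinite_finite_induct) (auto intro: R0 Ra)
  have p: "R (prod f I) (prod g I)" if "\<And>i. i \<in> I \<Longrightarrow> R (f i) (g i)" for f g and I :: "nat set"
    using that by (induction I rule: infinite_finite_induct) (auto intro: R1 Rm)
  have "R (of_int (sign q)) (of_int (sign q))" for q :: "nat \<Rightarrow> nat"
    using R1 Ru[OF R1] by (auto simp: sign_def)
  moreover have "R (\<Prod>i = 0..<n. A $$ (i, q i)) (\<Prod>i = 0..<n. B $$ (i, q i))" if "q permutes {0..<n}" for q
  proof (rule p)
    fix i assume i: "i \<in> {0..<n}"
    then have "q i < n" using permutes_in_image[OF that, of i] by simp
    with i show "R (A $$ (i, q i)) (B $$ (i, q i))" by (intro AB) auto
  qed
  ultimately show ?thesis unfolding det_def'[OF A] det_def'[OF B]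
    by (intro s Rm) auto
qed

lemma det_in_subring:
  assumes S: "is_subring S" and A: "A \<in> carrier_mat n n"
    and "\<And>i j. i < n \<Longrightarrow> j < n \<Longrightarrow> A $$ (i, j) \<in> S"
  shows "det A \<in> S"
  by (rule det_rel[of "\<lambda>x y. x \<in> S", OF _ _ _ _ _ A A])
    (use assms in \<open>auto intro: subring_closed[OF S]\<close>)

lemma det_cong_ideal:
  assumes S: "is_subring S" and I: "is_ideal S I" and A: "A \<in> carrier_mat n n" and B: "B \<in> carrier_mat n n"
    and AB: "\<And>i j. i < n \<Longrightarrow> j < n \<Longrightarrow> A $$ (i, j) \<in> S \<and> B $$ (i, j) \<in> S \<and> A $$ (i, j) - B $$ (i, j) \<in> I"
  shows "det A - det B \<in> I"
proof -
  have m: "x * x' - y * y' \<in> I" if "x \<in> S" "y \<in> S" "x' \<in> S" "y' \<in> S" "x - y \<in> I" "x' - y' \<in> I" for x y x' y'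
  proof -
    have "x * x' - y * y' = x * (x' - y') + y' * (x - y)" by (simp add: algebra_simps)
    then show ?thesis using that I by (auto intro!: is_ideal_add is_ideal_mult)
  qed
  have "det A \<in> S \<and> det B \<in> S \<and> det A - det B \<in> I"
  proof (rule det_rel[of "\<lambda>x y. x \<in> S \<and> y \<in> S \<and> x - y \<in> I", OF _ _ _ _ _ A B])
    fix x x' y y' assume "x \<in> S \<and> y \<in> S \<and> x - y \<in> I" "x' \<in> S \<and> y' \<in> S \<and> x' - y' \<in> I"
    then show "x + x' \<in> S \<and> y + y' \<in> S \<and> x + x' - (y + y') \<in> I"
      using is_ideal_add[OF I, of "x - y" "x' - y'"] by (auto intro: subring_closed[OF S] simp: algebra_simps)
  next
    fix x y assume "x \<in> S \<and> y \<in> S \<and> x - y \<in> I"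
    then show "- x \<in> S \<and> - y \<in> S \<and> - x - - y \<in> I"
      using is_ideal_mult[OF I, of "- 1" "x - y"] by (auto intro: subring_closed[OF S])
  qed (use AB I S m in \<open>auto intro: subring_closed[OF S] simp: is_ideal_def\<close>)
  then show ?thesis by simp
qed

text \<open>A weak form of Cauchy-Binet. Since J W is \<open>s\<close> times the identity,
  multilinear expansion of its determinant writes \<open>s ^ M\<close> as a combination of maximal
  minors of \<open>J\<close>; a prime containing all of them would contain \<open>s\<close>.
  Repeated columns give determinant 0, so the chosen columns are distinct.\<close>

lemma exists_minor:
  fixes J :: "nat \<Rightarrow> nat \<Rightarrow> 'a::comm_ring_1"
  assumes S: "is_subring S" and P: "is_prime_ideal S P"
    and J: "\<And>k l. k < M \<Longrightarrow> l < N \<Longrightarrow> J k l \<in> S" and W: "\<And>k l. k < M \<Longrightarrow> l < N \<Longrightarrow> W l k \<in> S"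
    and s: "s \<in> S - P"
    and JW: "\<And>k k'. k < M \<Longrightarrow> k' < M \<Longrightarrow> (\<Sum>l<N. J k l * W l k') = (if k = k' then s else 0)"
  obtains \<kappa> where "inj_on \<kappa> {..<M}" "\<And>j. j < M \<Longrightarrow> \<kappa> j < N" "det (mat M M (\<lambda>(i, j). J i (\<kappa> j))) \<notin> P"
proof -
  define v where "v l = vec M (\<lambda>k. J k l)" for l
  let ?F = "{f. (\<forall>i\<in>{0..<M}. f i \<in> {..<N}) \<and> (\<forall>i. i \<notin> {0..<M} \<longrightarrow> f i = i)}"
  have v: "v l \<in> carrier_vec M" for l by (simp add: v_def)
  have "mat\<^sub>r M M (\<lambda>k'. finsum_vec TYPE('a) M (\<lambda>l. W l k' \<cdot>\<^sub>v v l) {..<N}) = s \<cdot>\<^sub>m 1\<^sub>m M" (is "?A = _")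
  proof (rule eq_matI)
    fix i j assume "i < dim_row (s \<cdot>\<^sub>m 1\<^sub>m M)" "j < dim_col (s \<cdot>\<^sub>m 1\<^sub>m M)"
    then have ij: "i < M" "j < M" by auto
    have "?A $$ (i, j) = (\<Sum>l<N. W l i * J j l)"
      using ij by (auto simp: index_finsum_vec v_def)
    also have "\<dots> = (if i = j then s else 0)"
      using JW[OF ij(2) ij(1)] by (auto simp: mult.commute)
    finally show "?A $$ (i, j) = (s \<cdot>\<^sub>m 1\<^sub>m M) $$ (i, j)" using ij by simp
  qed auto
  then have "s ^ M = det ?A" by simp
  also have "\<dots> = (\<Sum>f\<in>?F. det (mat\<^sub>r M M (\<lambda>i. W (f i) i \<cdot>\<^sub>v v (f i))))"
    by (rule det_linear_rows_sum) (auto simp: v)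
  also have "\<dots> = (\<Sum>f\<in>?F. (\<Prod>i\<in>{0..<M}. W (f i) i) * det (mat\<^sub>r M M (\<lambda>i. v (f i))))"
    by (intro sum.cong refl det_rows_mul) (auto simp: v)
  finally have sM: "s ^ M = \<dots>" .
  have "\<exists>f\<in>?F. det (mat\<^sub>r M M (\<lambda>i. v (f i))) \<notin> P"
  proof (rule ccontr)
    assume "\<not> ?thesis"
    then have "s ^ M \<in> P" unfolding sM
      by (intro prime_ideal_sum[OF P] prime_ideal_mult[OF P] subring_prod S W) auto
    then show False using prime_ideal_power[OF P S, of s M] s by auto
  qed
  then obtain f where f: "f \<in> ?F" "det (mat\<^sub>r M M (\<lambda>i. v (f i))) \<notin> P" by blast
  have C: "mat\<^sub>r M M (\<lambda>i. v (f i)) \<in> carrier_mat M M" by simp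
  have "mat\<^sub>r M M (\<lambda>i. v (f i)) = transpose_mat (mat M M (\<lambda>(i, j). J i (f j)))"
    by (rule eq_matI) (auto simp: v_def)
  then have "det (mat M M (\<lambda>(i, j). J i (f j))) \<notin> P"
    using f(2) det_transpose[of "mat M M (\<lambda>(i, j). J i (f j))" M] by simp
  moreover have "inj_on f {..<M}"
  proof (rule inj_onI, rule ccontr)
    fix i j assume "i \<in> {..<M}" "j \<in> {..<M}" "f i = f j" "i \<noteq> j"
    then have "det (mat\<^sub>r M M (\<lambda>i. v (f i))) = 0"
      by (intro det_identical_rows[OF C, of i j]) (auto simp: v)
    then show False using f(2) prime_ideal_0[OF P] by simp
  qed
  ultimately show thesis using f(1) by (intro that[of f]) auto
qed

text \<open>Modulo \<open>P\<close>, the matrix \<open>a\<close> J factors through a free module of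
  rank \<open>c\<close>. If \<open>c < m\<close>, padding both factors with zeros to square matrices
  makes the product singular, so \<open>a ^ m\<close> times the determinant of J lies in
  \<open>P\<close>, which primality forbids.\<close>

lemma rank_bound:
  fixes J :: "nat \<Rightarrow> nat \<Rightarrow> 'a::comm_ring_1"
  assumes S: "is_subring S" and P: "is_prime_ideal S P"
    and a: "a \<in> S - P" and J: "\<And>i l. i < m \<Longrightarrow> l < m \<Longrightarrow> J i l \<in> S"
    and Q: "\<And>i j. i < m \<Longrightarrow> j < c \<Longrightarrow> Q i j \<in> S" and D: "\<And>j l. j < c \<Longrightarrow> l < m \<Longrightarrow> D j l \<in> S"
    and eq: "\<And>i l. i < m \<Longrightarrow> l < m \<Longrightarrow> a * J i l - (\<Sum>j<c. Q i j * D j l) \<in> P"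
    and det: "det (mat m m (\<lambda>(i, l). J i l)) \<notin> P"
  shows "m \<le> c"
proof (rule ccontr)
  assume "\<not> m \<le> c"
  then have cm: "c < m" by simp
  define A where "A = mat m m (\<lambda>(i, j). if j < c then Q i j else 0)"
  define B where "B = mat m m (\<lambda>(j, l). if j < c then D j l else 0)"
  define C where "C = a \<cdot>\<^sub>m mat m m (\<lambda>(i, l). J i l)"
  have car: "A \<in> carrier_mat m m" "B \<in> carrier_mat m m" "C \<in> carrier_mat m m"
    by (auto simp: A_def B_def C_def)
  have AB: "(A * B) $$ (i, l) = (\<Sum>j<c. Q i j * D j l)" if "i < m" "l < m" for i l
  proof -
    have "(A * B) $$ (i, l) = (\<Sum>j<m. (if j < c then Q i j else 0) * (if j < c then D j l else 0))"
      using that by (auto simp: A_def B_def scalar_prod_def lessThan_atLeast0)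
    also have "\<dots> = (\<Sum>j<c. (if j < c then Q i j else 0) * (if j < c then D j l else 0))"
      using cm by (intro sum.mono_neutral_right) auto
    finally show ?thesis by simp
  qed
  have "col A c = 0\<^sub>v m" using cm by (auto simp: A_def)
  then have "row (transpose_mat A) c = 0\<^sub>v m" using car cm by simp
  then have "transpose_mat A = mat\<^sub>r m m (\<lambda>i. if i = c then 0\<^sub>v m else row (transpose_mat A) i)"
    using car by (intro eq_rowI) auto
  also have "det \<dots> = 0" by (rule det_row_0[OF cm]) (use car in auto)
  finally have "det A = 0" using det_transpose[OF car(1)] by simp
  then have "det (A * B) = 0" using det_mult[OF car(1,2)] by simp
  have "det C - det (A * B) \<in> P"
  proof (rule det_cong_ideal[OF S prime_ideal_imp_ideal[OF P] car(3)])
    show "A * B \<in> carrier_mat m m" using car by auto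
    fix i l assume il: "i < m" "l < m"
    then have "C $$ (i, l) = a * J i l" by (simp add: C_def)
    then show "C $$ (i, l) \<in> S \<and> (A * B) $$ (i, l) \<in> S \<and> C $$ (i, l) - (A * B) $$ (i, l) \<in> P"
      unfolding AB[OF il] using eq[OF il] il a
      by (auto intro!: subring_sum[OF S] subring_mult[OF S] J Q D)
  qed
  then have "a ^ m * det (mat m m (\<lambda>(i, l). J i l)) \<in> P"
    using \<open>det (A * B) = 0\<close> by (simp add: C_def)
  moreover have "det (mat m m (\<lambda>(i, l). J i l)) \<in> S"
    by (rule det_in_subring[OF S, of _ m]) (use J in auto)
  ultimately have "a ^ m \<in> P"
    using prime_ideal_multD[OF P, of "a ^ m"] a det subring_power[OF S] by blast
  then show False using prime_ideal_power[OF P S, of a m] a by auto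
qed

section \<open>Chains of primes in polynomial rings\<close>

text \<open>Pseudo-division: adjoining one generator \<open>x\<close> to \<open>S0\<close> costs at most one more local generator \<open>\<mu>\<close>
  of \<open>P\<close>, namely an element of \<open>P\<close> of least degree in \<open>x\<close> whose leading coefficient is not in \<open>P\<close>.\<close>

lemma local_generators_step:
  fixes x :: "'a::comm_ring_1"
  assumes S: "is_subring S" and P: "is_prime_ideal S P" and S0: "is_subring S0" "S0 \<subseteq> S" and x: "x \<in> S"
    and gen: "\<And>f. f \<in> P \<Longrightarrow> f \<in> S0 \<Longrightarrow> \<exists>a\<in>S - P. a * f \<in> ideal_gen S X"
  obtains \<mu> where "\<mu> \<in> P"
    "\<And>p. (\<And>l. Polynomial.coeff p l \<in> S0) \<Longrightarrow> poly p x \<in> P \<Longrightarrow> \<exists>a\<in>S - P. a * poly p x \<in> ideal_gen S (insert \<mu> X)"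
proof -
  define Q where "Q e p \<longleftrightarrow> (\<forall>l. Polynomial.coeff p l \<in> S0) \<and> degree p = e \<and> lead_coeff p \<notin> P \<and> poly p x \<in> P" for e p
  \<comment> \<open>If no polynomial over \<open>S0\<close> with value in \<open>P\<close> has its
    leading coefficient outside \<open>P\<close>, the default 0 is harmless: the induction below
    then meets only leading coefficients in \<open>P\<close>.\<close>
  define \<mu> where "\<mu> = (if \<exists>e p. Q e p then poly (SOME p. Q (LEAST e. \<exists>p. Q e p) p) x else 0)"
  let ?I = "ideal_gen S (insert \<mu> X)"
  have I: "is_ideal S ?I" by (rule ideal_gen_ideal[OF S])
  have polyS: "poly p x \<in> S" if "\<And>l. Polynomial.coeff p l \<in> S0" for p
    unfolding poly_altdef using that S0 x by (intro subring_sum subring_mult subring_power S) auto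
  have mu: "\<exists>p. Q (LEAST e. \<exists>p. Q e p) p \<and> \<mu> = poly p x" if "\<exists>e p. Q e p"
  proof -
    have "\<exists>p. Q (LEAST e. \<exists>p. Q e p) p" using LeastI_ex[of "\<lambda>e. \<exists>p. Q e p"] that by blast
    then show ?thesis using that someI_ex[of "Q (LEAST e. \<exists>p. Q e p)"] by (auto simp: \<mu>_def)
  qed
  have "\<mu> \<in> P"
  proof (cases "\<exists>e p. Q e p")
    case True
    then show ?thesis using mu by (auto simp: Q_def)
  qed (use P in \<open>auto simp: \<mu>_def prime_ideal_0\<close>)
  \<comment> \<open>Induction on a bound \<open>d\<close> for the degree; each reduction contributes
    a multiplier outside \<open>P\<close>.\<close>
  have "\<exists>a\<in>S - P. a * poly p x \<in> ?I"
    if "\<And>l. Polynomial.coeff p l \<in> S0" "poly p x \<in> P" "\<And>l. l \<ge> d \<Longrightarrow> Polynomial.coeff p l = 0" for p d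
    using that
  proof (induction d arbitrary: p)
    case 0
    then have "p = 0" by (auto intro: poly_eqI)
    then show ?case using S P I by (intro bexI[of _ 1]) (auto simp: is_ideal_def prime_ideal_1 intro: subring_1)
  next
    case (Suc d)
    let ?b = "Polynomial.coeff p d"
    have b: "?b \<in> S0" by (rule Suc.prems)
    then have bS: "?b \<in> S" using S0 by auto
    show ?case
    proof (cases "?b \<in> P")
      case True
      \<comment> \<open>The top coefficient lies in \<open>P\<close> and in \<open>S0\<close>, so up
        to a multiplier it is already covered by \<open>X\<close> and its monomial can be split
        off.\<close>
      obtain a1 where a1: "a1 \<in> S - P" "a1 * ?b \<in> ideal_gen S X" using gen[OF True b] by auto
      then have a1': "a1 * ?b \<in> ?I" using ideal_gen_mono[of X "insert \<mu> X" S] by auto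
      let ?p = "p - monom ?b d"
      have eq: "poly ?p x = poly p x - ?b * x ^ d" by (simp add: poly_monom)
      have "x ^ d * ?b \<in> P" by (intro prime_ideal_mult[OF P] subring_power S x True)
      then have "poly ?p x \<in> P" unfolding eq using Suc.prems(2)
        by (intro prime_ideal_diff[OF P S]) (auto simp: mult.commute)
      moreover have "Polynomial.coeff ?p l \<in> S0" for l
        using Suc.prems(1)[of l] b by (auto intro: subring_diff[OF S0(1)] subring_0[OF S0(1)])
      moreover have "Polynomial.coeff ?p l = 0" if "l \<ge> d" for l
        using Suc.prems(3)[of l] that by (cases "l = d") auto
      ultimately obtain a2 where a2: "a2 \<in> S - P" "a2 * poly ?p x \<in> ?I"
        using Suc.IH[of ?p] by blast
      have "a1 * a2 * poly p x = a1 * (a2 * poly ?p x) + (a2 * x ^ d) * (a1 * ?b)"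
        unfolding eq by (simp add: algebra_simps)
      also have "\<dots> \<in> ?I"
      proof (rule is_ideal_add[OF I])
        show "a1 * (a2 * poly ?p x) \<in> ?I" by (rule is_ideal_mult[OF I]) (use a1 a2 in auto)
        show "(a2 * x ^ d) * (a1 * ?b) \<in> ?I"
          by (rule is_ideal_mult[OF I]) (use a2 a1' x S in \<open>auto intro: subring_mult subring_power\<close>)
      qed
      finally show ?thesis using a1 a2 prime_ideal_multD[OF P, of a1 a2] subring_mult[OF S, of a1 a2] by blast
    next
      case False
      then have "?b \<noteq> 0" using prime_ideal_0[OF P] by auto
      then have deg: "degree p = d"
        using Suc.prems(3) by (intro antisym degree_le le_degree) (auto simp: Suc_le_eq)
      then have Qd: "Q d p" using False Suc.prems by (auto simp: Q_def)
      then obtain u where u: "Q (LEAST e. \<exists>p. Q e p) u" "\<mu> = poly u x" using mu by blast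
      define e where "e = (LEAST e. \<exists>p. Q e p)"
      have "e \<le> d" unfolding e_def using Qd by (auto intro: Least_le)
      let ?c = "Polynomial.coeff u e"
      have c: "?c \<in> S - P" "?c \<in> S0" and du: "degree u = e" and uS: "\<And>l. Polynomial.coeff u l \<in> S0"
        using u(1) S0 by (auto simp: Q_def e_def)
      \<comment> \<open>One step of pseudo-division by \<open>u\<close>: coefficient
        \<open>d\<close> cancels, and \<open>e \<le> d\<close> holds by minimality of
        \<open>e\<close>.\<close>
      let ?p = "smult ?c p - monom ?b (d - e) * u"
      have co: "Polynomial.coeff ?p l = ?c * Polynomial.coeff p l - (if l < d - e then 0 else ?b * Polynomial.coeff u (l - (d - e)))" for l
        by (simp add: coeff_monom_mult)
      have eq: "poly ?p x = ?c * poly p x - ?b * x ^ (d - e) * \<mu>" by (simp add: poly_monom u)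
      have "poly ?p x \<in> P" unfolding eq using c x b bS Suc.prems(2) \<open>\<mu> \<in> P\<close>
        by (intro prime_ideal_diff[OF P S] prime_ideal_mult[OF P] subring_mult subring_power S) auto
      moreover have "Polynomial.coeff ?p l \<in> S0" for l
        unfolding co using Suc.prems c b uS by (auto intro!: subring_closed[OF S0(1)])
      moreover have "Polynomial.coeff ?p l = 0" if "l \<ge> d" for l
      proof (cases "l = d")
        case True
        then show ?thesis unfolding co using \<open>e \<le> d\<close> by (auto simp: mult.commute)
      next
        case False
        then have "l > d" "l - (d - e) > e" using that \<open>e \<le> d\<close> by auto
        then show ?thesis unfolding co using Suc.prems(3)[of l] coeff_eq_0[of u "l - (d - e)"] du by auto
      qed
      ultimately obtain a where a: "a \<in> S - P" "a * poly ?p x \<in> ?I" using Suc.IH[of ?p] by blast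
      have "a * ?c * poly p x = a * poly ?p x + (a * (?b * x ^ (d - e))) * \<mu>"
        unfolding eq by (simp add: algebra_simps)
      also have "\<dots> \<in> ?I"
      proof (rule is_ideal_add[OF I])
        show "(a * (?b * x ^ (d - e))) * \<mu> \<in> ?I"
          by (rule is_ideal_mult[OF I])
            (use a bS x S in \<open>auto intro: subring_mult subring_power ideal_gen_superset\<close>)
      qed (rule a)
      finally show ?thesis using a c prime_ideal_multD[OF P, of a ?c] subring_mult[OF S, of a ?c] by blast
    qed
  qed
  moreover have "\<exists>d. \<forall>l\<ge>d. Polynomial.coeff p l = 0" for p :: "'a poly"
    by (rule exI[of _ "Suc (degree p)"]) (auto intro: coeff_eq_0)
  ultimately show thesis using \<open>\<mu> \<in> P\<close> by (intro that[of \<mu>]) blast+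
qed

text \<open>Iterates \<open>local_generators_step\<close> along a tower in which each ring is
  generated by one element over the previous one. At the bottom the prime is zero, so nothing is
  spent there and each further step costs one generator.\<close>

lemma local_generators:
  fixes x :: "nat \<Rightarrow> 'a::comm_ring_1"
  assumes S: "is_subring S" and P: "is_prime_ideal S P"
    and T: "\<And>i. i \<le> m \<Longrightarrow> is_subring (T i)" "\<And>i. i \<le> m \<Longrightarrow> T i \<subseteq> S"
    and x: "\<And>i. i < m \<Longrightarrow> x i \<in> S"
    and T0: "\<And>f. f \<in> P \<Longrightarrow> f \<in> T 0 \<Longrightarrow> f = 0"
    and Tx: "\<And>i f. i < m \<Longrightarrow> f \<in> T (Suc i) \<Longrightarrow> \<exists>p. (\<forall>l. Polynomial.coeff p l \<in> T i) \<and> f = poly p (x i)"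
  shows "i \<le> m \<Longrightarrow> \<exists>\<mu>. (\<forall>j<i. \<mu> j \<in> P) \<and> (\<forall>f\<in>P \<inter> T i. \<exists>a\<in>S - P. a * f \<in> ideal_gen S (\<mu> ` {..<i}))"
proof (induction i)
  case 0
  have "is_ideal S (ideal_gen S {})" by (rule ideal_gen_ideal[OF S])
  then have "1 * f \<in> ideal_gen S {}" if "f \<in> P \<inter> T 0" for f
    using T0[of f] that by (auto simp: is_ideal_def)
  moreover have "1 \<in> S - P" using S P by (auto intro: subring_1 dest: prime_ideal_1)
  ultimately have "\<forall>f\<in>P \<inter> T 0. \<exists>a\<in>S - P. a * f \<in> ideal_gen S {}" by blast
  then show ?case by simp
next
  case (Suc i)
  then obtain \<mu> where mu: "\<forall>j<i. \<mu> j \<in> P" "\<forall>f\<in>P \<inter> T i. \<exists>a\<in>S - P. a * f \<in> ideal_gen S (\<mu> ` {..<i})"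
    by auto
  have "is_subring (T i)" "T i \<subseteq> S" "x i \<in> S" using Suc.prems T x by auto
  then obtain \<nu> where nu: "\<nu> \<in> P" "\<And>p. (\<And>l. Polynomial.coeff p l \<in> T i) \<Longrightarrow> poly p (x i) \<in> P \<Longrightarrow>
      \<exists>a\<in>S - P. a * poly p (x i) \<in> ideal_gen S (insert \<nu> (\<mu> ` {..<i}))"
    using local_generators_step[OF S P, of "T i" "x i" "\<mu> ` {..<i}"] mu(2) by blast
  have im: "(\<mu>(i := \<nu>)) ` {..<Suc i} = insert \<nu> (\<mu> ` {..<i})" by (auto simp: lessThan_Suc)
  show ?case
  proof (intro exI[of _ "\<mu>(i := \<nu>)"] conjI ballI)
    show "\<forall>j<Suc i. (\<mu>(i := \<nu>)) j \<in> P" using mu nu by auto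
    fix f assume "f \<in> P \<inter> T (Suc i)"
    then show "\<exists>a\<in>S - P. a * f \<in> ideal_gen S ((\<mu>(i := \<nu>)) ` {..<Suc i})"
      unfolding im using Tx[of i f] nu(2) Suc.prems by auto
  qed
qed

text \<open>Singles out the last variable. This is the step of the tower in
  \<open>local_generators\<close> and the expansion along which algebraic independence is
  proved.\<close>

lemma mpol_ring_Suc_poly:
  fixes f :: "'a::comm_ring_1 mpol"
  assumes "f \<in> mpol_ring R (Suc n)" "is_subring R"
  shows "\<exists>p. (\<forall>l. Polynomial.coeff p l \<in> mpol_ring R n) \<and> f = poly p (mvar n)"
  using assms(1)
proof (induction rule: mpol_ring_induct[OF _ assms(2), consumes 1, case_names const var add mult])
  have S: "is_subring (mpol_ring R n)" using assms by auto
  case (const c)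
  then show ?case using S by (intro exI[of _ "[:mconst c:]"]) (auto simp: coeff_pCons split: nat.splits intro: subring_0)
next
  case (var i)
  have S: "is_subring (mpol_ring R n)" using assms by auto
  show ?case
  proof (cases "i = n")
    case True
    then show ?thesis using S
      by (intro exI[of _ "[:0, 1:]"]) (auto simp: coeff_pCons split: nat.splits intro: subring_0 subring_1)
  next
    case False
    then have "i < n" using var by simp
    then show ?thesis using S assms(2)
      by (intro exI[of _ "[:mvar i:]"]) (auto simp: coeff_pCons split: nat.splits intro: subring_0)
  qed
next
  case (add f g)
  then obtain p q where "\<forall>l. Polynomial.coeff p l \<in> mpol_ring R n" "f = poly p (mvar n)"
    "\<forall>l. Polynomial.coeff q l \<in> mpol_ring R n" "g = poly q (mvar n)" by auto
  then show ?case using assms(2) by (intro exI[of _ "p + q"]) (auto intro: subring_add)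
next
  case (mult f g)
  then obtain p q where "\<forall>l. Polynomial.coeff p l \<in> mpol_ring R n" "f = poly p (mvar n)"
    "\<forall>l. Polynomial.coeff q l \<in> mpol_ring R n" "g = poly q (mvar n)" by auto
  then show ?case using assms(2)
    by (intro exI[of _ "p * q"]) (auto simp: coeff_mult intro!: subring_sum subring_mult)
qed

text \<open>Each \<open>y i\<close> separates two neighbours of the chain, counted from the top. If
  \<open>c + e * y i\<close> vanishes modulo \<open>P (k - Suc i)\<close>, then \<open>c\<close>
  vanishes modulo \<open>P (k - i)\<close>, hence \<open>c = 0\<close> by induction on
  \<open>i\<close>, and \<open>y i\<close> can be cancelled from the rest.\<close>

lemma chain_algebraically_independent:
  fixes P :: "nat \<Rightarrow> 'a::comm_ring_1 set" and \<phi> :: "'f::field \<Rightarrow> 'a"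
  assumes S: "is_subring S" and P: "\<And>i. i \<le> k \<Longrightarrow> is_prime_ideal S (P i)"
    and sub: "\<And>i. i < k \<Longrightarrow> P i \<subseteq> P (Suc i)"
    and \<phi>: "comm_ring_hom \<phi>" "\<And>c. \<phi> c \<in> S"
    and y: "\<And>i. i < k \<Longrightarrow> y i \<in> P (k - i) - P (k - Suc i)"
  shows "i \<le> k \<Longrightarrow> g \<in> mpol_ring UNIV i \<Longrightarrow> mpol_eval \<phi> y g \<in> P (k - i) \<Longrightarrow> g = 0"
proof (induction i arbitrary: g)
  interpret \<phi>: comm_ring_hom \<phi> by fact
  case 0
  then have "g = mconst (Poly_Mapping.lookup g 0)"
    by (intro poly_mapping_eqI) (auto simp: mpol_ring_def lookup_single when_def in_keys_iff)
  then obtain c where g: "g = mconst c" by auto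
  \<comment> \<open>A nonzero constant of the field would be a unit inside the prime
    \<open>P k\<close>.\<close>
  have "c = 0"
  proof (rule ccontr)
    assume "c \<noteq> 0"
    then have "\<phi> (1 / c) * \<phi> c = 1" by (simp flip: \<phi>.hom_mult)
    moreover have "\<phi> (1 / c) * \<phi> c \<in> P k"
      using 0(3) \<phi> P[of k] by (intro prime_ideal_mult) (auto simp: g mpol_eval_const[OF \<phi>(1)])
    ultimately show False using prime_ideal_1[OF P[of k]] by simp
  qed
  then show ?case using g by simp
next
  case (Suc i)
  interpret ev: comm_ring_hom "mpol_eval \<phi> y" by (rule comm_ring_hom_mpol_eval[OF \<phi>(1)])
  let ?P = "P (k - Suc i)"
  have i: "i < k" "k - i = Suc (k - Suc i)" using Suc.prems by auto
  have P': "is_prime_ideal S ?P" "is_prime_ideal S (P (k - i))" by (auto intro: P)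
  have PP: "?P \<subseteq> P (k - i)" using sub[of "k - Suc i"] i by auto
  have yS: "y j \<in> S" if "j < k" for j using y[OF that] prime_ideal_subset[OF P[of "k - j"]] by auto
  have evS: "mpol_eval \<phi> y h \<in> S" if "h \<in> mpol_ring UNIV (Suc i)" for h
    using that i yS \<phi>(2) by (intro mpol_eval_in_subring[OF that S]) auto
  obtain p where p: "\<forall>l. Polynomial.coeff p l \<in> mpol_ring UNIV i" "g = poly p (mvar i)"
    using mpol_ring_Suc_poly[OF Suc.prems(2) is_subring_UNIV] by auto
  have polyR: "poly p (mvar i) \<in> mpol_ring UNIV (Suc i)" if "\<forall>l. Polynomial.coeff p l \<in> mpol_ring UNIV i" for p :: "'f mpol poly"
    unfolding poly_altdef using that mpol_ring_mono[of UNIV UNIV i "Suc i"]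
    by (intro subring_sum subring_mult subring_power is_subring_mpol_ring is_subring_UNIV mpol_ring_var) auto
  have "p = 0" if "\<forall>l. Polynomial.coeff p l \<in> mpol_ring UNIV i" "mpol_eval \<phi> y (poly p (mvar i)) \<in> ?P" for p
    using that
  proof (induction p)
    case (pCons c p)
    have c: "c \<in> mpol_ring UNIV i" using pCons.prems(1)[rule_format, of 0] by simp
    have pl: "\<forall>l. Polynomial.coeff p l \<in> mpol_ring UNIV i"
      using pCons.prems(1) by (auto simp: coeff_pCons split: nat.splits)
    let ?e = "mpol_eval \<phi> y (poly p (mvar i))"
    have eS: "?e \<in> S" using evS polyR pl by blast
    have eq: "mpol_eval \<phi> y (poly (pCons c p) (mvar i)) = mpol_eval \<phi> y c + ?e * y i"
      by (simp add: ev.hom_add ev.hom_mult mpol_eval_var[OF \<phi>(1)] mult.commute)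
    have "?e * y i \<in> P (k - i)" using y[OF i(1)] eS by (intro prime_ideal_mult[OF P'(2)]) auto
    moreover have "mpol_eval \<phi> y c + ?e * y i \<in> P (k - i)" using pCons.prems(2) PP unfolding eq by auto
    ultimately have "mpol_eval \<phi> y c \<in> P (k - i)"
      using prime_ideal_diff[OF P'(2) S, of "mpol_eval \<phi> y c + ?e * y i" "?e * y i"] by simp
    then have "c = 0" using Suc.IH[of c] c i by simp
    then have "?e * y i \<in> ?P" using pCons.prems(2) unfolding eq by simp
    then have "?e \<in> ?P" using prime_ideal_multD[OF P'(1) eS yS[OF i(1)]] y[OF i(1)] by auto
    then have "p = 0" using pCons.IH pl by blast
    then show ?case using \<open>c = 0\<close> by simp
  qed simp
  from this[of p] have "p = 0" using p Suc.prems(3) by simp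
  then show ?case using p by simp
qed

text \<open>Graph construction: \<open>k\<close> new variables are mapped to elements
  \<open>y i\<close> separating the members of the chain. The preimage \<open>P'\<close> of
  \<open>P 0\<close> meets the polynomials in the new variables only in 0, so it is locally
  generated by \<open>r\<close> elements, one per old variable. It contains the \<open>M\<close>
  given equations and the \<open>k\<close> equations of the graph, whose differentials are
  independent modulo \<open>P'\<close>.\<close>

theorem chain_bound:
  fixes P :: "nat \<Rightarrow> 'f::field mpol set"
  assumes P: "\<And>i. i \<le> k \<Longrightarrow> is_prime_ideal (mpol_ring UNIV r) (P i)"
    and sub: "\<And>i. i < k \<Longrightarrow> P i \<subset> P (Suc i)"
    and f: "\<And>i. i < M \<Longrightarrow> f i \<in> P 0"
    and \<kappa>: "\<And>j. j < M \<Longrightarrow> \<kappa> j < r"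
    and minor: "det (mat M M (\<lambda>(i, j). mpol_deriv (\<kappa> j) (f i))) \<notin> P 0"
  shows "k + M \<le> r"
proof -
  let ?R = "mpol_ring (UNIV :: 'f set)"
  define S where "S = ?R (k + r)"
  note sr = is_subring_mpol_ring[OF is_subring_UNIV]
  have S: "is_subring S" by (auto simp: S_def sr)
  have P0: "is_prime_ideal (?R r) (P 0)" using P[of 0] by simp
  have fr: "f i \<in> ?R r" if "i < M" for i using prime_ideal_subset[OF P0 f[OF that]] .
  have "\<exists>z. z \<in> P (k - i) - P (k - Suc i)" if "i < k" for i
    using sub[of "k - Suc i"] that Suc_diff_Suc[OF that] by auto
  then obtain y where y: "\<And>i. i < k \<Longrightarrow> y i \<in> P (k - i) - P (k - Suc i)" by metis
  have yr: "y i \<in> ?R r" if "i < k" for i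
    using y[OF that] prime_ideal_subset[OF P[of "k - i"]] by auto
  \<comment> \<open>The new variables get the indices below \<open>k\<close> and the old ones are
    shifted up by \<open>k\<close>, so that the tower in \<open>local_generators\<close> starts from
    the new variables.\<close>
  define q where "q j = (if j < k then y j else mvar (j - k))" for j
  define ev where "ev = mpol_eval mconst q"
  define sh where "sh = mpol_eval (mconst :: 'f \<Rightarrow> _) (\<lambda>j. mvar (k + j))"
  have hm: "comm_ring_hom (mconst :: 'f \<Rightarrow> _)" by (rule comm_ring_hom_mconst)
  interpret ev: comm_ring_hom ev unfolding ev_def by (rule comm_ring_hom_mpol_eval[OF hm])
  interpret sh: comm_ring_hom sh unfolding sh_def by (rule comm_ring_hom_mpol_eval[OF hm])
  have ev_mem: "ev g \<in> ?R r" if "g \<in> S" for g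
    unfolding ev_def by (rule mpol_eval_in_subring[OF that[unfolded S_def] sr])
      (auto simp: q_def yr sr intro!: mpol_ring_var is_subring_UNIV)
  have sh_mem: "sh g \<in> S" if "g \<in> ?R r" for g
    unfolding sh_def S_def by (rule mpol_eval_in_subring[OF that sr])
      (auto intro!: mpol_ring_var is_subring_UNIV)
  have ev_sh: "ev (sh g) = g" if "g \<in> ?R r" for g
    unfolding ev_def sh_def mpol_eval_subst[OF hm] mpol_eval_var[OF hm]
    using mpol_eval_mvar[OF that is_subring_UNIV] by (simp add: q_def)
  define P' where "P' = {g \<in> S. ev g \<in> P 0}"
  have P': "is_prime_ideal S P'"
    unfolding is_prime_ideal_def P'_def
    using prime_idealD[OF P0] S ev_mem
    by (auto simp: ev.hom_add ev.hom_mult intro: subring_closed[OF S])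
  have d_sh: "mpol_deriv (k + j) (sh g) = sh (mpol_deriv j g)" if "g \<in> ?R r" for g j
    using that
  proof (induction rule: mpol_ring_induct[OF _ is_subring_UNIV, consumes 1, case_names const var add mult])
    case (var i)
    then show ?case using sh.hom_zero sh.hom_one
      by (auto simp: sh_def mpol_eval_var[OF hm] mpol_deriv_var)
  qed (simp_all add: sh.hom_add sh.hom_mult mpol_deriv_add mpol_deriv_mult, simp add: sh_def mpol_eval_const[OF hm] mpol_eval_zero[OF hm])
  have d_sh0: "mpol_deriv i (sh g) = 0" if "g \<in> ?R r" "i < k" for g i
    using that(1)
  proof (induction rule: mpol_ring_induct[OF _ is_subring_UNIV, consumes 1, case_names const var add mult])
    case (var j)
    then show ?case using that(2) by (simp add: sh_def mpol_eval_var[OF hm] mpol_deriv_var)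
  qed (simp_all add: sh.hom_add sh.hom_mult mpol_deriv_add mpol_deriv_mult, simp add: sh_def mpol_eval_const[OF hm])
  define F where "F i = (if i < M then sh (f i) else mvar (i - M) - sh (y (i - M)))" for i
  \<comment> \<open>Columns in the order of the rows: the \<open>\<kappa>\<close>-columns of the
    given minor, moved up by \<open>k\<close>, and after them the new variables.\<close>
  define co where "co l = (if l < M then k + \<kappa> l else l - M)" for l
  define m where "m = M + k"
  define J where "J i l = mpol_deriv (co l) (F i)" for i l
  have F: "F i \<in> P'" if "i < m" for i
  proof (cases "i < M")
    case True
    then show ?thesis using f[OF True] fr[OF True] by (simp add: F_def P'_def ev_sh sh_mem)
  next
    case False
    then have ik: "i - M < k" using that by (simp add: m_def)
    have "ev (mvar (i - M)) = y (i - M)" using ik by (simp add: ev_def mpol_eval_var[OF hm] q_def)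
    then have "ev (F i) = 0" using False by (simp add: F_def ev.hom_minus ev_sh yr[OF ik])
    moreover have "mvar (i - M) \<in> S" unfolding S_def
      using ik by (intro mpol_ring_var is_subring_UNIV) auto
    then have "F i \<in> S" using False ik by (auto simp: F_def intro!: subring_diff[OF S] sh_mem yr)
    ultimately show ?thesis using prime_ideal_0[OF P0] by (simp add: P'_def)
  qed
  have PS: "P' \<subseteq> S" by (auto simp: P'_def)
  have FS: "F i \<in> S" if "i < m" for i using F[OF that] PS by auto
  have dS: "mpol_deriv l g \<in> S" if "g \<in> S" for l g
    using mpol_deriv_closed[OF _ is_subring_UNIV] that by (auto simp: S_def)
  define J1 where "J1 = mat M M (\<lambda>(i, j). mpol_deriv (\<kappa> j) (f i))"
  \<comment> \<open>The given equations do not involve the new variables, and each graph equation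
    contains exactly one of them, with coefficient 1; hence a zero block and an identity
    block.\<close>
  have "mat m m (\<lambda>(i, l). J i l) = four_block_mat (map_mat sh J1) (0\<^sub>m M k) (mat k M (\<lambda>(i, l). J (M + i) l)) (1\<^sub>m k)"
    by (rule eq_matI)
      (auto simp: m_def J1_def J_def F_def co_def d_sh[OF fr] d_sh0[OF fr] d_sh0[OF yr] mpol_deriv_diff mpol_deriv_var)
  then have "det (mat m m (\<lambda>(i, l). J i l)) = sh (det J1)"
    by (simp add: det_four_block_mat_upper_right_zero[where n = M and m = k] J1_def)
  moreover have "det J1 \<in> ?R r" unfolding J1_def
    by (rule det_in_subring[OF sr]) (auto intro!: mpol_deriv_closed fr is_subring_UNIV)
  ultimately have detJ: "det (mat m m (\<lambda>(i, l). J i l)) \<notin> P'"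
    using minor by (simp add: P'_def ev_sh J1_def)
  have PI: "P' \<inter> ?R (k + r) = P'" using PS by (auto simp: S_def)
  have "\<exists>\<mu>. (\<forall>j<r. \<mu> j \<in> P') \<and> (\<forall>g\<in>P' \<inter> ?R (k + r). \<exists>a\<in>S - P'. a * g \<in> ideal_gen S (\<mu> ` {..<r}))"
  proof (rule local_generators[OF S P', where T = "\<lambda>i. ?R (k + i)" and x = "\<lambda>i. mvar (k + i)"])
    fix g assume g: "g \<in> P'" "g \<in> ?R (k + 0)"
    \<comment> \<open>A polynomial in the new variables alone is evaluated at the
      \<open>y i\<close>, which are independent modulo \<open>P 0\<close>.\<close>
    have "ev g = mpol_eval mconst y g"
      unfolding ev_def by (rule mpol_eval_cong) (use g in \<open>auto simp: q_def\<close>)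
    then have "mpol_eval mconst y g \<in> P (k - k)" using g by (simp add: P'_def)
    show "g = 0"
      by (rule chain_algebraically_independent[where S = "?R r" and P = P and \<phi> = mconst and y = y and k = k and i = k])
        (use g sub P y \<open>mpol_eval mconst y g \<in> P (k - k)\<close> in \<open>auto simp: sr hm\<close>)
  next
    fix i g assume "g \<in> ?R (k + Suc i)"
    then show "\<exists>p. (\<forall>l. Polynomial.coeff p l \<in> ?R (k + i)) \<and> g = poly p (mvar (k + i))"
      using mpol_ring_Suc_poly[of g UNIV "k + i"] is_subring_UNIV by auto
  next
    fix i assume "i \<le> r"
    then show "?R (k + i) \<subseteq> S" unfolding S_def by (intro mpol_ring_mono) auto
  next
    fix i assume "i < r"
    then show "mvar (k + i) \<in> S" unfolding S_def by (intro mpol_ring_var is_subring_UNIV) auto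
  qed (auto simp: sr)
  then obtain \<mu> where mu: "\<And>j. j < r \<Longrightarrow> \<mu> j \<in> P'"
    "\<And>g. g \<in> P' \<Longrightarrow> \<exists>a\<in>S - P'. a * g \<in> ideal_gen S (\<mu> ` {..<r})"
    unfolding PI by blast
  have "\<exists>a. a \<in> S - P' \<and> a * F i \<in> ideal_gen S (\<mu> ` {..<r})" if "i < m" for i using mu(2)[OF F[OF that]] by auto
  then obtain a where a: "\<And>i. i < m \<Longrightarrow> a i \<in> S - P' \<and> a i * F i \<in> ideal_gen S (\<mu> ` {..<r})" by metis
  \<comment> \<open>A common multiplier for all \<open>F i\<close>; by primality it stays outside
    \<open>P'\<close>.\<close>
  define b where "b = prod a {..<m}"
  have b: "b \<in> S - P'" unfolding b_def by (rule prime_ideal_prod[OF P' S]) (use a in auto)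
  have "\<exists>c. (\<forall>j<r. c j \<in> S) \<and> b * F i = (\<Sum>j<r. c j * \<mu> j)" if "i < m" for i
  proof -
    have "b * F i = prod a ({..<m} - {i}) * (a i * F i)"
      unfolding b_def using that by (subst prod.remove[of _ i]) auto
    also have "\<dots> \<in> ideal_gen S (\<mu> ` {..<r})"
      by (rule is_ideal_mult[OF ideal_gen_ideal[OF S]]) (use a that in \<open>auto intro!: subring_prod S\<close>)
    finally show ?thesis using ideal_gen_finite[OF S] by metis
  qed
  then obtain c where c: "\<And>i j. i < m \<Longrightarrow> j < r \<Longrightarrow> c i j \<in> S" "\<And>i. i < m \<Longrightarrow> b * F i = (\<Sum>j<r. c i j * \<mu> j)"
    by metis
  have muS: "\<mu> j \<in> S" if "j < r" for j using mu(1)[OF that] PS by auto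
  have "m \<le> r"
  proof (rule rank_bound[OF S P' b, where J = J and Q = c and D = "\<lambda>j l. mpol_deriv (co l) (\<mu> j)"])
    fix i l assume il: "i < m" "l < m"
    \<comment> \<open>Product rule modulo \<open>P'\<close>: the terms in which
      \<open>\<mu> j\<close> or \<open>F i\<close> remains undifferentiated lie in
      \<open>P'\<close>. What is left factors the Jacobian through rank \<open>r\<close>.\<close>
    have "mpol_deriv (co l) (b * F i) = (\<Sum>j<r. mpol_deriv (co l) (c i j) * \<mu> j + c i j * mpol_deriv (co l) (\<mu> j))"
      unfolding c(2)[OF il(1)] by (simp add: mpol_deriv_sum mpol_deriv_mult)
    then have "b * J i l - (\<Sum>j<r. c i j * mpol_deriv (co l) (\<mu> j)) =
      (\<Sum>j<r. mpol_deriv (co l) (c i j) * \<mu> j) - mpol_deriv (co l) b * F i"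
      by (simp add: J_def mpol_deriv_mult sum.distrib algebra_simps)
    also have "\<dots> \<in> P'"
      by (intro prime_ideal_diff[OF P' S] prime_ideal_sum[OF P'] prime_ideal_mult[OF P'] dS F il mu)
        (use b c il in auto)
    finally show "b * J i l - (\<Sum>j<r. c i j * mpol_deriv (co l) (\<mu> j)) \<in> P'" .
  qed (use detJ c muS in \<open>auto simp: J_def intro!: dS FS\<close>)
  then show ?thesis by (simp add: m_def)
qed

section \<open>Algebras with involution in coordinates\<close>

lemma sum_rotate3:
  fixes F :: "'i \<Rightarrow> 'j \<Rightarrow> 'k \<Rightarrow> 'a::comm_monoid_add"
  shows "(\<Sum>m\<in>A. \<Sum>j\<in>B. \<Sum>k\<in>C. F m j k) = (\<Sum>j\<in>B. \<Sum>k\<in>C. \<Sum>m\<in>A. F m j k)"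
  by (subst sum.swap) (intro sum.cong refl sum.swap)

lemma sum_rotate4:
  fixes F :: "'i \<Rightarrow> 'j \<Rightarrow> 'k \<Rightarrow> 'l \<Rightarrow> 'a::comm_monoid_add"
  shows "(\<Sum>m\<in>A. \<Sum>k\<in>B. \<Sum>i\<in>C. \<Sum>j\<in>D. F m k i j) = (\<Sum>i\<in>C. \<Sum>j\<in>D. \<Sum>k\<in>B. \<Sum>m\<in>A. F m k i j)"
proof -
  have "(\<Sum>m\<in>A. \<Sum>k\<in>B. \<Sum>i\<in>C. \<Sum>j\<in>D. F m k i j) = (\<Sum>m\<in>A. \<Sum>i\<in>C. \<Sum>j\<in>D. \<Sum>k\<in>B. F m k i j)"
    by (intro sum.cong refl sum_rotate3)
  also have "\<dots> = (\<Sum>i\<in>C. \<Sum>j\<in>D. \<Sum>m\<in>A. \<Sum>k\<in>B. F m k i j)" by (rule sum_rotate3)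
  also have "\<dots> = (\<Sum>i\<in>C. \<Sum>j\<in>D. \<Sum>k\<in>B. \<Sum>m\<in>A. F m k i j)" by (intro sum.cong refl sum.swap)
  finally show ?thesis .
qed

lemma sum_delta_mult:
  fixes f :: "nat \<Rightarrow> 'a::comm_ring_1"
  shows "(\<Sum>i<r. (if i = j then 1 else 0) * f i) = (if j < r then f j else 0)"
    and "(\<Sum>i<r. (if j = i then 1 else 0) * f i) = (if j < r then f j else 0)"
    and "(\<Sum>i<r. f i * (if i = j then 1 else 0)) = (if j < r then f j else 0)"
    and "(\<Sum>i<r. f i * (if j = i then 1 else 0)) = (if j < r then f j else 0)"
  by (simp_all add: if_distrib[of "\<lambda>x. x * _"] if_distrib[of "\<lambda>x. _ * x"] sum.delta sum.delta' cong: if_cong)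

lemma smult_one_mat_mult_vec:
  fixes a :: "'a::comm_ring_1"
  assumes "v \<in> carrier_vec n"
  shows "(a \<cdot>\<^sub>m 1\<^sub>m n) *\<^sub>v v = a \<cdot>\<^sub>v v"
proof (rule eq_vecI)
  fix i assume "i < dim_vec (a \<cdot>\<^sub>v v)"
  then have i: "i < n" using assms by simp
  have "row (a \<cdot>\<^sub>m 1\<^sub>m n) i = a \<cdot>\<^sub>v unit_vec n i" by (rule eq_vecI) (use i in auto)
  then show "((a \<cdot>\<^sub>m 1\<^sub>m n) *\<^sub>v v) $ i = (a \<cdot>\<^sub>v v) $ i"
    using i assms by (simp add: scalar_prod_left_unit)
qed (use assms in simp)

text \<open>Structure constants of an \<open>r\<close>-dimensional algebra with an anti-involution: \<open>c i j k\<close> is the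
  \<open>k\<close>-th coordinate of \<open>t\<^sub>i t\<^sub>j\<close>, \<open>\<tau> i k\<close> that of \<open>t\<^sub>i\<^sup>*\<close> and \<open>e k\<close> that of \<open>1\<close>.\<close>

locale star_coords =
  fixes r :: nat and c :: "nat \<Rightarrow> nat \<Rightarrow> nat \<Rightarrow> 'f::field" and \<tau> :: "nat \<Rightarrow> nat \<Rightarrow> 'f" and e :: "nat \<Rightarrow> 'f"
  assumes c_assoc: "\<And>i j k l. i < r \<Longrightarrow> j < r \<Longrightarrow> k < r \<Longrightarrow> l < r \<Longrightarrow>
      (\<Sum>m<r. c i j m * c m k l) = (\<Sum>m<r. c j k m * c i m l)"
    and c_unit_left: "\<And>j k. j < r \<Longrightarrow> k < r \<Longrightarrow> (\<Sum>i<r. e i * c i j k) = (if j = k then 1 else 0)"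
    and c_unit_right: "\<And>i k. i < r \<Longrightarrow> k < r \<Longrightarrow> (\<Sum>j<r. e j * c i j k) = (if i = k then 1 else 0)"
    and \<tau>_mult: "\<And>i j l. i < r \<Longrightarrow> j < r \<Longrightarrow> l < r \<Longrightarrow>
      (\<Sum>k<r. c i j k * \<tau> k l) = (\<Sum>p<r. \<Sum>q<r. c p q l * \<tau> j p * \<tau> i q)"
    and \<tau>_unit: "\<And>k. k < r \<Longrightarrow> (\<Sum>i<r. e i * \<tau> i k) = e k"
begin

text \<open>\<open>\<eta>\<close> is a base change, so one set of structure constants describes the
  algebra over polynomial rings, over their fraction fields and over the ground field
  itself.\<close>

definition mul :: "('f \<Rightarrow> 'b::comm_ring_1) \<Rightarrow> (nat \<Rightarrow> 'b) \<Rightarrow> (nat \<Rightarrow> 'b) \<Rightarrow> nat \<Rightarrow> 'b" where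
  "mul \<eta> y z k = (\<Sum>i<r. \<Sum>j<r. \<eta> (c i j k) * y i * z j)"

definition star :: "('f \<Rightarrow> 'b::comm_ring_1) \<Rightarrow> (nat \<Rightarrow> 'b) \<Rightarrow> nat \<Rightarrow> 'b" where
  "star \<eta> y k = (\<Sum>i<r. y i * \<eta> (\<tau> i k))"

definition Lm :: "('f \<Rightarrow> 'b::comm_ring_1) \<Rightarrow> (nat \<Rightarrow> 'b) \<Rightarrow> 'b mat" where
  "Lm \<eta> y = mat r r (\<lambda>(k, j). \<Sum>i<r. \<eta> (c i j k) * y i)"

text \<open>Cramer's rule in the algebra: the adjugate of the matrix of left multiplication by
  \<open>y\<close>, applied to the unit. It is an inverse with cleared denominators, since
  \<open>y\<close> times it is \<open>det (Lm \<eta> y)\<close> times the unit.\<close>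

definition quasi_inv :: "('f \<Rightarrow> 'b::comm_ring_1) \<Rightarrow> (nat \<Rightarrow> 'b) \<Rightarrow> nat \<Rightarrow> 'b" where
  "quasi_inv \<eta> y k = (\<Sum>j<r. adj_mat (Lm \<eta> y) $$ (k, j) * \<eta> (e j))"

lemma mul_cong: "(\<And>i. i < r \<Longrightarrow> y i = y' i) \<Longrightarrow> (\<And>i. i < r \<Longrightarrow> z i = z' i) \<Longrightarrow> mul \<eta> y z k = mul \<eta> y' z' k"
  unfolding mul_def by (intro sum.cong refl) auto

lemma star_cong: "(\<And>i. i < r \<Longrightarrow> y i = y' i) \<Longrightarrow> star \<eta> y k = star \<eta> y' k"
  unfolding star_def by (intro sum.cong refl) auto

lemma Lm_cong: "(\<And>i. i < r \<Longrightarrow> y i = y' i) \<Longrightarrow> Lm \<eta> y = Lm \<eta> y'"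
  unfolding Lm_def by (intro eq_matI) auto

lemma Lm_carrier [simp]: "Lm \<eta> y \<in> carrier_mat r r"
  by (simp add: Lm_def)

lemma mul_add_left: "mul \<eta> (\<lambda>i. y i + y' i) z k = mul \<eta> y z k + mul \<eta> y' z k"
  by (simp add: mul_def algebra_simps sum.distrib)

lemma mul_add_right: "mul \<eta> z (\<lambda>i. y i + y' i) k = mul \<eta> z y k + mul \<eta> z y' k"
  by (simp add: mul_def algebra_simps sum.distrib)

lemma mul_diff_left: "mul \<eta> (\<lambda>i. y i - y' i) z k = mul \<eta> y z k - mul \<eta> y' z k"
  by (simp add: mul_def algebra_simps sum_subtractf)

lemma mul_diff_right: "mul \<eta> z (\<lambda>i. y i - y' i) k = mul \<eta> z y k - mul \<eta> z y' k"
  by (simp add: mul_def algebra_simps sum_subtractf)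

lemma mul_scale_left: "mul \<eta> (\<lambda>i. a * y i) z k = a * mul \<eta> y z k"
  by (simp add: mul_def sum_distrib_left mult_ac)

lemma mul_scale_right: "mul \<eta> y (\<lambda>i. a * z i) k = a * mul \<eta> y z k"
  by (simp add: mul_def sum_distrib_left mult_ac)

lemma star_add: "star \<eta> (\<lambda>i. y i + y' i) k = star \<eta> y k + star \<eta> y' k"
  by (simp add: star_def algebra_simps sum.distrib)

lemma star_diff: "star \<eta> (\<lambda>i. y i - y' i) k = star \<eta> y k - star \<eta> y' k"
  by (simp add: star_def algebra_simps sum_subtractf)

lemma star_scale: "star \<eta> (\<lambda>i. a * y i) k = a * star \<eta> y k"
  by (simp add: star_def sum_distrib_left mult_ac)

lemma star_sum: "star \<eta> (\<lambda>i. \<Sum>t\<in>T. u t * y t i) k = (\<Sum>t\<in>T. u t * star \<eta> (y t) k)"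
  by (induction T rule: infinite_finite_induct) (simp_all add: star_add star_scale, simp_all add: star_def)

lemma mul_hom:
  assumes "comm_ring_hom \<theta>"
  shows "\<theta> (mul \<eta> y z k) = mul (\<lambda>a. \<theta> (\<eta> a)) (\<lambda>i. \<theta> (y i)) (\<lambda>i. \<theta> (z i)) k"
proof -
  interpret comm_ring_hom \<theta> by fact
  show ?thesis by (simp add: mul_def hom_sum hom_mult)
qed

lemma Lm_hom:
  assumes "comm_ring_hom \<theta>"
  shows "map_mat \<theta> (Lm \<eta> y) = Lm (\<lambda>a. \<theta> (\<eta> a)) (\<lambda>i. \<theta> (y i))"
proof -
  interpret comm_ring_hom \<theta> by fact
  show ?thesis by (rule eq_matI) (simp_all add: Lm_def hom_sum hom_mult)
qed

lemma det_Lm_hom: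
  assumes "comm_ring_hom \<theta>"
  shows "\<theta> (det (Lm \<eta> y)) = det (Lm (\<lambda>a. \<theta> (\<eta> a)) (\<lambda>i. \<theta> (y i)))"
proof -
  interpret comm_ring_hom \<theta> by fact
  show ?thesis using Lm_hom[OF assms] by (metis hom_det)
qed

lemma Lm_mult_vec: "k < r \<Longrightarrow> (Lm \<eta> y *\<^sub>v vec r z) $ k = mul \<eta> y z k"
  by (simp add: Lm_def mul_def scalar_prod_def lessThan_atLeast0 sum_distrib_right) (rule sum.swap)

context
  fixes \<eta> :: "'f \<Rightarrow> 'b::comm_ring_1"
  assumes hom: "comm_ring_hom \<eta>"
begin

interpretation comm_ring_hom \<eta> by (rule hom)

lemma mul_assoc:
  assumes l: "l < r"
  shows "mul \<eta> (mul \<eta> y z) w l = mul \<eta> y (mul \<eta> z w) l"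
proof -
  have "mul \<eta> (mul \<eta> y z) w l =
      (\<Sum>m<r. \<Sum>k<r. \<Sum>i<r. \<Sum>j<r. \<eta> (c i j m) * \<eta> (c m k l) * (y i * z j * w k))"
    by (simp add: mul_def sum_distrib_left sum_distrib_right mult_ac)
  also have "\<dots> = (\<Sum>i<r. \<Sum>j<r. \<Sum>k<r. \<Sum>m<r. \<eta> (c i j m) * \<eta> (c m k l) * (y i * z j * w k))"
    by (rule sum_rotate4)
  also have "\<dots> = (\<Sum>i<r. \<Sum>j<r. \<Sum>k<r. \<eta> (\<Sum>m<r. c i j m * c m k l) * (y i * z j * w k))"
    by (simp add: hom_sum hom_mult sum_distrib_right)
  also have "\<dots> = (\<Sum>i<r. \<Sum>j<r. \<Sum>k<r. \<eta> (\<Sum>m<r. c j k m * c i m l) * (y i * z j * w k))"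
    using l by (intro sum.cong refl) (simp add: c_assoc)
  also have "\<dots> = (\<Sum>i<r. \<Sum>j<r. \<Sum>k<r. \<Sum>m<r. \<eta> (c j k m) * \<eta> (c i m l) * (y i * z j * w k))"
    by (simp add: hom_sum hom_mult sum_distrib_right)
  also have "\<dots> = (\<Sum>i<r. \<Sum>m<r. \<Sum>j<r. \<Sum>k<r. \<eta> (c j k m) * \<eta> (c i m l) * (y i * z j * w k))"
    by (intro sum.cong refl sum_rotate3[symmetric])
  also have "\<dots> = mul \<eta> y (mul \<eta> z w) l"
    by (simp add: mul_def sum_distrib_left sum_distrib_right mult_ac)
  finally show ?thesis .
qed

lemma mul_unit_left: assumes "k < r" shows "mul \<eta> (\<lambda>i. \<eta> (e i)) y k = y k"
proof -
  have "mul \<eta> (\<lambda>i. \<eta> (e i)) y k = (\<Sum>j<r. \<Sum>i<r. \<eta> (e i * c i j k) * y j)"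
    unfolding mul_def by (subst sum.swap) (simp add: hom_mult mult_ac)
  also have "\<dots> = (\<Sum>j<r. \<eta> (\<Sum>i<r. e i * c i j k) * y j)"
    by (simp add: hom_sum sum_distrib_right)
  also have "\<dots> = (\<Sum>j<r. (if j = k then 1 else 0) * y j)"
    using assms by (intro sum.cong refl) (simp add: c_unit_left)
  finally show ?thesis using assms by (simp add: sum_delta_mult)
qed

lemma mul_unit_right: assumes "k < r" shows "mul \<eta> y (\<lambda>i. \<eta> (e i)) k = y k"
proof -
  have "mul \<eta> y (\<lambda>i. \<eta> (e i)) k = (\<Sum>i<r. \<eta> (\<Sum>j<r. e j * c i j k) * y i)"
    unfolding mul_def by (simp add: hom_mult hom_sum sum_distrib_right sum_distrib_left mult_ac)
  also have "\<dots> = (\<Sum>j<r. (if j = k then 1 else 0) * y j)"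
    using assms by (intro sum.cong refl) (simp add: c_unit_right)
  finally show ?thesis using assms by (simp add: sum_delta_mult)
qed

lemma star_mul:
  assumes l: "l < r"
  shows "star \<eta> (mul \<eta> y z) l = mul \<eta> (star \<eta> z) (star \<eta> y) l"
proof -
  have "star \<eta> (mul \<eta> y z) l = (\<Sum>k<r. \<Sum>i<r. \<Sum>j<r. \<eta> (c i j k) * \<eta> (\<tau> k l) * (y i * z j))"
    by (simp add: star_def mul_def sum_distrib_left sum_distrib_right mult_ac)
  also have "\<dots> = (\<Sum>i<r. \<Sum>j<r. \<Sum>k<r. \<eta> (c i j k) * \<eta> (\<tau> k l) * (y i * z j))"
    by (rule sum_rotate3)
  also have "\<dots> = (\<Sum>i<r. \<Sum>j<r. \<eta> (\<Sum>k<r. c i j k * \<tau> k l) * (y i * z j))"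
    by (simp add: hom_sum hom_mult sum_distrib_right)
  also have "\<dots> = (\<Sum>i<r. \<Sum>j<r. \<eta> (\<Sum>p<r. \<Sum>q<r. c p q l * \<tau> j p * \<tau> i q) * (y i * z j))"
    using l by (intro sum.cong refl) (simp add: \<tau>_mult)
  also have "\<dots> = (\<Sum>i<r. \<Sum>j<r. \<Sum>p<r. \<Sum>q<r. \<eta> (c p q l) * (z j * \<eta> (\<tau> j p)) * (y i * \<eta> (\<tau> i q)))"
    by (simp add: hom_sum hom_mult sum_distrib_right sum_distrib_left mult_ac)
  also have "\<dots> = (\<Sum>p<r. \<Sum>q<r. \<Sum>j<r. \<Sum>i<r. \<eta> (c p q l) * (z j * \<eta> (\<tau> j p)) * (y i * \<eta> (\<tau> i q)))"
    by (rule sum_rotate4)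
  also have "\<dots> = mul \<eta> (star \<eta> z) (star \<eta> y) l"
    by (simp add: star_def mul_def sum_distrib_left sum_distrib_right mult_ac)
  finally show ?thesis .
qed

lemma star_unit: "k < r \<Longrightarrow> star \<eta> (\<lambda>i. \<eta> (e i)) k = \<eta> (e k)"
  unfolding star_def by (simp add: \<tau>_unit flip: hom_mult hom_sum)

lemma Lm_mul: "Lm \<eta> y * Lm \<eta> z = Lm \<eta> (mul \<eta> y z)"
proof (rule eq_matI)
  fix k j assume "k < dim_row (Lm \<eta> (mul \<eta> y z))" "j < dim_col (Lm \<eta> (mul \<eta> y z))"
  then have kj: "k < r" "j < r" by (auto simp: Lm_def)
  let ?u = "\<lambda>i. if i = j then 1 else 0 :: 'b"
  have L: "Lm \<eta> y $$ (k, j) = mul \<eta> y ?u k" if "k < r" for y k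
    using that kj by (simp add: Lm_def mul_def sum_delta_mult)
  have "col (Lm \<eta> z) j = vec r (mul \<eta> z ?u)"
    by (rule eq_vecI) (use L kj in \<open>auto simp: Lm_def\<close>)
  then have "(Lm \<eta> y * Lm \<eta> z) $$ (k, j) = (Lm \<eta> y *\<^sub>v vec r (mul \<eta> z ?u)) $ k"
    using kj by (simp add: Lm_def)
  also have "\<dots> = Lm \<eta> (mul \<eta> y z) $$ (k, j)"
    unfolding Lm_mult_vec[OF kj(1)] L[OF kj(1)] using mul_assoc[OF kj(1)] by simp
  finally show "(Lm \<eta> y * Lm \<eta> z) $$ (k, j) = Lm \<eta> (mul \<eta> y z) $$ (k, j)" .
qed (auto simp: Lm_def)

lemma Lm_unit: "Lm \<eta> (\<lambda>i. a * \<eta> (e i)) = a \<cdot>\<^sub>m 1\<^sub>m r"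
proof (rule eq_matI)
  fix k j assume "k < dim_row (a \<cdot>\<^sub>m 1\<^sub>m r)" "j < dim_col (a \<cdot>\<^sub>m 1\<^sub>m r)"
  then have kj: "k < r" "j < r" by auto
  then have "Lm \<eta> (\<lambda>i. a * \<eta> (e i)) $$ (k, j) = mul \<eta> (\<lambda>i. a * \<eta> (e i)) (\<lambda>i. if i = j then 1 else 0) k"
    by (simp add: Lm_def mul_def sum_delta_mult)
  also have "\<dots> = a * (if k = j then 1 else 0)" using kj by (simp add: mul_scale_left mul_unit_left)
  finally show "Lm \<eta> (\<lambda>i. a * \<eta> (e i)) $$ (k, j) = (a \<cdot>\<^sub>m 1\<^sub>m r) $$ (k, j)" using kj by simp
qed (auto simp: Lm_def)

lemma quasi_inv_right: assumes k: "k < r" shows "mul \<eta> y (quasi_inv \<eta> y) k = det (Lm \<eta> y) * \<eta> (e k)"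
proof -
  have adj: "adj_mat (Lm \<eta> y) \<in> carrier_mat r r" by (rule adj_mat) simp
  have v: "vec r (quasi_inv \<eta> y) = adj_mat (Lm \<eta> y) *\<^sub>v vec r (\<lambda>i. \<eta> (e i))"
    by (rule eq_vecI) (use adj in \<open>auto simp: quasi_inv_def scalar_prod_def lessThan_atLeast0\<close>)
  have "Lm \<eta> y *\<^sub>v vec r (quasi_inv \<eta> y) = (Lm \<eta> y * adj_mat (Lm \<eta> y)) *\<^sub>v vec r (\<lambda>i. \<eta> (e i))"
    unfolding v by (rule assoc_mult_mat_vec[symmetric, OF Lm_carrier adj]) simp
  also have "\<dots> = det (Lm \<eta> y) \<cdot>\<^sub>v vec r (\<lambda>i. \<eta> (e i))"
    by (subst adj_mat(2)[OF Lm_carrier]) (simp add: smult_one_mat_mult_vec)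
  finally show ?thesis unfolding Lm_mult_vec[OF k, symmetric] using k by simp
qed

end

lemma mul_cancel_left:
  fixes \<eta> :: "'f \<Rightarrow> 'b::idom"
  assumes D: "det (Lm \<eta> y) \<noteq> 0" and 0: "\<And>k. k < r \<Longrightarrow> mul \<eta> y v k = mul \<eta> y w k" and k: "k < r"
  shows "v k = w k"
proof -
  have adj: "adj_mat (Lm \<eta> y) \<in> carrier_mat r r" by (rule adj_mat) simp
  have *: "det (Lm \<eta> y) * v k = (adj_mat (Lm \<eta> y) *\<^sub>v (Lm \<eta> y *\<^sub>v vec r v)) $ k" for v :: "nat \<Rightarrow> 'b"
  proof -
    have "adj_mat (Lm \<eta> y) *\<^sub>v (Lm \<eta> y *\<^sub>v vec r v) = (adj_mat (Lm \<eta> y) * Lm \<eta> y) *\<^sub>v vec r v"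
      by (rule assoc_mult_mat_vec[symmetric, OF adj Lm_carrier]) simp
    also have "\<dots> = det (Lm \<eta> y) \<cdot>\<^sub>v vec r v"
      by (subst adj_mat(3)[OF Lm_carrier]) (simp add: smult_one_mat_mult_vec)
    finally show ?thesis using k by simp
  qed
  have "Lm \<eta> y *\<^sub>v vec r v = Lm \<eta> y *\<^sub>v vec r w"
  proof (rule eq_vecI)
    fix i assume "i < dim_vec (Lm \<eta> y *\<^sub>v vec r w)"
    then have "i < r" by (simp add: Lm_def)
    then show "(Lm \<eta> y *\<^sub>v vec r v) $ i = (Lm \<eta> y *\<^sub>v vec r w) $ i" using 0 by (simp only: Lm_mult_vec)
  qed (simp add: Lm_def)
  then show ?thesis using *[of v] *[of w] D by (metis mult_left_cancel)
qed

text \<open>For the quasi-inverse z of y, reassociating gives y (z y) = (y z) y = y d, where d is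
  the determinant; over a domain y can be cancelled on the left because d is nonzero.\<close>

lemma quasi_inv_left:
  fixes \<eta> :: "'f \<Rightarrow> 'b::idom"
  assumes hom: "comm_ring_hom \<eta>" and D: "det (Lm \<eta> y) \<noteq> 0" and k: "k < r"
  shows "mul \<eta> (quasi_inv \<eta> y) y k = det (Lm \<eta> y) * \<eta> (e k)"
proof (rule mul_cancel_left[OF D _ k])
  fix k assume k: "k < r"
  have "mul \<eta> y (mul \<eta> (quasi_inv \<eta> y) y) k = mul \<eta> (mul \<eta> y (quasi_inv \<eta> y)) y k"
    by (rule mul_assoc[OF hom k, symmetric])
  also have "\<dots> = mul \<eta> (\<lambda>k. det (Lm \<eta> y) * \<eta> (e k)) y k"
    by (rule mul_cong) (auto simp: quasi_inv_right[OF hom])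
  also have "\<dots> = mul \<eta> y (\<lambda>k. det (Lm \<eta> y) * \<eta> (e k)) k"
    by (simp add: mul_scale_left mul_scale_right mul_unit_left[OF hom k] mul_unit_right[OF hom k])
  finally show "mul \<eta> y (mul \<eta> (quasi_inv \<eta> y) y) k = mul \<eta> y (\<lambda>k. det (Lm \<eta> y) * \<eta> (e k)) k" .
qed

lemma det_Lm_in_subring:
  assumes S: "is_subring S" and y: "\<And>i. i < r \<Longrightarrow> y i \<in> S" and \<eta>: "\<And>a. \<eta> a \<in> S"
  shows "det (Lm \<eta> y) \<in> S"
  by (rule det_in_subring[OF S Lm_carrier])
    (auto simp: Lm_def intro!: subring_sum[OF S] subring_mult[OF S] y \<eta>)

lemma quasi_inv_in_subring:
  assumes S: "is_subring S" and y: "\<And>i. i < r \<Longrightarrow> y i \<in> S" and \<eta>: "\<And>a. \<eta> a \<in> S" and k: "k < r"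
  shows "quasi_inv \<eta> y k \<in> S"
proof -
  have "adj_mat (Lm \<eta> y) $$ (k, j) \<in> S" if j: "j < r" for j
  proof -
    have "det (mat_delete (Lm \<eta> y) j k) \<in> S"
      by (rule det_in_subring[OF S, of _ "r - 1"])
        (use j k in \<open>auto simp: Lm_def mat_delete_def intro!: subring_sum[OF S] subring_mult[OF S] y \<eta>\<close>)
    then show ?thesis using j k
      by (auto simp: adj_mat_def cofactor_def Lm_def[of \<eta> y, THEN arg_cong[of _ _ dim_row]] Lm_def[of \<eta> y, THEN arg_cong[of _ _ dim_col]]
          intro!: subring_mult[OF S] subring_power[OF S] subring_uminus[OF S] subring_1[OF S])
  qed
  then show ?thesis unfolding quasi_inv_def by (intro subring_sum[OF S] subring_mult[OF S] \<eta>) auto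
qed

end

text \<open>\<open>a\<close> is the matrix of a linear map from the algebra to an
  \<open>M\<close>-dimensional space and \<open>sec\<close> is a section of it. In the application
  this map is \<psi>.\<close>

locale star_forms = star_coords r c \<tau> e
  for r :: nat and c :: "nat \<Rightarrow> nat \<Rightarrow> nat \<Rightarrow> 'f::field" and \<tau> :: "nat \<Rightarrow> nat \<Rightarrow> 'f" and e :: "nat \<Rightarrow> 'f" +
  fixes M :: nat and a :: "nat \<Rightarrow> nat \<Rightarrow> 'f" and sec :: "nat \<Rightarrow> nat \<Rightarrow> 'f"
  assumes sec_a: "\<And>k k'. k < M \<Longrightarrow> k' < M \<Longrightarrow> (\<Sum>i<r. sec k i * a i k') = (if k = k' then 1 else 0)"
begin

text \<open>Coordinate \<open>k\<close> of the image under \<open>a\<close> of the adjoint of basis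
  vector \<open>j\<close> times basis vector \<open>l\<close>. When \<open>a\<close> represents
  \<psi>, this is the polarisation of \<phi>.\<close>

definition bb :: "nat \<Rightarrow> nat \<Rightarrow> nat \<Rightarrow> 'f" where
  "bb j l k = (\<Sum>m<r. (\<Sum>p<r. c p l m * \<tau> j p) * a m k)"

lemma im_mul_star:
  assumes "comm_ring_hom \<eta>"
  shows "(\<Sum>m<r. mul \<eta> (star \<eta> Z) w m * \<eta> (a m k)) = (\<Sum>l<r. w l * (\<Sum>j<r. Z j * \<eta> (bb j l k)))"
proof -
  interpret comm_ring_hom \<eta> by fact
  have "(\<Sum>m<r. mul \<eta> (star \<eta> Z) w m * \<eta> (a m k)) =
    (\<Sum>m<r. \<Sum>p<r. \<Sum>l<r. \<Sum>j<r. w l * (Z j * (\<eta> (c p l m) * \<eta> (\<tau> j p) * \<eta> (a m k))))"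
    by (simp add: mul_def star_def sum_distrib_left sum_distrib_right mult_ac)
  also have "\<dots> = (\<Sum>l<r. \<Sum>j<r. \<Sum>p<r. \<Sum>m<r. w l * (Z j * (\<eta> (c p l m) * \<eta> (\<tau> j p) * \<eta> (a m k))))"
    by (rule sum_rotate4)
  also have "\<dots> = (\<Sum>l<r. \<Sum>j<r. \<Sum>m<r. \<Sum>p<r. w l * (Z j * (\<eta> (c p l m) * \<eta> (\<tau> j p) * \<eta> (a m k))))"
    by (intro sum.cong refl sum.swap)
  also have "\<dots> = (\<Sum>l<r. w l * (\<Sum>j<r. Z j * \<eta> (bb j l k)))"
    by (simp add: bb_def hom_sum hom_mult sum_distrib_left sum_distrib_right mult_ac)
  finally show ?thesis .
qed

text \<open>The differential of \<open>Z \<mapsto> Z\<^sup>* Z\<close> in direction \<open>w\<close> is the image of \<open>Z\<^sup>* w\<close>; it has a section up to the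
  factor \<open>s\<close> as soon as \<open>Z\<close> has an inverse up to \<open>s\<close>.\<close>

lemma jacobian_section:
  assumes hom: "comm_ring_hom \<eta>" and y: "\<And>k. k < r \<Longrightarrow> mul \<eta> y Z k = s * \<eta> (e k)" and k: "k < M" "k' < M"
  shows "(\<Sum>l<r. (\<Sum>j<r. Z j * \<eta> (bb j l k)) * mul \<eta> (star \<eta> y) (\<lambda>i. \<eta> (sec k' i)) l) = (if k = k' then s else 0)"
proof -
  interpret comm_ring_hom \<eta> by fact
  let ?w = "mul \<eta> (star \<eta> y) (\<lambda>i. \<eta> (sec k' i))"
  have "mul \<eta> (star \<eta> Z) ?w m = s * \<eta> (sec k' m)" if m: "m < r" for m
  proof -
    have "mul \<eta> (star \<eta> Z) ?w m = mul \<eta> (mul \<eta> (star \<eta> Z) (star \<eta> y)) (\<lambda>i. \<eta> (sec k' i)) m"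
      by (rule mul_assoc[OF hom m, symmetric])
    also have "\<dots> = mul \<eta> (star \<eta> (mul \<eta> y Z)) (\<lambda>i. \<eta> (sec k' i)) m"
      by (rule mul_cong) (simp_all add: star_mul[OF hom])
    also have "\<dots> = mul \<eta> (\<lambda>k. s * \<eta> (e k)) (\<lambda>i. \<eta> (sec k' i)) m"
    proof (rule mul_cong)
      fix i assume i: "i < r"
      have "star \<eta> (mul \<eta> y Z) i = star \<eta> (\<lambda>k. s * \<eta> (e k)) i" by (rule star_cong) (rule y)
      then show "star \<eta> (mul \<eta> y Z) i = s * \<eta> (e i)" by (simp add: star_scale star_unit[OF hom i])
    qed simp
    finally show ?thesis by (simp add: mul_scale_left mul_unit_left[OF hom m])
  qed
  then have "(\<Sum>l<r. ?w l * (\<Sum>j<r. Z j * \<eta> (bb j l k))) = s * \<eta> (\<Sum>m<r. sec k' m * a m k)"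
    unfolding im_mul_star[OF hom, symmetric] by (simp add: hom_sum hom_mult sum_distrib_left mult_ac)
  then show ?thesis using sec_a[OF k(2,1)] by (auto simp: mult.commute)
qed

text \<open>The diagonal coefficients \<open>b\<close> are kept apart from the mixed ones, since in
  characteristic 2 a quadratic map is not determined by its polarisation \<open>bb\<close>. With
  different linear and constant terms the same shape gives the equations of \<open>G\<close> and the
  comorphism of \<rho>.\<close>

definition quadric :: "(nat \<Rightarrow> nat \<Rightarrow> 'f) \<Rightarrow> (nat \<Rightarrow> nat \<Rightarrow> 'f) \<Rightarrow> (nat \<Rightarrow> 'f) \<Rightarrow> nat \<Rightarrow> 'f mpol" where
  "quadric lin b h k = (\<Sum>i<r. mconst (lin i k) * mvar i) + (\<Sum>i<r. mconst (b i k) * (mvar i * mvar i)) +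
     (\<Sum>i<r. \<Sum>j<i. mconst (bb j i k) * (mvar j * mvar i)) - mconst (h k)"

text \<open>As \<open>bb\<close> is symmetric and twice \<open>b\<close> on the diagonal, the square
  and mixed terms combine into a single sum over all \<open>j\<close>, without division by
  2.\<close>

lemma mpol_deriv_quadric:
  assumes sym: "\<And>i j. i < r \<Longrightarrow> j < r \<Longrightarrow> bb i j k = bb j i k" and dbl: "\<And>i. i < r \<Longrightarrow> bb i i k = 2 * b i k"
    and l: "l < r"
  shows "mpol_deriv l (quadric lin b h k) = mconst (lin l k) + (\<Sum>j<r. mvar j * mconst (bb j l k))"
proof -
  have d: "mpol_deriv l (mconst x * (mvar j * mvar i)) =
    mconst x * ((if l = j then 1 else 0) * mvar i) + mconst x * (mvar j * (if l = i then 1 else 0))"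
    for x :: 'f and i j
    by (simp add: mpol_deriv_mult mpol_deriv_var distrib_left)
  have 1: "(\<Sum>i<r. mpol_deriv l (mconst (lin i k) * mvar i)) = mconst (lin l k)"
    using l by (simp add: mpol_deriv_mult mpol_deriv_var sum_delta_mult)
  have "(\<Sum>i<r. mpol_deriv l (mconst (b i k) * (mvar i * mvar i))) =
     (\<Sum>i<r. (mconst (b i k) * mvar i) * (if l = i then 1 else 0)) +
     (\<Sum>i<r. (mconst (b i k) * mvar i) * (if l = i then 1 else 0))"
    unfolding d sum.distrib by (simp add: mult_ac)
  also have "\<dots> = mvar l * mconst (bb l l k)"
  proof -
    have "mconst (bb l l k) = mconst (b l k) + mconst (b l k)"
      unfolding dbl[OF l] by (simp only: mult_2 single_add)
    then show ?thesis using l by (simp only: sum_delta_mult distrib_left distrib_right mult.commute if_True lessThan_iff)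
  qed
  finally have 2: "(\<Sum>i<r. mpol_deriv l (mconst (b i k) * (mvar i * mvar i))) = mvar l * mconst (bb l l k)" .
  have "(\<Sum>i<r. \<Sum>j<i. mpol_deriv l (mconst (bb j i k) * (mvar j * mvar i))) =
     (\<Sum>i<r. \<Sum>j<i. (if l = j then 1 else 0) * (mconst (bb j i k) * mvar i)) +
     (\<Sum>i<r. (\<Sum>j<i. mconst (bb j i k) * mvar j) * (if l = i then 1 else 0))"
    unfolding d by (simp add: sum.distrib mult_ac sum_distrib_left)
  also have "(\<Sum>i<r. \<Sum>j<i. (if l = j then 1 else 0) * (mconst (bb j i k) * mvar i)) =
     (\<Sum>i<r. if l < i then mvar i * mconst (bb i l k) else 0)"
    using l sym by (intro sum.cong refl) (auto simp: sum_delta_mult mult.commute)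
  also have "\<dots> = (\<Sum>i\<in>{l<..<r}. mvar i * mconst (bb i l k))"
    by (rule sum.mono_neutral_cong_right) auto
  also have "(\<Sum>i<r. (\<Sum>j<i. mconst (bb j i k) * mvar j) * (if l = i then 1 else 0)) =
     (\<Sum>j<l. mvar j * mconst (bb j l k))"
    using l by (simp add: sum_delta_mult mult.commute)
  finally have 3: "(\<Sum>i<r. \<Sum>j<i. mpol_deriv l (mconst (bb j i k) * (mvar j * mvar i))) =
    (\<Sum>i\<in>{l<..<r}. mvar i * mconst (bb i l k)) + (\<Sum>j<l. mvar j * mconst (bb j l k))" .
  have r: "{..<r} = insert l ({l<..<r} \<union> {..<l})" using l by auto
  have "(\<Sum>j\<in>{l<..<r} \<union> {..<l}. mvar j * mconst (bb j l k)) =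
      (\<Sum>i\<in>{l<..<r}. mvar i * mconst (bb i l k)) + (\<Sum>j<l. mvar j * mconst (bb j l k))"
    by (rule sum.union_disjoint) auto
  then have "(\<Sum>j<r. mvar j * mconst (bb j l k)) = mvar l * mconst (bb l l k) +
      ((\<Sum>i\<in>{l<..<r}. mvar i * mconst (bb i l k)) + (\<Sum>j<l. mvar j * mconst (bb j l k)))"
    unfolding r by (subst sum.insert) auto
  then show ?thesis
    unfolding quadric_def by (simp add: mpol_deriv_add mpol_deriv_diff mpol_deriv_sum 1 2 3 add.assoc)
qed

end

section \<open>The Cayley transform\<close>

lemma comm_ring_hom_to_fract: "comm_ring_hom to_fract"
  by unfold_locales simp_all

lemma to_fract_power: "to_fract (x ^ n) = to_fract x ^ n"
  by (induction n) simp_all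

lemma solve_linear_system:
  fixes A :: "'a::field mat"
  assumes A: "A \<in> carrier_mat n n" and D: "det A \<noteq> 0" and v: "v \<in> carrier_vec n"
  shows "\<exists>x\<in>carrier_vec n. A *\<^sub>v x = v"
proof -
  define x where "x = (1 / det A) \<cdot>\<^sub>v (adj_mat A *\<^sub>v v)"
  have adj: "adj_mat A \<in> carrier_mat n n" by (rule adj_mat[OF A])
  have "A *\<^sub>v (adj_mat A *\<^sub>v v) = (A * adj_mat A) *\<^sub>v v"
    by (rule assoc_mult_mat_vec[symmetric, OF A adj v])
  also have "\<dots> = det A \<cdot>\<^sub>v v" by (subst adj_mat(2)[OF A]) (rule smult_one_mat_mult_vec[OF v])
  finally have "A *\<^sub>v x = v" unfolding x_def using A adj v D
    by (subst mult_mat_vec[of A n n]) (auto simp: smult_smult_assoc)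
  moreover have "x \<in> carrier_vec n" using adj v by (simp add: x_def)
  ultimately show ?thesis by blast
qed

text \<open>The kernel of \<open>a\<close> consists of skew elements, so adding kernel elements to
  \<open>z0\<close> keeps the relation y + y^* = 1. Invertibility of \<open>z0\<close> passes to the
  generic element of the resulting affine space.\<close>

locale star_cayley = star_forms r c \<tau> e M a sec
  for r :: nat and c :: "nat \<Rightarrow> nat \<Rightarrow> nat \<Rightarrow> 'f::field" and \<tau> :: "nat \<Rightarrow> nat \<Rightarrow> 'f" and e :: "nat \<Rightarrow> 'f"
    and M :: nat and a :: "nat \<Rightarrow> nat \<Rightarrow> 'f" and sec :: "nat \<Rightarrow> nat \<Rightarrow> 'f" +
  fixes z0 :: "nat \<Rightarrow> 'f"
  assumes skew: "\<And>y k. (\<And>m. m < M \<Longrightarrow> (\<Sum>i<r. y i * a i m) = 0) \<Longrightarrow> k < r \<Longrightarrow> y k + star (\<lambda>x. x) y k = 0"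
    and z0: "\<And>k. k < r \<Longrightarrow> z0 k + star (\<lambda>x. x) z0 k = e k"
    and z0_inv: "det (Lm (\<lambda>x. x) z0) \<noteq> 0"
begin

lemma is_prime_ideal_0: "is_prime_ideal UNIV {0::'f}"
  by (auto simp: is_prime_ideal_def)

text \<open>The section yields an invertible minor of \<open>a\<close> of size \<open>M\<close>;
  solving for its coordinates parametrises the kernel by the remaining \<open>r - M\<close> ones.
  The vectors \<open>X l\<close> restrict to unit vectors on the free coordinates, so parameters can
  be read off there.\<close>

lemma free_columns:
  obtains Fr X where "Fr \<subseteq> {..<r}" "card Fr = r - M" "M \<le> r"
    "\<And>l m. l \<in> Fr \<Longrightarrow> m < M \<Longrightarrow> (\<Sum>i<r. X l i * a i m) = 0"
    "\<And>l i. l \<in> Fr \<Longrightarrow> i \<in> Fr \<Longrightarrow> X l i = (if i = l then 1 else 0)"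
proof -
  have sec': "(\<Sum>l<r. a l k * sec k' l) = (if k = k' then 1 else 0)" if "k < M" "k' < M" for k k'
    using sec_a[OF that(2,1)] by (auto simp: mult.commute)
  obtain \<kappa> where kappa: "inj_on \<kappa> {..<M}" "\<And>j. j < M \<Longrightarrow> \<kappa> j < r"
    "det (mat M M (\<lambda>(i, j). a (\<kappa> j) i)) \<notin> {0}"
    by (rule exists_minor[OF is_subring_UNIV is_prime_ideal_0, of M r "\<lambda>k l. a l k" "\<lambda>l k. sec k l" 1])
      (auto simp: sec')
  let ?K = "\<kappa> ` {..<M}"
  define Fr where "Fr = {..<r} - ?K"
  have K: "?K \<subseteq> {..<r}" using kappa by auto
  have cK: "card ?K = M" using kappa by (simp add: card_image)
  have "M \<le> r" using card_mono[OF _ K] cK by simp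
  have "\<exists>x. \<forall>m<M. (\<Sum>j<M. x j * a (\<kappa> j) m) = a l m" for l
  proof -
    let ?A = "mat M M (\<lambda>(i, j). a (\<kappa> j) i)"
    obtain x where x: "x \<in> carrier_vec M" "?A *\<^sub>v x = vec M (a l)"
      using solve_linear_system[of ?A M "vec M (a l)"] kappa(3) by auto
    have "(\<Sum>j<M. x $ j * a (\<kappa> j) m) = a l m" if "m < M" for m
      using arg_cong[OF x(2), of "\<lambda>v. v $ m"] that x(1)
      by (simp add: scalar_prod_def lessThan_atLeast0 mult.commute)
    then show ?thesis by (intro exI[of _ "\<lambda>j. x $ j"]) auto
  qed
  then obtain x where x: "\<And>l m. m < M \<Longrightarrow> (\<Sum>j<M. x l j * a (\<kappa> j) m) = a l m" by metis
  define X where "X l i = (if i \<in> ?K then - x l (the_inv_into {..<M} \<kappa> i) else if i = l then 1 else 0)" for l i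
  have "(\<Sum>i<r. X l i * a i m) = 0" if l: "l \<in> Fr" and m: "m < M" for l m
  proof -
    have "(\<Sum>i<r. X l i * a i m) = (\<Sum>i\<in>Fr. X l i * a i m) + (\<Sum>i\<in>?K. X l i * a i m)"
      unfolding Fr_def by (rule sum.subset_diff[OF K]) simp
    also have "(\<Sum>i\<in>Fr. X l i * a i m) = (\<Sum>i\<in>Fr. if i = l then a i m else 0)"
      by (intro sum.cong refl) (auto simp: X_def Fr_def)
    also have "\<dots> = a l m" using l by (simp add: Fr_def)
    also have "(\<Sum>i\<in>?K. X l i * a i m) = (\<Sum>j<M. X l (\<kappa> j) * a (\<kappa> j) m)"
      by (rule sum.reindex_cong[OF kappa(1)]) auto
    also have "\<dots> = (\<Sum>j<M. - (x l j * a (\<kappa> j) m))"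
      by (intro sum.cong refl) (auto simp: X_def the_inv_into_f_f[OF kappa(1)])
    also have "\<dots> = - a l m" using x[OF m] by (simp add: sum_negf)
    finally show ?thesis by simp
  qed
  moreover have "X l i = (if i = l then 1 else 0)" if "l \<in> Fr" "i \<in> Fr" for l i
    using that by (auto simp: X_def Fr_def)
  moreover have "card Fr = r - M" unfolding Fr_def using cK K by (simp add: card_Diff_subset finite_subset)
  ultimately show thesis using \<open>M \<le> r\<close> by (intro that[of Fr X]) (auto simp: Fr_def)
qed

text \<open>If \<open>Y + Y\<^sup>* = 1\<close> and \<open>V\<close> is the inverse of \<open>Y\<close>, then \<open>1 - V\<close> is unitary; unlike the classical Cayley transform
  this also makes sense in characteristic two.\<close>

lemma cayley_unitary:
  assumes hom: "comm_ring_hom \<eta>" and Y: "\<And>k. k < r \<Longrightarrow> Y k + star \<eta> Y k = \<eta> (e k)"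
    and YV: "\<And>k. k < r \<Longrightarrow> mul \<eta> Y V k = \<eta> (e k)" and VY: "\<And>k. k < r \<Longrightarrow> mul \<eta> V Y k = \<eta> (e k)"
    and k: "k < r"
  shows "mul \<eta> (star \<eta> (\<lambda>i. \<eta> (e i) - V i)) (\<lambda>i. \<eta> (e i) - V i) k = \<eta> (e k)"
proof -
  interpret comm_ring_hom \<eta> by fact
  let ?E = "\<lambda>i. \<eta> (e i)"
  have sE: "star \<eta> (\<lambda>i. ?E i - V i) i = ?E i - star \<eta> V i" if "i < r" for i
    by (simp add: star_diff star_unit[OF hom that])
  have "mul \<eta> (star \<eta> (\<lambda>i. ?E i - V i)) (\<lambda>i. ?E i - V i) k = mul \<eta> (\<lambda>i. ?E i - star \<eta> V i) (\<lambda>i. ?E i - V i) k"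
    by (rule mul_cong) (auto simp: sE)
  also have "\<dots> = \<eta> (e k) - V k - star \<eta> V k + mul \<eta> (star \<eta> V) V k"
    by (simp add: mul_diff_left mul_diff_right mul_unit_left[OF hom k] mul_unit_right[OF hom k])
  also have "mul \<eta> (star \<eta> V) V k = mul \<eta> (star \<eta> V) (mul \<eta> (\<lambda>i. Y i + star \<eta> Y i) V) k"
  proof (rule mul_cong)
    fix i assume i: "i < r"
    have "mul \<eta> (\<lambda>i. Y i + star \<eta> Y i) V i = mul \<eta> ?E V i" by (rule mul_cong) (auto simp: Y)
    then show "V i = mul \<eta> (\<lambda>i. Y i + star \<eta> Y i) V i" by (simp add: mul_unit_left[OF hom i])
  qed simp
  also have "\<dots> = mul \<eta> (star \<eta> V) (\<lambda>i. mul \<eta> Y V i + mul \<eta> (star \<eta> Y) V i) k"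
    by (rule mul_cong) (auto simp: mul_add_left)
  also have "\<dots> = mul \<eta> (star \<eta> V) (mul \<eta> Y V) k + mul \<eta> (star \<eta> V) (mul \<eta> (star \<eta> Y) V) k"
    by (rule mul_add_right)
  also have "mul \<eta> (star \<eta> V) (mul \<eta> Y V) k = mul \<eta> (star \<eta> V) ?E k" by (rule mul_cong) (auto simp: YV)
  also have "\<dots> = star \<eta> V k" by (rule mul_unit_right[OF hom k])
  also have "mul \<eta> (star \<eta> V) (mul \<eta> (star \<eta> Y) V) k = mul \<eta> (mul \<eta> (star \<eta> V) (star \<eta> Y)) V k"
    by (rule mul_assoc[OF hom k, symmetric])
  also have "\<dots> = mul \<eta> ?E V k"
  proof (rule mul_cong)
    fix i assume i: "i < r"
    have "mul \<eta> (star \<eta> V) (star \<eta> Y) i = star \<eta> (mul \<eta> Y V) i" by (rule star_mul[OF hom i, symmetric])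
    also have "\<dots> = star \<eta> ?E i" by (rule star_cong) (rule YV)
    finally show "mul \<eta> (star \<eta> V) (star \<eta> Y) i = ?E i" by (simp add: star_unit[OF hom i])
  qed simp
  also have "\<dots> = V k" by (rule mul_unit_left[OF hom k])
  finally show ?thesis by simp
qed

abbreviation fconst :: "'f \<Rightarrow> 'f mpol fract" where "fconst x \<equiv> to_fract (mconst x)"

text \<open>\<open>Y i\<close> is \<open>z0\<close> plus the generic combination of kernel vectors
  with the parameters below \<open>i\<close> set to 0, and \<open>P i\<close> is the ideal of
  relations of the unitary point q = 1 - V, where V is the inverse of \<open>Y i\<close>.
  Specialising one more parameter gives the inclusion. It is strict because \<open>Y i\<close> is
  recovered as the inverse of 1 - q, which makes the vanishing of a parameter a polynomial relation
  on q.\<close>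

theorem cayley_chain:
  obtains P where "M \<le> r"
    "\<And>i. i \<le> r - M \<Longrightarrow> \<exists>q. P i = {f \<in> mpol_ring UNIV r. mpol_eval fconst q f = 0} \<and>
       (\<forall>k<r. mul fconst (star fconst q) q k = fconst (e k))"
    "\<And>i. i < r - M \<Longrightarrow> P i \<subset> P (Suc i)"
proof -
  obtain Fr X where Fr: "Fr \<subseteq> {..<r}" "card Fr = r - M" "M \<le> r"
    and X: "\<And>l m. l \<in> Fr \<Longrightarrow> m < M \<Longrightarrow> (\<Sum>i<r. X l i * a i m) = 0"
    and XF: "\<And>l i. l \<in> Fr \<Longrightarrow> i \<in> Fr \<Longrightarrow> X l i = (if i = l then 1 else 0)"
    by (rule free_columns) blast
  define d where "d = r - M"
  obtain \<nu> where "bij_betw \<nu> {0..<d} Fr"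
    using ex_bij_betw_nat_finite[of Fr] Fr finite_subset[OF Fr(1)] unfolding d_def by auto
  then have nu: "\<And>t. t < d \<Longrightarrow> \<nu> t \<in> Fr" "\<And>t t'. t < d \<Longrightarrow> t' < d \<Longrightarrow> \<nu> t = \<nu> t' \<longleftrightarrow> t = t'"
    by (auto simp: bij_betw_def inj_on_def)
  have hm: "comm_ring_hom (mconst :: 'f \<Rightarrow> _)" by (rule comm_ring_hom_mconst)
  have hf: "comm_ring_hom fconst" by (rule comm_ring_hom_comp[OF comm_ring_hom_to_fract hm])
  interpret hm: comm_ring_hom "mconst :: 'f \<Rightarrow> _" by (rule hm)
  interpret hf: comm_ring_hom fconst by (rule hf)
  define u :: "nat \<Rightarrow> nat \<Rightarrow> 'f mpol" where "u i t = (if t < i then 0 else mvar t)" for i t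
  define Y where "Y i k = mconst (z0 k) + (\<Sum>t<d. u i t * mconst (X (\<nu> t) k))" for i k
  define D where "D i = det (Lm mconst (Y i))" for i
  define W where "W i = quasi_inv mconst (Y i)" for i
  \<comment> \<open>Setting all parameters to 0 turns \<open>D i\<close> into the determinant for
    \<open>z0\<close>.\<close>
  have D0: "D i \<noteq> 0" for i
  proof -
    have h0: "comm_ring_hom (mpol_eval (\<lambda>x::'f. x) (\<lambda>_. 0))" by (rule comm_ring_hom_mpol_eval[OF comm_ring_hom_id])
    interpret h0: comm_ring_hom "mpol_eval (\<lambda>x::'f. x) (\<lambda>_. 0)" by (rule h0)
    have "mpol_eval (\<lambda>x::'f. x) (\<lambda>_. 0) (u i t) = 0" for t
      using h0.hom_zero by (simp add: u_def mpol_eval_var[OF comm_ring_hom_id])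
    then have "mpol_eval (\<lambda>x. x) (\<lambda>_. 0) (Y i k) = z0 k" for k
      by (simp add: Y_def h0.hom_add h0.hom_sum h0.hom_mult mpol_eval_const[OF comm_ring_hom_id])
    then have "mpol_eval (\<lambda>x. x) (\<lambda>_. 0) (D i) = det (Lm (\<lambda>x. x) z0)"
      unfolding D_def det_Lm_hom[OF h0] by (simp add: mpol_eval_const[OF comm_ring_hom_id])
    then show ?thesis using z0_inv h0.hom_zero by auto
  qed
  define Yf where "Yf i k = to_fract (Y i k)" for i k
  define V where "V i k = to_fract (W i k) / to_fract (D i)" for i k
  define q where "q i k = fconst (e k) - V i k" for i k
  have Ystar: "Yf i k + star fconst (Yf i) k = fconst (e k)" if k: "k < r" for i k
  proof -
    have Yfe: "Yf i = (\<lambda>k. fconst (z0 k) + (\<Sum>t<d. to_fract (u i t) * fconst (X (\<nu> t) k)))"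
      by (rule ext) (simp add: Yf_def Y_def to_fract_add to_fract_sum to_fract_mult)
    have st: "star fconst (\<lambda>k. fconst (y k)) k = fconst (star (\<lambda>x. x) y k)" for y k
      by (simp add: star_def hf.hom_sum hf.hom_mult)
    have sk: "fconst (X (\<nu> t) k) + star fconst (\<lambda>k. fconst (X (\<nu> t) k)) k = 0" if "t < d" for t
      using skew[of "X (\<nu> t)" k, OF X[OF nu(1)[OF that]] k] unfolding st by (simp flip: hf.hom_add)
    have zk: "fconst (z0 k) + star fconst (\<lambda>k. fconst (z0 k)) k = fconst (e k)"
      using z0[OF k] unfolding st by (simp flip: hf.hom_add)
    have "Yf i k + star fconst (Yf i) k = (fconst (z0 k) + star fconst (\<lambda>k. fconst (z0 k)) k) +
      (\<Sum>t<d. to_fract (u i t) * (fconst (X (\<nu> t) k) + star fconst (\<lambda>k. fconst (X (\<nu> t) k)) k))"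
      unfolding Yfe star_add star_sum by (simp add: algebra_simps sum.distrib)
    also have "\<dots> = fconst (e k)" unfolding zk by (simp add: sk)
    finally show ?thesis .
  qed
  have Df: "to_fract (D i) \<noteq> 0" for i using D0 by simp
  have YV: "mul fconst (Yf i) (V i) k = fconst (e k)" if k: "k < r" for i k
  proof -
    have "to_fract (mul mconst (Y i) (W i) k) = to_fract (D i * mconst (e k))"
      unfolding W_def D_def using quasi_inv_right[OF hm k] by simp
    then have "mul fconst (Yf i) (\<lambda>k. to_fract (W i k)) k = to_fract (D i) * fconst (e k)"
      unfolding mul_hom[OF comm_ring_hom_to_fract] Yf_def by (simp add: to_fract_mult)
    moreover have "mul fconst (Yf i) (V i) k = (1 / to_fract (D i)) * mul fconst (Yf i) (\<lambda>k. to_fract (W i k)) k"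
      unfolding mul_scale_right[symmetric] V_def by simp
    ultimately show ?thesis using Df by simp
  qed
  have VY: "mul fconst (V i) (Yf i) k = fconst (e k)" if k: "k < r" for i k
  proof -
    have "to_fract (mul mconst (W i) (Y i) k) = to_fract (D i * mconst (e k))"
      unfolding W_def D_def using quasi_inv_left[OF hm _ k, of "Y i"] D0[of i] by (simp add: D_def)
    then have "mul fconst (\<lambda>k. to_fract (W i k)) (Yf i) k = to_fract (D i) * fconst (e k)"
      unfolding mul_hom[OF comm_ring_hom_to_fract] Yf_def by (simp add: to_fract_mult)
    moreover have "mul fconst (V i) (Yf i) k = (1 / to_fract (D i)) * mul fconst (\<lambda>k. to_fract (W i k)) (Yf i) k"
      unfolding mul_scale_left[symmetric] V_def by simp
    ultimately show ?thesis using Df by simp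
  qed
  define P where "P i = {f \<in> mpol_ring UNIV r. mpol_eval fconst (q i) f = 0}" for i
  have un: "mul fconst (star fconst (q i)) (q i) k = fconst (e k)" if "k < r" for i k
    unfolding q_def by (rule cayley_unitary[OF hf Ystar YV VY that])
  have sub: "P i \<subseteq> P (Suc i)" for i
  proof
    fix f assume f: "f \<in> P i"
    define \<theta> where "\<theta> = mpol_eval (mconst :: 'f \<Rightarrow> _) (\<lambda>j. if j = i then 0 else mvar j)"
    have h\<theta>: "comm_ring_hom \<theta>" unfolding \<theta>_def by (rule comm_ring_hom_mpol_eval[OF hm])
    interpret \<theta>: comm_ring_hom \<theta> by (rule h\<theta>)
    have th_c: "\<theta> (mconst x) = mconst x" for x by (simp add: \<theta>_def mpol_eval_const[OF hm])
    have "\<theta> (u i t) = u (Suc i) t" for t by (auto simp: u_def \<theta>_def mpol_eval_var[OF hm] mpol_eval_zero[OF hm] less_Suc_eq)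
    then have thY: "\<theta> (Y i k) = Y (Suc i) k" for k
      by (simp add: Y_def \<theta>.hom_add \<theta>.hom_sum \<theta>.hom_mult th_c)
    then have thD: "\<theta> (D i) = D (Suc i)" by (simp add: D_def det_Lm_hom[OF h\<theta>] th_c)
    \<comment> \<open>Adjugates need not be specialised entry by entry: both sides solve the same
      linear system, whose determinant is nonzero.\<close>
    have thW: "\<theta> (W i k) = W (Suc i) k" if k: "k < r" for k
    proof (rule mul_cancel_left[where \<eta> = mconst and y = "Y (Suc i)", OF _ _ k])
      show "det (Lm mconst (Y (Suc i))) \<noteq> 0" using D0[of "Suc i"] by (simp add: D_def)
      fix k assume k: "k < r"
      have "mul mconst (Y (Suc i)) (\<lambda>k. \<theta> (W i k)) k = \<theta> (mul mconst (Y i) (W i) k)"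
        by (simp add: mul_hom[OF h\<theta>] th_c thY)
      also have "\<dots> = mul mconst (Y (Suc i)) (W (Suc i)) k"
        unfolding W_def quasi_inv_right[OF hm k] by (simp add: \<theta>.hom_mult th_c thD flip: D_def)
      finally show "mul mconst (Y (Suc i)) (\<lambda>k. \<theta> (W i k)) k = mul mconst (Y (Suc i)) (W (Suc i)) k" .
    qed
    \<comment> \<open>Specialising parameter \<open>i\<close> makes no sense on all fractions, but
      it does on those whose denominator is a power of \<open>D i\<close>. \<open>R\<close> relates
      such a fraction to its specialisation through representatives, and is compatible with sums and
      products.\<close>
    define R where "R x x' \<longleftrightarrow> (\<exists>b n. x = to_fract b / to_fract (D i) ^ n \<and> x' = to_fract (\<theta> b) / to_fract (D (Suc i)) ^ n)" for x x'
    have Rc: "R (fconst x) (fconst x)" for x unfolding R_def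
      by (rule exI[of _ "mconst x"], rule exI[of _ 0]) (simp add: th_c)
    have Ra: "R (x + y) (x' + y')" if "R x x'" "R y y'" for x x' y y'
    proof -
      from that(1) obtain b n where bn: "x = to_fract b / to_fract (D i) ^ n"
        "x' = to_fract (\<theta> b) / to_fract (D (Suc i)) ^ n" unfolding R_def by blast
      from that(2) obtain b' n' where bn': "y = to_fract b' / to_fract (D i) ^ n'"
        "y' = to_fract (\<theta> b') / to_fract (D (Suc i)) ^ n'" unfolding R_def by blast
      show ?thesis unfolding R_def bn bn'
        by (intro exI[of _ "b * D i ^ n' + b' * D i ^ n"] exI[of _ "n + n'"])
          (simp add: add_frac_eq D0 to_fract_power \<theta>.hom_add \<theta>.hom_mult \<theta>.hom_power thD power_add)
    qed
    have Rm: "R (x * y) (x' * y')" if "R x x'" "R y y'" for x x' y y'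
    proof -
      from that(1) obtain b n where bn: "x = to_fract b / to_fract (D i) ^ n"
        "x' = to_fract (\<theta> b) / to_fract (D (Suc i)) ^ n" unfolding R_def by blast
      from that(2) obtain b' n' where bn': "y = to_fract b' / to_fract (D i) ^ n'"
        "y' = to_fract (\<theta> b') / to_fract (D (Suc i)) ^ n'" unfolding R_def by blast
      show ?thesis unfolding R_def bn bn'
        by (intro exI[of _ "b * b'"] exI[of _ "n + n'"]) (simp add: \<theta>.hom_mult power_add)
    qed
    have Rq: "R (q i k) (q (Suc i) k)" if "k < r" for k unfolding R_def q_def V_def
      by (intro exI[of _ "D i * mconst (e k) - W i k"] exI[of _ 1])
        (simp add: D0 diff_divide_distrib \<theta>.hom_minus \<theta>.hom_mult th_c thD thW[OF that])
    have "f \<in> mpol_ring UNIV r" using f by (simp add: P_def)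
    then have "R (mpol_eval fconst (q i) f) (mpol_eval fconst (q (Suc i)) f)"
      by (induction rule: mpol_ring_induct[OF _ is_subring_UNIV, consumes 1, case_names const var add mult])
        (simp_all add: mpol_eval_const[OF hf] mpol_eval_var[OF hf] mpol_eval_add[OF hf] mpol_eval_mult[OF hf] Rc Rq Ra Rm)
    moreover have "mpol_eval fconst (q i) f = 0" using f by (simp add: P_def)
    ultimately obtain b n where "0 = to_fract b / to_fract (D i) ^ n"
      "mpol_eval fconst (q (Suc i)) f = to_fract (\<theta> b) / to_fract (D (Suc i)) ^ n" unfolding R_def by auto
    then have "mpol_eval fconst (q (Suc i)) f = 0" using Df[of i] by simp
    then show "f \<in> P (Suc i)" using f by (simp add: P_def)
  qed
  have strict: "\<exists>f. f \<in> P (Suc i) \<and> f \<notin> P i" if i: "i < d" for i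
  proof -
    \<comment> \<open>The Cayley transform undone on the universal point: at \<open>q j\<close> the
      coordinates \<open>Z\<close> become those of \<open>V j\<close>, and \<open>G\<close> becomes
      \<open>Y j\<close> up to the nonzero factor coming from \<open>S\<close>.\<close>
    define Z where "Z k = mconst (e k) - mvar k" for k :: nat
    define S where "S = det (Lm mconst Z)"
    define G where "G = quasi_inv mconst Z"
    have sr: "is_subring (mpol_ring (UNIV :: 'f set) r)" by (intro is_subring_mpol_ring is_subring_UNIV)
    have ZR: "Z k \<in> mpol_ring UNIV r" if "k < r" for k
      unfolding Z_def using that by (intro subring_diff[OF sr] mpol_ring_const mpol_ring_var is_subring_UNIV) auto
    have SR: "S \<in> mpol_ring UNIV r" unfolding S_def by (rule det_Lm_in_subring[OF sr ZR]) auto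
    have GR: "G k \<in> mpol_ring UNIV r" if "k < r" for k
      unfolding G_def by (rule quasi_inv_in_subring[OF sr ZR _ that]) auto
    have ZG: "mul mconst Z G k = S * mconst (e k)" if "k < r" for k
      unfolding G_def S_def by (rule quasi_inv_right[OF hm that])
    have evG: "mpol_eval fconst (q j) (G k) = mpol_eval fconst (q j) S * Yf j k"
      and evS: "mpol_eval fconst (q j) S \<noteq> 0" if k: "k < r" for j k
    proof -
      let ?ev = "mpol_eval fconst (q j)"
      have hev: "comm_ring_hom ?ev" by (rule comm_ring_hom_mpol_eval[OF hf])
      interpret ev: comm_ring_hom ?ev by (rule hev)
      have evc: "?ev (mconst x) = fconst x" for x by (rule mpol_eval_const[OF hf])
      have evZ: "?ev (Z k) = V j k" for k
        by (simp add: Z_def ev.hom_minus evc mpol_eval_var[OF hf] q_def)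
      have dV: "?ev S = det (Lm fconst (V j))" unfolding S_def det_Lm_hom[OF hev] by (simp add: evc evZ)
      have "Lm fconst (mul fconst (V j) (Yf j)) = Lm fconst (\<lambda>i. 1 * fconst (e i))"
        by (rule Lm_cong) (simp add: VY)
      then have "Lm fconst (V j) * Lm fconst (Yf j) = 1 \<cdot>\<^sub>m 1\<^sub>m r" unfolding Lm_mul[OF hf] Lm_unit[OF hf] .
      then have "det (Lm fconst (V j)) * det (Lm fconst (Yf j)) = 1"
        using det_mult[of "Lm fconst (V j)" r "Lm fconst (Yf j)"] by simp
      then show S0: "?ev S \<noteq> 0" unfolding dV by auto
      show "?ev (G k) = ?ev S * Yf j k"
      proof (rule mul_cancel_left[where \<eta> = fconst and y = "V j", OF _ _ k])
        show "det (Lm fconst (V j)) \<noteq> 0" using S0 dV by simp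
        fix k assume k: "k < r"
        have "mul fconst (V j) (\<lambda>k. ?ev (G k)) k = ?ev (mul mconst Z G k)"
          by (simp add: mul_hom[OF hev] evc evZ)
        also have "\<dots> = ?ev S * fconst (e k)" by (simp add: ZG[OF k] ev.hom_mult evc)
        finally show "mul fconst (V j) (\<lambda>k. ?ev (G k)) k = mul fconst (V j) (\<lambda>k. ?ev S * Yf j k) k"
          by (simp add: mul_scale_right VY[OF k])
      qed
    qed
    define l where "l = \<nu> i"
    have l: "l \<in> Fr" "l < r" using nu(1)[OF i] Fr(1) by (auto simp: l_def)
    \<comment> \<open>Numerator of coordinate \<open>\<nu> i\<close> of Y minus its constant part.
      On this free coordinate only parameter \<open>i\<close> contributes; it is present in
      \<open>Y i\<close> and 0 in \<open>Y (Suc i)\<close>.\<close>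
    define f where "f = G l - S * mconst (z0 l)"
    have Yl: "Yf j l = fconst (z0 l) + to_fract (u j i)" for j
    proof -
      have "(\<Sum>t<d. u j t * mconst (X (\<nu> t) l)) = (\<Sum>t<d. u j t * (if t = i then 1 else 0))"
        using nu i l by (intro sum.cong refl arg_cong2[of _ _ _ _ "(*)"]) (auto simp: XF l_def)
      also have "\<dots> = u j i" using i by (simp add: sum_delta_mult)
      finally show ?thesis by (simp add: Yf_def Y_def to_fract_add)
    qed
    have evf: "mpol_eval fconst (q j) f = mpol_eval fconst (q j) S * to_fract (u j i)" for j
    proof -
      interpret ev: comm_ring_hom "mpol_eval fconst (q j)" by (rule comm_ring_hom_mpol_eval[OF hf])
      show ?thesis by (simp add: f_def ev.hom_minus ev.hom_mult evG[OF l(2)] Yl mpol_eval_const[OF hf] algebra_simps)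
    qed
    have fR: "f \<in> mpol_ring UNIV r" unfolding f_def
      by (intro subring_diff[OF sr] subring_mult[OF sr] GR SR l mpol_ring_const) auto
    have "mvar i \<noteq> (0 :: 'f mpol)"
    proof
      assume "mvar i = (0 :: 'f mpol)"
      then have "mpol_deriv i (mvar i :: 'f mpol) = mpol_deriv i 0" by simp
      then show False by (simp add: mpol_deriv_var)
    qed
    then have "f \<notin> P i" using evf[of i] evS[OF l(2), of i] by (simp add: P_def u_def)
    moreover have "f \<in> P (Suc i)" using evf[of "Suc i"] fR by (simp add: P_def u_def)
    ultimately show ?thesis by blast
  qed
  show thesis
  proof (rule that[of P])
    show "\<exists>p. P i = {f \<in> mpol_ring UNIV r. mpol_eval fconst p f = 0} \<and>
       (\<forall>k<r. mul fconst (star fconst p) p k = fconst (e k))" for i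
      by (rule exI[of _ "q i"]) (auto simp: P_def un)
    show "P i \<subset> P (Suc i)" if "i < r - M" for i
      using sub[of i] strict[of i] that by (auto simp: d_def)
  qed (rule Fr)
qed

end

section \<open>Bases\<close>

definition coords :: "('f::field \<Rightarrow> 'w \<Rightarrow> 'w) \<Rightarrow> nat \<Rightarrow> (nat \<Rightarrow> 'w::comm_monoid_add) \<Rightarrow> 'w \<Rightarrow> nat \<Rightarrow> 'f" where
  "coords sc N b w = (THE c. (\<forall>i\<ge>N. c i = 0) \<and> w = (\<Sum>i<N. sc (c i) (b i)))"

lemma is_basisD:
  assumes "is_basis C sc N b W"
  shows is_basis_sum: "(\<And>i. i < N \<Longrightarrow> c i \<in> C) \<Longrightarrow> (\<Sum>i<N. sc (c i) (b i)) \<in> W"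
    and is_basis_ex: "w \<in> W \<Longrightarrow> \<exists>c. (\<forall>i<N. c i \<in> C) \<and> w = (\<Sum>i<N. sc (c i) (b i))"
    and is_basis_unique: "(\<And>i. i < N \<Longrightarrow> c i \<in> C) \<Longrightarrow> (\<And>i. i < N \<Longrightarrow> d i \<in> C) \<Longrightarrow>
      (\<Sum>i<N. sc (c i) (b i)) = (\<Sum>i<N. sc (d i) (b i)) \<Longrightarrow> j < N \<Longrightarrow> c j = d j"
proof -
  show s: "(\<Sum>i<N. sc (c i) (b i)) \<in> W" if "\<And>i. i < N \<Longrightarrow> c i \<in> C" for c
    using assms that by (auto simp: is_basis_def)
  show "w \<in> W \<Longrightarrow> \<exists>c. (\<forall>i<N. c i \<in> C) \<and> w = (\<Sum>i<N. sc (c i) (b i))"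
    using assms unfolding is_basis_def by blast
  assume c: "\<And>i. i < N \<Longrightarrow> c i \<in> C" and d: "\<And>i. i < N \<Longrightarrow> d i \<in> C"
    and eq: "(\<Sum>i<N. sc (c i) (b i)) = (\<Sum>i<N. sc (d i) (b i))" and j: "j < N"
  let ?t = "\<lambda>c i. if i < N then c i else 0"
  have t: "(\<Sum>i<N. sc (?t c i) (b i)) = (\<Sum>i<N. sc (c i) (b i))" for c by (rule sum.cong) auto
  let ?Q = "\<lambda>x. (\<forall>i<N. x i \<in> C) \<and> (\<forall>i\<ge>N. x i = 0) \<and> (\<Sum>i<N. sc (c i) (b i)) = (\<Sum>i<N. sc (x i) (b i))"
  have "\<forall>w\<in>W. \<exists>!c. (\<forall>i<N. c i \<in> C) \<and> (\<forall>i\<ge>N. c i = 0) \<and> w = (\<Sum>i<N. sc (c i) (b i))"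
    using assms by (simp add: is_basis_def)
  from bspec[OF this s[OF c]] have ex1: "\<exists>!x. ?Q x" by simp
  then obtain x where x: "\<And>y. ?Q y \<Longrightarrow> y = x" unfolding Ex1_def by (elim exE conjE) (rule that, elim allE, erule mp)
  have "?t c = x" by (rule x) (use c t[of c] in simp)
  moreover have "?t d = x" by (rule x) (use d eq t[of d] in simp)
  ultimately have "?t c = ?t d" by simp
  from fun_cong[OF this, of j] show "c j = d j" using j by simp
qed

lemma coords_sum:
  assumes b: "is_basis UNIV sc N b W" and w: "w \<in> W"
  shows "(\<Sum>i<N. sc (coords sc N b w i) (b i)) = w" and coords_ge: "\<And>i. i \<ge> N \<Longrightarrow> coords sc N b w i = 0"
proof -
  have "\<exists>!c. (\<forall>i\<ge>N. c i = 0) \<and> w = (\<Sum>i<N. sc (c i) (b i))"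
    using b w by (auto simp: is_basis_def)
  from theI'[OF this] show "(\<Sum>i<N. sc (coords sc N b w i) (b i)) = w" "\<And>i. i \<ge> N \<Longrightarrow> coords sc N b w i = 0"
    by (auto simp: coords_def)
qed

lemma coords_eqI:
  assumes b: "is_basis UNIV sc N b W" and w: "w = (\<Sum>i<N. sc (c i) (b i))" and j: "j < N"
  shows "coords sc N b w j = c j"
proof -
  have "w \<in> W" unfolding w by (rule is_basis_sum[OF b]) auto
  then show ?thesis using coords_sum(1)[OF b, of w] is_basis_unique[OF b, of "coords sc N b w" c j] w j by auto
qed

lemma coords_lin:
  assumes v: "vector_space sc" and b: "is_basis UNIV sc N b W" and W: "x \<in> W" "y \<in> W" and j: "j < N"
  shows "coords sc N b (sc a x + sc a' y) j = a * coords sc N b x j + a' * coords sc N b y j"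
proof (rule coords_eqI[OF b _ j])
  interpret vector_space sc by fact
  have "sc a (\<Sum>i<N. sc (coords sc N b x i) (b i)) + sc a' (\<Sum>i<N. sc (coords sc N b y i) (b i)) =
    (\<Sum>i<N. sc (a * coords sc N b x i + a' * coords sc N b y i) (b i))"
    by (simp add: scale_sum_right scale_left_distrib sum.distrib)
  then show "sc a x + sc a' y = (\<Sum>i<N. sc (a * coords sc N b x i + a' * coords sc N b y i) (b i))"
    unfolding coords_sum(1)[OF b W(1)] coords_sum(1)[OF b W(2)] .
qed

lemma is_basis_mem: "vector_space sc \<Longrightarrow> is_basis UNIV sc N b W \<Longrightarrow> i < N \<Longrightarrow> b i \<in> W"
proof -
  assume "vector_space sc" and b: "is_basis UNIV sc N b W" and i: "i < N"
  interpret vector_space sc by fact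
  have "(\<Sum>j<N. sc (if j = i then 1 else 0) (b j)) = b i"
    using i by (simp add: if_distrib[of "\<lambda>x. sc x _"] sum.delta cong: if_cong)
  then show ?thesis using is_basis_sum[OF b, of "\<lambda>j. if j = i then 1 else 0"] by simp
qed

text \<open>A singular matrix would have a kernel vector, against injectivity; so the determinant is
  nonzero and every target can be solved for.\<close>

lemma inj_imp_surj_basis:
  assumes v: "vector_space sc" and b: "is_basis UNIV sc N b W"
    and f: "\<And>x. x \<in> W \<Longrightarrow> f x \<in> W"
    and lin: "\<And>c. f (\<Sum>i<N. sc (c i) (b i)) = (\<Sum>i<N. sc (c i) (f (b i)))"
    and inj: "\<And>x. x \<in> W \<Longrightarrow> f x = 0 \<Longrightarrow> x = 0" and y: "y \<in> W"
  shows "\<exists>x\<in>W. f x = y"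
proof -
  interpret vector_space sc by fact
  define A where "A = mat N N (\<lambda>(i, j). coords sc N b (f (b j)) i)"
  have A: "A \<in> carrier_mat N N" by (simp add: A_def)
  have fx: "f (\<Sum>j<N. sc (x $ j) (b j)) = (\<Sum>i<N. sc ((A *\<^sub>v x) $ i) (b i))" if "x \<in> carrier_vec N" for x
  proof -
    have "f (\<Sum>j<N. sc (x $ j) (b j)) = (\<Sum>j<N. sc (x $ j) (\<Sum>i<N. sc (coords sc N b (f (b j)) i) (b i)))"
      unfolding lin using coords_sum(1)[OF b f[OF is_basis_mem[OF v b]]] by simp
    also have "\<dots> = (\<Sum>j<N. \<Sum>i<N. sc (x $ j * coords sc N b (f (b j)) i) (b i))" by (simp add: scale_sum_right)
    also have "\<dots> = (\<Sum>i<N. sc (\<Sum>j<N. x $ j * coords sc N b (f (b j)) i) (b i))"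
      by (subst sum.swap) (simp add: scale_sum_left)
    also have "\<dots> = (\<Sum>i<N. sc ((A *\<^sub>v x) $ i) (b i))"
      using that by (intro sum.cong refl arg_cong2[of _ _ _ _ sc])
        (auto simp: A_def scalar_prod_def lessThan_atLeast0 mult.commute)
    finally show ?thesis .
  qed
  have "det A \<noteq> 0"
  proof
    assume "det A = 0"
    then obtain x where x: "x \<in> carrier_vec N" "x \<noteq> 0\<^sub>v N" "A *\<^sub>v x = 0\<^sub>v N"
      using det_0_iff_vec_prod_zero_field[OF A] by auto
    have m: "(\<Sum>j<N. sc (x $ j) (b j)) \<in> W" by (rule is_basis_sum[OF b]) auto
    have "f (\<Sum>j<N. sc (x $ j) (b j)) = 0" unfolding fx[OF x(1)] x(3) by simp
    then have e: "(\<Sum>j<N. sc (x $ j) (b j)) = (\<Sum>j<N. sc 0 (b j))" using inj[OF m] by simp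
    have "x $ j = 0" if "j < N" for j by (rule is_basis_unique[OF b _ _ e that]) auto
    then have "x = 0\<^sub>v N" using x(1) by (intro eq_vecI) auto
    then show False using x by simp
  qed
  then obtain x where x: "x \<in> carrier_vec N" "A *\<^sub>v x = vec N (coords sc N b y)"
    using solve_linear_system[OF A, of "vec N (coords sc N b y)"] by auto
  have "f (\<Sum>j<N. sc (x $ j) (b j)) = (\<Sum>i<N. sc (coords sc N b y i) (b i))"
    unfolding fx[OF x(1)] x(2) by simp
  then show ?thesis using coords_sum(1)[OF b y] is_basis_sum[OF b, of "\<lambda>j. x $ j"] by (intro bexI) auto
qed

text \<open>Every vector can be scaled into the lattice and every scalar into the coefficient ring.
  Expansions and linear relations over the field are thus obtained from those over \<open>C\<close>
  by clearing denominators.\<close>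

lemma is_basis_extend_scalars:
  assumes v: "vector_space sc" and b: "is_basis C sc N b W0" and C: "is_subring C" and W0: "W0 \<subseteq> W"
    and frac: "\<And>x. \<exists>a\<in>C. a \<noteq> 0 \<and> a * x \<in> C"
    and W: "\<And>x y a. x \<in> W \<Longrightarrow> y \<in> W \<Longrightarrow> x + y \<in> W" "\<And>x a. x \<in> W \<Longrightarrow> sc a x \<in> W" "0 \<in> W"
    and clear: "\<And>w. w \<in> W \<Longrightarrow> \<exists>a\<in>C. a \<noteq> 0 \<and> sc a w \<in> W0"
  shows "is_basis UNIV sc N b W"
proof -
  interpret vector_space sc by fact
  have mem: "b i \<in> W" if "i < N" for i
  proof -
    have "(\<Sum>j<N. sc (if j = i then 1 else 0) (b j)) = b i"
      using that by (simp add: if_distrib[of "\<lambda>x. sc x _"] sum.delta cong: if_cong)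
    moreover have "(\<Sum>j<N. sc (if j = i then 1 else 0) (b j)) \<in> W0"
      using C by (intro is_basis_sum[OF b]) (auto intro: subring_0 subring_1)
    ultimately show ?thesis using W0 by auto
  qed
  have sumW: "(\<Sum>i\<in>I. f i) \<in> W" if "\<And>i. i \<in> I \<Longrightarrow> f i \<in> W" for I :: "nat set" and f
    using that by (induction I rule: infinite_finite_induct) (auto intro: W)
  have common: "\<exists>a\<in>C. a \<noteq> 0 \<and> (\<forall>i<k. a * c i \<in> C)" for c and k :: nat
  proof (induction k)
    case 0
    show ?case using C by (intro bexI[of _ 1]) (auto intro: subring_1)
  next
    case (Suc k)
    then obtain a where a: "a \<in> C" "a \<noteq> 0" "\<forall>i<k. a * c i \<in> C" by auto
    obtain a' where a': "a' \<in> C" "a' \<noteq> 0" "a' * c k \<in> C" using frac by auto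
    have "a' * a * c i \<in> C" if "i < Suc k" for i
    proof (cases "i = k")
      case True
      have "a * (a' * c k) \<in> C" using a a' C by (auto intro: subring_mult)
      then show ?thesis using True by (simp add: mult_ac)
    next
      case False
      then have "a' * (a * c i) \<in> C" using a a' C that by (auto intro: subring_mult)
      then show ?thesis by (simp add: mult_ac)
    qed
    then show ?case using a a' C by (intro bexI[of _ "a' * a"]) (auto intro: subring_mult)
  qed
  have inj: "c i = d i" if eq: "(\<Sum>i<N. sc (c i) (b i)) = (\<Sum>i<N. sc (d i) (b i))" and i: "i < N" for c d i
  proof -
    obtain a where a: "a \<in> C" "a \<noteq> 0" "\<forall>i<N. a * c i \<in> C" using common by blast
    obtain a' where a': "a' \<in> C" "a' \<noteq> 0" "\<forall>i<N. a' * d i \<in> C" using common by blast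
    have "a' * a * c j \<in> C" "a' * a * d j \<in> C" if "j < N" for j
      using subring_mult[OF C, of a' "a * c j"] subring_mult[OF C, of a "a' * d j"] a a' that
      by (auto simp: mult_ac)
    moreover have e: "(\<Sum>i<N. sc (a' * a * c i) (b i)) = (\<Sum>i<N. sc (a' * a * d i) (b i))"
      using arg_cong[OF eq, of "sc (a' * a)"] by (simp add: scale_sum_right mult.assoc)
    ultimately have "a' * a * c i = a' * a * d i"
      by (intro is_basis_unique[OF b _ _ e i])
    then show ?thesis using a a' by simp
  qed
  show ?thesis unfolding is_basis_def
  proof (intro conjI allI impI ballI)
    show "(\<Sum>i<N. sc (c i) (b i)) \<in> W" for c by (intro sumW W mem) auto
    fix w assume "w \<in> W"
    then obtain a where a: "a \<in> C" "a \<noteq> 0" "sc a w \<in> W0" using clear by blast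
    then obtain c where c: "sc a w = (\<Sum>i<N. sc (c i) (b i))" using is_basis_ex[OF b] by blast
    have "w = (\<Sum>i<N. sc ((1 / a) * c i) (b i))"
      using arg_cong[OF c, of "sc (1 / a)"] a by (simp add: scale_sum_right)
    then have w: "w = (\<Sum>i<N. sc (if i < N then (1 / a) * c i else 0) (b i))" by simp
    let ?c = "\<lambda>i. if i < N then (1 / a) * c i else 0"
    show "\<exists>!c. (\<forall>i<N. c i \<in> UNIV) \<and> (\<forall>i\<ge>N. c i = 0) \<and> w = (\<Sum>i<N. sc (c i) (b i))"
    proof (rule ex1I[of _ ?c])
      show "(\<forall>i<N. ?c i \<in> UNIV) \<and> (\<forall>i\<ge>N. ?c i = 0) \<and> w = (\<Sum>i<N. sc (?c i) (b i))" using w by simp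
      fix d assume d: "(\<forall>i<N. d i \<in> UNIV) \<and> (\<forall>i\<ge>N. d i = 0) \<and> w = (\<Sum>i<N. sc (d i) (b i))"
      then have e: "(\<Sum>i<N. sc (d i) (b i)) = (\<Sum>i<N. sc (?c i) (b i))" using w by simp
      show "d = ?c"
      proof
        fix i show "d i = ?c i" by (cases "i < N") (use inj[OF e, of i] d in auto)
      qed
    qed
  qed
qed

section \<open>Valuation ring, forms and adjoints\<close>

context hermitian_lattice
begin

lemma val_mult: "x \<noteq> 0 \<Longrightarrow> y \<noteq> 0 \<Longrightarrow> val (x * y) = val x + val y"
  and val_ge_add: "val_ge val k x \<Longrightarrow> val_ge val k y \<Longrightarrow> val_ge val k (x + y)"
  using local_field by (auto simp: nonarch_local_field_def)

lemma val_one: "val 1 = 0"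
  using val_mult[of 1 1] by simp

lemma val_ge_mult: "val_ge val k x \<Longrightarrow> val_ge val l y \<Longrightarrow> val_ge val (k + l) (x * y)"
  using val_mult[of x y] by (cases "x = 0 \<or> y = 0") (auto simp: val_ge_def)

lemma val_uminus: "val (- x) = val x"
proof -
  have "val (- 1) + val (- 1) = val 1" using val_mult[of "- 1" "- 1"] by simp
  then have "val (- 1) = 0" using val_one by simp
  then show ?thesis using val_mult[of "- 1" x] by (cases "x = 0") auto
qed

lemma subring_A: "is_subring A"
proof -
  have u: "val_ge val 0 (- y)" if "val_ge val 0 y" for y using that by (auto simp: val_ge_def val_uminus)
  show ?thesis unfolding is_subring_def val_ring_def
    using val_one val_ge_add[of 0 _ "- _"] u val_ge_mult[of 0 _ 0]
    by (auto simp: val_ge_def[of _ _ 1])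
qed

lemma A_frac: "\<exists>a\<in>A. a \<noteq> 0 \<and> a * x \<in> A"
proof (cases "x \<in> A")
  case True
  then show ?thesis using subring_1[OF subring_A] by (intro bexI[of _ 1]) auto
next
  case False
  then have x: "x \<noteq> 0" "val x < 0" by (auto simp: val_ring_def val_ge_def)
  then have "val (1 / x) = - val x" using val_mult[of x "1 / x"] val_one by simp
  then have "1 / x \<in> A" using x by (simp add: val_ring_def val_ge_def)
  then show ?thesis using x subring_1[OF subring_A] by (intro bexI[of _ "1 / x"]) auto
qed

lemma iota_simps [simp]: "\<iota> 1 = 1" "\<iota> (a + b) = \<iota> a + \<iota> b" "\<iota> (a * b) = \<iota> a * \<iota> b"
  and iota_central: "\<iota> a * x = x * \<iota> a"
  using algebra_map unfolding is_central_algebra_map_def by blast+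

lemma iota_0 [simp]: "\<iota> 0 = 0"
  using iota_simps(2)[of 0 0] by simp

lemma iota_uminus [simp]: "\<iota> (- a) = - \<iota> a"
  using iota_simps(2)[of a "- a"] by (simp add: minus_unique)

lemma sigma_iota [simp]: "\<sigma> (\<iota> a) = \<iota> a"
  using K_cases
proof (elim disjE)
  assume "case_split \<iota> \<sigma>"
  then obtain pr1 pr2 :: "'k \<Rightarrow> 'f" where b: "bij (\<lambda>x. (pr1 x, pr2 x))"
    and p: "\<forall>a. pr1 (\<iota> a) = a \<and> pr2 (\<iota> a) = a" "\<forall>x. pr1 (\<sigma> x) = pr2 x \<and> pr2 (\<sigma> x) = pr1 x"
    unfolding case_split_def by (elim exE conjE) (rule that)
  have "(\<lambda>x. (pr1 x, pr2 x)) (\<sigma> (\<iota> a)) = (\<lambda>x. (pr1 x, pr2 x)) (\<iota> a)" using p by simp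
  then show ?thesis using b by (auto simp: bij_def inj_def)
qed (auto simp: case_base_def case_quadratic_def case_quaternion_def)

lemma sigma_0 [simp]: "\<sigma> 0 = 0" and sigma_1 [simp]: "\<sigma> 1 = 1"
  using sigma_iota[of 0] sigma_iota[of 1] by simp_all

lemma act_simps [simp]: "act v 1 = v" "act v (x * y) = act (act v x) y"
  and act_add: "act (v + w) x = act v x + act w x" "act v (x + y) = act v x + act v y"
  using right_module by (auto simp: is_right_module_def)

lemma act_0 [simp]: "act 0 x = 0" "act v 0 = 0"
  using act_add(1)[of 0 0 x] act_add(2)[of v 0 0] by simp_all

lemma act_sum: "act (sum f I) x = (\<Sum>i\<in>I. act (f i) x)" "act v (sum g I) = (\<Sum>i\<in>I. act v (g i))"
  by (induction I rule: infinite_finite_induct) (auto simp: act_add)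

lemma act_iota_commute: "act (act v (\<iota> a)) x = act (act v x) (\<iota> a)"
  by (simp add: iota_central flip: act_simps(2))

text \<open>In the quadratic case \<open>\<iota>\<close> is bijective and \<sigma> is the identity,
  so the recorded symmetric bilinear form is hermitian with sign 1. From here on both kinds of forms
  are treated alike, except where integrality enters.\<close>

lemma is_form_sesqui:
  assumes "is_form val p \<iota> \<sigma> \<epsilon> B act L f"
  shows "is_sesqui_hermitian act \<sigma> \<epsilon> f"
proof (cases "case_base \<iota> \<sigma> \<and> \<epsilon> = 1 \<and> p = 2")
  case True
  then obtain q where q: "is_quadratic_form act \<iota> q" and f: "\<And>v w. f v w = \<iota> ((q (v + w) - q v - q w) / 2)"
    using assms by (auto simp: is_form_def)
  define b where "b v w = q (v + w) - q v - q w" for v w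
  have b: "b (u + v) w = b u w + b v w" "b (act v (\<iota> x)) w = x * b v w" for u v w x
    using q by (auto simp: is_quadratic_form_def b_def)
  have bs: "b v w = b w v" for v w by (simp add: b_def add.commute)
  have fb: "f v w = \<iota> (b v w / 2)" for v w by (simp add: f b_def)
  have surj: "\<exists>a. x = \<iota> a" for x using True by (auto simp: case_base_def bij_def surj_def)
  have f2: "f (act v x) (act w y) = x * f v w * y" for v w x y
  proof -
    obtain a a' where "x = \<iota> a" "y = \<iota> a'" using surj by metis
    have "b (act v (\<iota> a)) (act w (\<iota> a')) / 2 = a * (b v w / 2) * a'"
      using b(2)[of v a "act w (\<iota> a')"] b(2)[of w a' v] bs[of v "act w (\<iota> a')"] bs[of v w] by simp
    then show ?thesis unfolding \<open>x = \<iota> a\<close> \<open>y = \<iota> a'\<close> fb by (simp only: iota_simps)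
  qed
  have "f (u + v) w = f u w + f v w" for u v w by (simp add: fb b add_divide_distrib)
  moreover have "f w v = f v w" for v w by (simp add: fb bs)
  ultimately show ?thesis using True f2 unfolding is_sesqui_hermitian_def case_base_def
    by auto
qed (use assms in \<open>auto simp: is_form_def\<close>)

lemma h_sesqui: "is_sesqui_hermitian act \<sigma> \<epsilon> h"
  by (rule is_form_sesqui[OF form])

lemma h_add: "h (u + v) w = h u w + h v w" "h w (u + v) = h w u + h w v"
  and h_act2: "h (act v x) (act w y) = \<sigma> x * h v w * y"
  and h_swap: "h w v = of_int \<epsilon> * \<sigma> (h v w)"
  using h_sesqui unfolding is_sesqui_hermitian_def by blast+

lemma h_act: "h (act v x) w = \<sigma> x * h v w" "h v (act w y) = h v w * y"
  using h_act2[of v x w 1] h_act2[of v 1 w y] by simp_all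

lemma h_0 [simp]: "h 0 w = 0" "h v 0 = 0"
  using h_add(1)[of 0 0 w] h_add(2)[of v 0 0] by simp_all

lemma h_uminus: "h (- v) w = - h v w" "h v (- w) = - h v w"
  using h_add(1)[of v "- v" w] h_add(2)[of v w "- w"] by (auto dest: minus_unique)

lemma h_diff: "h (u - v) w = h u w - h v w" "h w (u - v) = h w u - h w v"
  using h_add(1)[of u "- v" w] h_add(2)[of w u "- v"] by (simp_all add: h_uminus)

lemma h_sum: "h (sum f I) w = (\<Sum>i\<in>I. h (f i) w)" "h v (sum f I) = (\<Sum>i\<in>I. h v (f i))"
  by (induction I rule: infinite_finite_induct) (auto simp: h_add)

lemma nondegenerate_right: "(\<And>v. h v w = 0) \<Longrightarrow> w = 0"
  using nondegenerate h_swap[of w] by simp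

lemma h_eq_iff: "(\<And>v. h v w = h v w') \<Longrightarrow> w = w'"
  using nondegenerate_right[of "w - w'"] by (simp add: h_diff)

section \<open>Endomorphisms of V as a vector space over the base field\<close>

lemma EndKD:
  assumes "X \<in> EndK"
  shows EndK_add: "X (v + w) = X v + X w" and EndK_act: "X (act v x) = act (X v) x"
    and EndK_0: "X 0 = 0" and EndK_sum: "X (sum f I) = (\<Sum>i\<in>I. X (f i))"
proof -
  show a: "X (v + w) = X v + X w" for v w using assms by (simp add: EndK_def)
  show "X (act v x) = act (X v) x" using assms by (simp add: EndK_def)
  show 0: "X 0 = 0" using a[of 0 0] by simp
  show "X (sum f I) = (\<Sum>i\<in>I. X (f i))"
    by (induction I rule: infinite_finite_induct) (auto simp: 0 a)
qed

lemma EndK_comp: "X \<in> EndK \<Longrightarrow> Y \<in> EndK \<Longrightarrow> X \<circ> Y \<in> EndK"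
  and EndK_plus: "X \<in> EndK \<Longrightarrow> Y \<in> EndK \<Longrightarrow> X + Y \<in> EndK"
  and EndK_id: "id \<in> EndK" and EndK_zero: "0 \<in> EndK"
  and EndK_scale: "X \<in> EndK \<Longrightarrow> scale_End a X \<in> EndK"
  by (auto simp: EndK_def act_add scale_End_def act_iota_commute algebra_simps)

sublocale scale_End: vector_space scale_End
  by unfold_locales (auto simp: scale_End_def fun_eq_iff act_add intro: act_iota_commute)

sublocale scale_form: vector_space scale_form
  by unfold_locales (auto simp: scale_form_def fun_eq_iff algebra_simps)

lemma EndK_Sum: "(\<And>i. i \<in> I \<Longrightarrow> f i \<in> EndK) \<Longrightarrow> sum f I \<in> EndK"
  by (induction I rule: infinite_finite_induct) (auto intro: EndK_plus EndK_zero)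

lemma sum_fun: "(\<Sum>i\<in>I. f i) x = (\<Sum>i\<in>I. f i x)"
  by (induction I rule: infinite_finite_induct) auto

definition eb :: "nat \<Rightarrow> 'v" where
  "eb = (SOME e. is_basis UNIV (\<lambda>x v. act v x) n e UNIV \<and> is_basis B (\<lambda>x v. act v x) n e L)"

lemma eb: "is_basis UNIV (\<lambda>x v. act v x) n eb UNIV" "is_basis B (\<lambda>x v. act v x) n eb L"
  using someI_ex[OF free] by (auto simp: eb_def)

lemma eb_ex: "\<exists>c. v = (\<Sum>i<n. act (eb i) (c i))"
  using is_basis_ex[OF eb(1), of v] by auto

lemma eb_unique: "(\<Sum>i<n. act (eb i) (c i)) = (\<Sum>i<n. act (eb i) (d i)) \<Longrightarrow> j < n \<Longrightarrow> c j = d j"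
  using is_basis_unique[OF eb(1), of c d j] by auto

lemma EndK_eb: "X \<in> EndK \<Longrightarrow> X (\<Sum>i<n. act (eb i) (c i)) = (\<Sum>i<n. act (X (eb i)) (c i))"
  by (simp add: EndK_sum EndK_act)

end

locale hermitian_lattice_basis = hermitian_lattice val p \<iota> \<sigma> \<epsilon> B act n L h
  for val :: "'f::field \<Rightarrow> int" and p :: nat and \<iota> :: "'f \<Rightarrow> 'k::ring_1" and \<sigma> :: "'k \<Rightarrow> 'k" and \<epsilon> :: int
    and B :: "'k set" and act :: "'v::ab_group_add \<Rightarrow> 'k \<Rightarrow> 'v" and n :: nat and L :: "'v set"
    and h :: "'v \<Rightarrow> 'v \<Rightarrow> 'k" +
  fixes r :: nat and E :: "nat \<Rightarrow> 'v \<Rightarrow> 'v"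
  assumes basis_End: "is_basis UNIV scale_End r E EndK"
begin

text \<open>The endomorphism \<open>\<theta>\<close> below is injective because \<open>h\<close> is nondegenerate; left multiplication by it on the
  finite-dimensional algebra \<open>EndK\<close> is then surjective, which yields adjoints.\<close>

lemma adjoint_ex: assumes X: "X \<in> EndK" shows "\<exists>!Y. Y \<in> EndK \<and> (\<forall>v w. h (X v) w = h v (Y w))"
proof -
  \<comment> \<open>\<open>S X\<close> takes the values \<open>h (X (eb i)) w\<close> as
    coordinates; additivity and linearity of \<open>h\<close> in the second argument make it an
    endomorphism for every \<open>X\<close>.\<close>
  define S where "S X w = (\<Sum>i<n. act (eb i) (h (X (eb i)) w))" for X w
  have S: "S X \<in> EndK" for X
    by (auto simp: EndK_def S_def h_add act_add sum.distrib h_act act_sum)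
  define \<theta> where "\<theta> = S id"
  have th: "\<theta> \<in> EndK" by (simp add: \<theta>_def S)
  have th_inj: "w = 0" if "\<theta> w = 0" for w
  proof (rule nondegenerate_right)
    fix v
    obtain c where c: "v = (\<Sum>i<n. act (eb i) (c i))" using eb_ex by blast
    have e: "(\<Sum>i<n. act (eb i) (h (eb i) w)) = (\<Sum>i<n. act (eb i) 0)" using that by (simp add: \<theta>_def S_def)
    have "h (eb i) w = 0" if "i < n" for i by (rule eb_unique[OF e that])
    then show "h v w = 0" by (simp add: c h_sum h_act)
  qed
  have "\<exists>R\<in>EndK. \<theta> \<circ> R = id"
  proof (rule inj_imp_surj_basis[OF scale_End.vector_space_axioms basis_End])
    show "\<theta> \<circ> x \<in> EndK" if "x \<in> EndK" for x by (rule EndK_comp[OF th that])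
    show "\<theta> \<circ> (\<Sum>i<r. scale_End (c i) (E i)) = (\<Sum>i<r. scale_End (c i) (\<theta> \<circ> E i))" for c
      by (rule ext) (simp add: sum_fun EndK_sum[OF th] scale_End_def EndK_act[OF th])
    show "x = 0" if "\<theta> \<circ> x = 0" for x
      using th_inj that by (auto simp: fun_eq_iff)
  qed (rule EndK_id)
  then obtain R where R: "R \<in> EndK" "\<And>w. \<theta> (R w) = w" by (auto simp: fun_eq_iff)
  have hR: "h (X v) w = h v (R (S X w))" for v w
  proof -
    obtain c where c: "v = (\<Sum>i<n. act (eb i) (c i))" using eb_ex by blast
    have e: "(\<Sum>i<n. act (eb i) (h (eb i) (R (S X w)))) = (\<Sum>i<n. act (eb i) (h (X (eb i)) w))"
      using R(2)[of "S X w"] by (simp add: \<theta>_def S_def)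
    have "h (eb i) (R (S X w)) = h (X (eb i)) w" if "i < n" for i by (rule eb_unique[OF e that])
    then show ?thesis by (simp add: c EndK_eb[OF X] h_sum h_act)
  qed
  show ?thesis
  proof (rule ex1I[of _ "R \<circ> S X"])
    show "R \<circ> S X \<in> EndK \<and> (\<forall>v w. h (X v) w = h v ((R \<circ> S X) w))" using EndK_comp[OF R(1) S] hR by simp
    fix Y assume "Y \<in> EndK \<and> (\<forall>v w. h (X v) w = h v (Y w))"
    then show "Y = R \<circ> S X" using hR by (intro ext h_eq_iff) (metis comp_apply)
  qed
qed

lemma adj_EndK: "X \<in> EndK \<Longrightarrow> adj X \<in> EndK" and h_adj: "X \<in> EndK \<Longrightarrow> h (X v) w = h v (adj X w)"
proof -
  assume "X \<in> EndK"
  then have "adj X \<in> EndK \<and> (\<forall>v w. h (X v) w = h v (adj X w))"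
    unfolding adj_def by (rule theI'[OF adjoint_ex])
  then show "adj X \<in> EndK" "h (X v) w = h v (adj X w)" by blast+
qed

lemma adj_eqI: "X \<in> EndK \<Longrightarrow> (\<And>v w. h (X v) w = h v (Y w)) \<Longrightarrow> adj X = Y"
  by (intro ext h_eq_iff) (simp flip: h_adj)

lemma h_adj': "X \<in> EndK \<Longrightarrow> h (adj X v) w = h v (X w)"
  using h_adj[of X w v] h_swap[of v] h_swap[of "adj X v"] by (metis h_swap)

lemma adj_adj: "X \<in> EndK \<Longrightarrow> adj (adj X) = X"
  by (rule adj_eqI) (auto simp: adj_EndK h_adj')

lemma adj_comp: "X \<in> EndK \<Longrightarrow> Y \<in> EndK \<Longrightarrow> adj (X \<circ> Y) = adj Y \<circ> adj X"
  by (rule adj_eqI) (auto simp: EndK_comp h_adj)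

lemma adj_plus: "X \<in> EndK \<Longrightarrow> Y \<in> EndK \<Longrightarrow> adj (X + Y) = adj X + adj Y"
  by (rule adj_eqI) (auto simp: EndK_plus h_adj h_add)

lemma adj_scale: "X \<in> EndK \<Longrightarrow> adj (scale_End a X) = scale_End a (adj X)"
proof (rule adj_eqI[OF EndK_scale])
  assume "X \<in> EndK"
  then show "h (scale_End a X v) w = h v (scale_End a (adj X) w)" for v w
    by (simp add: scale_End_def h_act h_adj iota_central)
qed

lemma adj_id: "adj id = id"
  by (rule adj_eqI) (auto simp: EndK_id)

lemma adj_zero: "adj 0 = 0"
  by (rule adj_eqI) (auto simp: EndK_zero)

lemma adj_sum: "(\<And>i. i \<in> I \<Longrightarrow> f i \<in> EndK) \<Longrightarrow> adj (sum f I) = (\<Sum>i\<in>I. adj (f i))"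
  by (induction I rule: infinite_finite_induct) (auto simp: adj_zero adj_plus EndK_Sum)

lemma \<psi>_adj: "X \<in> EndK \<Longrightarrow> \<psi> X = (\<lambda>v w. h v ((X + adj X) w))"
  by (auto simp: \<psi>_def fun_eq_iff h_adj h_add)

lemma \<psi>_plus: "X \<in> EndK \<Longrightarrow> Y \<in> EndK \<Longrightarrow> \<psi> (X + Y) = \<psi> X + \<psi> Y"
  by (auto simp: \<psi>_def fun_eq_iff h_add)

lemma \<psi>_scale: "\<psi> (scale_End a X) = scale_form a (\<psi> X)"
  by (auto simp: \<psi>_def fun_eq_iff h_act scale_End_def scale_form_def iota_central distrib_left distrib_right)

lemma \<psi>_zero: "\<psi> 0 = 0"
  by (auto simp: \<psi>_def fun_eq_iff)

lemma \<psi>_of_adj: "X \<in> EndK \<Longrightarrow> \<psi> (adj X) = \<psi> X"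
  by (auto simp: \<psi>_def fun_eq_iff h_adj h_adj' add.commute)

text \<open>Turns \<open>h = \<psi> Z\<close> into
  \<open>\<phi> Y = \<psi> (adj Y \<circ> Z \<circ> Y)\<close>, and is the reason why the lattices
  \<open>T m\<close> are closed under composition.\<close>

lemma \<psi>_conj: "Z \<in> EndK \<Longrightarrow> Y \<in> EndK \<Longrightarrow> \<psi> (adj Y \<circ> Z \<circ> Y) v w = \<psi> Z (Y v) (Y w)"
  by (simp add: \<psi>_def h_adj h_adj' EndK_comp adj_EndK adj_adj)

lemma \<phi>_comp: "\<phi> (X \<circ> Y) v w = \<phi> X (Y v) (Y w)"
  by (simp add: \<phi>_def)

text \<open>The defect of additivity of \<phi> is again a value of \<psi>, at an element of any
  algebra with involution that contains both arguments.\<close>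

lemma \<phi>_plus: "X \<in> EndK \<Longrightarrow> Y \<in> EndK \<Longrightarrow> \<phi> (X + Y) = \<phi> X + \<phi> Y + \<psi> (adj X \<circ> Y)"
  by (auto simp: \<phi>_def \<psi>_def fun_eq_iff h_add h_adj' h_adj)

lemma \<phi>_scale: "\<phi> (scale_End a X) = scale_form (a * a) (\<phi> X)"
  by (auto simp: \<phi>_def fun_eq_iff h_act scale_End_def scale_form_def mult.assoc) (metis iota_central mult.assoc)

end

section \<open>The lattices \<open>T\<^sup>m\<close>\<close>

context hermitian_lattice_basis
begin

lemma subring_B: "is_subring B"
  using maximal_order by (simp add: is_maximal_order_def is_order_def)

lemma B_gens: "\<exists>(m::nat) b. B = {\<Sum>i<m. \<iota> (a i) * b i | a. \<forall>i<m. a i \<in> A}"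
  and B_clear: "\<exists>a\<in>A. a \<noteq> 0 \<and> \<iota> a * x \<in> B"
  using maximal_order by (simp_all add: is_maximal_order_def is_order_def)

lemma iota_B: assumes a: "a \<in> A" shows "\<iota> a \<in> B"
proof -
  obtain m :: nat and b where B: "B = {\<Sum>i<m. \<iota> (a i) * b i | a. \<forall>i<m. a i \<in> A}" using B_gens by auto
  have "1 \<in> B" by (rule subring_1[OF subring_B])
  then obtain c where c: "1 = (\<Sum>i<m. \<iota> (c i) * b i)" "\<forall>i<m. c i \<in> A" unfolding B by auto
  have "\<iota> a = \<iota> a * (\<Sum>i<m. \<iota> (c i) * b i)" using c(1) by simp
  also have "\<dots> = (\<Sum>i<m. \<iota> (a * c i) * b i)" by (simp add: sum_distrib_left mult.assoc)
  finally have "\<iota> a = (\<Sum>i<m. \<iota> (a * c i) * b i)" .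
  moreover have "\<forall>i<m. a * c i \<in> A" using c(2) a subring_mult[OF subring_A] by auto
  ultimately show ?thesis unfolding B by (intro CollectI exI[of _ "\<lambda>i. a * c i"] conjI)
qed

lemma B_scale: "a \<in> A \<Longrightarrow> x \<in> B \<Longrightarrow> \<iota> a * x \<in> B"
  by (rule subring_mult[OF subring_B iota_B])

lemma L_sum: "(\<And>i. i < n \<Longrightarrow> c i \<in> B) \<Longrightarrow> (\<Sum>i<n. act (eb i) (c i)) \<in> L"
  by (rule is_basis_sum[OF eb(2)])

lemma L_ex: "v \<in> L \<Longrightarrow> \<exists>c. (\<forall>i<n. c i \<in> B) \<and> v = (\<Sum>i<n. act (eb i) (c i))"
  by (rule is_basis_ex[OF eb(2)])

lemma L_0: "0 \<in> L"
  using L_sum[of "\<lambda>_. 0"] subring_0[OF subring_B] by simp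

lemma L_add: assumes "v \<in> L" "w \<in> L" shows "v + w \<in> L"
proof -
  obtain c where c: "\<forall>i<n. c i \<in> B" "v = (\<Sum>i<n. act (eb i) (c i))" using L_ex[OF assms(1)] by auto
  obtain d where d: "\<forall>i<n. d i \<in> B" "w = (\<Sum>i<n. act (eb i) (d i))" using L_ex[OF assms(2)] by auto
  have "v + w = (\<Sum>i<n. act (eb i) (c i + d i))" unfolding c d by (simp add: act_add sum.distrib)
  then show ?thesis using L_sum[of "\<lambda>i. c i + d i"] c d subring_add[OF subring_B] by simp
qed

lemma L_scale: assumes "a \<in> A" "v \<in> L" shows "act v (\<iota> a) \<in> L"
proof -
  obtain c where c: "\<forall>i<n. c i \<in> B" "v = (\<Sum>i<n. act (eb i) (c i))" using L_ex[OF assms(2)] by auto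
  have "act v (\<iota> a) = (\<Sum>i<n. act (eb i) (c i * \<iota> a))" unfolding c by (simp add: act_sum)
  then show ?thesis using L_sum[of "\<lambda>i. c i * \<iota> a"] c iota_B[OF assms(1)] subring_mult[OF subring_B] by simp
qed

lemma eb_L: assumes "i < n" shows "eb i \<in> L"
proof -
  have "(\<Sum>j<n. act (eb j) (if j = i then 1 else 0)) = eb i"
    using assms by (simp add: if_distrib[of "act _"] sum.delta cong: if_cong)
  then show ?thesis
    using L_sum[of "\<lambda>j. if j = i then 1 else 0"] subring_0[OF subring_B] subring_1[OF subring_B] by simp
qed

lemma dual_add: "v \<in> dual \<Longrightarrow> w \<in> dual \<Longrightarrow> v + w \<in> dual"
  by (auto simp: dual_def h_add intro: subring_add[OF subring_B])

lemma dual_scale: "a \<in> A \<Longrightarrow> v \<in> dual \<Longrightarrow> act v (\<iota> a) \<in> dual"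
  by (auto simp: dual_def h_act intro: B_scale)

lemma dual_0: "0 \<in> dual"
  by (auto simp: dual_def intro: subring_0[OF subring_B])

lemma L_iff_dual: "x \<in> L \<longleftrightarrow> (\<forall>y\<in>dual. h x y \<in> B)"
  using double_dual by (auto simp: dual_def)

declare T.simps [simp del]

lemma T0_iff: "X \<in> T 0 \<longleftrightarrow> X \<in> EndK \<and> (\<forall>v\<in>L. X v \<in> L) \<and> (\<forall>v\<in>dual. X v \<in> dual)"
  by (auto simp: T.simps)

lemma T0_D: "X \<in> T 0 \<Longrightarrow> X \<in> EndK" "X \<in> T 0 \<Longrightarrow> v \<in> L \<Longrightarrow> X v \<in> L" "X \<in> T 0 \<Longrightarrow> v \<in> dual \<Longrightarrow> X v \<in> dual"
  by (auto simp: T0_iff)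

text \<open>Moving \<open>X\<close> across \<open>h\<close> shows that it preserves the dual lattice
  as soon as its adjoint preserves \<open>L\<close>.\<close>

lemma T0_adjI:
  assumes X: "X \<in> EndK" and "\<And>v. v \<in> L \<Longrightarrow> X v \<in> L" "\<And>v. v \<in> L \<Longrightarrow> adj X v \<in> L"
  shows "X \<in> T 0"
  unfolding T0_iff using assms by (auto simp: dual_def h_adj[OF X])

text \<open>Reflexivity of \<open>L\<close> enters here: a vector lies in \<open>L\<close> once it
  pairs integrally with \<open>dual\<close>, and \<open>X\<close> preserves
  \<open>dual\<close>.\<close>

lemma T0_adj: assumes X: "X \<in> T 0" shows "adj X \<in> T 0"
proof -
  have X': "X \<in> EndK" by (rule T0_D(1)[OF X])
  have "adj X v \<in> L" if "v \<in> L" for v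
    unfolding L_iff_dual[of "adj X v"] h_adj'[OF X'] using that T0_D(3)[OF X] L_iff_dual by blast
  moreover have "adj (adj X) v \<in> L" if "v \<in> L" for v using T0_D(2)[OF X that] by (simp add: adj_adj[OF X'])
  ultimately show ?thesis by (intro T0_adjI adj_EndK X')
qed

text \<open>Guarantees that the class of \<open>\<phi> X\<close> in the recursion makes sense. In
  the quadratic case the integral object is the composite of q with \<open>X\<close>, while the
  recorded bilinear form is handled on \<open>L\<close> and \<open>dual\<close> by the definition of
  the dual.\<close>

lemma \<phi>_H0: assumes X: "X \<in> T 0" shows "\<phi> X \<in> H0"
proof -
  have X': "X \<in> EndK" by (rule T0_D(1)[OF X])
  have Xa: "X (v + w) = X v + X w" "X (act v x) = act (X v) x" for v w x
    using EndK_add[OF X'] EndK_act[OF X'] by auto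
  have XL: "X v \<in> L" if "v \<in> L" for v by (rule T0_D(2)[OF X that])
  have "is_form val p \<iota> \<sigma> \<epsilon> B act L (\<phi> X)"
  proof (cases "case_base \<iota> \<sigma> \<and> \<epsilon> = 1 \<and> p = 2")
    case True
    then obtain q where q: "is_quadratic_form act \<iota> q" "\<forall>v\<in>L. q v \<in> A"
      and hq: "\<forall>v w. h v w = \<iota> ((q (v + w) - q v - q w) / 2)"
      using form by (auto simp: is_form_def)
    have "is_quadratic_form act \<iota> (\<lambda>v. q (X v))"
      using q(1) unfolding is_quadratic_form_def Let_def Xa by blast
    then have "\<exists>q. is_quadratic_form act \<iota> q \<and> (\<forall>v\<in>L. q v \<in> A) \<and>
        (\<forall>v w. \<phi> X v w = \<iota> ((q (v + w) - q v - q w) / 2))"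
      using q(2) hq XL by (intro exI[of _ "\<lambda>v. q (X v)"]) (simp add: \<phi>_def Xa)
    then show ?thesis using True by (simp add: is_form_def)
  next
    case False
    then have "\<forall>v\<in>L. \<forall>w\<in>L. h v w \<in> B" using form by (simp add: is_form_def)
    moreover have "is_sesqui_hermitian act \<sigma> \<epsilon> (\<phi> X)"
      unfolding is_sesqui_hermitian_def
    proof (intro conjI allI)
      show "\<phi> X (act v x) (act w y) = \<sigma> x * \<phi> X v w * y" for v w x y
        unfolding \<phi>_def Xa by (rule h_act2)
      show "\<phi> X w v = of_int \<epsilon> * \<sigma> (\<phi> X v w)" for v w unfolding \<phi>_def by (rule h_swap)
    qed (simp_all add: \<phi>_def Xa h_add)
    ultimately show ?thesis unfolding is_form_def if_not_P[OF False] using XL by (simp add: \<phi>_def)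
  qed
  moreover have "\<phi> X v w \<in> B" if "v \<in> L" "w \<in> dual" for v w
    using T0_D(3)[OF X that(2)] XL[OF that(1)] L_iff_dual unfolding \<phi>_def by blast
  ultimately show ?thesis by (simp add: H0_def)
qed

lemma scale_End_apply: "scale_End a X v = act (X v) (\<iota> a)"
  by (simp add: scale_End_def)

text \<open>A subalgebra over \<open>A\<close> of \<open>T 0\<close>, stable under the involution
  and possibly without unit: the identity may drop out of the sequence because \<open>h\<close> need
  not be in the image of the current lattice under \<psi>.\<close>

definition star_closed :: "('v \<Rightarrow> 'v) set \<Rightarrow> bool" where
  "star_closed S \<longleftrightarrow> S \<subseteq> T 0 \<and> 0 \<in> S \<and> (\<forall>X\<in>S. adj X \<in> S) \<and> (\<forall>X\<in>S. \<forall>Y\<in>S. X + Y \<in> S) \<and>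
    (\<forall>X\<in>S. \<forall>Y\<in>S. X \<circ> Y \<in> S) \<and> (\<forall>X\<in>S. \<forall>a\<in>A. scale_End a X \<in> S)"

lemma star_closedI:
  assumes "\<And>X. X \<in> S \<Longrightarrow> X \<in> T 0" "0 \<in> S" "\<And>X. X \<in> S \<Longrightarrow> adj X \<in> S" "\<And>X Y. X \<in> S \<Longrightarrow> Y \<in> S \<Longrightarrow> X + Y \<in> S"
    "\<And>X Y. X \<in> S \<Longrightarrow> Y \<in> S \<Longrightarrow> X \<circ> Y \<in> S" "\<And>X a. X \<in> S \<Longrightarrow> a \<in> A \<Longrightarrow> scale_End a X \<in> S"
  shows "star_closed S"
  unfolding star_closed_def by (intro conjI ballI subsetI assms)

lemma star_closedD:
  assumes "star_closed S"
  shows "X \<in> S \<Longrightarrow> X \<in> T 0" "0 \<in> S" "X \<in> S \<Longrightarrow> adj X \<in> S" "X \<in> S \<Longrightarrow> Y \<in> S \<Longrightarrow> X + Y \<in> S"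
    "X \<in> S \<Longrightarrow> Y \<in> S \<Longrightarrow> X \<circ> Y \<in> S" "X \<in> S \<Longrightarrow> a \<in> A \<Longrightarrow> scale_End a X \<in> S"
  using assms unfolding star_closed_def by blast+

text \<open>By induction every defect is a value of \<psi> on \<open>T m\<close>:
  \<open>\<phi> (X + Y)\<close> differs from the sum by \<open>\<psi> (adj X \<circ> Y)\<close>,
  \<open>\<phi> (X \<circ> Y)\<close> is \<open>\<psi> (adj Y \<circ> Z \<circ> Y)\<close> when
  \<open>\<phi> X = \<psi> Z\<close>, and scaling by \<open>a\<close> multiplies \<phi> by the
  square of \<open>a\<close>.\<close>

lemma T_closed: "star_closed (T m)"
proof (induction m)
  case 0
  show ?case
  proof (rule star_closedI)
    show "0 \<in> T 0" by (auto simp: T0_iff EndK_zero L_0 dual_0)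
    show "X + Y \<in> T 0" "X \<circ> Y \<in> T 0" if "X \<in> T 0" "Y \<in> T 0" for X Y
      using that unfolding T0_iff by (auto intro: EndK_plus EndK_comp L_add dual_add)
    show "scale_End a X \<in> T 0" if "X \<in> T 0" "a \<in> A" for X a
      using that unfolding T0_iff by (auto simp: EndK_scale scale_End_apply intro: L_scale dual_scale)
  qed (simp_all add: T0_adj)
next
  case (Suc m)
  note T0 = star_closedD(1)[OF Suc.IH] and z = star_closedD(2)[OF Suc.IH] and ad = star_closedD(3)[OF Suc.IH]
    and pl = star_closedD(4)[OF Suc.IH] and co = star_closedD(5)[OF Suc.IH] and sc = star_closedD(6)[OF Suc.IH]
  have EndK': "X \<in> EndK" if "X \<in> T m" for X by (rule T0_D(1)[OF T0[OF that]])
  have iff: "X \<in> T (Suc m) \<longleftrightarrow> X \<in> T m \<and> \<phi> X \<in> \<psi> ` T m \<and> \<phi> (adj X) \<in> \<psi> ` T m" for X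
    using \<phi>_H0[OF T0, of X] \<phi>_H0[OF T0[OF ad], of X] unfolding T.simps(2) by blast
  have pls: "\<phi> (X + Y) \<in> \<psi> ` T m" if "X \<in> T m" "Y \<in> T m" "\<phi> X \<in> \<psi> ` T m" "\<phi> Y \<in> \<psi> ` T m" for X Y
  proof -
    obtain Z Z' where Z: "Z \<in> T m" "\<phi> X = \<psi> Z" "Z' \<in> T m" "\<phi> Y = \<psi> Z'" using \<open>\<phi> X \<in> \<psi> ` T m\<close> \<open>\<phi> Y \<in> \<psi> ` T m\<close> by auto
    have "\<phi> (X + Y) = \<psi> (Z + Z' + (adj X \<circ> Y))"
      using that Z by (simp add: \<phi>_plus \<psi>_plus EndK' EndK_plus EndK_comp adj_EndK)
    moreover have "Z + Z' + (adj X \<circ> Y) \<in> T m" using that Z by (intro pl co ad)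
    ultimately show ?thesis by blast
  qed
  have cos: "\<phi> (X \<circ> Y) \<in> \<psi> ` T m" if "X \<in> T m" "Y \<in> T m" "\<phi> X \<in> \<psi> ` T m" for X Y
  proof -
    obtain Z where Z: "Z \<in> T m" "\<phi> X = \<psi> Z" using \<open>\<phi> X \<in> \<psi> ` T m\<close> by auto
    have "\<phi> (X \<circ> Y) = \<psi> (adj Y \<circ> Z \<circ> Y)"
      using that Z by (intro ext) (simp only: \<phi>_comp \<psi>_conj EndK')
    moreover have "adj Y \<circ> Z \<circ> Y \<in> T m" using that Z by (intro co ad)
    ultimately show ?thesis by blast
  qed
  have scs: "\<phi> (scale_End a X) \<in> \<psi> ` T m" if "\<phi> X \<in> \<psi> ` T m" "a \<in> A" for X a
  proof -
    obtain Z where Z: "Z \<in> T m" "\<phi> X = \<psi> Z" using \<open>\<phi> X \<in> \<psi> ` T m\<close> by auto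
    have "\<phi> (scale_End a X) = \<psi> (scale_End (a * a) Z)" by (simp only: \<phi>_scale \<psi>_scale Z)
    moreover have "scale_End (a * a) Z \<in> T m" using Z that by (intro sc subring_mult[OF subring_A])
    ultimately show ?thesis by blast
  qed
  have "\<phi> 0 = \<psi> 0" by (auto simp: \<phi>_def \<psi>_def fun_eq_iff)
  then have "\<phi> 0 \<in> \<psi> ` T m" using z by auto
  then have "0 \<in> T (Suc m)" using z by (simp only: iff adj_zero)
  moreover have "adj X \<in> T (Suc m)" if "X \<in> T (Suc m)" for X
    using that ad unfolding iff by (simp add: adj_adj EndK')
  moreover have "X + Y \<in> T (Suc m)" if "X \<in> T (Suc m)" "Y \<in> T (Suc m)" for X Y
  proof -
    have XY: "X \<in> T m" "Y \<in> T m" and "\<phi> X \<in> \<psi> ` T m" "\<phi> Y \<in> \<psi> ` T m"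
      "\<phi> (adj X) \<in> \<psi> ` T m" "\<phi> (adj Y) \<in> \<psi> ` T m" using that unfolding iff by simp_all
    then have "\<phi> (X + Y) \<in> \<psi> ` T m" "\<phi> (adj X + adj Y) \<in> \<psi> ` T m"
      using pls[of X Y] pls[of "adj X" "adj Y"] ad by auto
    then show ?thesis unfolding iff adj_plus[OF EndK'[OF XY(1)] EndK'[OF XY(2)]] using pl[OF XY] by simp
  qed
  moreover have "X \<circ> Y \<in> T (Suc m)" if "X \<in> T (Suc m)" "Y \<in> T (Suc m)" for X Y
  proof -
    \<comment> \<open>The adjoint reverses the product, so the condition on \<phi> itself is taken
      from \<open>X\<close> and the condition on adjoints from \<open>Y\<close>.\<close>
    have XY: "X \<in> T m" "Y \<in> T m" and "\<phi> X \<in> \<psi> ` T m" "\<phi> (adj Y) \<in> \<psi> ` T m"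
      using that unfolding iff by simp_all
    then have "\<phi> (X \<circ> Y) \<in> \<psi> ` T m" "\<phi> (adj Y \<circ> adj X) \<in> \<psi> ` T m"
      using cos[of X Y] cos[of "adj Y" "adj X"] ad by auto
    then show ?thesis unfolding iff adj_comp[OF EndK'[OF XY(1)] EndK'[OF XY(2)]] using co[OF XY] by simp
  qed
  moreover have "scale_End a X \<in> T (Suc m)" if "X \<in> T (Suc m)" "a \<in> A" for X a
  proof -
    have X: "X \<in> T m" and "\<phi> X \<in> \<psi> ` T m" "\<phi> (adj X) \<in> \<psi> ` T m" using that unfolding iff by simp_all
    then have "\<phi> (scale_End a X) \<in> \<psi> ` T m" "\<phi> (scale_End a (adj X)) \<in> \<psi> ` T m" using scs that by auto
    then show ?thesis unfolding iff adj_scale[OF EndK'[OF X]] using sc[OF X that(2)] by simp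
  qed
  moreover have "X \<in> T 0" if "X \<in> T (Suc m)" for X using T0 that unfolding iff by blast
  ultimately show ?case by (intro star_closedI)
qed

lemmas T_subset_T0 = star_closedD(1)[OF T_closed]
  and T_0 = star_closedD(2)[OF T_closed] and T_adj = star_closedD(3)[OF T_closed]
  and T_plus = star_closedD(4)[OF T_closed] and T_comp = star_closedD(5)[OF T_closed]
  and T_scale = star_closedD(6)[OF T_closed]

lemmas T_EndK = T0_D(1)[OF T_subset_T0]

lemma T_sum: "(\<And>i. i \<in> I \<Longrightarrow> f i \<in> T m) \<Longrightarrow> sum f I \<in> T m"
  by (induction I rule: infinite_finite_induct) (auto intro: T_0 T_plus)

lemma T_Suc_iff: "X \<in> T (Suc m) \<longleftrightarrow> X \<in> T m \<and> \<phi> X \<in> \<psi> ` T m \<and> \<phi> (adj X) \<in> \<psi> ` T m"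
  using \<phi>_H0[OF T_subset_T0[of X m]] \<phi>_H0[OF T_subset_T0[OF T_adj[of X m]]] unfolding T.simps(2) by blast

lemma T_antimono: "m \<le> m' \<Longrightarrow> T m' \<subseteq> T m"
  by (rule lift_Suc_antimono_le) (auto simp: T_Suc_iff)

section \<open>Clearing denominators and counting residues\<close>

lemma common_multiple:
  assumes fin: "finite I" and ex: "\<And>i. i \<in> I \<Longrightarrow> \<exists>a\<in>A. a \<noteq> 0 \<and> Q i a"
    and Q: "\<And>i a a'. i \<in> I \<Longrightarrow> Q i a \<Longrightarrow> a' \<in> A \<Longrightarrow> Q i (a' * a)"
  shows "\<exists>a\<in>A. a \<noteq> 0 \<and> (\<forall>i\<in>I. Q i a)"
  using fin ex Q
proof (induction I)
  case empty
  then show ?case using subring_1[OF subring_A] by (intro bexI[of _ 1]) auto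
next
  case (insert x I)
  have "\<exists>a\<in>A. a \<noteq> 0 \<and> (\<forall>i\<in>I. Q i a)"
  proof (rule insert.IH)
    show "\<And>i. i \<in> I \<Longrightarrow> \<exists>a\<in>A. a \<noteq> 0 \<and> Q i a" using insert.prems(1) by simp
    show "\<And>i a a'. i \<in> I \<Longrightarrow> Q i a \<Longrightarrow> a' \<in> A \<Longrightarrow> Q i (a' * a)" using insert.prems(2) by simp
  qed
  then obtain a where a: "a \<in> A" "a \<noteq> 0" "\<forall>i\<in>I. Q i a" by auto
  obtain a' where a': "a' \<in> A" "a' \<noteq> 0" "Q x a'" using insert.prems(1)[of x] by auto
  have "Q x (a * a')" using insert.prems(2)[of x a' a] a a' by simp
  moreover have "\<forall>i\<in>I. Q i (a * a')" using insert.prems(2) a a' by (metis insertCI mult.commute)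
  ultimately show ?case using a a' subring_mult[OF subring_A] by (intro bexI[of _ "a * a'"]) auto
qed

lemma EndK_clear_L:
  assumes X: "X \<in> EndK" shows "\<exists>a\<in>A. a \<noteq> 0 \<and> (\<forall>v\<in>L. act (X v) (\<iota> a) \<in> L)"
proof -
  have "\<exists>x. X (eb i) = (\<Sum>j<n. act (eb j) (x j))" for i by (rule eb_ex)
  then obtain x where x: "\<And>i. X (eb i) = (\<Sum>j<n. act (eb j) (x i j))" by metis
  have "\<exists>a\<in>A. a \<noteq> 0 \<and> (\<forall>ij\<in>{..<n} \<times> {..<n}. \<iota> a * x (fst ij) (snd ij) \<in> B)"
    by (rule common_multiple) (auto simp: B_clear mult.assoc intro: B_scale)
  then obtain a where a: "a \<in> A" "a \<noteq> 0" "\<And>i j. i < n \<Longrightarrow> j < n \<Longrightarrow> \<iota> a * x i j \<in> B" by force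
  have Xe: "act (X (eb i)) (\<iota> a) \<in> L" if "i < n" for i
  proof -
    have "act (X (eb i)) (\<iota> a) = (\<Sum>j<n. act (eb j) (\<iota> a * x i j))"
      unfolding x by (simp only: act_sum iota_central act_simps(2))
    also have "\<dots> \<in> L" by (rule L_sum) (rule a(3)[OF that])
    finally show ?thesis .
  qed
  have L_B: "act w c \<in> L" if w: "w \<in> L" and cB: "c \<in> B" for w c
  proof -
    obtain d where d: "\<forall>i<n. d i \<in> B" "w = (\<Sum>i<n. act (eb i) (d i))" using L_ex[OF w] by auto
    have "act w c = (\<Sum>i<n. act (eb i) (d i * c))" unfolding d by (simp add: act_sum)
    also have "\<dots> \<in> L" by (rule L_sum) (use d cB subring_mult[OF subring_B] in auto)
    finally show ?thesis .
  qed
  have Lsum: "(\<Sum>i\<in>I. f i) \<in> L" if "\<And>i. i \<in> I \<Longrightarrow> f i \<in> L" for I :: "nat set" and f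
    using that by (induction I rule: infinite_finite_induct) (auto intro: L_0 L_add)
  have "act (X v) (\<iota> a) \<in> L" if v: "v \<in> L" for v
  proof -
    obtain c where c: "\<forall>i<n. c i \<in> B" "v = (\<Sum>i<n. act (eb i) (c i))" using L_ex[OF v] by auto
    have "act (X v) (\<iota> a) = (\<Sum>i<n. act (act (X (eb i)) (\<iota> a)) (c i))"
      unfolding c EndK_eb[OF X] by (simp only: act_sum act_iota_commute)
    also have "\<dots> \<in> L" by (intro Lsum L_B Xe) (use c in auto)
    finally show ?thesis .
  qed
  then show ?thesis using a by blast
qed

lemma EndK_clear:
  assumes X: "X \<in> EndK" shows "\<exists>a\<in>A. a \<noteq> 0 \<and> scale_End a X \<in> T 0"
proof -
  obtain a where a: "a \<in> A" "a \<noteq> 0" "\<forall>v\<in>L. act (X v) (\<iota> a) \<in> L" using EndK_clear_L[OF X] by auto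
  obtain a' where a': "a' \<in> A" "a' \<noteq> 0" "\<forall>v\<in>L. act (adj X v) (\<iota> a') \<in> L"
    using EndK_clear_L[OF adj_EndK[OF X]] by auto
  have "scale_End (a * a') X \<in> T 0"
  proof (rule T0_adjI[OF EndK_scale[OF X]])
    fix v assume v: "v \<in> L"
    have "act (act (X v) (\<iota> a)) (\<iota> a') \<in> L" by (rule L_scale[OF a'(1)]) (use a(3) v in blast)
    then show "scale_End (a * a') X v \<in> L" by (simp add: scale_End_def)
    have "act (act (adj X v) (\<iota> a')) (\<iota> a) \<in> L" by (rule L_scale[OF a(1)]) (use a'(3) v in blast)
    then show "adj (scale_End (a * a') X) v \<in> L"
      unfolding adj_scale[OF X] by (simp only: scale_End_apply mult.commute[of a a'] iota_simps act_simps)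
  qed
  then show ?thesis using a a' subring_mult[OF subring_A] by (intro bexI[of _ "a * a'"]) auto
qed

text \<open>Successive approximation: a representative modulo a power of a uniformiser is refined by
  one of the finitely many residues of the quotient.\<close>

lemma A_residues: "\<exists>R. finite R \<and> (\<forall>x\<in>A. \<exists>\<rho>\<in>R. val_ge val (int k) (x - \<rho>))"
proof (induction k)
  case 0
  show ?case by (rule exI[of _ "{0}"]) (auto simp: val_ring_def)
next
  case (Suc k)
  then obtain R where R: "finite R" "\<forall>x\<in>A. \<exists>\<rho>\<in>R. val_ge val (int k) (x - \<rho>)" by auto
  obtain R1 where R1: "finite R1" "\<forall>x\<in>A. \<exists>\<rho>\<in>R1. val_ge val 1 (x - \<rho>)"
    using local_field unfolding nonarch_local_field_def by auto
  obtain \<pi> where pi: "\<pi> \<noteq> 0" "val \<pi> = 1" using local_field unfolding nonarch_local_field_def by auto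
  have vk: "val (\<pi> ^ k) = int k" for k using pi by (induction k) (auto simp: val_one val_mult)
  let ?R = "(\<lambda>(\<rho>, \<rho>'). \<rho> + \<pi> ^ k * \<rho>') ` (R \<times> R1)"
  have "\<exists>\<rho>\<in>?R. val_ge val (int (Suc k)) (x - \<rho>)" if x: "x \<in> A" for x
  proof -
    obtain \<rho> where rho: "\<rho> \<in> R" "val_ge val (int k) (x - \<rho>)" using R x by auto
    define y where "y = (x - \<rho>) / \<pi> ^ k"
    have xy: "x - \<rho> = \<pi> ^ k * y" using pi by (simp add: y_def)
    have "y \<in> A"
    proof (cases "y = 0")
      case False
      then have "val (x - \<rho>) = int k + val y" unfolding xy using pi by (simp add: val_mult vk)
      moreover have "x - \<rho> \<noteq> 0" using False by (auto simp: y_def)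
      ultimately show ?thesis using rho(2) by (simp add: val_ge_def val_ring_def)
    qed (simp add: val_ring_def val_ge_def)
    then obtain \<rho>' where rho': "\<rho>' \<in> R1" "val_ge val 1 (y - \<rho>')" using R1 by auto
    have "val_ge val (int k + 1) (\<pi> ^ k * (y - \<rho>'))"
      by (rule val_ge_mult) (use rho' pi vk[of k] in \<open>auto simp: val_ge_def\<close>)
    moreover have "\<pi> ^ k * (y - \<rho>') = x - (\<rho> + \<pi> ^ k * \<rho>')"
      using xy by (simp add: algebra_simps)
    ultimately have "val_ge val (int (Suc k)) (x - (\<rho> + \<pi> ^ k * \<rho>'))" by (simp add: add.commute)
    then show ?thesis using rho(1) rho'(1) by (intro bexI[of _ "\<rho> + \<pi> ^ k * \<rho>'"]) auto
  qed
  then show ?case using R R1 by (intro exI[of _ ?R]) auto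
qed

lemma A_residues_mod:
  assumes c: "c \<in> A" "c \<noteq> 0"
  shows "\<exists>R. finite R \<and> (\<forall>x\<in>A. \<exists>\<rho>\<in>R. \<exists>y\<in>A. x = \<rho> + c * y)"
proof -
  have k: "int (nat (val c)) = val c" using c by (simp add: val_ring_def val_ge_def)
  obtain R where R: "finite R" "\<forall>x\<in>A. \<exists>\<rho>\<in>R. val_ge val (val c) (x - \<rho>)"
    using A_residues[of "nat (val c)"] unfolding k by blast
  have "\<exists>\<rho>\<in>R. \<exists>y\<in>A. x = \<rho> + c * y" if "x \<in> A" for x
  proof -
    from bspec[OF R(2) that] obtain \<rho> where rho: "\<rho> \<in> R" "val_ge val (val c) (x - \<rho>)" by (elim bexE)
    define y where "y = (x - \<rho>) / c"
    have xy: "x - \<rho> = c * y" using c by (simp add: y_def)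
    have "y \<in> A"
    proof (cases "y = 0")
      case False
      then have "val (x - \<rho>) = val c + val y" unfolding xy using c by (simp add: val_mult)
      moreover have "x - \<rho> \<noteq> 0" using False by (auto simp: y_def)
      ultimately show ?thesis using rho(2) by (simp add: val_ge_def val_ring_def)
    qed (simp add: val_ring_def val_ge_def)
    moreover have "x = \<rho> + c * y" using xy by (simp add: algebra_simps)
    ultimately show ?thesis using rho(1) by blast
  qed
  then show ?thesis using R by blast
qed

text \<open>Matrix units with entries from a finite generating set of \<open>B\<close> over
  \<open>A\<close>. They span a finitely generated module containing \<open>T 0\<close>, which
  suffices for counting residues; the generators themselves may lie outside
  \<open>T 0\<close>.\<close>

lemma End_L_gens:
  obtains I :: "(nat \<times> nat \<times> nat) set" and g where "finite I" "\<And>i. i \<in> I \<Longrightarrow> g i \<in> EndK"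
    "\<And>X. X \<in> T 0 \<Longrightarrow> \<exists>x. (\<forall>i\<in>I. x i \<in> A) \<and> X = (\<Sum>i\<in>I. scale_End (x i) (g i))"
proof -
  obtain m :: nat and b where B: "B = {\<Sum>i<m. \<iota> (a i) * b i | a. \<forall>i<m. a i \<in> A}" using B_gens by auto
  have "\<exists>c. v = (\<Sum>i<n. act (eb i) (c i))" for v by (rule eb_ex)
  then obtain kc where kc: "\<And>v. v = (\<Sum>i<n. act (eb i) (kc v i))" by metis
  have kcI: "kc v i = c i" if "v = (\<Sum>i<n. act (eb i) (c i))" "i < n" for v c i
  proof -
    have "(\<Sum>i<n. act (eb i) (kc v i)) = (\<Sum>i<n. act (eb i) (c i))" using that(1) kc[of v] by simp
    from eb_unique[OF this that(2)] show ?thesis .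
  qed
  have kc_add: "kc (v + w) i = kc v i + kc w i" if "i < n" for v w i
  proof (rule kcI[OF _ that])
    show "v + w = (\<Sum>i<n. act (eb i) (kc v i + kc w i))"
      by (subst (1) kc[of v], subst (1) kc[of w]) (simp add: act_add sum.distrib)
  qed
  have kc_act: "kc (act v x) i = kc v i * x" if "i < n" for v x i
  proof (rule kcI[OF _ that])
    show "act v x = (\<Sum>i<n. act (eb i) (kc v i * x))"
      by (subst (1) kc[of v]) (simp add: act_sum)
  qed
  \<comment> \<open>\<open>g (i, j, l)\<close> multiplies the \<open>i\<close>-th coordinate of the
    argument on the left by \<open>b l\<close> and places it at basis vector
    \<open>j\<close>.\<close>
  define g where "g = (\<lambda>(i, j, l) v. act (eb j) (b l * kc v i))"
  define I where "I = {..<n} \<times> {..<n} \<times> {..<m}"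
  have "g i \<in> EndK" if "i \<in> I" for i
    using that by (auto simp: I_def g_def EndK_def kc_add kc_act distrib_left act_add mult.assoc[symmetric])
  moreover have "\<exists>x. (\<forall>i\<in>I. x i \<in> A) \<and> X = (\<Sum>i\<in>I. scale_End (x i) (g i))" if X: "X \<in> T 0" for X
  proof -
    have X': "X \<in> EndK" by (rule T0_D(1)[OF X])
    have XL: "X (eb i) \<in> L" if "i < n" for i by (rule T0_D(2)[OF X eb_L[OF that]])
    define Q where "Q i a \<longleftrightarrow> (\<forall>j<n. \<forall>l<m. a j l \<in> A) \<and>
      X (eb i) = (\<Sum>j<n. act (eb j) (\<Sum>l<m. \<iota> (a j l) * b l))" for i a
    have "\<exists>a. Q i a" if "i < n" for i
    proof -
      have "X (eb i) \<in> L" by (rule XL[OF that])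
      then obtain c where c: "\<forall>j<n. c j \<in> B" "X (eb i) = (\<Sum>j<n. act (eb j) (c j))" using L_ex by blast
      have "\<exists>a. (\<forall>l<m. a l \<in> A) \<and> c j = (\<Sum>l<m. \<iota> (a l) * b l)" if "j < n" for j
        using c(1) that unfolding B by auto
      then obtain a where "\<And>j. j < n \<Longrightarrow> (\<forall>l<m. a j l \<in> A) \<and> c j = (\<Sum>l<m. \<iota> (a j l) * b l)" by metis
      then show ?thesis using c(2) unfolding Q_def by (intro exI[of _ a]) simp
    qed
    then have "\<forall>i. \<exists>a. i < n \<longrightarrow> Q i a" by blast
    from choice[OF this] obtain a where "\<forall>i. i < n \<longrightarrow> Q i (a i)" by blast
    then have a: "\<And>i j l. i < n \<Longrightarrow> j < n \<Longrightarrow> l < m \<Longrightarrow> a i j l \<in> A"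
      "\<And>i. i < n \<Longrightarrow> X (eb i) = (\<Sum>j<n. act (eb j) (\<Sum>l<m. \<iota> (a i j l) * b l))"
      by (simp_all add: Q_def)
    have "X v = (\<Sum>(i, j, l)\<in>I. act (g (i, j, l) v) (\<iota> (a i j l)))" for v
    proof -
      have "X v = (\<Sum>i<n. act (X (eb i)) (kc v i))"
        by (subst (1) kc[of v]) (rule EndK_eb[OF X'])
      also have "\<dots> = (\<Sum>i<n. \<Sum>j<n. \<Sum>l<m. act (eb j) (\<iota> (a i j l) * b l * kc v i))"
        using a(2) by (intro sum.cong refl) (simp add: act_sum sum_distrib_right flip: act_simps(2))
      also have "\<dots> = (\<Sum>i<n. \<Sum>j<n. \<Sum>l<m. act (g (i, j, l) v) (\<iota> (a i j l)))"
        by (intro sum.cong refl) (simp add: g_def mult.assoc iota_central[of _ "b _ * kc v _"] flip: act_simps(2))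
      finally show ?thesis by (simp add: I_def sum.cartesian_product)
    qed
    then have "X = (\<Sum>i\<in>I. scale_End (case i of (i, j, l) \<Rightarrow> a i j l) (g i))"
      by (intro ext) (simp add: sum_fun scale_End_def case_prod_beta)
    moreover have "\<forall>i\<in>I. (case i of (i, j, l) \<Rightarrow> a i j l) \<in> A" using a(1) by (auto simp: I_def)
    ultimately show ?thesis by blast
  qed
  ultimately show thesis by (intro that[of I g]) (auto simp: I_def)
qed

section \<open>Stabilisation of the lattices once \<open>h\<close> is a value of \<psi>\<close>

context
  fixes Z0 assumes Z0: "Z0 \<in> EndK" "h = \<psi> Z0"
begin

lemma \<phi>_via_Z0: "X \<in> EndK \<Longrightarrow> \<phi> X = \<psi> (adj X \<circ> Z0 \<circ> X)"
  by (intro ext) (simp only: \<psi>_conj[OF Z0(1)] \<phi>_def Z0(2)[symmetric])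

text \<open>\<open>a\<close> clears the denominators of \<open>Z0\<close>. With Y =
  \<open>adj X \<circ> scale_End a Z0 \<circ> X\<close> in \<open>T 0\<close>, \<phi> of
  \<open>a\<close> X equals \<psi> of \<open>a\<close> Y, and \<open>a\<close> Y is in
  \<open>T m\<close> by induction. The same \<open>a\<close> therefore works for every
  \<open>m\<close>.\<close>

lemma T_uniform: "\<exists>a\<in>A. a \<noteq> 0 \<and> (\<forall>m. \<forall>X\<in>T 0. scale_End a X \<in> T m)"
proof -
  obtain a where a: "a \<in> A" "a \<noteq> 0" "scale_End a Z0 \<in> T 0" using EndK_clear[OF Z0(1)] by auto
  have "scale_End a X \<in> T m" if "X \<in> T 0" for X m
    using that
  proof (induction m arbitrary: X)
    case 0
    show ?case by (rule T_scale[OF 0 a(1)])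
  next
    case (Suc m)
    have *: "\<phi> (scale_End a X) \<in> \<psi> ` T m" if X: "X \<in> T 0" for X
    proof -
      have XE: "X \<in> EndK" using T_EndK[OF X] .
      have "adj (scale_End a X) \<circ> Z0 \<circ> scale_End a X = scale_End a (adj X \<circ> scale_End a Z0 \<circ> X)"
        unfolding adj_scale[OF XE]
        by (intro ext) (simp add: scale_End_apply EndK_act[OF adj_EndK[OF XE]] EndK_act[OF Z0(1)])
      then have "\<phi> (scale_End a X) = \<psi> (scale_End a (adj X \<circ> scale_End a Z0 \<circ> X))"
        using \<phi>_via_Z0[OF EndK_scale[OF XE]] by simp
      moreover have "adj X \<circ> scale_End a Z0 \<circ> X \<in> T 0" by (intro T_comp T_adj X a)
      ultimately show ?thesis using Suc.IH by blast
    qed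
    have XE: "X \<in> EndK" using T_EndK[OF Suc.prems] .
    show ?case unfolding T_Suc_iff adj_scale[OF XE]
      using Suc.IH[OF Suc.prems] *[OF Suc.prems] *[OF T_adj[OF Suc.prems]] by simp
  qed
  then show ?thesis using a by blast
qed

text \<open>All \<open>T m\<close> contain the multiples by \<open>c\<close> of one finite set of
  generators and lie in the span of that set, so each \<open>T m\<close> is determined by the
  residue vectors modulo \<open>c\<close> that it contains. These finite sets decrease with
  \<open>m\<close> and hence become constant.\<close>

lemma T_stabilises: "\<exists>m0. \<forall>m\<ge>m0. T m = T m0"
proof -
  obtain I :: "(nat \<times> nat \<times> nat) set" and g where I: "finite I" and g: "\<And>i. i \<in> I \<Longrightarrow> g i \<in> EndK"
    and gen: "\<And>X. X \<in> T 0 \<Longrightarrow> \<exists>x. (\<forall>i\<in>I. x i \<in> A) \<and> X = (\<Sum>i\<in>I. scale_End (x i) (g i))"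
    by (rule End_L_gens) blast
  obtain a where a: "a \<in> A" "a \<noteq> 0" "\<And>m X. X \<in> T 0 \<Longrightarrow> scale_End a X \<in> T m" using T_uniform by auto
  have "\<exists>a'\<in>A. a' \<noteq> 0 \<and> (\<forall>i\<in>I. scale_End a' (g i) \<in> T 0)"
  proof (rule common_multiple[OF I])
    show "\<exists>a\<in>A. a \<noteq> 0 \<and> scale_End a (g i) \<in> T 0" if "i \<in> I" for i using EndK_clear[OF g[OF that]] .
    show "scale_End (a' * a) (g i) \<in> T 0" if "scale_End a (g i) \<in> T 0" "a' \<in> A" for i a a'
      using T_scale[OF that] by simp
  qed
  then obtain a' where a': "a' \<in> A" "a' \<noteq> 0" "\<And>i. i \<in> I \<Longrightarrow> scale_End a' (g i) \<in> T 0" by auto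
  define c where "c = a * a'"
  have c: "c \<in> A" "c \<noteq> 0" using a a' subring_mult[OF subring_A] by (auto simp: c_def)
  have cg: "scale_End c (g i) \<in> T m" if "i \<in> I" for i m
    using a(3)[OF a'(3)[OF that]] by (simp add: c_def)
  obtain R where R: "finite R" "\<forall>x\<in>A. \<exists>\<rho>\<in>R. \<exists>y\<in>A. x = \<rho> + c * y" using A_residues_mod[OF c] by auto
  define lc where "lc x = (\<Sum>i\<in>I. scale_End (x i) (g i))" for x
  define code where "code m = {\<rho> \<in> I \<rightarrow>\<^sub>E R. lc \<rho> \<in> T m}" for m
  have fin: "finite (code m)" for m unfolding code_def using finite_PiE[OF I, of "\<lambda>_. R"] R by simp
  \<comment> \<open>The remainder has coefficients divisible by \<open>c\<close>, so it lies in
    every \<open>T m\<close>, and membership of \<open>X\<close> is decided by its residue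
    vector.\<close>
  have split: "\<exists>\<rho>\<in>I \<rightarrow>\<^sub>E R. \<forall>m. \<exists>D\<in>T m. X = lc \<rho> + D" if X: "X \<in> T 0" for X
  proof -
    obtain x where x: "\<forall>i\<in>I. x i \<in> A" "X = lc x" using gen[OF X] unfolding lc_def by auto
    have "\<exists>\<rho> y. \<rho> \<in> R \<and> y \<in> A \<and> x i = \<rho> + c * y" if "i \<in> I" for i using R x that by blast
    then obtain \<rho> y where ry: "\<And>i. i \<in> I \<Longrightarrow> \<rho> i \<in> R \<and> y i \<in> A \<and> x i = \<rho> i + c * y i" by metis
    have "X = lc (restrict \<rho> I) + (\<Sum>i\<in>I. scale_End (y i) (scale_End c (g i)))"
      unfolding x lc_def sum.distrib[symmetric]
    proof (rule sum.cong[OF refl])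
      fix i assume i: "i \<in> I"
      have "x i = \<rho> i + y i * c" using ry[OF i] by (simp add: mult.commute)
      then show "scale_End (x i) (g i) = scale_End (restrict \<rho> I i) (g i) + scale_End (y i) (scale_End c (g i))"
        using i by (simp add: scale_End.scale_left_distrib)
    qed
    moreover have "(\<Sum>i\<in>I. scale_End (y i) (scale_End c (g i))) \<in> T m" for m
      by (intro T_sum T_scale cg) (use ry in auto)
    moreover have "restrict \<rho> I \<in> I \<rightarrow>\<^sub>E R" using ry by auto
    ultimately show ?thesis by blast
  qed
  have T_diff: "X - Y \<in> T m" if "X \<in> T m" "Y \<in> T m" for X Y m
    using T_plus[OF that(1) T_scale[OF that(2), of "- 1"]] subring_1[OF subring_A] subring_uminus[OF subring_A]
    by simp
  have anti: "code m' \<subseteq> code m" if "m \<le> m'" for m m' using T_antimono[OF that] by (auto simp: code_def)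
  obtain m0 where m0: "\<And>m. card (code m0) \<le> card (code m)"
    using ex_has_least_nat[of "\<lambda>_. True" 0 "\<lambda>m. card (code m)"] by auto
  have "T m = T m0" if m: "m0 \<le> m" for m
  proof
    show "T m \<subseteq> T m0" by (rule T_antimono[OF m])
    have ceq: "code m = code m0" by (rule card_seteq[OF fin anti[OF m] m0])
    show "T m0 \<subseteq> T m"
    proof
      fix X assume X: "X \<in> T m0"
      obtain \<rho> where rho: "\<rho> \<in> I \<rightarrow>\<^sub>E R" "\<forall>m. \<exists>D\<in>T m. X = lc \<rho> + D" using split[OF T_subset_T0[OF X]] by blast
      obtain D where D: "D \<in> T m0" "X = lc \<rho> + D" using rho(2) by blast
      obtain D' where D': "D' \<in> T m" "X = lc \<rho> + D'" using rho(2) by blast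
      have "lc \<rho> \<in> T m0" using T_diff[OF X D(1)] D(2) by simp
      then have "\<rho> \<in> code m" unfolding ceq using rho by (simp add: code_def)
      then have "lc \<rho> \<in> T m" by (simp add: code_def)
      then show "X \<in> T m" using T_plus[OF _ D'(1), of "lc \<rho>"] D'(2) by simp
    qed
  qed
  then show ?thesis by blast
qed

text \<open>Stabilisation provides an index as in the definition of \<alpha>, which makes
  \<open>T_tilde\<close> a fixed point of the recursion. It follows that \<phi> maps
  \<open>T_tilde\<close> into its image under \<psi>.\<close>

lemma T_tilde_Suc: "T (Suc \<alpha>) = T_tilde"
proof -
  have "\<forall>m\<ge>\<alpha>. T m = T \<alpha>" unfolding \<alpha>_def by (rule LeastI_ex[OF T_stabilises])
  from mp[OF spec[OF this, of "Suc \<alpha>"]] show ?thesis unfolding T_tilde_def by simp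
qed

lemma T_tilde_\<phi>: "X \<in> T_tilde \<Longrightarrow> \<phi> X \<in> \<psi> ` T_tilde"
  using T_Suc_iff[of X \<alpha>] unfolding T_tilde_Suc by (simp add: T_tilde_def)

lemma T_tilde_clear: assumes X: "X \<in> EndK" shows "\<exists>a\<in>A. a \<noteq> 0 \<and> scale_End a X \<in> T_tilde"
proof -
  obtain a where a: "a \<in> A" "a \<noteq> 0" "\<And>m X. X \<in> T 0 \<Longrightarrow> scale_End a X \<in> T m" using T_uniform by auto
  obtain a' where a': "a' \<in> A" "a' \<noteq> 0" "scale_End a' X \<in> T 0" using EndK_clear[OF X] by auto
  have "scale_End (a * a') X \<in> T_tilde" using a(3)[OF a'(3)] by (simp add: T_tilde_def)
  then show ?thesis using a a' subring_mult[OF subring_A] by (intro bexI[of _ "a * a'"]) auto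
qed

text \<open>By \<open>T_uniform\<close> every endomorphism can be scaled into
  \<open>T_tilde\<close>, so the rank of \<open>T_tilde\<close> is the dimension of
  \<open>EndK\<close>.\<close>

lemma basis_T_EndK: "is_basis A scale_End N t T_tilde \<Longrightarrow> is_basis UNIV scale_End N t EndK"
  by (rule is_basis_extend_scalars[OF scale_End.vector_space_axioms _ subring_A _ A_frac _ _ _ T_tilde_clear])
    (auto simp: T_tilde_def T_EndK EndK_zero intro: EndK_plus EndK_scale)

lemma basis_H_EndK:
  assumes b: "is_basis A scale_form M s (\<psi> ` T_tilde)"
  shows "is_basis UNIV scale_form M s (\<psi> ` EndK)"
proof (rule is_basis_extend_scalars[OF scale_form.vector_space_axioms b subring_A _ A_frac])
  show "\<psi> ` T_tilde \<subseteq> \<psi> ` EndK" by (auto simp: T_tilde_def T_EndK)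
  show "x + y \<in> \<psi> ` EndK" if "x \<in> \<psi> ` EndK" "y \<in> \<psi> ` EndK" for x y
    using that by (auto simp: \<psi>_plus[symmetric] EndK_plus)
  show "scale_form a x \<in> \<psi> ` EndK" if "x \<in> \<psi> ` EndK" for x a
    using that by (auto simp: \<psi>_scale[symmetric] EndK_scale)
  show "0 \<in> \<psi> ` EndK" using \<psi>_zero EndK_zero by (metis imageI)
  show "\<exists>a\<in>A. a \<noteq> 0 \<and> scale_form a w \<in> \<psi> ` T_tilde" if "w \<in> \<psi> ` EndK" for w
  proof -
    from that obtain X where "X \<in> EndK" "w = \<psi> X" by (elim imageE)
    then show ?thesis using T_tilde_clear[of X] by (auto simp: \<psi>_scale[symmetric])
  qed
qed

end

end

section \<open>Extension of scalars\<close>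

definition biadditive :: "('a::ab_group_add \<Rightarrow> 'b::ab_group_add \<Rightarrow> 'c::ab_group_add) \<Rightarrow> bool" where
  "biadditive \<beta> \<longleftrightarrow> (\<forall>x y z. \<beta> (x + y) z = \<beta> x z + \<beta> y z) \<and> (\<forall>x y z. \<beta> z (x + y) = \<beta> z x + \<beta> z y)"

lemma biadditiveD:
  assumes "biadditive \<beta>"
  shows "\<beta> (x + x') y = \<beta> x y + \<beta> x' y" "\<beta> x (y + y') = \<beta> x y + \<beta> x y'" "\<beta> 0 y = 0" "\<beta> x 0 = 0"
proof -
  show a: "\<beta> (x + x') y = \<beta> x y + \<beta> x' y" for x x' y using assms by (simp add: biadditive_def)
  show b: "\<beta> x (y + y') = \<beta> x y + \<beta> x y'" for x y y' using assms by (simp add: biadditive_def)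
  show "\<beta> 0 y = 0" using a[of 0 0 y] by simp
  show "\<beta> x 0 = 0" using b[of x 0 0] by simp
qed

lemma conv_superset:
  assumes \<beta>: "biadditive \<beta>" and "finite A" "Poly_Mapping.keys g \<subseteq> A" "finite A'" "Poly_Mapping.keys g' \<subseteq> A'"
  shows "conv \<beta> g g' = (\<Sum>a\<in>A. \<Sum>b\<in>A'. Poly_Mapping.single (a + b) (\<beta> (Poly_Mapping.lookup g a) (Poly_Mapping.lookup g' b)))"
proof -
  have "conv \<beta> g g' = (\<Sum>a\<in>Poly_Mapping.keys g. \<Sum>b\<in>A'. Poly_Mapping.single (a + b) (\<beta> (Poly_Mapping.lookup g a) (Poly_Mapping.lookup g' b)))"
    unfolding conv_def
    by (intro sum.cong refl sum.mono_neutral_left) (use assms in \<open>auto simp: in_keys_iff biadditiveD[OF \<beta>]\<close>)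
  also have "\<dots> = (\<Sum>a\<in>A. \<Sum>b\<in>A'. Poly_Mapping.single (a + b) (\<beta> (Poly_Mapping.lookup g a) (Poly_Mapping.lookup g' b)))"
    by (rule sum.mono_neutral_left) (use assms in \<open>auto simp: in_keys_iff biadditiveD[OF \<beta>]\<close>)
  finally show ?thesis .
qed

lemma conv_single:
  assumes \<beta>: "biadditive \<beta>"
  shows "conv \<beta> (Poly_Mapping.single a x) (Poly_Mapping.single b y) = Poly_Mapping.single (a + b) (\<beta> x y)"
  by (subst conv_superset[OF \<beta>, of "{a}" _ "{b}"]) auto

lemma conv_add_left:
  assumes \<beta>: "biadditive \<beta>"
  shows "conv \<beta> (g1 + g2) g' = conv \<beta> g1 g' + conv \<beta> g2 g'"
proof -
  let ?A = "Poly_Mapping.keys g1 \<union> Poly_Mapping.keys g2"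
  note c = conv_superset[OF \<beta>, of ?A _ "Poly_Mapping.keys g'" g']
  have "conv \<beta> (g1 + g2) g' = (\<Sum>a\<in>?A. \<Sum>b\<in>Poly_Mapping.keys g'.
      Poly_Mapping.single (a + b) (\<beta> (Poly_Mapping.lookup (g1 + g2) a) (Poly_Mapping.lookup g' b)))"
    by (rule c) (use keys_add[of g1 g2] in auto)
  also have "\<dots> = conv \<beta> g1 g' + conv \<beta> g2 g'"
    by (subst (1 2) c) (auto simp: lookup_add biadditiveD[OF \<beta>] single_add sum.distrib)
  finally show ?thesis .
qed

lemma conv_add_right:
  assumes \<beta>: "biadditive \<beta>"
  shows "conv \<beta> g' (g1 + g2) = conv \<beta> g' g1 + conv \<beta> g' g2"
proof -
  let ?A = "Poly_Mapping.keys g1 \<union> Poly_Mapping.keys g2"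
  note c = conv_superset[OF \<beta>, of "Poly_Mapping.keys g'" g' ?A]
  have "conv \<beta> g' (g1 + g2) = (\<Sum>b\<in>Poly_Mapping.keys g'. \<Sum>a\<in>?A.
      Poly_Mapping.single (b + a) (\<beta> (Poly_Mapping.lookup g' b) (Poly_Mapping.lookup (g1 + g2) a)))"
    by (rule c) (use keys_add[of g1 g2] in auto)
  also have "\<dots> = conv \<beta> g' g1 + conv \<beta> g' g2"
    by (subst (1 2) c) (auto simp: lookup_add biadditiveD[OF \<beta>] single_add sum.distrib)
  finally show ?thesis .
qed

lemma additive_zero:
  fixes F :: "'a::ab_group_add \<Rightarrow> 'b::ab_group_add"
  assumes "\<And>x y. F (x + y) = F x + F y" shows "F 0 = 0"
  using assms[of 0 0] by simp

lemma additive_sum: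
  fixes F :: "'a::ab_group_add \<Rightarrow> 'b::ab_group_add"
  assumes "\<And>x y. F (x + y) = F x + F y" shows "F (sum f I) = (\<Sum>i\<in>I. F (f i))"
  by (induction I rule: infinite_finite_induct) (simp_all add: additive_zero[of F, OF assms] assms)

text \<open>Monomials generate additively, so identities between base-changed maps need checking
  only there. The versions for two and three arguments iterate this one.\<close>

lemma additive_ext1:
  fixes F G :: "'a::ab_group_add mpol \<Rightarrow> 'b::ab_group_add"
  assumes F: "\<And>x y. F (x + y) = F x + F y" and G: "\<And>x y. G (x + y) = G x + G y"
    and "\<And>a x. F (Poly_Mapping.single a x) = G (Poly_Mapping.single a x)"
  shows "F P = G P"
proof -
  have "F (\<Sum>a\<in>Poly_Mapping.keys P. Poly_Mapping.single a (Poly_Mapping.lookup P a)) =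
      G (\<Sum>a\<in>Poly_Mapping.keys P. Poly_Mapping.single a (Poly_Mapping.lookup P a))"
    by (simp only: additive_sum[of F, OF F] additive_sum[of G, OF G] assms(3))
  then show ?thesis using mpol_sum_singles[of "Poly_Mapping.keys P" P] by simp
qed

lemma additive_ext2:
  fixes F G :: "'a::ab_group_add mpol \<Rightarrow> 'b::ab_group_add mpol \<Rightarrow> 'c::ab_group_add"
  assumes "\<And>x y z. F (x + y) z = F x z + F y z" "\<And>x y z. F z (x + y) = F z x + F z y"
    "\<And>x y z. G (x + y) z = G x z + G y z" "\<And>x y z. G z (x + y) = G z x + G z y"
    and "\<And>a x b y. F (Poly_Mapping.single a x) (Poly_Mapping.single b y) = G (Poly_Mapping.single a x) (Poly_Mapping.single b y)"
  shows "F P Q = G P Q"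
  by (rule additive_ext1[of "\<lambda>P. F P Q" "\<lambda>P. G P Q"], (rule assms)+)
    (rule additive_ext1[of "\<lambda>Q. F _ Q" "\<lambda>Q. G _ Q"], (rule assms)+)

lemma additive_ext3:
  fixes F G :: "'a::ab_group_add mpol \<Rightarrow> 'b::ab_group_add mpol \<Rightarrow> 'c::ab_group_add mpol \<Rightarrow> 'd::ab_group_add"
  assumes "\<And>x y z w. F (x + y) z w = F x z w + F y z w" "\<And>x y z w. F z (x + y) w = F z x w + F z y w"
    "\<And>x y z w. F z w (x + y) = F z w x + F z w y"
    "\<And>x y z w. G (x + y) z w = G x z w + G y z w" "\<And>x y z w. G z (x + y) w = G z x w + G z y w"
    "\<And>x y z w. G z w (x + y) = G z w x + G z w y"
    and "\<And>a x b y c z. F (Poly_Mapping.single a x) (Poly_Mapping.single b y) (Poly_Mapping.single c z) =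
      G (Poly_Mapping.single a x) (Poly_Mapping.single b y) (Poly_Mapping.single c z)"
  shows "F P Q R = G P Q R"
  by (rule additive_ext1[of "\<lambda>P. F P Q R" "\<lambda>P. G P Q R"], (rule assms)+)
    (rule additive_ext2[of "\<lambda>Q R. F _ Q R" "\<lambda>Q R. G _ Q R"], (rule assms)+)

lemma lookup_map: "f 0 = 0 \<Longrightarrow> Poly_Mapping.lookup (Poly_Mapping.map f P) a = f (Poly_Mapping.lookup P a)"
  by (simp add: Poly_Mapping.map.rep_eq when_def)

lemma map_add:
  fixes f :: "'a::ab_group_add \<Rightarrow> 'b::ab_group_add"
  assumes "\<And>x y. f (x + y) = f x + f y"
  shows "Poly_Mapping.map f (P + Q) = Poly_Mapping.map f P + Poly_Mapping.map f Q"
  by (rule poly_mapping_eqI) (simp add: lookup_map additive_zero[of f, OF assms] lookup_add assms)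

context hermitian_lattice
begin

lemma biadd_pscale: "biadditive (\<lambda>a v. act v (\<iota> a))"
  by (simp add: biadditive_def act_add)

lemma biadd_kscale: "biadditive (\<lambda>a c. \<iota> a * c)"
  by (simp add: biadditive_def algebra_simps)

lemma pscale_add: "pscale (x + y) P = pscale x P + pscale y P" "pscale x (P + Q) = pscale x P + pscale x Q"
  unfolding pscale_def by (rule conv_add_left[OF biadd_pscale], rule conv_add_right[OF biadd_pscale])

lemma kscale_add: "kscale (x + y) P = kscale x P + kscale y P" "kscale x (P + Q) = kscale x P + kscale x Q"
  unfolding kscale_def by (rule conv_add_left[OF biadd_kscale], rule conv_add_right[OF biadd_kscale])

lemma pscale_single: "pscale (Poly_Mapping.single a x) (Poly_Mapping.single b v) = Poly_Mapping.single (a + b) (act v (\<iota> x))"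
  unfolding pscale_def by (rule conv_single[OF biadd_pscale])

lemma kscale_single: "kscale (Poly_Mapping.single a x) (Poly_Mapping.single b v) = Poly_Mapping.single (a + b) (\<iota> x * v)"
  unfolding kscale_def by (rule conv_single[OF biadd_kscale])

lemma pscale_mult: "pscale (x * y) P = pscale x (pscale y P)"
proof (rule additive_ext3[of "\<lambda>x y P. pscale (x * y) P" "\<lambda>x y P. pscale x (pscale y P)"])
  show "pscale (Poly_Mapping.single a x * Poly_Mapping.single b y) (Poly_Mapping.single c v) =
      pscale (Poly_Mapping.single a x) (pscale (Poly_Mapping.single b y) (Poly_Mapping.single c v))" for a b c x y v
    by (simp only: mult_single pscale_single iota_simps act_simps add.assoc act_iota_commute[of v x])
qed (simp_all add: distrib_left distrib_right pscale_add)

lemma kscale_mult: "kscale (x * y) P = kscale x (kscale y P)"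
proof (rule additive_ext3[of "\<lambda>x y P. kscale (x * y) P" "\<lambda>x y P. kscale x (kscale y P)"])
  show "kscale (Poly_Mapping.single a x * Poly_Mapping.single b y) (Poly_Mapping.single c v) =
      kscale (Poly_Mapping.single a x) (kscale (Poly_Mapping.single b y) (Poly_Mapping.single c v))" for a b c x y v
    by (simp only: mult_single kscale_single iota_simps mult.assoc add.assoc)
qed (simp_all add: distrib_left distrib_right kscale_add)

lemma pscale_sum: "pscale (sum f I) P = (\<Sum>i\<in>I. pscale (f i) P)" "pscale x (sum g I) = (\<Sum>i\<in>I. pscale x (g i))"
  by (rule additive_sum[of "\<lambda>x. pscale x P"], rule pscale_add) (rule additive_sum[of "pscale x"], rule pscale_add)

lemma kscale_sum: "kscale (sum f I) P = (\<Sum>i\<in>I. kscale (f i) P)" "kscale x (sum g I) = (\<Sum>i\<in>I. kscale x (g i))"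
  by (rule additive_sum[of "\<lambda>x. kscale x P"], rule kscale_add) (rule additive_sum[of "kscale x"], rule kscale_add)

lemma map_EndK_add: "X \<in> EndK \<Longrightarrow> Poly_Mapping.map X (P + Q) = Poly_Mapping.map X P + Poly_Mapping.map X Q"
  by (rule map_add) (rule EndK_add)

lemma map_EndK_sum: "X \<in> EndK \<Longrightarrow> Poly_Mapping.map X (sum f I) = (\<Sum>i\<in>I. Poly_Mapping.map X (f i))"
  by (rule additive_sum) (rule map_EndK_add)

lemma map_EndK_pscale:
  assumes X: "X \<in> EndK" shows "Poly_Mapping.map X (pscale y P) = pscale y (Poly_Mapping.map X P)"
proof (rule additive_ext2[of "\<lambda>y P. Poly_Mapping.map X (pscale y P)" "\<lambda>y P. pscale y (Poly_Mapping.map X P)"])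
  show "Poly_Mapping.map X (pscale (Poly_Mapping.single a x) (Poly_Mapping.single b v)) =
      pscale (Poly_Mapping.single a x) (Poly_Mapping.map X (Poly_Mapping.single b v))" for a b x v
    by (simp add: pscale_single map_single EndK_0[OF X] EndK_act[OF X])
qed (simp_all add: pscale_add map_EndK_add[OF X])

lemma map_EndK_comp: "X \<in> EndK \<Longrightarrow> Y \<in> EndK \<Longrightarrow> Poly_Mapping.map X (Poly_Mapping.map Y P) = Poly_Mapping.map (X \<circ> Y) P"
  by (rule poly_mapping_eqI) (simp add: lookup_map EndK_0)

lemma map_scale_End:
  assumes X: "X \<in> EndK" shows "Poly_Mapping.map (scale_End a X) P = pscale (mconst a) (Poly_Mapping.map X P)"
proof (rule additive_ext1[of "Poly_Mapping.map (scale_End a X)" "\<lambda>P. pscale (mconst a) (Poly_Mapping.map X P)"])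
  show "Poly_Mapping.map (scale_End a X) (Poly_Mapping.single b v) = pscale (mconst a) (Poly_Mapping.map X (Poly_Mapping.single b v))" for b v
    by (simp add: pscale_single map_single EndK_0[OF X] scale_End_def)
qed (simp_all add: pscale_add map_EndK_add[OF X] map_EndK_add[OF EndK_scale[OF X]])

lemma map_plus_fun:
  assumes X: "X \<in> EndK" "Y \<in> EndK" shows "Poly_Mapping.map (X + Y) P = Poly_Mapping.map X P + Poly_Mapping.map Y P"
  by (rule poly_mapping_eqI) (simp add: lookup_map lookup_add EndK_0 X)

lemma map_zero_fun: "Poly_Mapping.map (0 :: 'v \<Rightarrow> 'v) P = 0"
  by (rule poly_mapping_eqI) (simp add: lookup_map)

lemma map_sum_fun:
  "(\<And>i. i \<in> I \<Longrightarrow> X i \<in> EndK) \<Longrightarrow> Poly_Mapping.map (sum X I) P = (\<Sum>i\<in>I. Poly_Mapping.map (X i) P)"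
proof (induction I rule: infinite_finite_induct)
  case (insert x F)
  have "Poly_Mapping.map (X x + sum X F) P = Poly_Mapping.map (X x) P + Poly_Mapping.map (sum X F) P"
    by (rule map_plus_fun) (auto intro!: EndK_Sum insert.prems)
  moreover have "Poly_Mapping.map (sum X F) P = (\<Sum>i\<in>F. Poly_Mapping.map (X i) P)"
    by (rule insert.IH) (auto intro: insert.prems)
  ultimately show ?case by (simp only: sum.insert[OF insert.hyps])
next
  case (infinite A)
  then show ?case by (simp only: sum.infinite[OF infinite(1)] map_zero_fun)
qed (simp only: sum.empty map_zero_fun)

text \<open>Forms bilinear over the base field; \<sigma> is trivial on it, so both variables scale
  alike. Hermitian symmetry is not demanded, which admits the single summands of
  \<open>\<psi> X\<close>.\<close>

definition fform :: "('v \<Rightarrow> 'v \<Rightarrow> 'k) \<Rightarrow> bool" where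
  "fform \<beta> \<longleftrightarrow> biadditive \<beta> \<and> (\<forall>v w a. \<beta> (act v (\<iota> a)) w = \<iota> a * \<beta> v w \<and> \<beta> v (act w (\<iota> a)) = \<iota> a * \<beta> v w)"

lemma fform_h: "fform h"
  by (simp add: fform_def biadditive_def h_add h_act iota_central)

lemma fformD:
  assumes "fform \<beta>" shows fform_biadd: "biadditive \<beta>"
    and fform_act: "\<beta> (act v (\<iota> a)) w = \<iota> a * \<beta> v w" "\<beta> v (act w (\<iota> a)) = \<iota> a * \<beta> v w"
  using assms by (auto simp: fform_def)

lemma fform_comp: "fform \<beta> \<Longrightarrow> X \<in> EndK \<Longrightarrow> Y \<in> EndK \<Longrightarrow> fform (\<lambda>v w. \<beta> (X v) (Y w))"
  by (simp add: fform_def biadditive_def EndK_add EndK_act)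

lemma fform_plus: "fform \<beta> \<Longrightarrow> fform \<gamma> \<Longrightarrow> fform (\<beta> + \<gamma>)"
  by (simp add: fform_def biadditive_def algebra_simps)

lemma fform_zero: "fform 0"
  by (simp add: fform_def biadditive_def)

lemma fform_scale: assumes "fform \<beta>" shows "fform (scale_form a \<beta>)"
proof -
  have "\<iota> a * (\<iota> b * x) = \<iota> b * (\<iota> a * x)" for b x
    by (simp only: mult.assoc[symmetric] iota_simps(3)[symmetric] mult.commute[of a b])
  then show ?thesis using assms by (simp add: fform_def biadditive_def scale_form_def algebra_simps)
qed

lemma fform_sum: "(\<And>i. i \<in> I \<Longrightarrow> fform (f i)) \<Longrightarrow> fform (sum f I)"
  by (induction I rule: infinite_finite_induct) (auto intro: fform_plus fform_zero)

lemma fform_\<psi>: "X \<in> EndK \<Longrightarrow> fform (\<psi> X)"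
  using fform_plus[OF fform_comp[OF fform_h EndK_id, of X] fform_comp[OF fform_h _ EndK_id, of X]]
  by (simp add: \<psi>_def plus_fun_def)

lemma conv_pscale_left:
  assumes \<beta>: "fform \<beta>" shows "conv \<beta> (pscale y P) Q = kscale y (conv \<beta> P Q)"
proof (rule additive_ext3[of "\<lambda>y P Q. conv \<beta> (pscale y P) Q" "\<lambda>y P Q. kscale y (conv \<beta> P Q)"])
  note b = fform_biadd[OF \<beta>]
  show "conv \<beta> (pscale (Poly_Mapping.single a x) (Poly_Mapping.single b v)) (Poly_Mapping.single c w) =
    kscale (Poly_Mapping.single a x) (conv \<beta> (Poly_Mapping.single b v) (Poly_Mapping.single c w))" for a x b v c w
    by (simp add: pscale_single kscale_single conv_single[OF b] fform_act[OF \<beta>] add.assoc)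
qed (simp_all add: pscale_add kscale_add conv_add_left[OF fform_biadd[OF \<beta>]] conv_add_right[OF fform_biadd[OF \<beta>]])

lemma conv_pscale_right:
  assumes \<beta>: "fform \<beta>" shows "conv \<beta> P (pscale y Q) = kscale y (conv \<beta> P Q)"
proof (rule additive_ext3[of "\<lambda>y P Q. conv \<beta> P (pscale y Q)" "\<lambda>y P Q. kscale y (conv \<beta> P Q)"])
  note b = fform_biadd[OF \<beta>]
  show "conv \<beta> (Poly_Mapping.single b v) (pscale (Poly_Mapping.single a x) (Poly_Mapping.single c w)) =
    kscale (Poly_Mapping.single a x) (conv \<beta> (Poly_Mapping.single b v) (Poly_Mapping.single c w))" for a x b v c w
    by (simp add: pscale_single kscale_single conv_single[OF b] fform_act[OF \<beta>] add_ac)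
qed (simp_all add: pscale_add kscale_add conv_add_left[OF fform_biadd[OF \<beta>]] conv_add_right[OF fform_biadd[OF \<beta>]])

lemma conv_map:
  assumes \<beta>: "fform \<beta>" and X: "X \<in> EndK" and Y: "Y \<in> EndK"
  shows "conv \<beta> (Poly_Mapping.map X P) (Poly_Mapping.map Y Q) = conv (\<lambda>v w. \<beta> (X v) (Y w)) P Q"
proof (rule additive_ext2[of "\<lambda>P Q. conv \<beta> (Poly_Mapping.map X P) (Poly_Mapping.map Y Q)" "\<lambda>P Q. conv (\<lambda>v w. \<beta> (X v) (Y w)) P Q"])
  note b = fform_biadd[OF \<beta>] and b' = fform_biadd[OF fform_comp[OF \<beta> X Y]]
  show "conv \<beta> (Poly_Mapping.map X (Poly_Mapping.single a v)) (Poly_Mapping.map Y (Poly_Mapping.single c w)) =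
    conv (\<lambda>v w. \<beta> (X v) (Y w)) (Poly_Mapping.single a v) (Poly_Mapping.single c w)" for a v c w
    by (simp add: map_single EndK_0 X Y conv_single[OF b] conv_single[OF b'])
qed (simp_all add: map_EndK_add X Y conv_add_left[OF fform_biadd[OF \<beta>]] conv_add_right[OF fform_biadd[OF \<beta>]]
    conv_add_left[OF fform_biadd[OF fform_comp[OF \<beta> X Y]]] conv_add_right[OF fform_biadd[OF fform_comp[OF \<beta> X Y]]])

lemma conv_plus_form:
  assumes \<beta>: "fform \<beta>" and \<gamma>: "fform \<gamma>"
  shows "conv (\<beta> + \<gamma>) P Q = conv \<beta> P Q + conv \<gamma> P Q"
proof (rule additive_ext2[of "\<lambda>P Q. conv (\<beta> + \<gamma>) P Q" "\<lambda>P Q. conv \<beta> P Q + conv \<gamma> P Q"])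
  note b = fform_biadd[OF \<beta>] fform_biadd[OF \<gamma>] fform_biadd[OF fform_plus[OF \<beta> \<gamma>]]
  show "conv (\<beta> + \<gamma>) (Poly_Mapping.single a v) (Poly_Mapping.single c w) =
    conv \<beta> (Poly_Mapping.single a v) (Poly_Mapping.single c w) + conv \<gamma> (Poly_Mapping.single a v) (Poly_Mapping.single c w)" for a v c w
    by (simp add: b[THEN conv_single] single_add)
qed (simp_all only: fform_biadd[OF \<beta>, THEN conv_add_left] fform_biadd[OF \<beta>, THEN conv_add_right]
    fform_biadd[OF \<gamma>, THEN conv_add_left] fform_biadd[OF \<gamma>, THEN conv_add_right]
    fform_biadd[OF fform_plus[OF \<beta> \<gamma>], THEN conv_add_left] fform_biadd[OF fform_plus[OF \<beta> \<gamma>], THEN conv_add_right] add_ac)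

lemma conv_zero_form: "conv (0 :: 'v \<Rightarrow> 'v \<Rightarrow> 'k) P Q = 0"
  by (simp add: conv_def)

lemma conv_sum_form:
  "(\<And>i. i \<in> I \<Longrightarrow> fform (f i)) \<Longrightarrow> conv (sum f I) P Q = (\<Sum>i\<in>I. conv (f i) P Q)"
proof (induction I rule: infinite_finite_induct)
  case (insert x F)
  have "conv (f x + sum f F) P Q = conv (f x) P Q + conv (sum f F) P Q"
    by (rule conv_plus_form) (auto intro!: fform_sum insert.prems)
  moreover have "conv (sum f F) P Q = (\<Sum>i\<in>F. conv (f i) P Q)"
    by (rule insert.IH) (auto intro: insert.prems)
  ultimately show ?case by (simp only: sum.insert[OF insert.hyps])
next
  case (infinite A)
  then show ?case by (simp only: sum.infinite[OF infinite(1)] conv_zero_form)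
qed (simp only: sum.empty conv_zero_form)

lemma conv_scale_form:
  assumes \<beta>: "fform \<beta>" shows "conv (scale_form x \<beta>) P Q = kscale (mconst x) (conv \<beta> P Q)"
proof (rule additive_ext2[of "\<lambda>P Q. conv (scale_form x \<beta>) P Q" "\<lambda>P Q. kscale (mconst x) (conv \<beta> P Q)"])
  note b = fform_biadd[OF \<beta>] and b' = fform_biadd[OF fform_scale[OF \<beta>]]
  show "conv (scale_form x \<beta>) (Poly_Mapping.single a v) (Poly_Mapping.single c w) =
    kscale (mconst x) (conv \<beta> (Poly_Mapping.single a v) (Poly_Mapping.single c w))" for a v c w
    by (simp only: conv_single[OF b] conv_single[OF b'] kscale_single add_0) (simp only: scale_form_def)
qed (simp_all add: kscale_add conv_add_left[OF fform_biadd[OF \<beta>]] conv_add_right[OF fform_biadd[OF \<beta>]]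
    conv_add_left[OF fform_biadd[OF fform_scale[OF \<beta>]]] conv_add_right[OF fform_biadd[OF fform_scale[OF \<beta>]]])

lemma conv_sum_left: "fform \<beta> \<Longrightarrow> conv \<beta> (sum f I) Q = (\<Sum>i\<in>I. conv \<beta> (f i) Q)"
  by (rule additive_sum[of "\<lambda>P. conv \<beta> P Q"]) (rule conv_add_left[OF fform_biadd])

lemma conv_sum_right: "fform \<beta> \<Longrightarrow> conv \<beta> P (sum f I) = (\<Sum>i\<in>I. conv \<beta> P (f i))"
  by (rule additive_sum[of "\<lambda>Q. conv \<beta> P Q"]) (rule conv_add_right[OF fform_biadd])

text \<open>On constant vectors coefficients are read off monomial by monomial. This reduces
  uniqueness of polynomial coordinates to uniqueness over the field.\<close>

lemma lookup_pscale_const: "Poly_Mapping.lookup (pscale y (mconst v)) a = act v (\<iota> (Poly_Mapping.lookup y a))"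
proof (rule additive_ext1[of "\<lambda>y. Poly_Mapping.lookup (pscale y (mconst v)) a" "\<lambda>y. act v (\<iota> (Poly_Mapping.lookup y a))"])
  show "Poly_Mapping.lookup (pscale (Poly_Mapping.single b x) (mconst v)) a = act v (\<iota> (Poly_Mapping.lookup (Poly_Mapping.single b x) a))" for b x
    by (simp add: pscale_single lookup_single when_def)
qed (simp_all add: pscale_add lookup_add act_add)

lemma lookup_kscale_const: "Poly_Mapping.lookup (kscale y (mconst c)) a = \<iota> (Poly_Mapping.lookup y a) * c"
proof (rule additive_ext1[of "\<lambda>y. Poly_Mapping.lookup (kscale y (mconst c)) a" "\<lambda>y. \<iota> (Poly_Mapping.lookup y a) * c"])
  show "Poly_Mapping.lookup (kscale (Poly_Mapping.single b x) (mconst c)) a = \<iota> (Poly_Mapping.lookup (Poly_Mapping.single b x) a) * c" for b x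
    by (simp add: kscale_single lookup_single when_def)
qed (simp_all add: kscale_add lookup_add distrib_right)

end

text \<open>Keeps the two orders of each mixed pair together, so that a double sum can be matched
  with \<open>quadric\<close> without halving.\<close>

lemma sum_square_split:
  fixes F :: "nat \<Rightarrow> nat \<Rightarrow> 'a::ab_group_add"
  shows "(\<Sum>i<N. \<Sum>j<N. F i j) = (\<Sum>i<N. F i i) + (\<Sum>i<N. \<Sum>j<i. F j i + F i j)"
  by (induction N) (simp_all add: sum.distrib algebra_simps)

section \<open>Coordinates of endomorphisms and forms\<close>

text \<open>\<open>t\<close> is a second basis of \<open>EndK\<close>, unrelated to
  \<open>E\<close>. The locale is used with \<open>t\<close> equal to \<open>E\<close> for
  \<open>G\<close>, and with a lattice basis of \<open>T_tilde\<close> for \<rho>.\<close>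

locale end_coords = hermitian_lattice_basis val p \<iota> \<sigma> \<epsilon> B act n L h r E
  for val :: "'f::field \<Rightarrow> int" and p :: nat and \<iota> :: "'f \<Rightarrow> 'k::ring_1" and \<sigma> :: "'k \<Rightarrow> 'k" and \<epsilon> :: int
    and B :: "'k set" and act :: "'v::ab_group_add \<Rightarrow> 'k \<Rightarrow> 'v" and n :: nat and L :: "'v set"
    and h :: "'v \<Rightarrow> 'v \<Rightarrow> 'k" and r :: nat and E :: "nat \<Rightarrow> 'v \<Rightarrow> 'v" +
  fixes N :: nat and t :: "nat \<Rightarrow> 'v \<Rightarrow> 'v"
  assumes basis_t: "is_basis UNIV scale_End N t EndK"
begin

abbreviation cE where "cE \<equiv> coords scale_End N t"

text \<open>Structure constants of composition and adjunction, and the coordinates of the identity.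
  The last ones can fail to be integral when \<open>t\<close> is a basis of
  \<open>T_tilde\<close>.\<close>

definition cc where "cc i j = cE (t i \<circ> t j)"
definition tt where "tt i = cE (adj (t i))"
definition ee where "ee = cE id"

lemma t_EndK: "i < N \<Longrightarrow> t i \<in> EndK"
  by (rule is_basis_mem[OF scale_End.vector_space_axioms basis_t])

lemma cE_sum: "X \<in> EndK \<Longrightarrow> (\<Sum>i<N. scale_End (cE X i) (t i)) = X"
  by (rule coords_sum(1)[OF basis_t])

lemma cE_lin:
  assumes "\<And>i. i \<in> I \<Longrightarrow> X i \<in> EndK" and l: "l < N" and "finite I"
  shows "cE (\<Sum>i\<in>I. scale_End (x i) (X i)) l = (\<Sum>i\<in>I. x i * cE (X i) l)"
  using assms(3,1)
proof (induction I)
  case empty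
  have "cE 0 l = 0" by (rule coords_eqI[OF basis_t _ l]) (simp only: scale_End.scale_zero_left sum.neutral_const)
  then show ?case by (simp only: sum.empty)
next
  case (insert i I)
  have e: "(\<Sum>i\<in>insert i I. scale_End (x i) (X i)) = scale_End (x i) (X i) + scale_End 1 (\<Sum>i\<in>I. scale_End (x i) (X i))"
    by (simp only: sum.insert[OF insert.hyps] scale_End.scale_one)
  have S: "(\<Sum>i\<in>I. scale_End (x i) (X i)) \<in> EndK" using insert.prems by (intro EndK_Sum EndK_scale) auto
  have Xi: "X i \<in> EndK" using insert.prems by simp
  have "cE (\<Sum>i\<in>I. scale_End (x i) (X i)) l = (\<Sum>i\<in>I. x i * cE (X i) l)"
    by (rule insert.IH) (auto intro: insert.prems)
  then show ?case unfolding e coords_lin[OF scale_End.vector_space_axioms basis_t Xi S l]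
    by (simp only: sum.insert[OF insert.hyps] mult_1)
qed

lemma cE_comp:
  assumes X: "X \<in> EndK" and Y: "Y \<in> EndK" and l: "l < N"
  shows "cE (X \<circ> Y) l = (\<Sum>i<N. \<Sum>j<N. cc i j l * cE X i * cE Y j)"
proof -
  have e: "X \<circ> Y = (\<Sum>ij\<in>{..<N} \<times> {..<N}. scale_End (cE X (fst ij) * cE Y (snd ij)) (t (fst ij) \<circ> t (snd ij)))"
  proof
    fix v
    have "X (Y v) = (\<Sum>i<N. act (t i (Y v)) (\<iota> (cE X i)))"
      by (subst (1) cE_sum[OF X, symmetric]) (simp add: sum_fun scale_End_def)
    also have "\<dots> = (\<Sum>i<N. act (t i (\<Sum>j<N. act (t j v) (\<iota> (cE Y j)))) (\<iota> (cE X i)))"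
      by (subst (1) cE_sum[OF Y, symmetric]) (simp add: sum_fun scale_End_def)
    also have "\<dots> = (\<Sum>i<N. \<Sum>j<N. act (t i (t j v)) (\<iota> (cE X i * cE Y j)))"
      by (intro sum.cong refl) (simp add: EndK_sum[OF t_EndK] EndK_act[OF t_EndK] act_sum act_iota_commute[of _ "cE Y _" "\<iota> (cE X _)"])
    finally show "(X \<circ> Y) v = (\<Sum>ij\<in>{..<N} \<times> {..<N}. scale_End (cE X (fst ij) * cE Y (snd ij)) (t (fst ij) \<circ> t (snd ij))) v"
      by (simp add: sum_fun scale_End_def sum.cartesian_product case_prod_beta)
  qed
  have "cE (X \<circ> Y) l = (\<Sum>ij\<in>{..<N} \<times> {..<N}. cE X (fst ij) * cE Y (snd ij) * cE (t (fst ij) \<circ> t (snd ij)) l)"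
    unfolding e by (rule cE_lin[OF _ l]) (auto intro!: EndK_comp t_EndK)
  moreover have "(\<Sum>ij\<in>{..<N} \<times> {..<N}. cE X (fst ij) * cE Y (snd ij) * cE (t (fst ij) \<circ> t (snd ij)) l) =
      (\<Sum>i<N. \<Sum>j<N. cc i j l * cE X i * cE Y j)"
    unfolding sum.cartesian_product cc_def by (rule sum.cong) (auto simp: mult.commute mult.left_commute)
  ultimately show ?thesis by (rule trans)
qed

lemma cE_adj:
  assumes X: "X \<in> EndK" and l: "l < N"
  shows "cE (adj X) l = (\<Sum>k<N. cE X k * tt k l)"
proof -
  have "adj X = adj (\<Sum>i<N. scale_End (cE X i) (t i))" by (rule arg_cong[OF cE_sum[OF X, symmetric]])
  also have "\<dots> = (\<Sum>i<N. adj (scale_End (cE X i) (t i)))"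
    by (rule adj_sum) (auto intro: EndK_scale t_EndK)
  also have "\<dots> = (\<Sum>i<N. scale_End (cE X i) (adj (t i)))"
    by (rule sum.cong[OF refl]) (auto intro: adj_scale t_EndK)
  finally have e: "adj X = (\<Sum>i<N. scale_End (cE X i) (adj (t i)))" .
  have "cE (adj X) l = (\<Sum>i<N. cE X i * cE (adj (t i)) l)"
    unfolding e by (rule cE_lin[OF _ l]) (auto intro: adj_EndK t_EndK)
  then show ?thesis by (simp only: tt_def)
qed

lemma cE_t: "i < N \<Longrightarrow> j < N \<Longrightarrow> cE (t i) j = (if i = j then 1 else 0)"
  by (rule coords_eqI[OF basis_t]) (simp_all add: if_distrib[of "\<lambda>x. scale_End x _"] sum.delta cong: if_cong)

sublocale star_coords N cc tt ee
proof
  fix i j k l assume "i < N" "j < N" "k < N" "l < N"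
  then have e: "t i \<in> EndK" "t j \<in> EndK" "t k \<in> EndK" and l: "l < N" and k: "k < N" and i: "i < N" by (auto intro: t_EndK)
  have "cE ((t i \<circ> t j) \<circ> t k) l = (\<Sum>m<N. cc i j m * cc m k l)"
    using k by (subst cE_comp[OF EndK_comp[OF e(1,2)] e(3) l]) (simp add: cE_t sum_delta_mult cc_def[of i j, symmetric] mult_ac)
  moreover have "cE (t i \<circ> (t j \<circ> t k)) l = (\<Sum>m<N. cc j k m * cc i m l)"
    using i by (subst cE_comp[OF e(1) EndK_comp[OF e(2,3)] l])
      (simp add: cE_t cc_def[of j k, symmetric] mult_ac if_distrib[of "\<lambda>x. x * _"] if_distrib[of "\<lambda>x. _ * x"] sum.delta' sum.delta cong: if_cong, subst sum.swap, simp add: sum.delta sum.delta' cong: if_cong)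
  ultimately show "(\<Sum>m<N. cc i j m * cc m k l) = (\<Sum>m<N. cc j k m * cc i m l)" by (simp add: comp_assoc)
next
  fix j k assume j: "j < N" and k: "k < N"
  show "(\<Sum>i<N. ee i * cc i j k) = (if j = k then 1 else 0)"
    using cE_comp[OF EndK_id t_EndK[OF j] k] j k by (simp add: cE_t sum_delta_mult ee_def mult_ac)
next
  fix i k assume i: "i < N" and k: "k < N"
  show "(\<Sum>j<N. ee j * cc i j k) = (if i = k then 1 else 0)"
    using cE_comp[OF t_EndK[OF i] EndK_id k] i k
    by (subst (asm) sum.swap) (simp add: cE_t sum_delta_mult ee_def mult_ac)
next
  fix i j l assume i: "i < N" and j: "j < N" and l: "l < N"
  have "cE (adj (t i \<circ> t j)) l = (\<Sum>k<N. cc i j k * tt k l)"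
    using cE_adj[OF EndK_comp[OF t_EndK[OF i] t_EndK[OF j]] l] by (simp add: cc_def)
  moreover have "cE (adj (t j) \<circ> adj (t i)) l = (\<Sum>p<N. \<Sum>q<N. cc p q l * tt j p * tt i q)"
    using cE_comp[OF adj_EndK[OF t_EndK[OF j]] adj_EndK[OF t_EndK[OF i]] l] by (simp add: tt_def)
  ultimately show "(\<Sum>k<N. cc i j k * tt k l) = (\<Sum>p<N. \<Sum>q<N. cc p q l * tt j p * tt i q)"
    using adj_comp[OF t_EndK[OF i] t_EndK[OF j]] by simp
next
  fix k assume "k < N"
  then show "(\<Sum>i<N. ee i * tt i k) = ee k" using cE_adj[OF EndK_id, of k] by (simp add: adj_id ee_def)
qed

end

text \<open>\<open>M\<close> is the dimension of the range of \<psi>, and \<open>Z0\<close> puts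
  every \<open>\<phi> X\<close> into this range. The preimages \<open>S\<close> are parameters so
  that they can be chosen inside \<open>T_tilde\<close>, where the section they define is
  integral.\<close>

locale hermitian_coords = end_coords val p \<iota> \<sigma> \<epsilon> B act n L h r E N t
  for val :: "'f::field \<Rightarrow> int" and p :: nat and \<iota> :: "'f \<Rightarrow> 'k::ring_1" and \<sigma> :: "'k \<Rightarrow> 'k" and \<epsilon> :: int
    and B :: "'k set" and act :: "'v::ab_group_add \<Rightarrow> 'k \<Rightarrow> 'v" and n :: nat and L :: "'v set"
    and h :: "'v \<Rightarrow> 'v \<Rightarrow> 'k" and r :: nat and E :: "nat \<Rightarrow> 'v \<Rightarrow> 'v"
    and N :: nat and t :: "nat \<Rightarrow> 'v \<Rightarrow> 'v" +
  fixes M :: nat and s :: "nat \<Rightarrow> 'v \<Rightarrow> 'v \<Rightarrow> 'k" and Z0 :: "'v \<Rightarrow> 'v" and S :: "nat \<Rightarrow> 'v \<Rightarrow> 'v"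
  assumes basis_s: "is_basis UNIV scale_form M s (\<psi> ` EndK)"
    and Z0: "Z0 \<in> EndK" "h = \<psi> Z0"
    and S: "\<And>k. k < M \<Longrightarrow> S k \<in> EndK \<and> \<psi> (S k) = s k"
begin

abbreviation cS where "cS \<equiv> coords scale_form M s"

definition aa where "aa i = cS (\<psi> (t i))"
definition sec where "sec k = cE (S k)"
definition bs where "bs i = cS (\<phi> (t i))"

lemma s_\<psi>: "k < M \<Longrightarrow> s k \<in> \<psi> ` EndK"
  using S[of k] by (auto intro!: image_eqI[of _ _ "S k"])

lemma s_fform: "k < M \<Longrightarrow> fform (s k)"
  using s_\<psi>[of k] fform_\<psi> by auto

lemma cS_sum: "f \<in> \<psi> ` EndK \<Longrightarrow> (\<Sum>i<M. scale_form (cS f i) (s i)) = f"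
  by (rule coords_sum(1)[OF basis_s])

lemma cS_lin:
  assumes "\<And>i. i \<in> I \<Longrightarrow> X i \<in> EndK" and l: "l < M" and "finite I"
  shows "cS (\<psi> (\<Sum>i\<in>I. scale_End (x i) (X i))) l = (\<Sum>i\<in>I. x i * cS (\<psi> (X i)) l)"
  using assms(3,1)
proof (induction I)
  case empty
  have "cS 0 l = 0" by (rule coords_eqI[OF basis_s _ l]) (simp only: scale_form.scale_zero_left sum.neutral_const)
  then show ?case by (simp only: sum.empty \<psi>_zero)
next
  case (insert i I)
  let ?S = "\<Sum>i\<in>I. scale_End (x i) (X i)"
  have S: "?S \<in> EndK" using insert.prems by (intro EndK_Sum EndK_scale) auto
  have Xi: "X i \<in> EndK" using insert.prems by simp
  have "\<psi> (\<Sum>i\<in>insert i I. scale_End (x i) (X i)) = scale_form (x i) (\<psi> (X i)) + scale_form 1 (\<psi> ?S)"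
    by (simp only: sum.insert[OF insert.hyps] \<psi>_plus[OF EndK_scale[OF Xi] S] \<psi>_scale scale_form.scale_one)
  then have "cS (\<psi> (\<Sum>i\<in>insert i I. scale_End (x i) (X i))) l = x i * cS (\<psi> (X i)) l + 1 * cS (\<psi> ?S) l"
    using coords_lin[OF scale_form.vector_space_axioms basis_s imageI[OF Xi] imageI[OF S] l, of "x i" 1] by (simp only:)
  moreover have "cS (\<psi> ?S) l = (\<Sum>i\<in>I. x i * cS (\<psi> (X i)) l)" by (rule insert.IH) (auto intro: insert.prems)
  ultimately show ?case by (simp only: sum.insert[OF insert.hyps] mult_1)
qed

lemma cS_\<psi>: assumes X: "X \<in> EndK" and l: "l < M" shows "cS (\<psi> X) l = (\<Sum>i<N. cE X i * aa i l)"
proof -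
  have "cS (\<psi> (\<Sum>i<N. scale_End (cE X i) (t i))) l = (\<Sum>i<N. cE X i * cS (\<psi> (t i)) l)"
    by (rule cS_lin[OF _ l]) (auto intro: t_EndK)
  then show ?thesis by (simp only: cE_sum[OF X] aa_def)
qed

lemma cS_s: "i < M \<Longrightarrow> j < M \<Longrightarrow> cS (s i) j = (if i = j then 1 else 0)"
  by (rule coords_eqI[OF basis_s]) (simp_all add: if_distrib[of "\<lambda>x. scale_form x _"] sum.delta cong: if_cong)

sublocale star_forms N cc tt ee M aa sec
proof
  fix k k' assume k: "k < M" "k' < M"
  have X: "S k \<in> EndK" "\<psi> (S k) = s k" using S[OF k(1)] by auto
  show "(\<Sum>i<N. sec k i * aa i k') = (if k = k' then 1 else 0)"
    using cS_\<psi>[OF X(1) k(2)] cS_s[OF k] by (simp add: X sec_def)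
qed

end

section \<open>The dimension of \<open>G\<close>\<close>

text \<open>Linear forms without common zero besides 0 contain a dual basis. Some form has a nonzero
  last coefficient; subtracting multiples of it reduces to the forms with last coefficient 0, for
  which separation on the remaining coordinates survives.\<close>

lemma dual_span:
  fixes W :: "(nat \<Rightarrow> 'f::field) set"
  assumes lin: "\<And>a b x y. a \<in> W \<Longrightarrow> b \<in> W \<Longrightarrow> (\<lambda>i. x * a i + y * b i) \<in> W" and zero: "(\<lambda>_. 0) \<in> W"
    and sep: "\<And>x. (\<And>a. a \<in> W \<Longrightarrow> (\<Sum>i<m. a i * x i) = 0) \<Longrightarrow> (\<And>i. i < m \<Longrightarrow> x i = 0)"
  shows "k < m \<Longrightarrow> \<exists>a\<in>W. \<forall>i<m. a i = (if i = k then 1 else 0)"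
  using lin zero sep
proof (induction m arbitrary: W k)
  case (Suc m)
  note lin = Suc.prems(2) and zero = Suc.prems(3) and sep = Suc.prems(4)
  have "\<exists>a\<in>W. a m \<noteq> 0"
  proof (rule ccontr)
    assume n: "\<not> (\<exists>a\<in>W. a m \<noteq> 0)"
    have "(\<lambda>i. if i = m then 1 else 0 :: 'f) m = 0"
    proof (rule sep[of "\<lambda>i. if i = m then 1 else 0" m])
      show "(\<Sum>i<Suc m. a i * (if i = m then 1 else 0)) = 0" if "a \<in> W" for a using n that by simp
    qed simp
    then show False by simp
  qed
  then obtain a0 where a0: "a0 \<in> W" "a0 m \<noteq> 0" by blast
  define a where "a i = (1 / a0 m) * a0 i + 0 * a0 i" for i
  have aW: "a \<in> W" unfolding a_def by (rule lin[OF a0(1) a0(1)])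
  have am: "a m = 1" using a0 by (simp add: a_def)
  define W' where "W' = {b \<in> W. b m = 0}"
  have red: "(\<lambda>i. 1 * b i + (- b m) * a i) \<in> W'" if "b \<in> W" for b
    using lin[OF that aW, of 1 "- b m"] am by (simp add: W'_def)
  have IH: "\<exists>b\<in>W'. \<forall>i<m. b i = (if i = k then 1 else 0)" if k: "k < m" for k
  proof (rule Suc.IH[OF k])
    show "(\<lambda>i. x * u i + y * v i) \<in> W'" if "u \<in> W'" "v \<in> W'" for u v x y
      using lin that by (simp add: W'_def)
    show "(\<lambda>_. 0) \<in> W'" using zero by (simp add: W'_def)
    fix x i assume x: "\<And>b. b \<in> W' \<Longrightarrow> (\<Sum>i<m. b i * x i) = 0" and i: "i < m"
    \<comment> \<open>The last entry is chosen so that \<open>a\<close> annihilates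
      \<open>x'\<close>; a common zero of \<open>W'\<close> thus extends to a common zero of
      \<open>W\<close>.\<close>
    define x' where "x' j = (if j = m then - (\<Sum>i<m. a i * x i) else x j)" for j
    have "x' i = 0"
    proof (rule sep[of x' i])
      fix b assume b: "b \<in> W"
      have "(\<Sum>i<m. (1 * b i + (- b m) * a i) * x i) = 0" by (rule x[OF red[OF b]])
      then have "(\<Sum>i<m. b i * x i) = b m * (\<Sum>i<m. a i * x i)"
        by (simp add: distrib_right sum.distrib sum_distrib_left sum_subtractf left_diff_distrib mult.assoc)
      then show "(\<Sum>i<Suc m. b i * x' i) = 0" by (simp add: x'_def)
    qed (use i in simp)
    then show "x i = 0" using i by (simp add: x'_def)
  qed
  show ?case
  proof (cases "k = m")
    case False
    then have "k < m" using Suc.prems(1) by simp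
    from IH[OF this] obtain b where b: "b \<in> W'" "\<forall>i<m. b i = (if i = k then 1 else 0)" by blast
    then show ?thesis using False by (intro bexI[of _ b]) (auto simp: W'_def less_Suc_eq)
  next
    case True
    have "\<exists>b. \<forall>k<m. b k \<in> W' \<and> (\<forall>i<m. b k i = (if i = k then 1 else 0))"
    proof -
      have "\<forall>k. \<exists>b. k < m \<longrightarrow> b \<in> W' \<and> (\<forall>i<m. b i = (if i = k then 1 else 0))" using IH by blast
      from choice[OF this] show ?thesis by blast
    qed
    then obtain b where b: "\<And>k. k < m \<Longrightarrow> b k \<in> W'" "\<And>k i. k < m \<Longrightarrow> i < m \<Longrightarrow> b k i = (if i = k then 1 else 0)" by blast
    have S: "l \<le> m \<Longrightarrow> (\<lambda>i. \<Sum>k<l. a k * b k i) \<in> W'" for l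
    proof (induction l)
      case 0
      show ?case using zero by (simp add: W'_def)
    next
      case (Suc l)
      then have "(\<lambda>i. 1 * (\<Sum>k<l. a k * b k i) + a l * b l i) \<in> W"
        using b(1)[of l] by (intro lin) (auto simp: W'_def)
      moreover have "(\<Sum>k<l. a k * b k m) = 0" using b(1) Suc.prems by (auto simp: W'_def intro!: sum.neutral)
      ultimately show ?case using b(1)[of l] Suc.prems by (simp add: W'_def)
    qed
    \<comment> \<open>For the last index, the first \<open>m\<close> coefficients of
      \<open>a\<close> are cleared with the dual vectors already found.\<close>
    define u where "u i = 1 * a i + (- 1) * (\<Sum>k<m. a k * b k i)" for i
    have SW: "(\<lambda>i. \<Sum>k<m. a k * b k i) \<in> W" "(\<Sum>k<m. a k * b k m) = 0" using S[of m] by (auto simp: W'_def)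
    have "u \<in> W" unfolding u_def by (rule lin[OF aW SW(1)])
    moreover have "u i = (if i = k then 1 else 0)" if "i < Suc m" for i
    proof (cases "i = m")
      case True
      then show ?thesis using SW(2) am \<open>k = m\<close> by (simp add: u_def)
    next
      case False
      then have i: "i < m" using that by simp
      have "(\<Sum>k<m. a k * b k i) = (\<Sum>k<m. a k * (if i = k then 1 else 0))"
        using b(2) i by (intro sum.cong refl) simp
      then show ?thesis using i \<open>k = m\<close> by (simp add: u_def sum_delta_mult)
    qed
    ultimately show ?thesis by blast
  qed
qed simp

context hermitian_lattice
begin

lemma vector_space_K: "vector_space (\<lambda>a x. \<iota> a * x)"
  by unfold_locales (simp_all add: distrib_left distrib_right mult.assoc)

text \<open>\<open>K\<close> is finite-dimensional over the base field in each of the four cases, so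
  a nonzero element has a nonzero coordinate or projection.\<close>

lemma functional_sep:
  assumes c: "(c :: 'k) \<noteq> 0"
  shows "\<exists>\<xi> :: 'k \<Rightarrow> 'f. (\<forall>x y. \<xi> (x + y) = \<xi> x + \<xi> y) \<and> (\<forall>a x. \<xi> (\<iota> a * x) = a * \<xi> x) \<and> \<xi> c \<noteq> 0"
proof -
  have *: ?thesis if "has_dim \<iota> d" for d
  proof -
    obtain b :: "nat \<Rightarrow> 'k" where b: "is_basis UNIV (\<lambda>a x. \<iota> a * x) d b UNIV" using \<open>has_dim \<iota> d\<close> by (auto simp: has_dim_def)
    let ?c = "coords (\<lambda>a x. \<iota> a * x) d b"
    have "\<exists>j<d. ?c c j \<noteq> 0"
    proof (rule ccontr)
      assume "\<not> ?thesis"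
      then have "(\<Sum>i<d. \<iota> (?c c i) * b i) = 0" by (intro sum.neutral) auto
      then show False using coords_sum(1)[OF b, of c] c by simp
    qed
    then obtain j where j: "j < d" "?c c j \<noteq> 0" by blast
    have l: "?c (\<iota> x * u + \<iota> y * v) j = x * ?c u j + y * ?c v j" for x y u v
      by (rule coords_lin[OF vector_space_K b _ _ j(1)]) auto
    show ?thesis
    proof (intro exI[of _ "\<lambda>x. ?c x j"] conjI allI)
      show "?c (x + y) j = ?c x j + ?c y j" for x y using l[of 1 x 1 y] by simp
      show "?c (\<iota> a * x) j = a * ?c x j" for a x using l[of a x 0 x] by simp
    qed (rule j(2))
  qed
  show ?thesis using K_cases
  proof (elim disjE)
    assume "case_base \<iota> \<sigma>"
    then have bij: "bij \<iota>" by (simp add: case_base_def)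
    have i: "inv_into UNIV \<iota> (\<iota> a) = a" "\<iota> (inv_into UNIV \<iota> x) = x" for a x
      using bij by (simp_all add: bij_is_inj bij_is_surj surj_f_inv_f)
    show ?thesis
    proof (intro exI[of _ "inv_into UNIV \<iota>"] conjI allI)
      show "inv_into UNIV \<iota> (x + y) = inv_into UNIV \<iota> x + inv_into UNIV \<iota> y" for x y using i(1)[of "inv_into UNIV \<iota> x + inv_into UNIV \<iota> y"] by (simp add: i(2))
      show "inv_into UNIV \<iota> (\<iota> a * x) = a * inv_into UNIV \<iota> x" for a x using i(1)[of "a * inv_into UNIV \<iota> x"] by (simp add: i(2))
      show "inv_into UNIV \<iota> c \<noteq> 0" using i(2)[of c] c by auto
    qed
  next
    assume "case_split \<iota> \<sigma>"
    then obtain pr1 pr2 :: "'k \<Rightarrow> 'f" where b: "bij (\<lambda>x. (pr1 x, pr2 x))"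
      and pa: "\<forall>x y. pr1 (x + y) = pr1 x + pr1 y \<and> pr2 (x + y) = pr2 x + pr2 y"
      and pm: "\<forall>x y. pr1 (x * y) = pr1 x * pr1 y \<and> pr2 (x * y) = pr2 x * pr2 y"
      and pi: "\<forall>a. pr1 (\<iota> a) = a \<and> pr2 (\<iota> a) = a"
      unfolding case_split_def by (elim exE conjE) (rule that)
    have "pr1 0 = 0" "pr2 0 = 0" using pi[rule_format, of 0] by simp_all
    then have "pr1 c \<noteq> 0 \<or> pr2 c \<noteq> 0" using b c unfolding bij_def inj_def by (metis)
    then show ?thesis
    proof
      assume "pr1 c \<noteq> 0"
      then show ?thesis using pa pm pi by (intro exI[of _ pr1]) simp
    next
      assume "pr2 c \<noteq> 0"
      then show ?thesis using pa pm pi by (intro exI[of _ pr2]) simp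
    qed
  next
    assume "case_quadratic \<iota> \<sigma>"
    then have "has_dim \<iota> 2" by (simp only: case_quadratic_def)
    then show ?thesis by (rule *)
  next
    assume "case_quaternion \<iota> \<sigma>"
    then have "has_dim \<iota> 4" by (simp only: case_quaternion_def)
    then show ?thesis by (rule *)
  qed
qed

lemma map_functional_kscale:
  assumes xi: "\<And>x y. \<xi> (x + y) = \<xi> x + \<xi> y" "\<And>a x. \<xi> (\<iota> a * x) = a * (\<xi> x :: 'f)"
  shows "Poly_Mapping.map \<xi> (kscale y (mconst c)) = y * mconst (\<xi> c)"
proof (rule poly_mapping_eqI)
  fix a
  have "y * mconst (\<xi> c) = Poly_Mapping.map ((*) (\<xi> c)) y" by (simp add: mult_map_scale_conv_mult mult.commute)
  then show "Poly_Mapping.lookup (Poly_Mapping.map \<xi> (kscale y (mconst c))) a = Poly_Mapping.lookup (y * mconst (\<xi> c)) a"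
    by (simp add: lookup_map additive_zero[of \<xi>, OF xi(1)] lookup_kscale_const xi(2) mult.commute)
qed

end

lemma Sup_enat_eq:
  assumes "enat d \<in> X" "\<And>x. x \<in> X \<Longrightarrow> x \<le> enat d"
  shows "Sup X = enat d"
  by (rule antisym) (use assms in \<open>auto intro: Sup_least Sup_upper\<close>)

context end_coords
begin

abbreviation lc :: "(nat \<Rightarrow> 'f mpol) \<Rightarrow> 'v mpol \<Rightarrow> 'v mpol" where "lc \<equiv> lin_comb N t"

lemma lc_cong: "(\<And>i. i < N \<Longrightarrow> y i = z i) \<Longrightarrow> lc y P = lc z P"
  unfolding lin_comb_def by (intro sum.cong refl) simp

lemma lc_add: "lc (\<lambda>i. y i + z i) P = lc y P + lc z P"
  by (simp add: lin_comb_def pscale_add sum.distrib)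

lemma lc_scale: "lc (\<lambda>i. x * y i) P = pscale x (lc y P)"
  by (simp add: lin_comb_def pscale_mult pscale_sum)

lemma lc_const:
  assumes X: "X \<in> EndK" shows "lc (\<lambda>i. mconst (cE X i)) P = Poly_Mapping.map X P"
proof -
  have "Poly_Mapping.map (\<Sum>i<N. scale_End (cE X i) (t i)) P = (\<Sum>i<N. Poly_Mapping.map (scale_End (cE X i) (t i)) P)"
    by (rule map_sum_fun) (auto intro: EndK_scale t_EndK)
  also have "\<dots> = (\<Sum>i<N. pscale (mconst (cE X i)) (Poly_Mapping.map (t i) P))"
    by (rule sum.cong[OF refl]) (auto intro: map_scale_End t_EndK)
  finally show ?thesis unfolding cE_sum[OF X] lin_comb_def by (rule sym)
qed

lemma map_id: "Poly_Mapping.map id P = P"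
  by (rule poly_mapping_eqI) (simp add: lookup_map)

lemma lc_unit: "lc (\<lambda>i. mconst (ee i)) P = P"
  unfolding ee_def lc_const[OF EndK_id] by (rule map_id)

text \<open>Composition of generic endomorphisms is multiplication in coordinates. This connects the
  inverses in \<open>M_star\<close> and \<open>G_points\<close> with \<open>mul\<close>.\<close>

lemma lc_comp: "lc y (lc z P) = lc (mul mconst y z) P"
proof -
  have "lc y (lc z P) = (\<Sum>i<N. \<Sum>j<N. pscale (y i) (pscale (z j) (Poly_Mapping.map (t i) (Poly_Mapping.map (t j) P))))"
    unfolding lin_comb_def
    by (intro sum.cong refl) (simp add: map_EndK_sum t_EndK map_EndK_pscale pscale_sum)
  also have "\<dots> = (\<Sum>i<N. \<Sum>j<N. pscale (y i * z j) (lc (\<lambda>k. mconst (cc i j k)) P))"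
  proof (intro sum.cong refl)
    fix i j assume "i \<in> {..<N}" "j \<in> {..<N}"
    then have e: "t i \<in> EndK" "t j \<in> EndK" by (auto intro: t_EndK)
    have "Poly_Mapping.map (t i) (Poly_Mapping.map (t j) P) = lc (\<lambda>k. mconst (cc i j k)) P"
      unfolding cc_def lc_const[OF EndK_comp[OF e]] by (rule map_EndK_comp[OF e])
    then show "pscale (y i) (pscale (z j) (Poly_Mapping.map (t i) (Poly_Mapping.map (t j) P))) =
        pscale (y i * z j) (lc (\<lambda>k. mconst (cc i j k)) P)" by (simp only: pscale_mult)
  qed
  also have "\<dots> = (\<Sum>i<N. \<Sum>j<N. \<Sum>k<N. pscale (mconst (cc i j k) * y i * z j) (Poly_Mapping.map (t k) P))"
    unfolding lin_comb_def pscale_sum pscale_mult[symmetric] by (simp only: mult_ac)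
  also have "\<dots> = (\<Sum>k<N. \<Sum>i<N. \<Sum>j<N. pscale (mconst (cc i j k) * y i * z j) (Poly_Mapping.map (t k) P))"
    by (rule sum_rotate3[symmetric])
  also have "\<dots> = lc (mul mconst y z) P"
    unfolding lin_comb_def mul_def pscale_sum ..
  finally show ?thesis .
qed

lemma lc_inj:
  assumes eq: "\<And>P. lc y P = lc z P" and k: "k < N"
  shows "y k = z k"
proof (rule poly_mapping_eqI)
  fix a
  have "(\<Sum>i<N. scale_End (Poly_Mapping.lookup (y i) a) (t i)) = (\<Sum>i<N. scale_End (Poly_Mapping.lookup (z i) a) (t i))"
  proof
    fix v
    have l: "Poly_Mapping.lookup (lc y (mconst v)) a = (\<Sum>i<N. scale_End (Poly_Mapping.lookup (y i) a) (t i)) v" for y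
      by (simp add: lin_comb_def lookup_sum map_single EndK_0 t_EndK lookup_pscale_const sum_fun scale_End_def)
    show "(\<Sum>i<N. scale_End (Poly_Mapping.lookup (y i) a) (t i)) v = (\<Sum>i<N. scale_End (Poly_Mapping.lookup (z i) a) (t i)) v"
      unfolding l[symmetric] eq ..
  qed
  note e = this
  show "Poly_Mapping.lookup (y k) a = Poly_Mapping.lookup (z k) a"
    by (rule is_basis_unique[OF basis_t, of "\<lambda>i. Poly_Mapping.lookup (y i) a" "\<lambda>i. Poly_Mapping.lookup (z i) a" k])
      (rule UNIV_I e k)+
qed

lemma lc_inverse_coords:
  assumes "\<And>P. lc y (lc z P) = pscale x P" and "k < N"
  shows "mul mconst y z k = x * mconst (ee k)"
  by (rule lc_inj[of "mul mconst y z" "\<lambda>k. x * mconst (ee k)", OF _ assms(2)])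
    (simp only: lc_comp[symmetric] assms(1) lc_scale lc_unit)

lemma conv_h_lc_left: "conv h (lc y P) Q = conv h P (lc (star mconst y) Q)"
proof -
  have "conv h (lc y P) Q = (\<Sum>i<N. kscale (y i) (conv h (Poly_Mapping.map (t i) P) (Poly_Mapping.map id Q)))"
    unfolding lin_comb_def conv_sum_left[OF fform_h] conv_pscale_left[OF fform_h] map_id ..
  also have "\<dots> = (\<Sum>i<N. kscale (y i) (conv h (Poly_Mapping.map id P) (Poly_Mapping.map (adj (t i)) Q)))"
  proof (intro sum.cong refl)
    fix i assume "i \<in> {..<N}"
    then have e: "t i \<in> EndK" by (auto intro: t_EndK)
    show "kscale (y i) (conv h (Poly_Mapping.map (t i) P) (Poly_Mapping.map id Q)) =
      kscale (y i) (conv h (Poly_Mapping.map id P) (Poly_Mapping.map (adj (t i)) Q))"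
      unfolding conv_map[OF fform_h e EndK_id] conv_map[OF fform_h EndK_id adj_EndK[OF e]]
      by (simp add: h_adj[OF e])
  qed
  also have "\<dots> = (\<Sum>i<N. conv h P (pscale (y i) (lc (\<lambda>k. mconst (tt i k)) Q)))"
    unfolding map_id conv_pscale_right[OF fform_h] tt_def
    by (intro sum.cong refl) (simp add: lc_const adj_EndK t_EndK)
  also have "\<dots> = conv h P (\<Sum>i<N. pscale (y i) (lc (\<lambda>k. mconst (tt i k)) Q))"
    by (rule conv_sum_right[OF fform_h, symmetric])
  also have "(\<Sum>i<N. pscale (y i) (lc (\<lambda>k. mconst (tt i k)) Q)) = lc (star mconst y) Q"
    unfolding lin_comb_def star_def pscale_sum pscale_mult by (rule sum.swap)
  finally show ?thesis .
qed

text \<open>Moving the generic endomorphism Z across \<open>h\<close> shows that the equations of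
  \<open>G\<close> are linear in the coordinates of Z^* Z, whichever functional and vectors are
  used.\<close>

lemma G_generator_expand:
  fixes \<xi> :: "'k \<Rightarrow> 'f"
  assumes xi: "\<And>x y. \<xi> (x + y) = \<xi> x + \<xi> y" "\<And>a x. \<xi> (\<iota> a * x) = a * \<xi> x"
  shows "Poly_Mapping.map \<xi> (conv h (lc mvar (mconst v)) (lc mvar (mconst w)) - mconst (h v w)) =
    (\<Sum>k<N. mul mconst (star mconst mvar) mvar k * mconst (\<xi> (h v (t k w)))) - mconst (\<xi> (h v w))"
proof -
  define m :: "nat \<Rightarrow> 'f mpol" where "m = mul mconst (star mconst mvar) mvar"
  have "conv h (lc mvar (mconst v)) (lc mvar (mconst w)) = conv h (mconst v) (lc m (mconst w))"
    unfolding conv_h_lc_left lc_comp m_def ..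
  also have "\<dots> = (\<Sum>k<N. kscale (m k) (mconst (h v (t k w))))"
    unfolding lin_comb_def conv_sum_right[OF fform_h] conv_pscale_right[OF fform_h]
    by (intro sum.cong refl) (simp add: map_single EndK_0 t_EndK conv_single[OF fform_biadd[OF fform_h]])
  finally have e: "conv h (lc mvar (mconst v)) (lc mvar (mconst w)) = (\<Sum>k<N. kscale (m k) (mconst (h v (t k w))))" .
  have mp: "Poly_Mapping.map \<xi> (X - Y) = Poly_Mapping.map \<xi> X - Poly_Mapping.map \<xi> Y" for X Y :: "'k mpol"
    using map_add[of \<xi> "X - Y" Y, OF xi(1)] by simp
  have x0: "\<xi> 0 = 0" by (rule additive_zero[of \<xi>, OF xi(1)])
  have "Poly_Mapping.map \<xi> (\<Sum>k<N. kscale (m k) (mconst (h v (t k w)))) = (\<Sum>k<N. m k * mconst (\<xi> (h v (t k w))))"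
    unfolding map_functional_kscale[of \<xi>, OF xi, symmetric] by (rule additive_sum) (rule map_add[OF xi(1)])
  then show ?thesis unfolding e mp m_def[symmetric] by (simp add: map_single x0)
qed

lemma G_generator_eval:
  fixes \<xi> :: "'k \<Rightarrow> 'f" and \<eta> :: "'f \<Rightarrow> 'b::comm_ring_1"
  assumes hom: "comm_ring_hom \<eta>" and xi: "\<And>x y. \<xi> (x + y) = \<xi> x + \<xi> y" "\<And>a x. \<xi> (\<iota> a * x) = a * \<xi> x"
  shows "mpol_eval \<eta> q (Poly_Mapping.map \<xi> (conv h (lc mvar (mconst v)) (lc mvar (mconst w)) - mconst (h v w))) =
    (\<Sum>k<N. mul \<eta> (star \<eta> q) q k * \<eta> (\<xi> (h v (t k w)))) - \<eta> (\<xi> (h v w))"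
proof -
  have hev: "comm_ring_hom (mpol_eval \<eta> q)" by (rule comm_ring_hom_mpol_eval[OF hom])
  interpret ev: comm_ring_hom "mpol_eval \<eta> q" by (rule hev)
  have evc: "mpol_eval \<eta> q (mconst x) = \<eta> x" and evv: "mpol_eval \<eta> q (mvar i) = q i" for x i
    by (simp_all add: mpol_eval_const[OF hom] mpol_eval_var[OF hom])
  have st: "mpol_eval \<eta> q (star mconst mvar i) = star \<eta> q i" for i
    by (simp add: star_def ev.hom_sum ev.hom_mult evc evv)
  have m: "mpol_eval \<eta> q (mul mconst (star mconst mvar) mvar k) = mul \<eta> (star \<eta> q) q k" for k
    unfolding mul_hom[OF hev] by (simp add: evc evv st)
  show ?thesis unfolding G_generator_expand[of \<xi> v w, OF xi]
    by (simp only: ev.hom_minus ev.hom_sum ev.hom_mult evc m)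
qed

lemma functional_unit:
  fixes \<xi> :: "'k \<Rightarrow> 'f"
  assumes xi: "\<And>x y. \<xi> (x + y) = \<xi> x + \<xi> y" "\<And>a x. \<xi> (\<iota> a * x) = a * \<xi> x" and X: "X \<in> EndK"
  shows "\<xi> (h v (X w)) = (\<Sum>k<N. cE X k * \<xi> (h v (t k w)))"
proof -
  have "h v (X w) = h v ((\<Sum>k<N. scale_End (cE X k) (t k)) w)" unfolding cE_sum[OF X] ..
  also have "\<dots> = (\<Sum>k<N. \<iota> (cE X k) * h v (t k w))"
    by (simp add: sum_fun scale_End_def h_sum h_act iota_central)
  finally have "\<xi> (h v (X w)) = \<xi> (\<Sum>k<N. \<iota> (cE X k) * h v (t k w))" by (rule arg_cong)
  also have "\<dots> = (\<Sum>k<N. \<xi> (\<iota> (cE X k) * h v (t k w)))" by (rule additive_sum) (rule xi(1))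
  finally show ?thesis by (simp only: xi(2))
qed

text \<open>A point q of a domain with q^* q = 1 has left multiplication of nonzero determinant. The
  determinant for the generic endomorphism is therefore outside the kernel and serves as the
  denominator of the inverse given by \<open>quasi_inv\<close>.\<close>

lemma kernel_in_G_points:
  fixes \<eta> :: "'f \<Rightarrow> 'b::idom"
  assumes hom: "comm_ring_hom \<eta>" and q: "\<And>k. k < N \<Longrightarrow> mul \<eta> (star \<eta> q) q k = \<eta> (ee k)"
  shows "{f \<in> mpol_ring UNIV N. mpol_eval \<eta> q f = 0} \<in> G_points N t" (is "?P \<in> _")
proof -
  let ?R = "mpol_ring (UNIV :: 'f set) N"
  let ?ev = "mpol_eval \<eta> q"
  have hev: "comm_ring_hom ?ev" by (rule comm_ring_hom_mpol_eval[OF hom])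
  interpret ev: comm_ring_hom ?ev by (rule hev)
  have hm: "comm_ring_hom (mconst :: 'f \<Rightarrow> _)" by (rule comm_ring_hom_mconst)
  have evc: "?ev (mconst x) = \<eta> x" and evv: "?ev (mvar i) = q i" for x i
    by (simp_all add: mpol_eval_const[OF hom] mpol_eval_var[OF hom])
  have sr: "is_subring ?R" by (intro is_subring_mpol_ring is_subring_UNIV)
  have prime: "is_prime_ideal ?R ?P"
    unfolding is_prime_ideal_def by (auto simp: ev.hom_add ev.hom_mult intro: subring_closed[OF sr])
  have gen: "?ev (Poly_Mapping.map \<xi> (conv h (lc mvar (mconst v)) (lc mvar (mconst w)) - mconst (h v w))) = 0"
    if xi: "\<And>x y. \<xi> (x + y) = \<xi> x + \<xi> y" "\<And>a x. \<xi> (\<iota> a * x) = a * (\<xi> x :: 'f)" for \<xi> v w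
  proof -
    interpret \<eta>: comm_ring_hom \<eta> by (rule hom)
    have "\<xi> (h v w) = (\<Sum>k<N. ee k * \<xi> (h v (t k w)))"
      using functional_unit[of \<xi> id v w, OF xi EndK_id] by (simp add: ee_def)
    then have "\<eta> (\<xi> (h v w)) = (\<Sum>k<N. mul \<eta> (star \<eta> q) q k * \<eta> (\<xi> (h v (t k w))))"
      by (simp add: \<eta>.hom_sum \<eta>.hom_mult q)
    then show ?thesis unfolding G_generator_eval[OF hom, of \<xi>, OF xi] by simp
  qed
  have v: "mvar i \<in> ?R" if "i < N" for i using that by (intro mpol_ring_var is_subring_UNIV)
  have genR: "Poly_Mapping.map \<xi> (conv h (lc mvar (mconst v)) (lc mvar (mconst w)) - mconst (h v w)) \<in> ?R"
    if xi: "\<And>x y. \<xi> (x + y) = \<xi> x + \<xi> y" "\<And>a x. \<xi> (\<iota> a * x) = a * (\<xi> x :: 'f)" for \<xi> v w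
    unfolding G_generator_expand[of \<xi> v w, OF xi] mul_def star_def
    by (intro subring_sum[OF sr] subring_mult[OF sr] subring_diff[OF sr] mpol_ring_const is_subring_UNIV v) auto
  have "G_ideal N t \<subseteq> ?P"
    unfolding G_ideal_def by (rule ideal_gen_least[OF prime_ideal_imp_ideal[OF prime]]) (use gen genR in blast)
  moreover have "\<exists>x\<in>?R - ?P. \<exists>y. (\<forall>i<N. y i \<in> ?R) \<and> (let Z = lc mvar; Z' = lc y in
      \<forall>P. Z (Z' P) = pscale x P \<and> Z' (Z P) = pscale x P)"
  proof (intro bexI[of _ "det (Lm mconst mvar)"] exI[of _ "quasi_inv mconst mvar"] conjI allI impI)
    have "det (Lm \<eta> (star \<eta> q)) * det (Lm \<eta> q) = det (Lm \<eta> (mul \<eta> (star \<eta> q) q))"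
      unfolding Lm_mul[OF hom, symmetric] by (rule det_mult[symmetric, of _ N]) (rule Lm_carrier)+
    also have "Lm \<eta> (mul \<eta> (star \<eta> q) q) = Lm \<eta> (\<lambda>k. 1 * \<eta> (ee k))" by (rule Lm_cong) (simp add: q)
    also have "det \<dots> = 1" unfolding Lm_unit[OF hom] by simp
    finally have "det (Lm \<eta> q) \<noteq> 0" by auto
    then have D: "?ev (det (Lm mconst mvar)) \<noteq> 0" unfolding det_Lm_hom[OF hev] by (simp add: evc evv)
    then have D0: "det (Lm mconst mvar :: 'f mpol mat) \<noteq> 0" using ev.hom_zero by auto
    show "det (Lm mconst mvar) \<in> ?R - ?P" proof -
      have "det (Lm mconst mvar) \<in> ?R" by (rule det_Lm_in_subring[OF sr]) (auto intro: v)
      then show ?thesis using D by simp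
    qed
    show "quasi_inv mconst mvar i \<in> ?R" if "i < N" for i by (rule quasi_inv_in_subring[OF sr v _ that]) auto
    show "let Z = lc mvar; Z' = lc (quasi_inv mconst mvar) in
      \<forall>P. Z (Z' P) = pscale (det (Lm mconst mvar)) P \<and> Z' (Z P) = pscale (det (Lm mconst mvar)) P"
      unfolding Let_def lc_comp
    proof (intro allI conjI)
      fix P
      have "lc (\<lambda>k. det (Lm mconst mvar) * mconst (ee k)) P = pscale (det (Lm mconst mvar)) P"
        unfolding lc_scale lc_unit ..
      moreover have "lc (mul mconst mvar (quasi_inv mconst mvar)) P = lc (\<lambda>k. det (Lm mconst mvar) * mconst (ee k)) P"
        by (rule lc_cong) (rule quasi_inv_right[OF hm])
      moreover have "lc (mul mconst (quasi_inv mconst mvar) mvar) P = lc (\<lambda>k. det (Lm mconst mvar) * mconst (ee k)) P"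
        by (rule lc_cong) (rule quasi_inv_left[OF hm D0])
      ultimately show "lc (mul mconst mvar (quasi_inv mconst mvar)) P = pscale (det (Lm mconst mvar)) P"
        "lc (mul mconst (quasi_inv mconst mvar) mvar) P = pscale (det (Lm mconst mvar)) P" by (simp_all only:)
    qed
  qed
  ultimately show ?thesis unfolding G_points_def using prime by blast
qed

end

context hermitian_coords
begin

lemma bb_eq:
  assumes j: "j < N" and l: "l < N" and k: "k < M"
  shows "bb j l k = cS (\<psi> (adj (t j) \<circ> t l)) k"
proof -
  have "cE (adj (t j) \<circ> t l) m = (\<Sum>p<N. cc p l m * tt j p)" if "m < N" for m
    using l by (subst cE_comp[OF adj_EndK[OF t_EndK[OF j]] t_EndK[OF l] that]) (simp add: cE_t sum_delta_mult tt_def)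
  then show ?thesis
    unfolding bb_def cS_\<psi>[OF EndK_comp[OF adj_EndK[OF t_EndK[OF j]] t_EndK[OF l]] k] by simp
qed

lemma bb_sym: assumes "i < N" "j < N" "k < M" shows "bb i j k = bb j i k"
proof -
  have e: "t i \<in> EndK" "t j \<in> EndK" using assms by (auto intro: t_EndK)
  have "\<psi> (adj (t i) \<circ> t j) = \<psi> (adj (adj (t i) \<circ> t j))"
    by (rule \<psi>_of_adj[symmetric]) (intro EndK_comp adj_EndK e)
  also have "adj (adj (t i) \<circ> t j) = adj (t j) \<circ> t i"
    by (simp only: adj_comp[OF adj_EndK[OF e(1)] e(2)] adj_adj[OF e(1)])
  finally show ?thesis using assms by (simp only: bb_eq)
qed

lemma \<phi>_in: "X \<in> EndK \<Longrightarrow> \<phi> X \<in> \<psi> ` EndK"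
  using \<phi>_via_Z0[OF Z0] by (auto intro!: imageI EndK_comp adj_EndK Z0)

lemma bb_diag: assumes "i < N" "k < M" shows "bb i i k = 2 * bs i k"
proof -
  have e: "t i \<in> EndK" using assms by (auto intro: t_EndK)
  have "\<psi> (adj (t i) \<circ> t i) = scale_form 1 (\<phi> (t i)) + scale_form 1 (\<phi> (t i))"
    by (intro ext) (simp add: \<psi>_def \<phi>_def h_adj[OF e] h_adj'[OF e] scale_form_def)
  then have "bb i i k = 1 * cS (\<phi> (t i)) k + 1 * cS (\<phi> (t i)) k"
    unfolding bb_eq[OF assms(1) assms(1) assms(2)]
    using coords_lin[OF scale_form.vector_space_axioms basis_s \<phi>_in[OF e] \<phi>_in[OF e] assms(2), of 1 1] by simp
  then show ?thesis by (simp add: bs_def)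
qed

lemma \<psi>_expand: "X \<in> EndK \<Longrightarrow> conv (\<psi> X) P Q = (\<Sum>k<M. kscale (mconst (cS (\<psi> X) k)) (conv (s k) P Q))"
proof -
  assume X: "X \<in> EndK"
  have "conv (\<Sum>k<M. scale_form (cS (\<psi> X) k) (s k)) P Q = (\<Sum>k<M. conv (scale_form (cS (\<psi> X) k) (s k)) P Q)"
    by (rule conv_sum_form) (auto intro: fform_scale s_fform)
  also have "\<dots> = (\<Sum>k<M. kscale (mconst (cS (\<psi> X) k)) (conv (s k) P Q))"
    by (rule sum.cong[OF refl]) (auto intro: conv_scale_form s_fform)
  finally show ?thesis unfolding cS_sum[OF imageI[OF X]] .
qed

text \<open>The diagonal terms come from \<open>\<phi> (t i)\<close> and each mixed pair from
  \<open>\<psi> (adj (t j) \<circ> t i)\<close>. Both lie in the range of \<psi>, the former thanks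
  to \<open>Z0\<close>, and are expanded in the basis \<open>s\<close>.\<close>

lemma conv_h_quad:
  "conv h (lc y P) (lc y Q) =
    (\<Sum>k<M. kscale ((\<Sum>i<N. mconst (bs i k) * (y i * y i)) + (\<Sum>i<N. \<Sum>j<i. mconst (bb j i k) * (y j * y i))) (conv (s k) P Q))"
proof -
  define c where "c i j = conv (\<lambda>v w. h (t i v) (t j w)) P Q" for i j
  have "conv h (lc y P) (lc y Q) = (\<Sum>i<N. \<Sum>j<N. kscale (y i * y j) (c i j))"
  proof -
    have "conv h (lc y P) (lc y Q) = (\<Sum>i<N. kscale (y i) (conv h (Poly_Mapping.map (t i) P) (lc y Q)))"
      unfolding lin_comb_def[of N t y] conv_sum_left[OF fform_h] conv_pscale_left[OF fform_h] ..
    also have "\<dots> = (\<Sum>i<N. kscale (y i) (\<Sum>j<N. kscale (y j) (conv h (Poly_Mapping.map (t i) P) (Poly_Mapping.map (t j) Q))))"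
      unfolding lin_comb_def conv_sum_right[OF fform_h] conv_pscale_right[OF fform_h] ..
    also have "\<dots> = (\<Sum>i<N. \<Sum>j<N. kscale (y i * y j) (c i j))"
      unfolding kscale_sum kscale_mult c_def
      by (intro sum.cong refl) (simp add: conv_map[OF fform_h] t_EndK)
    finally show ?thesis .
  qed
  also have "\<dots> = (\<Sum>i<N. kscale (y i * y i) (c i i)) + (\<Sum>i<N. \<Sum>j<i. kscale (y j * y i) (c j i) + kscale (y i * y j) (c i j))"
    by (rule sum_square_split)
  also have "(\<Sum>i<N. kscale (y i * y i) (c i i)) = (\<Sum>i<N. \<Sum>k<M. kscale (mconst (bs i k) * (y i * y i)) (conv (s k) P Q))"
  proof (intro sum.cong refl)
    fix i assume "i \<in> {..<N}"
    then have e: "t i \<in> EndK" by (auto intro: t_EndK)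
    have "c i i = conv (\<phi> (t i)) P Q" by (simp add: c_def \<phi>_def)
    also have "\<dots> = (\<Sum>k<M. kscale (mconst (bs i k)) (conv (s k) P Q))"
      unfolding bs_def \<phi>_via_Z0[OF Z0 e] by (rule \<psi>_expand) (intro EndK_comp adj_EndK e Z0)
    finally show "kscale (y i * y i) (c i i) = (\<Sum>k<M. kscale (mconst (bs i k) * (y i * y i)) (conv (s k) P Q))"
      by (simp add: kscale_sum kscale_mult[symmetric] mult.commute)
  qed
  also have "(\<Sum>i<N. \<Sum>j<i. kscale (y j * y i) (c j i) + kscale (y i * y j) (c i j)) =
     (\<Sum>i<N. \<Sum>j<i. \<Sum>k<M. kscale (mconst (bb j i k) * (y j * y i)) (conv (s k) P Q))"
  proof (intro sum.cong refl)
    fix i j assume "i \<in> {..<N}" "j \<in> {..<i}"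
    then have ij: "i < N" "j < N" by auto
    then have e: "t i \<in> EndK" "t j \<in> EndK" by (auto intro: t_EndK)
    have ps: "\<psi> (adj (t j) \<circ> t i) = (\<lambda>v w. h (t j v) (t i w)) + (\<lambda>v w. h (t i v) (t j w))"
      by (intro ext) (simp add: \<psi>_def h_adj[OF e(2)] h_adj'[OF e(2)])
    have "c j i + c i j = conv ((\<lambda>v w. h (t j v) (t i w)) + (\<lambda>v w. h (t i v) (t j w))) P Q"
      unfolding c_def
      by (rule conv_plus_form[OF fform_comp[OF fform_h e(2) e(1)] fform_comp[OF fform_h e(1) e(2)], symmetric])
    also have "\<dots> = (\<Sum>k<M. kscale (mconst (cS (\<psi> (adj (t j) \<circ> t i)) k)) (conv (s k) P Q))"
      unfolding ps[symmetric] by (rule \<psi>_expand) (intro EndK_comp adj_EndK e)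
    also have "\<dots> = (\<Sum>k<M. kscale (mconst (bb j i k)) (conv (s k) P Q))"
      using ij by (intro sum.cong refl) (simp add: bb_eq)
    finally have cc: "c j i + c i j = (\<Sum>k<M. kscale (mconst (bb j i k)) (conv (s k) P Q))" .
    have "kscale (y j * y i) (c j i) + kscale (y i * y j) (c i j) = kscale (y j * y i) (c j i + c i j)"
      by (simp only: kscale_add mult.commute[of "y i"])
    then show "kscale (y j * y i) (c j i) + kscale (y i * y j) (c i j) = (\<Sum>k<M. kscale (mconst (bb j i k) * (y j * y i)) (conv (s k) P Q))"
      unfolding cc by (simp only: kscale_sum kscale_mult[symmetric] mult.commute[of "y j * y i"])
  qed
  also have "(\<Sum>i<N. \<Sum>k<M. kscale (mconst (bs i k) * (y i * y i)) (conv (s k) P Q)) +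
     (\<Sum>i<N. \<Sum>j<i. \<Sum>k<M. kscale (mconst (bb j i k) * (y j * y i)) (conv (s k) P Q)) =
     (\<Sum>k<M. (\<Sum>i<N. kscale (mconst (bs i k) * (y i * y i)) (conv (s k) P Q)) +
      (\<Sum>i<N. \<Sum>j<i. kscale (mconst (bb j i k) * (y j * y i)) (conv (s k) P Q)))"
    unfolding sum.distrib
    by (rule arg_cong2[of _ _ _ _ "(+)"], rule sum.swap, subst sum.swap, rule sum.cong[OF refl], rule sum.swap)
  finally show ?thesis by (simp only: kscale_add kscale_sum)
qed

lemma form_coords_inj:
  assumes eq: "\<And>v w. (\<Sum>k<M. kscale (g k) (mconst (s k v w))) = (\<Sum>k<M. kscale (g' k) (mconst (s k v w)))" and k: "k < M"
  shows "g k = g' k"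
proof (rule poly_mapping_eqI)
  fix a
  have "(\<Sum>i<M. scale_form (Poly_Mapping.lookup (g i) a) (s i)) = (\<Sum>i<M. scale_form (Poly_Mapping.lookup (g' i) a) (s i))"
  proof (intro ext)
    fix v w
    have l: "Poly_Mapping.lookup (\<Sum>k<M. kscale (g k) (mconst (s k v w))) a = (\<Sum>i<M. scale_form (Poly_Mapping.lookup (g i) a) (s i)) v w" for g
      by (simp add: lookup_sum lookup_kscale_const sum_fun scale_form_def)
    show "(\<Sum>i<M. scale_form (Poly_Mapping.lookup (g i) a) (s i)) v w = (\<Sum>i<M. scale_form (Poly_Mapping.lookup (g' i) a) (s i)) v w"
      unfolding l[symmetric] eq ..
  qed
  note e = this
  show "Poly_Mapping.lookup (g k) a = Poly_Mapping.lookup (g' k) a"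
    by (rule is_basis_unique[OF basis_s, of "\<lambda>i. Poly_Mapping.lookup (g i) a" "\<lambda>i. Poly_Mapping.lookup (g' i) a" k])
      (rule UNIV_I e k)+
qed

lemma conv_s_const: "k < M \<Longrightarrow> conv (s k) (mconst v) (mconst w) = mconst (s k v w)"
  by (subst conv_single[OF fform_biadd[OF s_fform]]) simp_all

definition geq :: "nat \<Rightarrow> 'f mpol" where
  "geq = quadric (\<lambda>_ _. 0) bs (cS h)"

lemma h_in: "h \<in> \<psi> ` EndK"
  using Z0 by auto

lemma G_generator:
  assumes xi: "\<And>x y. \<xi> (x + y) = \<xi> x + \<xi> y" "\<And>a x. \<xi> (\<iota> a * x) = a * (\<xi> x :: 'f)"
  shows "Poly_Mapping.map \<xi> (conv h (lc mvar (mconst v)) (lc mvar (mconst w)) - mconst (h v w)) =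
    (\<Sum>k<M. geq k * mconst (\<xi> (s k v w)))"
proof -
  define qd :: "nat \<Rightarrow> 'f mpol" where "qd k = (\<Sum>i<N. mconst (bs i k) * (mvar i * mvar i)) + (\<Sum>i<N. \<Sum>j<i. mconst (bb j i k) * (mvar j * mvar i))" for k
  have "conv h (lc mvar (mconst v)) (lc mvar (mconst w)) = (\<Sum>k<M. kscale (qd k) (mconst (s k v w)))"
    unfolding conv_h_quad qd_def by (intro sum.cong refl) (simp add: conv_s_const)
  moreover have "mconst (h v w) = (\<Sum>k<M. kscale (mconst (cS h k)) (mconst (s k v w)))"
  proof (rule poly_mapping_eqI)
    fix a
    have "h v w = (\<Sum>k<M. scale_form (cS h k) (s k)) v w" by (simp only: cS_sum[OF h_in])
    then have "h v w = (\<Sum>k<M. \<iota> (cS h k) * s k v w)" by (simp add: sum_fun scale_form_def)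
    then show "Poly_Mapping.lookup (mconst (h v w)) a = Poly_Mapping.lookup (\<Sum>k<M. kscale (mconst (cS h k)) (mconst (s k v w))) a"
      by (simp add: lookup_sum lookup_kscale_const lookup_single when_def)
  qed
  moreover have "geq k = qd k - mconst (cS h k)" for k by (simp add: geq_def quadric_def qd_def)
  ultimately have e: "conv h (lc mvar (mconst v)) (lc mvar (mconst w)) - mconst (h v w) = (\<Sum>k<M. kscale (geq k) (mconst (s k v w)))"
  proof -
    assume 1: "conv h (lc mvar (mconst v)) (lc mvar (mconst w)) = (\<Sum>k<M. kscale (qd k) (mconst (s k v w)))"
      and 2: "mconst (h v w) = (\<Sum>k<M. kscale (mconst (cS h k)) (mconst (s k v w)))"
      and 3: "\<And>k. geq k = qd k - mconst (cS h k)"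
    have k: "kscale (qd k) x = kscale (geq k) x + kscale (mconst (cS h k)) x" for k x
      unfolding kscale_add(1)[symmetric] 3 by simp
    show ?thesis unfolding 1 2 k sum.distrib by simp
  qed
  have "Poly_Mapping.map \<xi> (\<Sum>k<M. kscale (geq k) (mconst (s k v w))) = (\<Sum>k<M. Poly_Mapping.map \<xi> (kscale (geq k) (mconst (s k v w))))"
    by (rule additive_sum) (rule map_add[OF xi(1)])
  then show ?thesis unfolding e map_functional_kscale[of \<xi>, OF xi] .
qed

text \<open>The generators of \<open>G_ideal\<close> are combinations of the \<open>geq k\<close>
  with coefficients \<open>\<xi> (s k v w)\<close>. The coefficient vectors that give elements of
  \<open>P\<close> form a subspace; since the forms \<open>s k\<close> are independent and
  functionals separate \<open>K\<close>, \<open>dual_span\<close> finds the unit vectors in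
  it.\<close>

lemma geq_in_prime:
  assumes P: "is_prime_ideal (mpol_ring UNIV N) P" and G: "G_ideal N t \<subseteq> P" and k: "k < M"
  shows "geq k \<in> P"
proof -
  have sr: "is_subring (mpol_ring (UNIV :: 'f set) N)" by (intro is_subring_mpol_ring is_subring_UNIV)
  define W where "W = {a. (\<Sum>k<M. geq k * mconst (a k)) \<in> P}"
  have cR: "mconst x \<in> mpol_ring UNIV N" for x :: 'f by auto
  have gen: "(\<lambda>k. \<xi> (s k v w)) \<in> W"
    if xi: "\<And>x y. \<xi> (x + y) = \<xi> x + \<xi> y" "\<And>a x. \<xi> (\<iota> a * x) = a * (\<xi> x :: 'f)" for \<xi> v w
  proof -
    have "(\<Sum>k<M. geq k * mconst (\<xi> (s k v w))) \<in> G_ideal N t"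
      unfolding G_ideal_def G_generator[of \<xi> v w, OF xi, symmetric]
      by (rule ideal_gen_superset[OF sr]) (use xi in blast)
    then show ?thesis using G by (auto simp: W_def)
  qed
  have "\<exists>a\<in>W. \<forall>i<M. a i = (if i = k then 1 else 0)"
  proof (rule dual_span[OF _ _ _ k])
    show "(\<lambda>i. x * a i + y * b i) \<in> W" if "a \<in> W" "b \<in> W" for a b x y
    proof -
      have "(\<Sum>k<M. geq k * mconst (x * a k + y * b k)) =
        mconst x * (\<Sum>k<M. geq k * mconst (a k)) + mconst y * (\<Sum>k<M. geq k * mconst (b k))"
      proof -
        have "mconst (x * a k + y * b k) = mconst x * mconst (a k) + mconst y * mconst (b k)" for k
          by (simp only: single_add mult_single add_0)
        then show ?thesis by (simp only: sum_distrib_left sum.distrib[symmetric] distrib_left mult_ac)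
      qed
      also have "\<dots> \<in> P"
        by (intro prime_ideal_add[OF P] prime_ideal_mult[OF P] cR) (use that in \<open>auto simp: W_def\<close>)
      finally show ?thesis by (simp add: W_def)
    qed
    show "(\<lambda>_. 0) \<in> W" using prime_ideal_0[OF P] by (simp add: W_def)
    fix x i assume x: "\<And>a. a \<in> W \<Longrightarrow> (\<Sum>i<M. a i * x i) = 0" and i: "i < M"
    have "(\<Sum>i<M. scale_form (x i) (s i)) = (\<Sum>i<M. scale_form 0 (s i))"
    proof (intro ext)
      fix v w
      define c where "c = (\<Sum>i<M. \<iota> (x i) * s i v w)"
      have "c = 0"
      proof (rule ccontr)
        assume "c \<noteq> 0"
        then obtain \<xi> :: "'k \<Rightarrow> 'f" where xi: "\<forall>x y. \<xi> (x + y) = \<xi> x + \<xi> y" "\<forall>a x. \<xi> (\<iota> a * x) = a * \<xi> x" "\<xi> c \<noteq> 0"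
          using functional_sep by blast
        have "(\<lambda>k. \<xi> (s k v w)) \<in> W" using gen[of \<xi> v w] xi by blast
        from x[OF this] have "(\<Sum>i<M. \<xi> (s i v w) * x i) = 0" .
        moreover have "\<xi> c = (\<Sum>i<M. \<xi> (\<iota> (x i) * s i v w))"
          unfolding c_def by (rule additive_sum) (use xi in blast)
        ultimately show False using xi by (simp add: mult.commute)
      qed
      then show "(\<Sum>i<M. scale_form (x i) (s i)) v w = (\<Sum>i<M. scale_form 0 (s i)) v w"
        by (simp add: sum_fun scale_form_def c_def)
    qed
    note e = this
    show "x i = 0" by (rule is_basis_unique[OF basis_s, of x "\<lambda>_. 0" i]) (rule UNIV_I e i)+
  qed
  then obtain a where a: "a \<in> W" "\<forall>i<M. a i = (if i = k then 1 else 0)" by blast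
  have "(\<Sum>i<M. geq i * mconst (a i)) = (\<Sum>i<M. geq i * (if i = k then 1 else 0))"
    using a(2) by (intro sum.cong refl) auto
  then show ?thesis using a(1) k by (simp add: W_def sum_delta_mult)
qed

end

section \<open>An invertible preimage of \<open>h\<close> and the dimension formula\<close>

context hermitian_lattice
begin

lemma infinite_F: "infinite (UNIV :: 'f set)"
proof -
  obtain u where u: "u \<noteq> 0" "val u = 1" using local_field by (auto simp: nonarch_local_field_def)
  have "val (u ^ k) = int k" for k
    using u by (induction k) (auto simp: val_one val_mult)
  then have "inj (\<lambda>k :: nat. u ^ k)" by (metis injI of_nat_eq_iff)
  then show ?thesis using finite_imageD[of "\<lambda>k. u ^ k" "UNIV :: nat set"] finite_subset[of "range (\<lambda>k. u ^ k)" UNIV] by auto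
qed

text \<open>The excluded shifts are the negatives of the roots of a characteristic polynomial, and
  the field is infinite.\<close>

lemma exists_regular_shift:
  fixes A :: "'f mat"
  assumes A: "A \<in> carrier_mat m m"
  shows "\<exists>x. det (A + x \<cdot>\<^sub>m 1\<^sub>m m) \<noteq> 0"
proof -
  have "char_poly A \<noteq> 0" using degree_monic_char_poly[OF A] by auto
  then have "finite {k. poly (char_poly A) k = 0}" by (rule poly_roots_finite)
  then obtain k where "poly (char_poly A) k \<noteq> 0" using infinite_F ex_new_if_finite[of "{k. poly (char_poly A) k = 0}"] by auto
  then have "det (char_matrix A k) \<noteq> 0" using eigenvalue_det[OF A] eigenvalue_root_char_poly[OF A] by blast
  moreover have "char_matrix A k = A + (- k) \<cdot>\<^sub>m 1\<^sub>m m" using A by (simp add: char_matrix_def)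
  ultimately show ?thesis by metis
qed

end

lemma comm_ring_hom_fconst: "comm_ring_hom (\<lambda>x :: 'a::field. to_fract (mconst x))"
  by (rule comm_ring_hom_comp[OF comm_ring_hom_to_fract comm_ring_hom_mconst])

context end_coords
begin

lemma add_adj_zero:
  assumes X: "X \<in> EndK" and 0: "\<psi> X = 0" shows "X + adj X = 0"
proof
  fix w
  have "h v ((X + adj X) w) = h v (0 w)" for v using fun_cong[OF fun_cong[OF \<psi>_adj[OF X], of v], of w] by (simp add: 0)
  then show "(X + adj X) w = 0 w" by (rule h_eq_iff)
qed

lemma cE_add_adj:
  assumes X: "X \<in> EndK" and l: "l < N"
  shows "cE (X + adj X) l = cE X l + star (\<lambda>x. x) (cE X) l"
proof -
  have "cE (scale_End 1 X + scale_End 1 (adj X)) l = 1 * cE X l + 1 * cE (adj X) l"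
    by (rule coords_lin[OF scale_End.vector_space_axioms basis_t X adj_EndK[OF X] l])
  then show ?thesis by (simp only: scale_End.scale_one mult_1 cE_adj[OF X l] star_def)
qed

lemma \<psi>_half:
  assumes "(2 :: 'f) \<noteq> 0" shows "\<psi> (scale_End (1 / 2) id) = h"
proof (intro ext)
  fix v w
  have "\<iota> (1 / 2) + \<iota> (1 / 2) = 1" using assms by (simp flip: iota_simps(2))
  then show "\<psi> (scale_End (1 / 2) id) v w = h v w"
    by (simp add: \<psi>_def scale_End_def h_act iota_central[of "1 / 2" "h v w"] flip: distrib_left)
qed

end

context hermitian_coords
begin

lemma mpol_deriv_geq:
  assumes "k < M" "l < N"
  shows "mpol_deriv l (geq k) = (\<Sum>j<N. mvar j * mconst (bb j l k))"
proof -
  have "mpol_deriv l (quadric (\<lambda>_ _. 0) bs (cS h) k) = mconst 0 + (\<Sum>j<N. mvar j * mconst (bb j l k))"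
    by (rule mpol_deriv_quadric) (use bb_sym bb_diag assms in auto)
  then show ?thesis by (simp add: geq_def)
qed

text \<open>At a point of \<open>G\<close> the generic endomorphism has an inverse up to a factor
  outside the prime, so \<open>jacobian_section\<close> makes the Jacobian of the
  \<open>geq k\<close> right-invertible up to this factor. This supplies the minor required by
  \<open>chain_bound\<close>.\<close>

lemma G_chain_bound:
  assumes P: "\<And>i. i \<le> k \<Longrightarrow> P i \<in> G_points N t" and sub: "\<And>i. i < k \<Longrightarrow> P i \<subset> P (Suc i)"
  shows "k + M \<le> N"
proof -
  let ?R = "mpol_ring (UNIV :: 'f set) N"
  have sr: "is_subring ?R" by (intro is_subring_mpol_ring is_subring_UNIV)
  have prime: "is_prime_ideal ?R (P i)" if "i \<le> k" for i using P[OF that] by (simp add: G_points_def)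
  have prime0: "is_prime_ideal ?R (P 0)" by (rule prime) simp
  have P0: "P 0 \<in> G_points N t" by (rule P) simp
  then have GP: "G_ideal N t \<subseteq> P 0" by (simp add: G_points_def)
  from P0 obtain x y where x: "x \<in> ?R - P 0" and y: "\<And>i. i < N \<Longrightarrow> y i \<in> ?R"
    and inv: "\<And>Q. lc y (lc mvar Q) = pscale x Q"
    unfolding G_points_def Let_def by blast
  have v: "mvar i \<in> ?R" if "i < N" for i using that by (intro mpol_ring_var is_subring_UNIV)
  have cR: "mconst a \<in> ?R" for a by (intro mpol_ring_const) simp
  have yv: "mul mconst y mvar l = x * mconst (ee l)" if "l < N" for l by (rule lc_inverse_coords[OF inv that])
  have JS: "(\<Sum>j<N. mvar j * mconst (bb j l k)) \<in> ?R" for l k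
    by (intro subring_sum[OF sr] subring_mult[OF sr] v cR) simp
  have starS: "star mconst y i \<in> ?R" for i
    unfolding star_def by (intro subring_sum[OF sr] subring_mult[OF sr] y cR) simp
  have WS: "mul mconst (star mconst y) (\<lambda>i. mconst (sec k' i)) l \<in> ?R" for l k'
    unfolding mul_def by (intro subring_sum[OF sr] subring_mult[OF sr] starS cR)
  have JW: "(\<Sum>l<N. (\<Sum>j<N. mvar j * mconst (bb j l k)) * mul mconst (star mconst y) (\<lambda>i. mconst (sec k' i)) l) = (if k = k' then x else 0)"
    if "k < M" "k' < M" for k k'
    by (rule jacobian_section[OF comm_ring_hom_mconst yv that])
  obtain \<kappa> where "inj_on \<kappa> {..<M}" and \<kappa>: "\<And>j. j < M \<Longrightarrow> \<kappa> j < N"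
    and D: "det (mat M M (\<lambda>(i, j). \<Sum>l<N. mvar l * mconst (bb l (\<kappa> j) i))) \<notin> P 0"
    by (rule exists_minor[OF sr prime0, where J = "\<lambda>k l. \<Sum>j<N. mvar j * mconst (bb j l k)"
        and W = "\<lambda>l k'. mul mconst (star mconst y) (\<lambda>i. mconst (sec k' i)) l", OF JS WS x JW],
      assumption, assumption, rule that, assumption, blast, assumption)
  have "mat M M (\<lambda>(i, j). \<Sum>l<N. mvar l * mconst (bb l (\<kappa> j) i)) = mat M M (\<lambda>(i, j). mpol_deriv (\<kappa> j) (geq i))"
    by (rule cong_mat) (auto simp: mpol_deriv_geq \<kappa>)
  then show ?thesis
    using D by (intro chain_bound[OF prime sub geq_in_prime[OF prime0 GP] \<kappa>]) auto
qed

text \<open>\<open>\<psi> Z = h\<close> says Z + adj Z = id, the starting point of the Cayley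
  construction. The chain it produces attains the bound from \<open>G_chain_bound\<close>.\<close>

lemma dim_G_aux:
  assumes Z: "Z \<in> EndK" "\<psi> Z = h" and D: "det (Lm (\<lambda>x. x) (cE Z)) \<noteq> 0"
  shows "M \<le> N \<and> dim_G N t = enat (N - M)"
proof -
  have star_cayley: "star_cayley N cc tt ee M aa sec (cE Z)"
  proof (intro star_cayley.intro star_cayley_axioms.intro star_forms_axioms)
    fix y k assume y: "\<And>m. m < M \<Longrightarrow> (\<Sum>i<N. y i * aa i m) = 0" and k: "k < N"
    define X where "X = (\<Sum>i<N. scale_End (y i) (t i))"
    have X: "X \<in> EndK" unfolding X_def by (rule is_basis_sum[OF basis_t UNIV_I])
    have cX: "cE X i = y i" if "i < N" for i by (rule coords_eqI[OF basis_t, of X y i]) (rule X_def that)+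
    have c0: "cS (\<psi> X) m = 0" if "m < M" for m
      unfolding cS_\<psi>[OF X that] y[OF that, symmetric] by (intro sum.cong refl) (simp add: cX)
    have "(\<Sum>i<M. scale_form (cS (\<psi> X) i) (s i)) = 0"
    proof (intro sum.neutral ballI)
      fix i assume "i \<in> {..<M}"
      then have "cS (\<psi> X) i = 0" by (intro c0) simp
      then show "scale_form (cS (\<psi> X) i) (s i) = 0" by (simp only: scale_form.scale_zero_left)
    qed
    then have "\<psi> X = 0" unfolding cS_sum[OF imageI[OF X]] .
    note 0 = add_adj_zero[OF X this]
    have "cE 0 k = 0" by (rule coords_eqI[OF basis_t _ k]) (simp only: scale_End.scale_zero_left sum.neutral_const)
    then have "cE X k + star (\<lambda>x. x) (cE X) k = 0" using cE_add_adj[OF X k] by (simp only: 0)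
    moreover have "star (\<lambda>x. x) (cE X) k = star (\<lambda>x. x) y k" by (rule star_cong) (rule cX)
    ultimately show "y k + star (\<lambda>x. x) y k = 0" using cX[OF k] by simp
  next
    fix k assume k: "k < N"
    have "Z + adj Z = id"
    proof
      fix w
      have "h v ((Z + adj Z) w) = h v (id w)" for v
        using fun_cong[OF fun_cong[OF \<psi>_adj[OF Z(1)], of v], of w] by (simp add: Z)
      then show "(Z + adj Z) w = id w" by (rule h_eq_iff)
    qed
    then show "cE Z k + star (\<lambda>x. x) (cE Z) k = ee k" using cE_add_adj[OF Z(1) k] by (simp only: ee_def)
  next
    show "det (Lm (\<lambda>x. x) (cE Z)) \<noteq> 0" by (rule D)
  qed
  let ?f = "\<lambda>x. to_fract (mconst x) :: 'f mpol fract"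
  obtain P where MN: "M \<le> N" and P: "\<And>i. i \<le> N - M \<Longrightarrow> \<exists>q. P i = {f \<in> mpol_ring UNIV N. mpol_eval ?f q f = 0} \<and>
      (\<forall>k<N. mul ?f (star ?f q) q k = ?f (ee k))" and lt: "\<And>i. i < N - M \<Longrightarrow> P i \<subset> P (Suc i)"
    by (rule star_cayley.cayley_chain[OF star_cayley], rule that, assumption, blast, blast)
  have PG: "P i \<in> G_points N t" if i: "i \<le> N - M" for i
  proof -
    from P[OF i] obtain q where e: "P i = {f \<in> mpol_ring UNIV N. mpol_eval ?f q f = 0}"
      and q: "\<forall>k<N. mul ?f (star ?f q) q k = ?f (ee k)" by (elim exE conjE)
    show ?thesis unfolding e by (rule kernel_in_G_points[OF comm_ring_hom_fconst]) (use q in simp)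
  qed
  have "dim_G N t = enat (N - M)" unfolding dim_G_def krull_dim_def
  proof (rule Sup_enat_eq)
    show "enat (N - M) \<in> {enat r | r. \<exists>P. (\<forall>i\<le>r. P i \<in> G_points N t) \<and> (\<forall>i<r. P i \<subset> P (Suc i))}" using PG lt by blast
    fix x assume "x \<in> {enat r | r. \<exists>P. (\<forall>i\<le>r. P i \<in> G_points N t) \<and> (\<forall>i<r. P i \<subset> P (Suc i))}"
    then obtain k P' where x: "x = enat k" and P': "\<forall>i\<le>k. P' i \<in> G_points N t" "\<forall>i<k. P' i \<subset> P' (Suc i)" by blast
    have "k + M \<le> N" by (rule G_chain_bound[of k P']) (use P' in auto)
    then show "x \<le> enat (N - M)" by (simp add: x)
  qed
  then show ?thesis using MN by simp
qed

text \<open>If 2 is invertible, half the identity works. In characteristic 2,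
  \<open>\<psi> id\<close> is twice \<open>h\<close> and so vanishes; \<open>Z0\<close> may be
  shifted by any scalar without changing its image, and some scalar makes it regular.\<close>

lemma exists_regular_Z:
  obtains Z where "Z \<in> EndK" "\<psi> Z = h" "det (Lm (\<lambda>x. x) (cE Z)) \<noteq> 0"
proof (cases "(2 :: 'f) = 0")
  case False
  let ?Z = "scale_End (1 / 2) id"
  have "\<psi> ?Z = h" by (rule \<psi>_half[OF False])
  moreover have Z: "?Z \<in> EndK" by (intro EndK_scale EndK_id)
  moreover have "det (Lm (\<lambda>x. x) (cE ?Z)) \<noteq> 0"
  proof -
    have "cE ?Z i = 1 / 2 * ee i" if "i < N" for i
      using coords_lin[OF scale_End.vector_space_axioms basis_t EndK_id EndK_id that, of "1 / 2" 0]
      by (simp only: scale_End.scale_zero_left add_0_right ee_def mult_zero_left)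
    then have "Lm (\<lambda>x. x) (cE ?Z) = Lm (\<lambda>x. x) (\<lambda>i. 1 / 2 * ee i)" by (rule Lm_cong)
    then show ?thesis using False Lm_unit[OF comm_ring_hom_id, of "1 / 2"] by simp
  qed
  ultimately show thesis by (intro that)
next
  case True
  obtain x where x: "det (Lm (\<lambda>x. x) (cE Z0) + x \<cdot>\<^sub>m 1\<^sub>m N) \<noteq> 0" using exists_regular_shift[OF Lm_carrier] by blast
  let ?Z = "Z0 + scale_End x id"
  have "h v w + h v w = 0" for v w
  proof -
    have "\<iota> (1 + 1) * h v w = h v w + h v w" by (simp only: iota_simps distrib_right mult_1)
    then show ?thesis using True by simp
  qed
  then have "\<psi> id = 0" by (intro ext) (simp add: \<psi>_def)
  then have "\<psi> ?Z = h"
    using Z0 by (simp only: \<psi>_plus[OF Z0(1) EndK_scale[OF EndK_id]] \<psi>_scale scale_form.scale_zero_right add_0_right)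
  moreover have "?Z \<in> EndK" by (intro EndK_scale EndK_id EndK_plus Z0)
  moreover have "Lm (\<lambda>x. x) (cE ?Z) = Lm (\<lambda>x. x) (cE Z0) + x \<cdot>\<^sub>m 1\<^sub>m N"
  proof -
    have "cE ?Z i = 1 * cE Z0 i + x * ee i" if "i < N" for i
      using coords_lin[OF scale_End.vector_space_axioms basis_t Z0(1) EndK_id that, of 1 x]
      by (simp only: scale_End.scale_one ee_def)
    then have "Lm (\<lambda>x. x) (cE ?Z) = Lm (\<lambda>x. x) (\<lambda>i. cE Z0 i + x * ee i)" by (intro Lm_cong) simp
    also have "\<dots> = Lm (\<lambda>x. x) (cE Z0) + Lm (\<lambda>x. x) (\<lambda>i. x * ee i)"
      by (rule eq_matI) (auto simp: Lm_def distrib_left sum.distrib)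
    finally show ?thesis unfolding Lm_unit[OF comm_ring_hom_id] .
  qed
  ultimately show thesis using x by (intro that[of ?Z]) simp_all
qed

lemma dim_G_eq: "M \<le> N" "dim_G N t = enat (N - M)"
proof -
  obtain Z where "Z \<in> EndK" "\<psi> Z = h" "det (Lm (\<lambda>x. x) (cE Z)) \<noteq> 0" by (rule exists_regular_Z)
  from dim_G_aux[OF this] show "M \<le> N" "dim_G N t = enat (N - M)" by auto
qed

end

section \<open>Lifting points of smooth algebras\<close>

lemma mpol_eval_ideal_cong:
  assumes \<phi>: "comm_ring_hom \<phi>" and R: "is_subring R" and S: "is_subring S" and J: "is_ideal S J"
    and \<phi>S: "\<And>a. a \<in> R \<Longrightarrow> \<phi> a \<in> S"
    and q: "\<And>i. i < n \<Longrightarrow> q i \<in> S" "\<And>i. i < n \<Longrightarrow> q' i \<in> S" "\<And>i. i < n \<Longrightarrow> q i - q' i \<in> J"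
    and g: "g \<in> mpol_ring R n"
  shows "mpol_eval \<phi> q g - mpol_eval \<phi> q' g \<in> J"
proof -
  interpret comm_ring_hom "mpol_eval \<phi> q" by (rule comm_ring_hom_mpol_eval[OF \<phi>])
  interpret q': comm_ring_hom "mpol_eval \<phi> q'" by (rule comm_ring_hom_mpol_eval[OF \<phi>])
  have "mpol_eval \<phi> q g - mpol_eval \<phi> q' g \<in> J \<and> mpol_eval \<phi> q g \<in> S \<and> mpol_eval \<phi> q' g \<in> S"
    using g
  proof (induction rule: mpol_ring_induct[OF _ R, consumes 1, case_names const var add mult])
    case (const c)
    then show ?case using J \<phi>S by (simp add: mpol_eval_const[OF \<phi>] is_ideal_def)
  next
    case (var i)
    then show ?case using q by (simp add: mpol_eval_var[OF \<phi>])
  next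
    case (add f g)
    have "mpol_eval \<phi> q (f + g) - mpol_eval \<phi> q' (f + g) =
      (mpol_eval \<phi> q f - mpol_eval \<phi> q' f) + (mpol_eval \<phi> q g - mpol_eval \<phi> q' g)"
      by (simp add: hom_add q'.hom_add)
    then have "mpol_eval \<phi> q (f + g) - mpol_eval \<phi> q' (f + g) \<in> J" using add is_ideal_add[OF J] by (simp only:)
    then show ?case using add subring_add[OF S] by (simp add: hom_add q'.hom_add)
  next
    case (mult f g)
    have "mpol_eval \<phi> q (f * g) - mpol_eval \<phi> q' (f * g) =
      mpol_eval \<phi> q f * (mpol_eval \<phi> q g - mpol_eval \<phi> q' g) + mpol_eval \<phi> q' g * (mpol_eval \<phi> q f - mpol_eval \<phi> q' f)"
      by (simp add: hom_mult q'.hom_mult algebra_simps)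
    then have "mpol_eval \<phi> q (f * g) - mpol_eval \<phi> q' (f * g) \<in> J"
      using mult is_ideal_add[OF J] is_ideal_mult[OF J] by (simp only:)
    then show ?case using mult subring_mult[OF S] by (simp add: hom_mult q'.hom_mult)
  qed
  then show ?thesis by simp
qed

text \<open>First-order expansion with the whole remainder absorbed into one multiple of
  \<open>t * t\<close>. No factorials occur, so it holds in every characteristic.\<close>

lemma mpol_taylor:
  assumes \<phi>: "comm_ring_hom \<phi>" and g: "g \<in> mpol_ring UNIV n"
  shows "\<exists>u. mpol_eval \<phi> (\<lambda>j. \<zeta> j + t * \<eta> j) g =
    mpol_eval \<phi> \<zeta> g + t * (\<Sum>j<n. \<eta> j * mpol_eval \<phi> \<zeta> (mpol_deriv j g)) + t * t * u"
  using g
proof (induction rule: mpol_ring_induct[OF _ is_subring_UNIV, consumes 1, case_names const var add mult])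
  case (const c)
  then show ?case by (intro exI[of _ 0]) (simp add: mpol_eval_const[OF \<phi>] mpol_eval_zero[OF \<phi>])
next
  case (var i)
  have "(\<Sum>j<n. \<eta> j * mpol_eval \<phi> \<zeta> (mpol_deriv j (mvar i))) = \<eta> i"
  proof -
    interpret comm_ring_hom "mpol_eval \<phi> \<zeta>" by (rule comm_ring_hom_mpol_eval[OF \<phi>])
    have "(\<Sum>j<n. \<eta> j * mpol_eval \<phi> \<zeta> (mpol_deriv j (mvar i))) = (\<Sum>j<n. if j = i then \<eta> j else 0)"
      by (intro sum.cong refl) (simp add: mpol_deriv_var)
    then show ?thesis using var by simp
  qed
  then show ?case by (intro exI[of _ 0]) (simp add: mpol_eval_var[OF \<phi>])
next
  case (add f g)
  then obtain u v where "mpol_eval \<phi> (\<lambda>j. \<zeta> j + t * \<eta> j) f =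
    mpol_eval \<phi> \<zeta> f + t * (\<Sum>j<n. \<eta> j * mpol_eval \<phi> \<zeta> (mpol_deriv j f)) + t * t * u"
    "mpol_eval \<phi> (\<lambda>j. \<zeta> j + t * \<eta> j) g =
    mpol_eval \<phi> \<zeta> g + t * (\<Sum>j<n. \<eta> j * mpol_eval \<phi> \<zeta> (mpol_deriv j g)) + t * t * v" by blast
  then show ?case
    by (intro exI[of _ "u + v"]) (simp add: mpol_eval_add[OF \<phi>] mpol_deriv_add distrib_left sum.distrib)
next
  case (mult f g)
  define \<alpha> \<beta> where "\<alpha> = (\<Sum>j<n. \<eta> j * mpol_eval \<phi> \<zeta> (mpol_deriv j f))" and "\<beta> = (\<Sum>j<n. \<eta> j * mpol_eval \<phi> \<zeta> (mpol_deriv j g))"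
  from mult obtain u v where uv: "mpol_eval \<phi> (\<lambda>j. \<zeta> j + t * \<eta> j) f = mpol_eval \<phi> \<zeta> f + t * \<alpha> + t * t * u"
    "mpol_eval \<phi> (\<lambda>j. \<zeta> j + t * \<eta> j) g = mpol_eval \<phi> \<zeta> g + t * \<beta> + t * t * v" unfolding \<alpha>_def \<beta>_def by blast
  have d: "(\<Sum>j<n. \<eta> j * mpol_eval \<phi> \<zeta> (mpol_deriv j (f * g))) = \<alpha> * mpol_eval \<phi> \<zeta> g + mpol_eval \<phi> \<zeta> f * \<beta>"
    unfolding \<alpha>_def \<beta>_def sum_distrib_left sum_distrib_right
    by (subst sum.distrib[symmetric], intro sum.cong refl)
      (simp add: mpol_deriv_mult mpol_eval_add[OF \<phi>] mpol_eval_mult[OF \<phi>] algebra_simps)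
  show ?case unfolding d mpol_eval_mult[OF \<phi>] uv
    by (intro exI[of _ "\<alpha> * \<beta> + u * (mpol_eval \<phi> \<zeta> g + t * \<beta> + t * t * v) + (mpol_eval \<phi> \<zeta> f + t * \<alpha>) * v"])
      (simp add: algebra_simps)
qed

lemma det_mat_hom: "comm_ring_hom \<theta> \<Longrightarrow> \<theta> (det (mat n n f)) = det (mat n n (\<lambda>x. \<theta> (f x)))"
proof -
  assume "comm_ring_hom \<theta>"
  then interpret comm_ring_hom \<theta> .
  have "map_mat \<theta> (mat n n f) = mat n n (\<lambda>x. \<theta> (f x))" by (rule eq_matI) auto
  then show ?thesis using hom_det[of "mat n n f"] by simp
qed

lemma comm_ring_hom_poly_map:
  assumes "comm_ring_hom \<theta>" shows "comm_ring_hom (\<lambda>g. poly (map_poly \<theta> g) w)"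
proof -
  interpret comm_ring_hom \<theta> by fact
  interpret m: map_poly_comm_ring_hom \<theta> ..
  show ?thesis by unfold_locales (simp_all add: m.hom_add m.hom_mult m.hom_one)
qed

lemma comm_ring_hom_pconst: "comm_ring_hom (\<lambda>a. [:a:])"
  by unfold_locales (simp_all add: one_pCons)

lemma comm_ring_hom_poly0: "comm_ring_hom (\<lambda>p. poly p a)"
  by unfold_locales simp_all

lemma is_subring_polys: "is_subring S \<Longrightarrow> is_subring {g :: 'a::comm_ring_1 poly. \<forall>i. Polynomial.coeff g i \<in> S}"
  unfolding is_subring_def[of "{g. _ g}"]
  by (auto simp: coeff_mult coeff_1 when_def intro!: subring_sum subring_mult subring_diff subring_0 subring_1)

lemma is_ideal_dvd_hom:
  assumes "comm_ring_hom \<theta>" shows "is_ideal S {a. x dvd \<theta> a}"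
proof -
  interpret comm_ring_hom \<theta> by fact
  show ?thesis by (simp add: is_ideal_def hom_add hom_mult)
qed

text \<open>One Newton step: if u is 1 modulo X, then u (2 - u) is 1 modulo X^2.\<close>

lemma inverse_mod_square:
  fixes p :: "'f::field poly"
  assumes "poly p 0 \<noteq> 0" shows "\<exists>w. [:0, 0, 1:] dvd p * w - 1"
proof -
  define u where "u = [:1 / poly p 0:] * p"
  have "[:0, 1:] dvd u - 1" using assms by (simp add: u_def flip: poly_eq_0_iff_dvd[of _ 0, simplified])
  then have "[:0, 1:] * [:0, 1:] dvd (u - 1) * (u - 1)" by (intro mult_dvd_mono)
  then have "[:0, 0, 1:] dvd - ((u - 1) * (u - 1))" by simp
  also have "- ((u - 1) * (u - 1)) = u * (2 - u) - 1" by (simp add: algebra_simps)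
  also have "\<dots> = p * ([:1 / poly p 0:] * (2 - u)) - 1" unfolding u_def by (simp only: mult_ac)
  finally show ?thesis by blast
qed

lemma X_dvd_iff: "[:0, 1:] dvd p \<longleftrightarrow> poly p 0 = (0 :: 'f::field)"
  using poly_eq_0_iff_dvd[of p 0] by simp

text \<open>Infinitesimal lifting from modulo X^2 to modulo X^3. The approximate point is
  transported to the presentation of the localised algebra, where the Jacobian block in the first
  \<open>c\<close> variables is invertible; correcting these variables by multiples of X^2 kills the
  X^2-coefficients of the equations, and the result is carried back to the original
  coordinates.\<close>

lemma smooth_lift:
  fixes I :: "'f::field mpol set" and x :: "nat \<Rightarrow> 'f poly"
  assumes smooth: "smooth_at UNIV mconst (mpol_ring UNIV r) I P d"
    and I: "I \<subseteq> mpol_ring UNIV r"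
    and P: "\<And>f. f \<in> mpol_ring UNIV r \<Longrightarrow> f \<notin> P \<Longrightarrow> mpol_eval (\<lambda>a. a) (\<lambda>i. poly (x i) 0) f \<noteq> 0"
    and x: "\<And>f. f \<in> I \<Longrightarrow> [:0, 0, 1:] dvd mpol_eval (\<lambda>a. [:a:]) x f"
  obtains x' where "\<And>i. i < r \<Longrightarrow> [:0, 0, 1:] dvd x' i - x i"
    "\<And>f. f \<in> I \<Longrightarrow> [:0, 0, 1:] * [:0, 1:] dvd mpol_eval (\<lambda>a. [:a:]) x' f"
proof -
  let ?R = "\<lambda>n. mpol_ring (UNIV :: 'f set) n" and ?C = "\<lambda>a :: 'f. [:a:]" and ?\<phi> = "\<lambda>a :: 'f. [:mconst a:]"
  let ?t = "[:0, 0, 1:] :: 'f poly"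
  note hC = comm_ring_hom_pconst
  have h\<phi>: "comm_ring_hom ?\<phi>" by (rule comm_ring_hom_comp[OF comm_ring_hom_pconst comm_ring_hom_mconst])
  have sr: "is_subring (?R n)" for n by (intro is_subring_mpol_ring is_subring_UNIV)
  from smooth obtain s where s: "s \<in> ?R r - P" and std0: "let S' = {g. \<forall>i. Polynomial.coeff g i \<in> ?R r} in
      standard_smooth UNIV ?\<phi> S' (ideal_gen S' (insert [:- 1, s:] ((\<lambda>a. [:a:]) ` I))) d"
    unfolding smooth_at_def by blast
  define S' where "S' = {g :: 'f mpol poly. \<forall>i. Polynomial.coeff g i \<in> ?R r}"
  define J where "J = ideal_gen S' (insert [:- 1, s:] ((\<lambda>a. [:a:]) ` I))"
  have S': "is_subring S'" unfolding S'_def by (rule is_subring_polys[OF sr])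
  have J: "is_ideal S' J" unfolding J_def by (rule ideal_gen_ideal[OF S'])
  have std: "standard_smooth UNIV ?\<phi> S' J d" using std0 unfolding Let_def S'_def[symmetric] J_def[symmetric] .
  obtain n c f q where f: "\<And>i. i < c \<Longrightarrow> f i \<in> ?R n" and n: "n = c + d" and q: "\<And>j. j < n \<Longrightarrow> q j \<in> S'"
    and surj: "\<And>a. a \<in> S' \<Longrightarrow> \<exists>g\<in>?R n. mpol_eval ?\<phi> q g - a \<in> J"
    and ker: "{g \<in> ?R n. mpol_eval ?\<phi> q g \<in> J} = ideal_gen (?R n) (f ` {..<c})"
    and jac: "\<exists>u\<in>S'. u * det (mat c c (\<lambda>(i, j). mpol_eval ?\<phi> q (mpol_deriv j (f i)))) - 1 \<in> J"
    using std unfolding standard_smooth_def by blast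
  define ev where "ev = mpol_eval ?C x"
  have hev: "comm_ring_hom ev" unfolding ev_def by (rule comm_ring_hom_mpol_eval[OF hC])
  have "poly (ev s) 0 = mpol_eval (\<lambda>a. a) (\<lambda>i. poly (x i) 0) s"
    unfolding ev_def mpol_eval_hom[OF comm_ring_hom_poly0] by simp
  then have "poly (ev s) 0 \<noteq> 0" using P[of s] s by simp
  then obtain w where w: "?t dvd ev s * w - 1" using inverse_mod_square by blast
  \<comment> \<open>The point as a homomorphism on polynomials in the extra variable of the
    localisation. That variable goes to an inverse of \<open>s\<close> modulo X^2, so
    \<open>J\<close> is killed modulo X^2.\<close>
  define \<theta> where "\<theta> g = poly (map_poly ev g) w" for g
  have h\<theta>: "comm_ring_hom \<theta>" unfolding \<theta>_def by (rule comm_ring_hom_poly_map[OF hev])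
  interpret ev: comm_ring_hom ev by (rule hev)
  interpret \<theta>: comm_ring_hom \<theta> by (rule h\<theta>)
  have mp: "map_poly ev (pCons a p) = pCons (ev a) (map_poly ev p)" for a p
    by (rule poly_eqI) (simp add: coeff_map_poly coeff_pCons split: nat.split)
  have \<theta>C: "\<theta> [:a:] = ev a" for a by (simp add: \<theta>_def mp)
  have "J \<subseteq> {a. ?t dvd \<theta> a}" unfolding J_def
  proof (rule ideal_gen_least[OF is_ideal_dvd_hom[OF h\<theta>]], intro subsetI)
    fix a assume "a \<in> insert [:- 1, s:] ((\<lambda>a. [:a:]) ` I)"
    then consider "a = [:- 1, s:]" | b where "b \<in> I" "a = [:b:]" by blast
    then show "a \<in> {a. ?t dvd \<theta> a}"
    proof cases
      case 1
      have "\<theta> a = ev s * w - 1"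
        by (simp add: 1 \<theta>_def mp ev.hom_uminus mult.commute)
      then show ?thesis using w by simp
    next
      case 2
      then show ?thesis using x[of b] by (simp add: \<theta>C ev_def)
    qed
  qed
  then have J\<theta>: "?t dvd \<theta> a" if "a \<in> J" for a using that by blast
  define \<zeta> where "\<zeta> j = \<theta> (q j)" for j
  have \<theta>ev: "\<theta> (mpol_eval ?\<phi> q g) = mpol_eval ?C \<zeta> g" for g
    unfolding mpol_eval_hom[OF h\<theta>] \<zeta>_def by (simp add: \<theta>C ev_def mpol_eval_const[OF hC])
  have kerD: "mpol_eval ?\<phi> q (f i) \<in> J" if "i < c" for i
  proof -
    have "f i \<in> ideal_gen (?R n) (f ` {..<c})" by (rule ideal_gen_superset[OF sr]) (use that in simp)
    then show ?thesis unfolding ker[symmetric] by simp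
  qed
  have "\<exists>a. \<forall>i<c. mpol_eval ?C \<zeta> (f i) = ?t * a i"
  proof -
    have "\<exists>a. i < c \<longrightarrow> mpol_eval ?C \<zeta> (f i) = ?t * a" for i
      using J\<theta>[OF kerD[of i]] unfolding \<theta>ev dvd_def by blast
    then have "\<forall>i. \<exists>a. i < c \<longrightarrow> mpol_eval ?C \<zeta> (f i) = ?t * a" ..
    from choice[OF this] show ?thesis by blast
  qed
  then obtain a where a: "\<And>i. i < c \<Longrightarrow> mpol_eval ?C \<zeta> (f i) = ?t * a i" by blast
  define m where "m = mat c c (\<lambda>(i, j). poly (mpol_eval ?C \<zeta> (mpol_deriv j (f i))) 0)"
  have "det m \<noteq> 0"
  proof -
    obtain u where "u * det (mat c c (\<lambda>(i, j). mpol_eval ?\<phi> q (mpol_deriv j (f i)))) - 1 \<in> J" using jac by blast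
    from J\<theta>[OF this] have "?t dvd \<theta> u * \<theta> (det (mat c c (\<lambda>(i, j). mpol_eval ?\<phi> q (mpol_deriv j (f i))))) - 1"
      by (simp only: \<theta>.hom_minus \<theta>.hom_mult \<theta>.hom_one)
    moreover have "\<theta> (det (mat c c (\<lambda>(i, j). mpol_eval ?\<phi> q (mpol_deriv j (f i))))) =
        det (mat c c (\<lambda>(i, j). mpol_eval ?C \<zeta> (mpol_deriv j (f i))))" (is "_ = ?D")
      unfolding det_mat_hom[OF h\<theta>] by (intro arg_cong[of _ _ det] cong_mat) (simp_all add: \<theta>ev)
    ultimately have "?t dvd \<theta> u * ?D - 1" by (simp only:)
    then have "[:0, 1:] dvd \<theta> u * ?D - 1" by (rule dvd_trans[rotated]) (rule dvdI[of _ _ "[:0, 1:]"], simp)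
    then have "poly (\<theta> u) 0 * poly ?D 0 = 1" unfolding X_dvd_iff by simp
    moreover have "poly ?D 0 = det m"
      unfolding m_def det_mat_hom[OF comm_ring_hom_poly0] by (intro arg_cong[of _ _ det] cong_mat) simp_all
    ultimately show ?thesis by auto
  qed
  \<comment> \<open>Linear system for the correction: the matrix is the Jacobian block at X = 0 and
    the right-hand side consists of the negated X^2-coefficients of the equations.\<close>
  then obtain z where "z \<in> carrier_vec c" and z: "m *\<^sub>v z = vec c (\<lambda>i. - poly (a i) 0)"
    using solve_linear_system[of m c "vec c (\<lambda>i. - poly (a i) 0)"] by (auto simp: m_def)
  define \<eta> where "\<eta> j = (if j < c then [:z $ j:] else 0)" for j
  define \<zeta>' where "\<zeta>' j = \<zeta> j + ?t * \<eta> j" for j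
  \<comment> \<open>The remainder of the expansion carries X^4, so modulo X^3 only the linear term
    counts.\<close>
  have X3: "?t * [:0, 1:] dvd mpol_eval ?C \<zeta>' (f i)" if i: "i < c" for i
  proof -
    obtain u where u: "mpol_eval ?C \<zeta>' (f i) = mpol_eval ?C \<zeta> (f i) +
        ?t * (\<Sum>j<n. \<eta> j * mpol_eval ?C \<zeta> (mpol_deriv j (f i))) + ?t * ?t * u"
      unfolding \<zeta>'_def using mpol_taylor[OF hC f[OF i]] by blast
    define b where "b = a i + (\<Sum>j<n. \<eta> j * mpol_eval ?C \<zeta> (mpol_deriv j (f i))) + ?t * u"
    have e: "mpol_eval ?C \<zeta>' (f i) = ?t * b" unfolding u a[OF i] b_def by (simp only: distrib_left mult.assoc)
    have "[:0, 1:] dvd b"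
    proof -
      have "poly (\<Sum>j<n. \<eta> j * mpol_eval ?C \<zeta> (mpol_deriv j (f i))) 0 = (\<Sum>j<c. z $ j * m $$ (i, j))"
      proof -
        have "(\<Sum>j<n. \<eta> j * mpol_eval ?C \<zeta> (mpol_deriv j (f i))) = (\<Sum>j<c. \<eta> j * mpol_eval ?C \<zeta> (mpol_deriv j (f i)))"
          by (rule sum.mono_neutral_right) (auto simp: n \<eta>_def)
        then show ?thesis using i by (simp add: poly_sum \<eta>_def m_def)
      qed
      also have "\<dots> = (m *\<^sub>v z) $ i"
        using i \<open>z \<in> carrier_vec c\<close> by (simp add: m_def scalar_prod_def lessThan_atLeast0 mult.commute)
      also have "\<dots> = - poly (a i) 0" using i by (simp add: z)
      finally show ?thesis by (simp add: X_dvd_iff b_def)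
    qed
    then show ?thesis unfolding e by (rule mult_dvd_mono[OF dvd_refl])
  qed
  have "ideal_gen (?R n) (f ` {..<c}) \<subseteq> {g. ?t * [:0, 1:] dvd mpol_eval ?C \<zeta>' g}"
    by (rule ideal_gen_least[OF is_ideal_dvd_hom[OF comm_ring_hom_mpol_eval[OF hC]]]) (use X3 in blast)
  then have K: "?t * [:0, 1:] dvd mpol_eval ?C \<zeta>' g" if "g \<in> ?R n" "mpol_eval ?\<phi> q g \<in> J" for g
    using that unfolding ker[symmetric] by blast
  have vS: "[:mvar i:] \<in> S'" if "i < r" for i
    using that mpol_ring_var[OF is_subring_UNIV] subring_0[OF sr] by (auto simp: S'_def coeff_pCons split: nat.split)
  \<comment> \<open>Polynomials expressing the original coordinates through the variables of the
    presentation, modulo \<open>J\<close>.\<close>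
  have "\<exists>g. \<forall>i<r. g i \<in> ?R n \<and> mpol_eval ?\<phi> q (g i) - [:mvar i:] \<in> J"
  proof -
    have "\<exists>g. i < r \<longrightarrow> g \<in> ?R n \<and> mpol_eval ?\<phi> q g - [:mvar i:] \<in> J" for i
      using surj[OF vS[of i]] by blast
    then have "\<forall>i. \<exists>g. i < r \<longrightarrow> g \<in> ?R n \<and> mpol_eval ?\<phi> q g - [:mvar i:] \<in> J" ..
    from choice[OF this] show ?thesis by blast
  qed
  then obtain g where g: "\<And>i. i < r \<Longrightarrow> g i \<in> ?R n" and gJ: "\<And>i. i < r \<Longrightarrow> mpol_eval ?\<phi> q (g i) - [:mvar i:] \<in> J" by blast
  show thesis
  proof (rule that[of "\<lambda>i. mpol_eval ?C \<zeta>' (g i)"])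
    fix i assume i: "i < r"
    have "?t dvd \<theta> (mpol_eval ?\<phi> q (g i) - [:mvar i:])" by (rule J\<theta>[OF gJ[OF i]])
    then have 1: "?t dvd mpol_eval ?C \<zeta> (g i) - x i"
      by (simp add: \<theta>.hom_minus \<theta>ev \<theta>C ev_def mpol_eval_var[OF hC])
    obtain u where "mpol_eval ?C \<zeta>' (g i) = mpol_eval ?C \<zeta> (g i) +
        ?t * (\<Sum>j<n. \<eta> j * mpol_eval ?C \<zeta> (mpol_deriv j (g i))) + ?t * ?t * u"
      unfolding \<zeta>'_def using mpol_taylor[OF hC g[OF i]] by blast
    then have "mpol_eval ?C \<zeta>' (g i) - x i = (mpol_eval ?C \<zeta> (g i) - x i) +
        ?t * ((\<Sum>j<n. \<eta> j * mpol_eval ?C \<zeta> (mpol_deriv j (g i))) + ?t * u)"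
      by (simp only: distrib_left mult.assoc diff_conv_add_uminus add_ac)
    then show "?t dvd mpol_eval ?C \<zeta>' (g i) - x i"
      using dvd_add[OF 1 dvd_triv_left] by (simp only:)
  next
    fix F assume F: "F \<in> I"
    then have FR: "F \<in> ?R r" using I by blast
    have J0: "[:F:] \<in> J" unfolding J_def by (rule ideal_gen_superset[OF S']) (use F in blast)
    have "mpol_eval ?\<phi> (\<lambda>i. mpol_eval ?\<phi> q (g i)) F - mpol_eval ?\<phi> (\<lambda>i. [:mvar i:]) F \<in> J"
    proof (rule mpol_eval_ideal_cong[OF h\<phi> is_subring_UNIV S' J _ _ vS gJ FR])
      show cS: "?\<phi> a \<in> S'" for a
        using mpol_ring_const[of a UNIV r] subring_0[OF sr] by (auto simp: S'_def coeff_pCons split: nat.split)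
      show "mpol_eval ?\<phi> q (g i) \<in> S'" if "i < r" for i
        by (rule mpol_eval_in_subring[OF g[OF that] S' q cS])
    qed
    moreover have "mpol_eval ?\<phi> (\<lambda>i. [:mvar i:]) F = [:F:]"
      using mpol_eval_hom[OF comm_ring_hom_pconst, of mconst mvar F] mpol_eval_mvar[OF FR is_subring_UNIV] by simp
    ultimately have "mpol_eval ?\<phi> (\<lambda>i. mpol_eval ?\<phi> q (g i)) F \<in> J"
      using is_ideal_add[OF J _ J0] by fastforce
    then have "mpol_eval ?\<phi> q (mpol_eval mconst g F) \<in> J" unfolding mpol_eval_subst[OF h\<phi>] .
    moreover have "mpol_eval mconst g F \<in> ?R n"
      by (rule mpol_eval_in_subring[OF FR sr g]) (auto intro: mpol_ring_const)
    ultimately have "?t * [:0, 1:] dvd mpol_eval ?C \<zeta>' (mpol_eval mconst g F)" by (intro K)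
    then show "?t * [:0, 1:] dvd mpol_eval ?C (\<lambda>i. mpol_eval ?C \<zeta>' (g i)) F" unfolding mpol_eval_subst[OF hC] .
  qed
qed

context end_coords
begin

text \<open>In characteristic 2 the curve \<open>(1 + X) id\<close> is unitary modulo \<open>X\<^sup>2\<close>; a lift modulo \<open>X\<^sup>3\<close> exhibits \<open>h\<close>
  as a value of \<open>\<psi>\<close>.\<close>

lemma h_in_range_\<psi>:
  assumes smooth: "G_smooth N t"
  shows "\<exists>Z\<in>EndK. h = \<psi> Z"
proof (cases "(2 :: 'f) = 0")
  case False
  then show ?thesis using \<psi>_half by (intro bexI[of _ "scale_End (1 / 2) id"] EndK_scale EndK_id) simp
next
  case True
  let ?R = "mpol_ring (UNIV :: 'f set) N" and ?C = "\<lambda>a :: 'f. [:a:]" and ?t = "[:0, 0, 1:] :: 'f poly"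
  let ?gen = "\<lambda>\<xi> v w. Poly_Mapping.map \<xi> (conv h (lc mvar (mconst v)) (lc mvar (mconst w)) - mconst (h v w))"
  let ?lin = "\<lambda>\<xi> :: 'k \<Rightarrow> 'f. (\<forall>x y. \<xi> (x + y) = \<xi> x + \<xi> y) \<and> (\<forall>a x. \<xi> (\<iota> a * x) = a * \<xi> x)"
  note hC = comm_ring_hom_pconst and hid = comm_ring_hom_id
  define P where "P = {f \<in> ?R. mpol_eval (\<lambda>a. a) ee f = 0}"
  have "P \<in> G_points N t" unfolding P_def
  proof (rule kernel_in_G_points[OF hid])
    fix k assume k: "k < N"
    have "mul (\<lambda>a. a) (star (\<lambda>a. a) ee) ee k = mul (\<lambda>a. a) ee ee k" by (rule mul_cong) (simp_all add: star_unit[OF hid])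
    then show "mul (\<lambda>a. a) (star (\<lambda>a. a) ee) ee k = ee k" by (simp add: mul_unit_left[OF hid k])
  qed
  note PG = this
  then obtain d where sm: "smooth_at UNIV mconst ?R (G_ideal N t) P d"
    using smooth unfolding G_smooth_def is_smooth_def by (elim ballE[of _ _ P] exE) simp_all
  have GP: "G_ideal N t \<subseteq> P" using PG by (simp add: G_points_def)
  define x where "x i = [:1, 1:] * [:ee i:]" for i
  \<comment> \<open>Characteristic 2 removes the mixed term of the square.\<close>
  have sq: "[:1, 1:] * [:1, 1:] = 1 + ?t" using True by (simp add: one_pCons)
  have gen0: "\<exists>\<xi> v w. ?lin \<xi> \<and> f = ?gen \<xi> v w"
    if "f \<in> {?gen \<xi> v w | \<xi> v w. ?lin \<xi>}" for f using that by blast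
  have mxx: "mul ?C (star ?C x) x k = (1 + ?t) * [:ee k:]" if k: "k < N" for k
  proof -
    have "mul ?C (star ?C x) x k = mul ?C (\<lambda>i. [:1, 1:] * star ?C (\<lambda>i. [:ee i:]) i) (\<lambda>i. [:1, 1:] * [:ee i:]) k"
      unfolding x_def star_scale ..
    also have "\<dots> = [:1, 1:] * ([:1, 1:] * mul ?C (star ?C (\<lambda>i. [:ee i:])) (\<lambda>i. [:ee i:]) k)"
      unfolding mul_scale_left mul_scale_right ..
    also have "mul ?C (star ?C (\<lambda>i. [:ee i:])) (\<lambda>i. [:ee i:]) k = mul ?C (\<lambda>i. [:ee i:]) (\<lambda>i. [:ee i:]) k"
      by (rule mul_cong) (simp_all add: star_unit[OF hC])
    also have "\<dots> = [:ee k:]" by (rule mul_unit_left[OF hC k])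
    finally show ?thesis by (simp only: mult.assoc[symmetric] sq)
  qed
  have unit: "(\<Sum>k<N. [:ee k:] * [:\<xi> (h v (t k w)):]) = [:\<xi> (h v w):]" if "?lin \<xi>" for \<xi> v w
  proof -
    interpret C: comm_ring_hom ?C by (rule hC)
    have "\<xi> (h v w) = (\<Sum>k<N. ee k * \<xi> (h v (t k w)))"
      using functional_unit[of \<xi> id v w, OF _ _ EndK_id] that by (simp add: ee_def)
    then have "[:\<xi> (h v w):] = ?C (\<Sum>k<N. ee k * \<xi> (h v (t k w)))" by simp
    then show ?thesis by (simp only: C.hom_sum C.hom_mult)
  qed
  have x2: "?t dvd mpol_eval ?C x f" if "f \<in> G_ideal N t" for f
  proof -
    have "G_ideal N t \<subseteq> {f. ?t dvd mpol_eval ?C x f}"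
      unfolding G_ideal_def
    proof (rule ideal_gen_least[OF is_ideal_dvd_hom[OF comm_ring_hom_mpol_eval[OF hC]]], intro subsetI)
      fix f assume "f \<in> {?gen \<xi> v w | \<xi> v w. ?lin \<xi>}"
      then obtain \<xi> v w where xi: "?lin \<xi>" and f: "f = ?gen \<xi> v w" using gen0 by blast
      have "mpol_eval ?C x f = (\<Sum>k<N. mul ?C (star ?C x) x k * [:\<xi> (h v (t k w)):]) - [:\<xi> (h v w):]"
        unfolding f by (rule G_generator_eval[OF hC]) (use xi in blast)+
      also have "(\<Sum>k<N. mul ?C (star ?C x) x k * [:\<xi> (h v (t k w)):]) = (\<Sum>k<N. (1 + ?t) * ([:ee k:] * [:\<xi> (h v (t k w)):]))"
        by (intro sum.cong refl) (simp only: lessThan_iff mxx mult.assoc)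
      also have "\<dots> = (1 + ?t) * [:\<xi> (h v w):]" unfolding sum_distrib_left[symmetric] unit[OF xi] ..
      finally have "mpol_eval ?C x f = ?t * [:\<xi> (h v w):]" by (simp only: distrib_right mult_1 add_diff_cancel_left')
      then show "f \<in> {f. ?t dvd mpol_eval ?C x f}" by (simp only: mem_Collect_eq dvd_triv_left)
    qed
    then show ?thesis using that by blast
  qed
  have px: "poly (x i) 0 = ee i" for i by (simp add: x_def)
  have GR: "G_ideal N t \<subseteq> ?R" using GP by (auto simp: P_def)
  obtain x' where x': "\<And>i. i < N \<Longrightarrow> ?t dvd x' i - x i" "\<And>f. f \<in> G_ideal N t \<Longrightarrow> ?t * [:0, 1:] dvd mpol_eval ?C x' f"
  proof (rule smooth_lift[OF sm GR _ x2])
    show "mpol_eval (\<lambda>a. a) (\<lambda>i. poly (x i) 0) f \<noteq> 0" if "f \<in> ?R" "f \<notin> P" for f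
      using that by (simp add: P_def px)
  qed (assumption | rule that)+
  have "\<exists>y. \<forall>i<N. x' i = x i + ?t * y i"
  proof -
    have "\<exists>y. i < N \<longrightarrow> x' i = x i + ?t * y" for i
    proof (cases "i < N")
      case True
      from x'(1)[OF True] obtain y where "x' i - x i = ?t * y" by (rule dvdE)
      then have "x' i = x i + ?t * y" by (simp only: diff_eq_eq add.commute)
      then show ?thesis by blast
    qed blast
    then have "\<forall>i. \<exists>y. i < N \<longrightarrow> x' i = x i + ?t * y" ..
    from choice[OF this] show ?thesis by blast
  qed
  then obtain y where y: "\<And>i. i < N \<Longrightarrow> x' i = x i + ?t * y i" by blast
  define Yc where "Yc i = poly (y i) 0" for i
  define Y where "Y = (\<Sum>i<N. scale_End (Yc i) (t i))"
  have Y: "Y \<in> EndK" unfolding Y_def by (rule is_basis_sum[OF basis_t UNIV_I])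
  have cY: "cE Y i = Yc i" if "i < N" for i by (rule coords_eqI[OF basis_t, of Y Yc i]) (rule Y_def that)+
  \<comment> \<open>Terms of the lifted endomorphism multiplied by its adjoint: \<open>m1\<close> is
    the cross term with \<open>x\<close> and \<open>m2\<close> is quadratic in the correction. At X
    = 0 the former becomes \<open>Y + adj Y\<close>.\<close>
  define m1 m2 where "m1 k = mul ?C (star ?C x) y k + mul ?C (star ?C y) x k" and "m2 k = mul ?C (star ?C y) y k" for k
  have mul': "mul ?C (star ?C x') x' k = (1 + ?t) * [:ee k:] + ?t * (m1 k + ?t * m2 k)" if k: "k < N" for k
  proof -
    have "star ?C x' i = star ?C x i + ?t * star ?C y i" for i
      using star_cong[of x' "\<lambda>i. x i + ?t * y i" ?C i] y by (simp only: star_add star_scale)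
    then have "mul ?C (star ?C x') x' k = mul ?C (\<lambda>i. star ?C x i + ?t * star ?C y i) (\<lambda>i. x i + ?t * y i) k"
      using y by (intro mul_cong) auto
    then show ?thesis
      by (simp only: mul_add_left mul_add_right mul_scale_left mul_scale_right mxx[OF k] m1_def m2_def distrib_left add_ac)
  qed
  have pm1: "poly (m1 k) 0 = cE (Y + adj Y) k" if k: "k < N" for k
  proof -
    have ps: "poly (star ?C z i) 0 = star (\<lambda>a. a) (\<lambda>i. poly (z i) 0) i" for z i by (simp add: star_def poly_sum mult.commute)
    have pm: "poly (mul ?C z z' k) 0 = mul (\<lambda>a. a) (\<lambda>i. poly (z i) 0) (\<lambda>i. poly (z' i) 0) k" for z z'
      unfolding mul_hom[OF comm_ring_hom_poly0] by simp
    have "poly (m1 k) 0 = mul (\<lambda>a. a) (star (\<lambda>a. a) ee) Yc k + mul (\<lambda>a. a) (star (\<lambda>a. a) Yc) ee k"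
      by (simp add: m1_def pm ps px Yc_def[abs_def])
    also have "mul (\<lambda>a. a) (star (\<lambda>a. a) ee) Yc k = mul (\<lambda>a. a) ee Yc k" by (rule mul_cong) (simp_all add: star_unit[OF hid])
    also have "\<dots> = Yc k" by (rule mul_unit_left[OF hid k])
    also have "mul (\<lambda>a. a) (star (\<lambda>a. a) Yc) ee k = star (\<lambda>a. a) Yc k" by (rule mul_unit_right[OF hid k])
    also have "star (\<lambda>a. a) Yc k = star (\<lambda>a. a) (cE Y) k" by (rule star_cong) (simp add: cY)
    finally show ?thesis by (simp add: cE_add_adj[OF Y k] cY[OF k])
  qed
  \<comment> \<open>The equation of \<open>G\<close> at the lift is X^2 times an expression that
    must vanish at X = 0; its value there is \<xi> of \<open>h v w + \<psi> Y v w\<close>.\<close>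
  have 0: "\<xi> (h v w + \<psi> Y v w) = 0" if xi: "?lin \<xi>" for \<xi> v w
  proof -
    have G: "?gen \<xi> v w \<in> G_ideal N t" unfolding G_ideal_def
      by (rule ideal_gen_superset) (use xi in \<open>auto intro: is_subring_UNIV\<close>)
    have "mpol_eval ?C x' (?gen \<xi> v w) = (\<Sum>k<N. mul ?C (star ?C x') x' k * [:\<xi> (h v (t k w)):]) - [:\<xi> (h v w):]"
      by (rule G_generator_eval[OF hC]) (use xi in blast)+
    also have "(\<Sum>k<N. mul ?C (star ?C x') x' k * [:\<xi> (h v (t k w)):]) =
      (\<Sum>k<N. (1 + ?t) * ([:ee k:] * [:\<xi> (h v (t k w)):]) + ?t * ((m1 k + ?t * m2 k) * [:\<xi> (h v (t k w)):]))"
      by (intro sum.cong refl) (simp only: lessThan_iff mul' distrib_right[of _ _ "[:\<xi> (h v (t _ w)):]"] mult.assoc)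
    also have "\<dots> = (1 + ?t) * [:\<xi> (h v w):] + ?t * (\<Sum>k<N. (m1 k + ?t * m2 k) * [:\<xi> (h v (t k w)):])"
      unfolding sum.distrib sum_distrib_left[symmetric] unit[OF xi] ..
    finally have "mpol_eval ?C x' (?gen \<xi> v w) = ?t * ([:\<xi> (h v w):] + (\<Sum>k<N. (m1 k + ?t * m2 k) * [:\<xi> (h v (t k w)):]))"
      by (simp only: distrib_left distrib_right mult_1 add_diff_cancel_left' add.assoc)
    then have "?t * [:0, 1:] dvd ?t * ([:\<xi> (h v w):] + (\<Sum>k<N. (m1 k + ?t * m2 k) * [:\<xi> (h v (t k w)):]))"
      using x'(2)[OF G] by (simp only:)
    then have "[:0, 1:] dvd [:\<xi> (h v w):] + (\<Sum>k<N. (m1 k + ?t * m2 k) * [:\<xi> (h v (t k w)):])"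
      by (subst (asm) dvd_times_left_cancel_iff) simp_all
    then have "\<xi> (h v w) + (\<Sum>k<N. poly (m1 k) 0 * \<xi> (h v (t k w))) = 0"
      unfolding X_dvd_iff by (simp add: poly_sum mult.commute)
    moreover have "\<psi> Y v w = h v ((Y + adj Y) w)" by (simp only: \<psi>_adj[OF Y])
    moreover have "\<xi> (h v ((Y + adj Y) w)) = (\<Sum>k<N. cE (Y + adj Y) k * \<xi> (h v (t k w)))"
      by (rule functional_unit) (use xi in blast, use xi in blast, intro EndK_plus Y adj_EndK)
    ultimately show ?thesis using xi by (simp add: pm1)
  qed
  have "h v w + \<psi> Y v w = 0" for v w
    using functional_sep[of "h v w + \<psi> Y v w"] 0[of _ v w] by blast
  then have "h = \<psi> (scale_End (- 1) Y)"
    unfolding \<psi>_scale by (intro ext) (simp add: scale_form_def eq_neg_iff_add_eq_0)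
  then show ?thesis using EndK_scale[OF Y] by blast
qed

end

text \<open>Expanding one basis in the other and back gives a matrix product equal to the identity,
  so \<open>exists_minor\<close> selects \<open>N\<close> distinct indices below
  \<open>r\<close>.\<close>

lemma is_basis_card_le:
  assumes b: "is_basis UNIV sc N b W" and b': "is_basis UNIV sc r b' W"
    and v: "vector_space sc"
  shows "N \<le> r"
proof -
  interpret vector_space sc by fact
  let ?c = "coords sc N b" and ?c' = "coords sc r b'"
  have bW: "b k \<in> W" if "k < N" for k by (rule is_basis_mem[OF v b that])
  have bW': "b' k \<in> W" if "k < r" for k by (rule is_basis_mem[OF v b' that])
  have JW: "(\<Sum>l<r. ?c' (b k) l * ?c (b' l) k') = (if k = k' then 1 else 0)" if k: "k < N" "k' < N" for k k'
  proof -
    have "b k = (\<Sum>l<r. sc (?c' (b k) l) (b' l))" by (rule coords_sum(1)[OF b' bW[OF k(1)], symmetric])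
    also have "\<dots> = (\<Sum>l<r. sc (?c' (b k) l) (\<Sum>j<N. sc (?c (b' l) j) (b j)))"
      by (intro sum.cong refl) (simp add: coords_sum(1)[OF b bW'])
    also have "\<dots> = (\<Sum>l<r. \<Sum>j<N. sc (?c' (b k) l * ?c (b' l) j) (b j))" by (simp add: scale_sum_right)
    also have "\<dots> = (\<Sum>j<N. sc (\<Sum>l<r. ?c' (b k) l * ?c (b' l) j) (b j))" by (subst sum.swap) (simp add: scale_sum_left)
    finally have "?c (b k) k' = (\<Sum>l<r. ?c' (b k) l * ?c (b' l) k')" by (rule coords_eqI[OF b _ k(2)])
    moreover have "?c (b k) k' = (if k = k' then 1 else 0)"
      by (rule coords_eqI[OF b _ k(2)]) (simp add: if_distrib[of "\<lambda>x. sc x _"] sum.delta k cong: if_cong)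
    ultimately show ?thesis by simp
  qed
  have prime: "is_prime_ideal (UNIV :: 'a set) {0}" by (auto simp: is_prime_ideal_def)
  have "\<exists>\<kappa>. inj_on \<kappa> {..<N} \<and> (\<forall>j<N. \<kappa> j < r)"
    by (rule exists_minor[OF is_subring_UNIV prime, where J = "\<lambda>k l. ?c' (b k) l" and W = "\<lambda>l k. ?c (b' l) k" and s = 1
      and M = N and N = r]) (auto simp: JW)
  then obtain \<kappa> where "inj_on \<kappa> {..<N}" "\<And>j. j < N \<Longrightarrow> \<kappa> j < r" by blast
  then show ?thesis using card_inj_on_le[of \<kappa> "{..<N}" "{..<r}"] by auto
qed

section \<open>Maps of affine spaces with a regular Jacobian minor\<close>

text \<open>The Jacobian condition in \<open>standard_smooth\<close> concerns the first variables,
  so the columns of a minor must be permuted to the front.\<close>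

lemma ex_bij_extend:
  fixes \<kappa> :: "nat \<Rightarrow> nat"
  assumes inj: "inj_on \<kappa> {..<M}" and \<kappa>: "\<And>j. j < M \<Longrightarrow> \<kappa> j < N"
  obtains \<pi> \<pi>' where "\<And>j. j < M \<Longrightarrow> \<pi> j = \<kappa> j" "\<And>j. j < N \<Longrightarrow> \<pi> j < N" "\<And>i. i < N \<Longrightarrow> \<pi>' i < N"
    "\<And>j. j < N \<Longrightarrow> \<pi>' (\<pi> j) = j" "\<And>i. i < N \<Longrightarrow> \<pi> (\<pi>' i) = i" "M \<le> N"
proof -
  let ?K = "\<kappa> ` {..<M}"
  have sub: "?K \<subseteq> {..<N}" using \<kappa> by auto
  have cK: "card ?K = M" using card_image[OF inj] by simp
  then have MN: "M \<le> N" using card_mono[OF _ sub] by simp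
  have "card ({..<N} - ?K) = N - M" using card_Diff_subset[OF finite_subset[OF sub] sub] cK by simp
  then obtain \<nu> where nu: "bij_betw \<nu> {0..<N - M} ({..<N} - ?K)"
    using ex_bij_betw_nat_finite[of "{..<N} - ?K"] by auto
  define \<pi> where "\<pi> j = (if j < M then \<kappa> j else \<nu> (j - M))" for j
  have "bij_betw \<pi> ({..<M} \<union> {M..<N}) (?K \<union> ({..<N} - ?K))"
  proof (rule bij_betw_combine)
    have "bij_betw \<pi> {..<M} ?K = bij_betw \<kappa> {..<M} ?K" by (rule bij_betw_cong) (simp add: \<pi>_def)
    then show "bij_betw \<pi> {..<M} ?K" using inj by (simp add: bij_betw_def)
    have "bij_betw (\<lambda>j. j - M) {M..<N} {0..<N - M}"
      by (rule bij_betwI[where g = "\<lambda>j. j + M"]) auto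
    from bij_betw_trans[OF this nu] have "bij_betw (\<nu> \<circ> (\<lambda>j. j - M)) {M..<N} ({..<N} - ?K)" .
    moreover have "bij_betw \<pi> {M..<N} ({..<N} - ?K) = bij_betw (\<nu> \<circ> (\<lambda>j. j - M)) {M..<N} ({..<N} - ?K)"
      by (rule bij_betw_cong) (simp add: \<pi>_def)
    ultimately show "bij_betw \<pi> {M..<N} ({..<N} - ?K)" by simp
  qed auto
  moreover have "{..<M} \<union> {M..<N} = {..<N}" "?K \<union> ({..<N} - ?K) = {..<N}" using MN sub by auto
  ultimately have bij: "bij_betw \<pi> {..<N} {..<N}" by simp
  show thesis
  proof (rule that[of \<pi> "the_inv_into {..<N} \<pi>"])
    show "\<pi> j = \<kappa> j" if "j < M" for j using that by (simp add: \<pi>_def)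
    show "\<pi> j < N" if "j < N" for j using that bij_betwE[OF bij] by auto
    show "the_inv_into {..<N} \<pi> i < N" if "i < N" for i
      using that bij_betwE[OF bij_betw_the_inv_into[OF bij]] by auto
    show "the_inv_into {..<N} \<pi> (\<pi> j) = j" if "j < N" for j
      using that the_inv_into_f_f[OF bij_betw_imp_inj_on[OF bij]] by auto
    show "\<pi> (the_inv_into {..<N} \<pi> i) = i" if "i < N" for i
      using that f_the_inv_into_f_bij_betw[OF bij] by auto
  qed (rule MN)
qed

text \<open>Chain rule for a renaming of variables combined with a change of coefficients. Several
  variables may receive the same name, hence the sum.\<close>

lemma mpol_deriv_rename:
  fixes b :: "'a::comm_ring_1 mpol"
  assumes b: "b \<in> mpol_ring R N" and R: "is_subring R" and \<chi>: "comm_ring_hom \<chi>"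
  shows "mpol_deriv l (mpol_eval (\<lambda>a. mconst (\<chi> a)) (\<lambda>i. mvar (\<nu> i)) b) =
    (\<Sum>i<N. if \<nu> i = l then mpol_eval (\<lambda>a. mconst (\<chi> a)) (\<lambda>i. mvar (\<nu> i)) (mpol_deriv i b) else 0)"
proof -
  let ?e = "mpol_eval (\<lambda>a. mconst (\<chi> a)) (\<lambda>i. mvar (\<nu> i))"
  have hom: "comm_ring_hom (\<lambda>a. mconst (\<chi> a))" by (rule comm_ring_hom_comp[OF comm_ring_hom_mconst \<chi>])
  interpret comm_ring_hom ?e by (rule comm_ring_hom_mpol_eval[OF hom])
  show ?thesis using b
  proof (induction rule: mpol_ring_induct[OF _ R, consumes 1, case_names const var add mult])
    case (const c)
    then show ?case by (simp add: mpol_eval_const[OF hom] cong: if_cong)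
  next
    case (var j)
    have "(\<Sum>i<N. if \<nu> i = l then ?e (mpol_deriv i (mvar j)) else 0) = (\<Sum>i<N. if i = j then (if \<nu> j = l then 1 else 0) else 0)"
      by (intro sum.cong refl) (simp add: mpol_deriv_var)
    then show ?case using var by (simp add: mpol_eval_var[OF hom] mpol_deriv_var)
  next
    case (add f g)
    have "?e (mpol_deriv i (f + g)) = ?e (mpol_deriv i f) + ?e (mpol_deriv i g)" for i
      by (simp only: mpol_deriv_add hom_add)
    then show ?case
      unfolding hom_add mpol_deriv_add add by (simp add: sum.distrib[symmetric] if_distrib cong: if_cong)
  next
    case (mult f g)
    have "?e (mpol_deriv i (f * g)) = ?e (mpol_deriv i f) * ?e g + ?e f * ?e (mpol_deriv i g)" for i
      by (simp only: mpol_deriv_mult hom_add hom_mult)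
    then show ?case
      unfolding hom_mult mpol_deriv_mult mult sum_distrib_left sum_distrib_right sum.distrib[symmetric]
      by (intro sum.cong refl) simp
  qed
qed

lemma det_first_column:
  fixes m :: "'a::comm_ring_1 mat"
  assumes m: "m \<in> carrier_mat (Suc M) (Suc M)" and 0: "\<And>i. i < M \<Longrightarrow> m $$ (Suc i, 0) = 0"
  shows "det m = m $$ (0, 0) * det (mat M M (\<lambda>(i, j). m $$ (Suc i, Suc j)))"
proof -
  have "det m = (\<Sum>i<Suc M. m $$ (i, 0) * cofactor m i 0)" by (rule laplace_expansion_column[OF m]) simp
  also have "\<dots> = m $$ (0, 0) * cofactor m 0 0" by (simp add: sum.lessThan_Suc_shift 0 del: sum.lessThan_Suc)
  also have "cofactor m 0 0 = det (mat_delete m 0 0)" by (simp add: cofactor_def)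
  also have "mat_delete m 0 0 = mat M M (\<lambda>(i, j). m $$ (Suc i, Suc j))"
    by (rule eq_matI) (use m in \<open>auto simp: mat_delete_def\<close>)
  finally show ?thesis .
qed

text \<open>With \<delta> the minor, the localisation of A[x] at \<delta> is presented over A[y] by
  variables w, x and the equations \<delta> w = 1 and g_k(x) = y_k. These are \<open>M + 1\<close>
  equations in \<open>N + 1\<close> variables, and the Jacobian in w and the
  \<open>\<kappa>\<close>-variables is \<delta>^2, with inverse w^2.\<close>

lemma smooth_at_of_minor:
  fixes A :: "'a::comm_ring_1 set" and g :: "nat \<Rightarrow> 'a mpol"
  assumes A: "is_subring A" and g: "\<And>k. k < M \<Longrightarrow> g k \<in> mpol_ring A N"
    and inj: "inj_on \<kappa> {..<M}" and \<kappa>: "\<And>j. j < M \<Longrightarrow> \<kappa> j < N"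
    and minor: "det (mat M M (\<lambda>(i, j). mpol_deriv (\<kappa> j) (g i))) \<notin> Q"
  shows "smooth_at (mpol_ring A M) (mpol_eval mconst g) (mpol_ring A N) {0} Q (N - M)"
proof -
  obtain \<pi> \<pi>' where \<pi>: "\<And>j. j < M \<Longrightarrow> \<pi> j = \<kappa> j" "\<And>j. j < N \<Longrightarrow> \<pi> j < N" "\<And>i. i < N \<Longrightarrow> \<pi>' i < N"
    "\<And>j. j < N \<Longrightarrow> \<pi>' (\<pi> j) = j" "\<And>i. i < N \<Longrightarrow> \<pi> (\<pi>' i) = i" "M \<le> N"
    by (rule ex_bij_extend[OF inj \<kappa>], assumption, rule that, assumption+)
  define R where "R = mpol_ring A M"
  define S where "S = mpol_ring A N"
  define \<delta> where "\<delta> = det (mat M M (\<lambda>(i, j). mpol_deriv (\<kappa> j) (g i)))"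
  define S' where "S' = {g :: 'a mpol poly. \<forall>i. Polynomial.coeff g i \<in> S}"
  define J where "J = ideal_gen S' (insert [:- 1, \<delta>:] ((\<lambda>a. [:a:]) ` {0}))"
  have R: "is_subring R" and S: "is_subring S" unfolding R_def S_def by (auto intro: A)
  have gS: "g k \<in> S" if "k < M" for k using g[OF that] by (simp add: S_def)
  have \<delta>S: "\<delta> \<in> S" unfolding \<delta>_def
    by (rule det_in_subring[OF S mat_carrier]) (use g \<kappa> in \<open>auto simp: S_def intro: mpol_deriv_closed A\<close>)
  have S': "is_subring S'" unfolding S'_def by (rule is_subring_polys[OF S])
  have J: "is_ideal S' J" unfolding J_def by (rule ideal_gen_ideal[OF S'])
  define Rz where "Rz = mpol_ring R (Suc N)"
  have Rz: "is_subring Rz" unfolding Rz_def by (auto intro: R)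
  have S'C: "[:a:] \<in> S'" if "a \<in> S" for a
    using that subring_0[OF S] by (auto simp: S'_def coeff_pCons split: nat.split)
  have S'w: "[:0, 1:] \<in> S'"
    using subring_0[OF S] subring_1[OF S] by (auto simp: S'_def coeff_pCons split: nat.split)
  define \<phi> where "\<phi> r = [:mpol_eval mconst g r:]" for r
  have h\<phi>: "comm_ring_hom \<phi>" unfolding \<phi>_def
    by (rule comm_ring_hom_comp[OF comm_ring_hom_pconst comm_ring_hom_mpol_eval[OF comm_ring_hom_mconst]])
  have gr: "mpol_eval mconst g r \<in> S" if "r \<in> R" for r
    by (rule mpol_eval_in_subring[OF that[unfolded R_def] S gS]) (auto simp: S_def intro: mpol_ring_const)
  have \<phi>S: "\<phi> r \<in> S'" if "r \<in> R" for r unfolding \<phi>_def by (rule S'C[OF gr[OF that]])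
  \<comment> \<open>Index 0 is reserved for w; variable \<open>Suc j\<close> of the presentation
    stands for variable \<open>\<pi> j\<close> of the source.\<close>
  define q :: "nat \<Rightarrow> 'a mpol poly" where "q j = (case j of 0 \<Rightarrow> [:0, 1:] | Suc i \<Rightarrow> [:mvar (\<pi> i):])" for j
  have q0: "q 0 = [:0, 1:]" and qS: "q (Suc i) = [:mvar (\<pi> i):]" for i by (simp_all add: q_def)
  have qS': "q j \<in> S'" if "j < Suc N" for j
    using that \<pi>(2) by (cases j) (auto simp: q0 qS S'w S_def intro!: S'C mpol_ring_var A)
  define ev where "ev = mpol_eval \<phi> q"
  have hev: "comm_ring_hom ev" unfolding ev_def by (rule comm_ring_hom_mpol_eval[OF h\<phi>])
  interpret ev: comm_ring_hom ev by (rule hev)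
  have evS: "ev G \<in> S'" if "G \<in> Rz" for G
    unfolding ev_def by (rule mpol_eval_in_subring[OF that[unfolded Rz_def] S' qS' \<phi>S])
  have evc: "ev (mconst r) = \<phi> r" and evv: "ev (mvar j) = q j" for r j
    by (simp_all add: ev_def mpol_eval_const[OF h\<phi>] mpol_eval_var[OF h\<phi>])
  \<comment> \<open>Lifts a polynomial in x to the presentation by renaming.
    \<open>\<Lambda>\<close> below extends this to polynomials in w and is a homomorphic right
    inverse of \<open>ev\<close>.\<close>
  define \<Lambda>0 :: "'a mpol \<Rightarrow> 'a mpol mpol" where "\<Lambda>0 = mpol_eval (\<lambda>a. mconst (mconst a)) (\<lambda>i. mvar (Suc (\<pi>' i)))"
  have hcc: "comm_ring_hom (\<lambda>a :: 'a. mconst (mconst a))" by (rule comm_ring_hom_comp[OF comm_ring_hom_mconst comm_ring_hom_mconst])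
  have h\<Lambda>0: "comm_ring_hom \<Lambda>0" unfolding \<Lambda>0_def by (rule comm_ring_hom_mpol_eval[OF hcc])
  interpret \<Lambda>0: comm_ring_hom \<Lambda>0 by (rule h\<Lambda>0)
  have cRz: "mconst (mconst a) \<in> Rz" if "a \<in> A" for a
    using that by (auto simp: Rz_def R_def intro!: mpol_ring_const)
  have vRz: "mvar j \<in> Rz" if "j < Suc N" for j using that by (auto simp: Rz_def intro!: mpol_ring_var R)
  have \<Lambda>0Rz: "\<Lambda>0 b \<in> Rz" if "b \<in> S" for b
    unfolding \<Lambda>0_def by (rule mpol_eval_in_subring[OF that[unfolded S_def] Rz]) (use \<pi>(3) in \<open>auto intro: vRz cRz\<close>)
  have ev\<Lambda>0: "ev (\<Lambda>0 b) = [:b:]" if b: "b \<in> S" for b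
  proof -
    have "ev (\<Lambda>0 b) = mpol_eval (\<lambda>a. [:mconst a:]) (\<lambda>i. q (Suc (\<pi>' i))) b"
      unfolding \<Lambda>0_def mpol_eval_hom[OF hev] by (simp add: evc evv \<phi>_def mpol_eval_const[OF comm_ring_hom_mconst])
    also have "\<dots> = mpol_eval (\<lambda>a. [:mconst a:]) (\<lambda>i. [:mvar i:]) b"
      by (rule mpol_eval_cong[OF b[unfolded S_def]]) (simp_all add: qS \<pi>(5))
    also have "\<dots> = [:mpol_eval mconst mvar b:]" by (rule mpol_eval_hom[OF comm_ring_hom_pconst, symmetric])
    finally show ?thesis using mpol_eval_mvar[OF b[unfolded S_def] A] by simp
  qed
  define \<Lambda> where "\<Lambda> a = poly (map_poly \<Lambda>0 a) (mvar 0)" for a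
  have h\<Lambda>: "comm_ring_hom \<Lambda>" unfolding \<Lambda>_def by (rule comm_ring_hom_poly_map[OF h\<Lambda>0])
  interpret \<Lambda>: comm_ring_hom \<Lambda> by (rule h\<Lambda>)
  have \<Lambda>p: "\<Lambda> (pCons a b) = \<Lambda>0 a + mvar 0 * \<Lambda> b" for a b
  proof -
    have "map_poly \<Lambda>0 (pCons a b) = pCons (\<Lambda>0 a) (map_poly \<Lambda>0 b)"
      by (rule poly_eqI) (simp add: coeff_map_poly coeff_pCons split: nat.split)
    then show ?thesis by (simp add: \<Lambda>_def)
  qed
  have \<Lambda>S': "\<Lambda> a \<in> Rz \<and> ev (\<Lambda> a) = a" if "a \<in> S'" for a
    using that
  proof (induction a)
    case 0
    then show ?case by (simp add: subring_0[OF Rz])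
  next
    case (pCons a b)
    from pCons.prems have ab: "a \<in> S" "b \<in> S'"
      unfolding S'_def by (auto simp: coeff_pCons split: nat.splits)
    have "ev (\<Lambda> (pCons a b)) = [:a:] + [:0, 1:] * b"
      using pCons.IH[OF ab(2)] by (simp add: \<Lambda>p ev.hom_add ev.hom_mult ev\<Lambda>0 ab evv q0)
    moreover have "\<Lambda> (pCons a b) \<in> Rz"
      using pCons.IH[OF ab(2)] by (auto simp: \<Lambda>p intro!: subring_add[OF Rz] subring_mult[OF Rz] \<Lambda>0Rz ab vRz)
    ultimately show ?case by simp
  qed
  define f where "f i = (case i of 0 \<Rightarrow> \<Lambda>0 \<delta> * mvar 0 - 1 | Suc k \<Rightarrow> \<Lambda>0 (g k) - mconst (mvar k))" for i
  have f0: "f 0 = \<Lambda>0 \<delta> * mvar 0 - 1" and fS: "f (Suc k) = \<Lambda>0 (g k) - mconst (mvar k)" for k by (simp_all add: f_def)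
  have vR: "mvar k \<in> R" if "k < M" for k using that by (auto simp: R_def intro!: mpol_ring_var A)
  have mRz: "mconst r \<in> Rz" if "r \<in> R" for r using that by (auto simp: Rz_def intro!: mpol_ring_const)
  have fRz: "f i \<in> Rz" if "i < Suc M" for i
    using that by (cases i)
      (auto simp: f0 fS intro!: subring_diff[OF Rz] subring_mult[OF Rz] subring_1[OF Rz] \<Lambda>0Rz \<delta>S gS vRz mRz vR)
  define I where "I = ideal_gen Rz (f ` {..<Suc M})"
  have I: "is_ideal Rz I" unfolding I_def by (rule ideal_gen_ideal[OF Rz])
  have fI: "f i \<in> I" if "i < Suc M" for i unfolding I_def by (rule ideal_gen_superset[OF Rz]) (use that in simp)
  have JG: "[:- 1, \<delta>:] \<in> J" unfolding J_def by (rule ideal_gen_superset[OF S']) simp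
  have J0: "0 \<in> J" using J by (simp add: is_ideal_def)
  have evf: "ev (f i) \<in> J" if i: "i < Suc M" for i
  proof (cases i)
    case 0
    have "ev (f i) = [:- 1, \<delta>:]"
      by (simp add: 0 f0 ev.hom_minus ev.hom_mult ev\<Lambda>0[OF \<delta>S] evv q0 one_pCons)
    then show ?thesis using JG by simp
  next
    case (Suc k)
    then have "ev (f i) = 0"
      using i by (simp add: fS ev.hom_minus ev\<Lambda>0[OF gS] evc \<phi>_def mpol_eval_var[OF comm_ring_hom_mconst])
    then show ?thesis using J0 by simp
  qed
  have preJ: "is_ideal Rz {G \<in> Rz. ev G \<in> J}"
    unfolding is_ideal_def
    using J0 evS is_ideal_add[OF J] is_ideal_mult[OF J] subring_add[OF Rz] subring_mult[OF Rz] subring_0[OF Rz]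
    by (simp add: ev.hom_add ev.hom_mult)
  \<comment> \<open>Every \<open>G\<close> is compared with its normal form
    \<open>\<Lambda> (ev G)\<close>. Among the generators only the constants y_k change, to the lift
    of \<open>g k\<close>, and that change is one of the equations.\<close>
  have section_I: "G - \<Lambda> (ev G) \<in> I \<and> G \<in> Rz \<and> \<Lambda> (ev G) \<in> Rz" if G: "G \<in> Rz" for G
    using G[unfolded Rz_def]
  proof (induction rule: mpol_ring_induct[OF _ R, consumes 1, case_names const var add mult])
    case (const r)
    have e1: "mconst r = mpol_eval (\<lambda>a. mconst (mconst a)) (\<lambda>k. mconst (mvar k)) r"
      using mpol_eval_hom[OF comm_ring_hom_mconst, of mconst mvar r] mpol_eval_mvar[OF const[unfolded R_def] A] by simp
    have "\<Lambda> (ev (mconst r)) = \<Lambda>0 (mpol_eval mconst g r)" by (simp add: evc \<phi>_def \<Lambda>p)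
    also have "\<dots> = mpol_eval (\<lambda>a. mconst (mconst a)) (\<lambda>k. \<Lambda>0 (g k)) r"
      unfolding mpol_eval_hom[OF h\<Lambda>0] by (simp add: \<Lambda>0_def mpol_eval_const[OF hcc])
    finally have e2: "\<Lambda> (ev (mconst r)) = mpol_eval (\<lambda>a. mconst (mconst a)) (\<lambda>k. \<Lambda>0 (g k)) r" .
    have "mconst r - \<Lambda> (ev (mconst r)) \<in> I"
      unfolding e2 unfolding e1
    proof (rule mpol_eval_ideal_cong[OF hcc A Rz I cRz _ _ _ const[unfolded R_def]])
      fix k assume k: "k < M"
      show "mconst (mvar k) \<in> Rz" by (rule mRz[OF vR[OF k]])
      show "\<Lambda>0 (g k) \<in> Rz" by (rule \<Lambda>0Rz[OF gS[OF k]])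
      have "(- 1) * f (Suc k) \<in> I" using k by (intro is_ideal_mult[OF I] fI) (auto intro: subring_uminus[OF Rz] subring_1[OF Rz])
      then show "mconst (mvar k) - \<Lambda>0 (g k) \<in> I" by (simp add: fS)
    qed
    moreover have "\<Lambda> (ev (mconst r)) \<in> Rz" using \<Lambda>S'[OF evS[OF mRz[OF const]]] by simp
    ultimately show ?case using mRz[OF const] by simp
  next
    case (var j)
    have "\<Lambda> (ev (mvar j)) = mvar j"
    proof (cases j)
      case 0
      then show ?thesis by (simp add: evv q0 \<Lambda>p)
    next
      case (Suc i)
      then show ?thesis using var \<pi>(4) by (simp add: evv qS \<Lambda>p) (simp add: \<Lambda>0_def mpol_eval_var[OF hcc])
    qed
    then show ?case using vRz[OF var] I by (simp add: is_ideal_def)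
  next
    case (add F G)
    have "F + G - \<Lambda> (ev (F + G)) = (F - \<Lambda> (ev F)) + (G - \<Lambda> (ev G))" by (simp add: ev.hom_add \<Lambda>.hom_add)
    then have "F + G - \<Lambda> (ev (F + G)) \<in> I" using add is_ideal_add[OF I] by (simp only:)
    then show ?case using add subring_add[OF Rz] by (simp add: ev.hom_add \<Lambda>.hom_add)
  next
    case (mult F G)
    have "F * G - \<Lambda> (ev (F * G)) = F * (G - \<Lambda> (ev G)) + \<Lambda> (ev G) * (F - \<Lambda> (ev F))"
      by (simp add: ev.hom_mult \<Lambda>.hom_mult algebra_simps)
    then have "F * G - \<Lambda> (ev (F * G)) \<in> I" using mult is_ideal_add[OF I] is_ideal_mult[OF I] by (simp only:)
    then show ?case using mult subring_mult[OF Rz] by (simp add: ev.hom_mult \<Lambda>.hom_mult)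
  qed
  have \<Lambda>J: "\<Lambda> a \<in> I" if "a \<in> J" for a
  proof -
    have "is_ideal S' {a. \<Lambda> a \<in> I}"
      using I \<Lambda>S' is_ideal_add[OF I] is_ideal_mult[OF I] by (simp add: is_ideal_def \<Lambda>.hom_add \<Lambda>.hom_mult)
    moreover have "insert [:- 1, \<delta>:] ((\<lambda>a. [:a:]) ` {0}) \<subseteq> {a. \<Lambda> a \<in> I}"
    proof -
      have "\<Lambda> [:- 1, \<delta>:] = f 0" by (simp add: \<Lambda>p f0 \<Lambda>0.hom_uminus mult.commute)
      then show ?thesis using fI[of 0] I by (simp add: is_ideal_def)
    qed
    ultimately have "J \<subseteq> {a. \<Lambda> a \<in> I}" unfolding J_def by (rule ideal_gen_least)
    then show ?thesis using that by blast
  qed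
  have ker: "{G \<in> Rz. ev G \<in> J} = I"
  proof
    show "I \<subseteq> {G \<in> Rz. ev G \<in> J}" unfolding I_def
      by (rule ideal_gen_least[OF preJ]) (use evf fRz in auto)
    show "{G \<in> Rz. ev G \<in> J} \<subseteq> I"
    proof
      fix G assume "G \<in> {G \<in> Rz. ev G \<in> J}"
      then have G: "G \<in> Rz" "ev G \<in> J" by auto
      have "(G - \<Lambda> (ev G)) + \<Lambda> (ev G) \<in> I" using section_I[OF G(1)] \<Lambda>J[OF G(2)] by (intro is_ideal_add[OF I]) auto
      then show "G \<in> I" by simp
    qed
  qed
  have jac: "det (mat (Suc M) (Suc M) (\<lambda>(i, j). ev (mpol_deriv j (f i)))) = [:\<delta>:] * [:\<delta>:]"
  proof -
    let ?m = "mat (Suc M) (Suc M) (\<lambda>(i, j). ev (mpol_deriv j (f i)))"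
    have dL: "mpol_deriv l (\<Lambda>0 b) = (\<Sum>i<N. if Suc (\<pi>' i) = l then \<Lambda>0 (mpol_deriv i b) else 0)" if "b \<in> S" for b l
      unfolding \<Lambda>0_def by (rule mpol_deriv_rename[OF that[unfolded S_def] A comm_ring_hom_mconst])
    have d0: "mpol_deriv 0 (\<Lambda>0 b) = 0" if "b \<in> S" for b unfolding dL[OF that] by simp
    have dS: "mpol_deriv (Suc j) (\<Lambda>0 b) = \<Lambda>0 (mpol_deriv (\<pi> j) b)" if b: "b \<in> S" and j: "j < N" for b j
    proof -
      have "mpol_deriv (Suc j) (\<Lambda>0 b) = (\<Sum>i<N. if i = \<pi> j then \<Lambda>0 (mpol_deriv i b) else 0)"
        unfolding dL[OF b] using \<pi>(4)[OF j] \<pi>(5) by (intro sum.cong refl) auto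
      then show ?thesis using \<pi>(2)[OF j] by simp
    qed
    have "det ?m = ?m $$ (0, 0) * det (mat M M (\<lambda>(i, j). ?m $$ (Suc i, Suc j)))"
    proof (rule det_first_column)
      fix i assume "i < M"
      then show "?m $$ (Suc i, 0) = 0" by (simp add: fS mpol_deriv_diff d0[OF gS])
    qed simp
    also have "?m $$ (0, 0) = [:\<delta>:]"
    proof -
      have "mpol_deriv 0 (1 :: 'a mpol mpol) = 0" using mpol_deriv_const[of 0 "1 :: 'a mpol"] by simp
      then have "mpol_deriv 0 (f 0) = \<Lambda>0 \<delta>" by (simp add: f0 mpol_deriv_diff mpol_deriv_mult d0[OF \<delta>S] mpol_deriv_var)
      then show ?thesis by (simp add: ev\<Lambda>0[OF \<delta>S])
    qed
    also have "mat M M (\<lambda>(i, j). ?m $$ (Suc i, Suc j)) = mat M M (\<lambda>(i, j). [:mpol_deriv (\<kappa> j) (g i):])"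
    proof (rule cong_mat[OF refl refl])
      fix i j assume ij: "i < M" "j < M"
      have "j < N" using ij \<pi>(6) by simp
      have "mpol_deriv (\<kappa> j) (g i) \<in> S" using g[OF ij(1)] by (auto simp: S_def intro: mpol_deriv_closed A)
      then have "ev (mpol_deriv (Suc j) (f (Suc i))) = [:mpol_deriv (\<kappa> j) (g i):]"
        using ij by (simp add: fS mpol_deriv_diff dS[OF gS \<open>j < N\<close>] \<pi>(1) ev\<Lambda>0)
      then show "(case (i, j) of (i, j) \<Rightarrow> ?m $$ (Suc i, Suc j)) = (case (i, j) of (i, j) \<Rightarrow> [:mpol_deriv (\<kappa> j) (g i):])"
        using ij by simp
    qed
    also have "det \<dots> = [:\<delta>:]"
      unfolding \<delta>_def det_mat_hom[OF comm_ring_hom_pconst] by (intro arg_cong[of _ _ det] cong_mat) simp_all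
    finally show ?thesis .
  qed
  have "standard_smooth R \<phi> S' J (N - M)"
    unfolding standard_smooth_def
  proof (intro exI conjI)
    show "Suc N = Suc M + (N - M)" using \<pi>(6) by simp
    show "\<forall>i<Suc M. f i \<in> mpol_ring R (Suc N)" using fRz by (simp add: Rz_def)
    show "\<forall>j<Suc N. q j \<in> S'" using qS' by simp
    show "\<forall>a\<in>S'. \<exists>g\<in>mpol_ring R (Suc N). mpol_eval \<phi> q g - a \<in> J"
    proof
      fix a assume "a \<in> S'"
      from \<Lambda>S'[OF this] show "\<exists>g\<in>mpol_ring R (Suc N). mpol_eval \<phi> q g - a \<in> J"
        using J0 by (intro bexI[of _ "\<Lambda> a"]) (simp_all add: ev_def Rz_def)
    qed
    show "{g \<in> mpol_ring R (Suc N). mpol_eval \<phi> q g \<in> J} = ideal_gen (mpol_ring R (Suc N)) (f ` {..<Suc M})"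
      using ker unfolding I_def Rz_def ev_def .
    show "\<exists>u\<in>S'. u * det (mat (Suc M) (Suc M) (\<lambda>(i, j). mpol_eval \<phi> q (mpol_deriv j (f i)))) - 1 \<in> J"
    proof (rule bexI)
      \<comment> \<open>w^2 \<delta>^2 - 1 factors as w \<delta> + 1 times the localisation relation
        w \<delta> - 1.\<close>
      have "([:0, 1:] * [:\<delta>:] + 1) * [:- 1, \<delta>:] \<in> J"
        by (intro is_ideal_mult[OF J] JG subring_add[OF S'] subring_mult[OF S'] subring_1[OF S'] S'w S'C \<delta>S)
      also have "([:0, 1:] * [:\<delta>:] + 1) * [:- 1, \<delta>:] = [:0, 1:] * [:0, 1:] * ([:\<delta>:] * [:\<delta>:]) - 1"
        by (simp add: one_pCons)
      finally show "[:0, 1:] * [:0, 1:] * det (mat (Suc M) (Suc M) (\<lambda>(i, j). mpol_eval \<phi> q (mpol_deriv j (f i)))) - 1 \<in> J"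
        using jac by (simp only: ev_def)
      show "[:0, 1:] * [:0, 1:] \<in> S'" by (intro subring_mult[OF S'] S'w)
    qed
  qed
  then show ?thesis
    unfolding smooth_at_def Let_def
    using \<delta>S minor by (intro bexI[of _ \<delta>]) (simp_all only: R_def S_def S'_def J_def \<phi>_def[abs_def] \<delta>_def Diff_iff not_False_eq_True simp_thms)
qed

section \<open>Smoothness of \<open>\<rho>\<close>\<close>

text \<open>Adds the lattices. Structure constants, quadratic coefficients and the section become
  integral, because \<open>T_tilde\<close> is closed under composition and adjoints and \<phi> maps
  it into its image under \<psi>.\<close>

locale integral_coords = hermitian_coords val p \<iota> \<sigma> \<epsilon> B act n L h r E N t M s Z0 S
  for val :: "'f::field \<Rightarrow> int" and p :: nat and \<iota> :: "'f \<Rightarrow> 'k::ring_1" and \<sigma> :: "'k \<Rightarrow> 'k" and \<epsilon> :: int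
    and B :: "'k set" and act :: "'v::ab_group_add \<Rightarrow> 'k \<Rightarrow> 'v" and n :: nat and L :: "'v set"
    and h :: "'v \<Rightarrow> 'v \<Rightarrow> 'k" and r :: nat and E :: "nat \<Rightarrow> 'v \<Rightarrow> 'v"
    and N :: nat and t :: "nat \<Rightarrow> 'v \<Rightarrow> 'v"
    and M :: nat and s :: "nat \<Rightarrow> 'v \<Rightarrow> 'v \<Rightarrow> 'k" and Z0 :: "'v \<Rightarrow> 'v" and S :: "nat \<Rightarrow> 'v \<Rightarrow> 'v" +
  assumes basis_tA: "is_basis A scale_End N t T_tilde"
    and basis_sA: "is_basis A scale_form M s (\<psi> ` T_tilde)"
    and S_T: "\<And>k. k < M \<Longrightarrow> S k \<in> T_tilde"
begin

lemma t_T: "i < N \<Longrightarrow> t i \<in> T_tilde"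
proof -
  assume i: "i < N"
  have "(\<Sum>j<N. scale_End (if j = i then 1 else 0) (t j)) = t i"
    using i by (simp add: if_distrib[of "\<lambda>x. scale_End x _"] sum.delta cong: if_cong)
  moreover have "(\<Sum>j<N. scale_End (if j = i then 1 else 0) (t j)) \<in> T_tilde"
    by (rule is_basis_sum[OF basis_tA]) (auto intro: subring_0 subring_1 subring_A)
  ultimately show ?thesis by (simp only:)
qed

lemma cE_A: assumes "X \<in> T_tilde" "i < N" shows "cE X i \<in> A"
proof -
  obtain c where c: "\<forall>i<N. c i \<in> A" "X = (\<Sum>i<N. scale_End (c i) (t i))"
    using is_basis_ex[OF basis_tA assms(1)] by blast
  have "cE X i = c i" by (rule coords_eqI[OF basis_t, of X c i]) (rule c assms)+
  then show ?thesis using c assms(2) by simp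
qed

lemma cS_A: assumes "f \<in> \<psi> ` T_tilde" "k < M" shows "cS f k \<in> A"
proof -
  obtain c where c: "\<forall>k<M. c k \<in> A" "f = (\<Sum>i<M. scale_form (c i) (s i))"
    using is_basis_ex[OF basis_sA assms(1)] by blast
  have "cS f k = c k" by (rule coords_eqI[OF basis_s, of f c k]) (rule c assms)+
  then show ?thesis using c assms(2) by simp
qed

lemma T_tilde_comp: "X \<in> T_tilde \<Longrightarrow> Y \<in> T_tilde \<Longrightarrow> X \<circ> Y \<in> T_tilde"
  and T_tilde_adj: "X \<in> T_tilde \<Longrightarrow> adj X \<in> T_tilde"
  by (simp_all add: T_tilde_def T_comp T_adj)

lemma integral:
  shows cc_A: "i < N \<Longrightarrow> j < N \<Longrightarrow> k < N \<Longrightarrow> cc i j k \<in> A"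
    and tt_A: "i < N \<Longrightarrow> k < N \<Longrightarrow> tt i k \<in> A"
    and aa_A: "i < N \<Longrightarrow> m < M \<Longrightarrow> aa i m \<in> A"
    and bs_A: "i < N \<Longrightarrow> m < M \<Longrightarrow> bs i m \<in> A"
    and bb_A: "i < N \<Longrightarrow> j < N \<Longrightarrow> m < M \<Longrightarrow> bb i j m \<in> A"
    and sec_A: "m < M \<Longrightarrow> i < N \<Longrightarrow> sec m i \<in> A"
  by (simp_all add: cc_def tt_def aa_def bs_def bb_eq sec_def cE_A cS_A t_T T_tilde_comp T_tilde_adj T_tilde_\<phi>[OF Z0] S_T)

abbreviation uu :: "nat \<Rightarrow> 'f mpol" where "uu \<equiv> \<lambda>i. mconst (ee i) + mvar i"

lemma univ_point_eq: "univ_point N t P = lc uu P"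
  unfolding univ_point_def lc_add lc_unit ..

text \<open>Coordinates of h \<circ> (1 + X) - h for generic X: the linear part comes from
  \<open>\<psi> X\<close> and the quadratic part from \<open>\<phi> X\<close>. The value 0 from
  \<open>M\<close> on matches the normalisation in \<open>rho_coords\<close>.\<close>

definition rc :: "nat \<Rightarrow> 'f mpol" where
  "rc k = (if k < M then quadric aa bs (\<lambda>_. 0) k else 0)"

lemma mpol_zero_const: "mconst 0 = (0 :: 'f mpol)"
  by simp

lemma rc_ring: "rc k \<in> mpol_ring A N"
proof -
  have sr: "is_subring (mpol_ring A N)" by (intro is_subring_mpol_ring subring_A)
  have v: "mvar i \<in> mpol_ring A N" if "i < N" for i using that by (intro mpol_ring_var subring_A)
  have c: "mconst a \<in> mpol_ring A N" if "a \<in> A" for a using that by (rule mpol_ring_const)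
  show ?thesis
  proof (cases "k < M")
    case True
    show ?thesis unfolding rc_def quadric_def if_P[OF True]
      by (intro subring_sum[OF sr] subring_mult[OF sr] subring_diff[OF sr] subring_add[OF sr] v c
          aa_A bs_A bb_A subring_0[OF subring_A] True) auto
  qed (simp add: rc_def subring_0[OF sr])
qed

lemma conv_univ_point:
  "conv h (univ_point N t P) (univ_point N t Q) = conv h P Q + (\<Sum>k<M. kscale (rc k) (conv (s k) P Q))"
proof -
  note al = conv_add_left[OF fform_biadd[OF fform_h]] and ar = conv_add_right[OF fform_biadd[OF fform_h]]
  have lin: "conv h P (lc mvar Q) + conv h (lc mvar P) Q = (\<Sum>k<M. kscale (\<Sum>i<N. mconst (aa i k) * mvar i) (conv (s k) P Q))"
  proof -
    have "conv h P (lc mvar Q) + conv h (lc mvar P) Q =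
      (\<Sum>i<N. kscale (mvar i) (conv h P (Poly_Mapping.map (t i) Q))) + (\<Sum>i<N. kscale (mvar i) (conv h (Poly_Mapping.map (t i) P) Q))"
      unfolding lin_comb_def conv_sum_left[OF fform_h] conv_sum_right[OF fform_h] conv_pscale_left[OF fform_h] conv_pscale_right[OF fform_h] ..
    also have "\<dots> = (\<Sum>i<N. kscale (mvar i) (conv h P (Poly_Mapping.map (t i) Q) + conv h (Poly_Mapping.map (t i) P) Q))"
      by (simp only: kscale_add sum.distrib)
    also have "\<dots> = (\<Sum>i<N. kscale (mvar i) (\<Sum>k<M. kscale (mconst (aa i k)) (conv (s k) P Q)))"
    proof (intro sum.cong refl)
      fix i assume "i \<in> {..<N}"
      then have e: "t i \<in> EndK" by (auto intro: t_EndK)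
      have f1: "fform (\<lambda>v w. h v (t i w))" using fform_comp[OF fform_h EndK_id e] by simp
      have f2: "fform (\<lambda>v w. h (t i v) w)" using fform_comp[OF fform_h e EndK_id] by simp
      have ps: "\<psi> (t i) = (\<lambda>v w. h v (t i w)) + (\<lambda>v w. h (t i v) w)" by (intro ext) (simp add: \<psi>_def)
      have "conv h P (Poly_Mapping.map (t i) Q) = conv (\<lambda>v w. h v (t i w)) P Q"
        using conv_map[OF fform_h EndK_id e, of P Q] by (simp add: map_id)
      moreover have "conv h (Poly_Mapping.map (t i) P) Q = conv (\<lambda>v w. h (t i v) w) P Q"
        using conv_map[OF fform_h e EndK_id, of P Q] by (simp add: map_id)
      ultimately have "conv h P (Poly_Mapping.map (t i) Q) + conv h (Poly_Mapping.map (t i) P) Q = conv (\<psi> (t i)) P Q"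
        unfolding ps using conv_plus_form[OF f1 f2, of P Q] by (simp only:)
      also have "\<dots> = (\<Sum>k<M. kscale (mconst (aa i k)) (conv (s k) P Q))"
        unfolding aa_def by (rule \<psi>_expand[OF e])
      finally show "kscale (mvar i) (conv h P (Poly_Mapping.map (t i) Q) + conv h (Poly_Mapping.map (t i) P) Q) =
        kscale (mvar i) (\<Sum>k<M. kscale (mconst (aa i k)) (conv (s k) P Q))" by (rule arg_cong)
    qed
    also have "\<dots> = (\<Sum>i<N. \<Sum>k<M. kscale (mconst (aa i k) * mvar i) (conv (s k) P Q))"
      unfolding kscale_sum kscale_mult[symmetric] by (simp only: mult.commute)
    also have "\<dots> = (\<Sum>k<M. kscale (\<Sum>i<N. mconst (aa i k) * mvar i) (conv (s k) P Q))"
      unfolding kscale_sum by (rule sum.swap)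
    finally show ?thesis .
  qed
  have "conv h (univ_point N t P) (univ_point N t Q) =
    conv h P Q + ((conv h P (lc mvar Q) + conv h (lc mvar P) Q) + conv h (lc mvar P) (lc mvar Q))"
    unfolding univ_point_def al ar by (simp only: add_ac)
  also have "\<dots> = conv h P Q + (\<Sum>k<M. kscale (quadric aa bs (\<lambda>_. 0) k) (conv (s k) P Q))"
    unfolding lin conv_h_quad sum.distrib[symmetric] kscale_add(1)[symmetric] quadric_def mpol_zero_const diff_0_right
    by (simp only: add.assoc)
  finally show ?thesis by (simp add: rc_def)
qed

text \<open>Uniqueness comes from testing on constant vectors, where polynomial coefficients of
  independent forms can be compared.\<close>

lemma rho_coords_eq: "rho_coords N t M s = rc"
  unfolding rho_coords_def
proof (rule the_equality)
  show "(\<forall>k<M. rc k \<in> mpol_ring A N) \<and> (\<forall>k\<ge>M. rc k = 0) \<and>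
     (\<forall>P Q. conv h (univ_point N t P) (univ_point N t Q) = conv h P Q + (\<Sum>k<M. kscale (rc k) (conv (s k) P Q)))"
    by (intro conjI allI impI rc_ring conv_univ_point) (simp add: rc_def)
next
  fix g assume g: "(\<forall>k<M. g k \<in> mpol_ring A N) \<and> (\<forall>k\<ge>M. g k = 0) \<and>
     (\<forall>P Q. conv h (univ_point N t P) (univ_point N t Q) = conv h P Q + (\<Sum>k<M. kscale (g k) (conv (s k) P Q)))"
  have e: "(\<Sum>k<M. kscale (g k) (mconst (s k v w))) = (\<Sum>k<M. kscale (rc k) (mconst (s k v w)))" for v w
  proof -
    have "conv h (mconst v) (mconst w) + (\<Sum>k<M. kscale (g k) (conv (s k) (mconst v) (mconst w))) =
      conv h (mconst v) (mconst w) + (\<Sum>k<M. kscale (rc k) (conv (s k) (mconst v) (mconst w)))"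
      using g conv_univ_point by (simp only:)
    then have "(\<Sum>k<M. kscale (g k) (conv (s k) (mconst v) (mconst w))) = (\<Sum>k<M. kscale (rc k) (conv (s k) (mconst v) (mconst w)))"
      by (rule add_left_imp_eq)
    moreover have "(\<Sum>k<M. kscale (g k) (conv (s k) (mconst v) (mconst w))) = (\<Sum>k<M. kscale (g k) (mconst (s k v w)))" for g
      by (intro sum.cong refl) (simp add: conv_s_const)
    ultimately show ?thesis by (simp only:)
  qed
  show "g = rc"
  proof
    fix k
    show "g k = rc k"
    proof (cases "k < M")
      case True
      show ?thesis by (rule form_coords_inj[OF e True])
    qed (use g in \<open>simp add: rc_def\<close>)
  qed
qed

text \<open>\<open>\<psi> (adj id \<circ> t l)\<close> is \<open>\<psi> (t l)\<close>. This lets the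
  linear part of \<open>rc\<close> be absorbed when the derivative is written in the shifted
  variables \<open>uu\<close>.\<close>

lemma bb_unit: assumes "l < N" "k < M" shows "(\<Sum>j<N. ee j * bb j l k) = aa l k"
proof -
  have e: "t l \<in> EndK" using assms by (auto intro: t_EndK)
  have "(\<Sum>j<N. ee j * bb j l k) = (\<Sum>j<N. ee j * cS (\<psi> (adj (t j) \<circ> t l)) k)"
    using assms by (intro sum.cong refl) (simp add: bb_eq)
  also have "\<dots> = cS (\<psi> (\<Sum>j<N. scale_End (ee j) (adj (t j) \<circ> t l))) k"
    by (rule cS_lin[OF _ assms(2), symmetric]) (auto intro!: EndK_comp adj_EndK t_EndK e)
  also have "(\<Sum>j<N. scale_End (ee j) (adj (t j) \<circ> t l)) = adj (\<Sum>j<N. scale_End (ee j) (t j)) \<circ> t l"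
  proof -
    have "adj (\<Sum>j<N. scale_End (ee j) (t j)) = (\<Sum>j<N. adj (scale_End (ee j) (t j)))"
      by (rule adj_sum) (auto intro: EndK_scale t_EndK)
    also have "\<dots> = (\<Sum>j<N. scale_End (ee j) (adj (t j)))"
      by (intro sum.cong refl) (simp add: adj_scale t_EndK)
    finally show ?thesis by (auto simp: fun_eq_iff sum_fun scale_End_def)
  qed
  also have "\<dots> = t l" unfolding ee_def cE_sum[OF EndK_id] by (simp add: adj_id)
  also have "cS (\<psi> (t l)) k = aa l k" by (simp only: aa_def)
  finally show ?thesis .
qed

text \<open>The Jacobian of \<rho> at 1 + X has the shape of the differential of Z^* Z at Z = 1 + X,
  which is what \<open>jacobian_section\<close> requires.\<close>

lemma mpol_deriv_rc:
  assumes l: "l < N" and k: "k < M"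
  shows "mpol_deriv l (rc k) = (\<Sum>j<N. uu j * mconst (bb j l k))"
proof -
  have "mpol_deriv l (rc k) = mconst (aa l k) + (\<Sum>j<N. mvar j * mconst (bb j l k))"
    unfolding rc_def if_P[OF k] by (rule mpol_deriv_quadric) (use bb_sym bb_diag assms in auto)
  also have "mconst (aa l k) = (\<Sum>j<N. mconst (ee j) * mconst (bb j l k))"
  proof -
    interpret comm_ring_hom "mconst :: 'f \<Rightarrow> _" by (rule comm_ring_hom_mconst)
    show ?thesis unfolding bb_unit[OF l k, symmetric] by (simp only: hom_sum hom_mult)
  qed
  finally show ?thesis by (simp only: distrib_right sum.distrib)
qed

text \<open>The inverse up to \<open>x\<close> provided by \<open>M_star\<close> makes the Jacobian
  right-invertible up to \<open>x\<close>. What remains to be checked is that the right inverse has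
  coefficients in A.\<close>

lemma M_star_minor:
  assumes Q: "Q \<in> M_star N t"
  obtains \<kappa> where "inj_on \<kappa> {..<M}" "\<And>j. j < M \<Longrightarrow> \<kappa> j < N" "det (mat M M (\<lambda>(i, j). mpol_deriv (\<kappa> j) (rc i))) \<notin> Q"
proof -
  let ?R = "mpol_ring A N"
  have sr: "is_subring ?R" by (intro is_subring_mpol_ring subring_A)
  have v: "mvar i \<in> ?R" if "i < N" for i using that by (intro mpol_ring_var subring_A)
  have c: "mconst a \<in> ?R" if "a \<in> A" for a using that by (rule mpol_ring_const)
  from Q have prime: "is_prime_ideal ?R Q" by (simp add: M_star_def)
  from Q obtain x y where x: "x \<in> ?R - Q" and y: "\<And>i. i < N \<Longrightarrow> y i \<in> ?R"
    and inv: "\<And>P. pscale x (univ_point N t P) + lc y (univ_point N t P) = pscale x P"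
    unfolding M_star_def Let_def by blast
  let ?y = "\<lambda>i. x * mconst (ee i) + y i"
  have "lc ?y P = pscale x P + lc y P" for P unfolding lc_add lc_scale lc_unit ..
  then have "lc ?y (lc uu P) = pscale x P" for P using inv[of P] by (simp only: univ_point_eq)
  then have yu: "mul mconst ?y uu k = x * mconst (ee k)" if "k < N" for k by (rule lc_inverse_coords[OF _ that])
  have JW: "(\<Sum>l<N. mpol_deriv l (rc k) * mul mconst (star mconst ?y) (\<lambda>i. mconst (sec k' i)) l) = (if k = k' then x else 0)"
    if k: "k < M" "k' < M" for k k'
  proof -
    have "(\<Sum>l<N. mpol_deriv l (rc k) * mul mconst (star mconst ?y) (\<lambda>i. mconst (sec k' i)) l) =
      (\<Sum>l<N. (\<Sum>j<N. uu j * mconst (bb j l k)) * mul mconst (star mconst ?y) (\<lambda>i. mconst (sec k' i)) l)"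
      by (intro sum.cong refl) (simp only: mpol_deriv_rc[OF _ k(1)] lessThan_iff)
    also have "\<dots> = (if k = k' then x else 0)" by (rule jacobian_section[OF comm_ring_hom_mconst yu k])
    finally show ?thesis .
  qed
  have JS: "mpol_deriv l (rc k) \<in> ?R" for l k by (rule mpol_deriv_closed[OF rc_ring subring_A])
  \<comment> \<open>The coordinates \<open>ee\<close> of the identity may fail to be integral, so
    the unit part of \<open>?y\<close> is multiplied out: it contributes \<open>x\<close> times the
    section, and both resulting terms have coefficients in A.\<close>
  have WS: "mul mconst (star mconst ?y) (\<lambda>i. mconst (sec k' i)) l \<in> ?R" if k': "k' < M" and l: "l < N" for l k'
  proof -
    have "mul mconst (star mconst ?y) (\<lambda>i. mconst (sec k' i)) l =
      mul mconst (\<lambda>i. x * mconst (ee i) + star mconst y i) (\<lambda>i. mconst (sec k' i)) l"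
      by (rule mul_cong) (simp_all add: star_add star_scale star_unit[OF comm_ring_hom_mconst])
    also have "\<dots> = x * mconst (sec k' l) + mul mconst (star mconst y) (\<lambda>i. mconst (sec k' i)) l"
      by (simp only: mul_add_left mul_scale_left mul_unit_left[OF comm_ring_hom_mconst l])
    also have "\<dots> \<in> ?R"
      unfolding mul_def star_def
      by (intro subring_add[OF sr] subring_sum[OF sr] subring_mult[OF sr] c sec_A cc_A tt_A y k' l) (use x in auto)
    finally show ?thesis .
  qed
  show thesis
    by (rule exists_minor[OF sr prime, where J = "\<lambda>k l. mpol_deriv l (rc k)"
        and W = "\<lambda>l k'. mul mconst (star mconst ?y) (\<lambda>i. mconst (sec k' i)) l" and s = x and M = M and N = N])
      (rule JS WS x JW that; assumption)+
qed

lemma rho_smooth: "rho_smooth_of_rel_dim N t M s (N - M)"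
  unfolding rho_smooth_of_rel_dim_def smooth_of_rel_dim_def
proof
  fix Q assume Q: "Q \<in> M_star N t"
  obtain \<kappa> where inj: "inj_on \<kappa> {..<M}" and \<kappa>: "\<And>j. j < M \<Longrightarrow> \<kappa> j < N"
    and D: "det (mat M M (\<lambda>(i, j). mpol_deriv (\<kappa> j) (rc i))) \<notin> Q"
    by (rule M_star_minor[OF Q], rule that, assumption, blast, assumption)
  have "smooth_at (mpol_ring A M) (mpol_eval mconst rc) (mpol_ring A N) {0} Q (N - M)"
    by (rule smooth_at_of_minor[OF subring_A rc_ring inj \<kappa> D])
  then show "smooth_at (mpol_ring A M) (rho_comorphism N t M s) (mpol_ring A N) {0} Q (N - M)"
    by (simp only: rho_comorphism_def rho_coords_eq)
qed

end

theorem theorem3p20: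
  fixes val :: "'f::field \<Rightarrow> int"
    and p :: nat
    and \<iota> :: "'f \<Rightarrow> 'k::ring_1"
    and \<sigma> :: "'k \<Rightarrow> 'k"
    and \<epsilon> :: int
    and B :: "'k set"
    and act :: "'v::ab_group_add \<Rightarrow> 'k \<Rightarrow> 'v"
    and n :: nat
    and L :: "'v set"
    and h :: "'v \<Rightarrow> 'v \<Rightarrow> 'k"
    and N M r :: nat
    and t :: "nat \<Rightarrow> 'v \<Rightarrow> 'v"
    and s :: "nat \<Rightarrow> 'v \<Rightarrow> 'v \<Rightarrow> 'k"
    and E :: "nat \<Rightarrow> 'v \<Rightarrow> 'v"
  assumes setting: "hermitian_lattice val p \<iota> \<sigma> \<epsilon> B act n L h"
    and basis_T: "is_basis (val_ring val) (hermitian_lattice.scale_End \<iota> act) N t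
      (hermitian_lattice.T_tilde val p \<iota> \<sigma> \<epsilon> B act L h)"
    and basis_H: "is_basis (val_ring val) (hermitian_lattice.scale_form \<iota>) M s
      (hermitian_lattice.H_tilde val p \<iota> \<sigma> \<epsilon> B act L h)"
    and basis_End: "is_basis UNIV (hermitian_lattice.scale_End \<iota> act) r E
      (hermitian_lattice.EndK act)"
    and G_smooth: "hermitian_lattice.G_smooth \<iota> act h r E"
  shows "\<exists>d. hermitian_lattice.dim_G \<iota> act h r E = enat d \<and>
    hermitian_lattice.rho_smooth_of_rel_dim val \<iota> act h N t M s d"
proof -
  interpret hl: hermitian_lattice val p \<iota> \<sigma> \<epsilon> B act n L h by (rule setting)
  interpret lb: hermitian_lattice_basis val p \<iota> \<sigma> \<epsilon> B act n L h r E
    by unfold_locales (rule basis_End)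
  interpret ec: end_coords val p \<iota> \<sigma> \<epsilon> B act n L h r E r E
    by unfold_locales (rule basis_End)
  obtain Z0 where Z0: "Z0 \<in> hl.EndK" "h = hl.\<psi> Z0" using ec.h_in_range_\<psi>[OF G_smooth] by blast
  note basis_H' = basis_H[unfolded hl.H_tilde_def]
  have bt: "is_basis UNIV hl.scale_End N t hl.EndK" by (rule lb.basis_T_EndK[OF Z0 basis_T])
  have bs: "is_basis UNIV hl.scale_form M s (hl.\<psi> ` hl.EndK)" by (rule lb.basis_H_EndK[OF Z0 basis_H'])
  \<comment> \<open>Preimages of the basis forms are chosen inside \<open>T_tilde\<close>, which
    makes the section integral.\<close>
  have "\<exists>X. k < M \<longrightarrow> X \<in> hl.T_tilde \<and> hl.\<psi> X = s k" for k
  proof (cases "k < M")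
    case True
    have "(\<Sum>j<M. hl.scale_form (if j = k then 1 else 0) (s j)) = s k"
      using True by (simp add: if_distrib[of "\<lambda>x. hl.scale_form x _"] sum.delta hl.scale_form.scale_zero_left cong: if_cong)
    moreover have "(\<Sum>j<M. hl.scale_form (if j = k then 1 else 0) (s j)) \<in> hl.\<psi> ` hl.T_tilde"
      by (rule is_basis_sum[OF basis_H']) (auto intro: subring_0 subring_1 hl.subring_A)
    ultimately have "s k \<in> hl.\<psi> ` hl.T_tilde" by (simp only:)
    then show ?thesis by auto
  qed simp
  then have "\<forall>k. \<exists>X. k < M \<longrightarrow> X \<in> hl.T_tilde \<and> hl.\<psi> X = s k" ..
  from choice[OF this] obtain S where S: "\<And>k. k < M \<Longrightarrow> S k \<in> hl.T_tilde" "\<And>k. k < M \<Longrightarrow> hl.\<psi> (S k) = s k" by blast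
  have SE: "S k \<in> hl.EndK" if "k < M" for k using lb.T_EndK[OF S(1)[OF that, unfolded hl.T_tilde_def]] .
  \<comment> \<open>\<open>G\<close> is given in the basis \<open>E\<close>, so its dimension is
    read off from this instance; the forms \<open>s\<close> and the preimages \<open>S\<close> are
    shared with the integral instance in the basis \<open>t\<close>.\<close>
  interpret E: hermitian_coords val p \<iota> \<sigma> \<epsilon> B act n L h r E r E M s Z0 S
    by (intro hermitian_coords.intro hermitian_coords_axioms.intro ec.end_coords_axioms bs Z0 conjI SE S(2))
  interpret et: end_coords val p \<iota> \<sigma> \<epsilon> B act n L h r E N t
    by unfold_locales (rule bt)
  interpret I: integral_coords val p \<iota> \<sigma> \<epsilon> B act n L h r E N t M s Z0 S
    by (intro integral_coords.intro integral_coords_axioms.intro hermitian_coords.intro hermitian_coords_axioms.intro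
        et.end_coords_axioms bs Z0 conjI SE S basis_T basis_H')
  \<comment> \<open>Over the field both \<open>t\<close> and \<open>E\<close> are bases of
    \<open>EndK\<close>, which identifies the relative dimension \<open>N - M\<close> of \<rho> with
    dim G.\<close>
  have "N = r"
    using is_basis_card_le[OF bt basis_End hl.scale_End.vector_space_axioms]
      is_basis_card_le[OF basis_End bt hl.scale_End.vector_space_axioms] by simp
  then show ?thesis using E.dim_G_eq(2) I.rho_smooth by (intro exI[of _ "r - M"]) simp
qed

end
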